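(* Let $m\in\mathbb N$ and let $(a_{\gamma,\delta})_{|\gamma|+|\delta|=m}$ be complex numbers such that for all $\epsilon>0$ the difference operator $\mathcal L_\epsilon:=\sum_{|\gamma|+|\delta|=m}a_{\gamma,\delta}D_\epsilon^\gamma\overline D{}_\epsilon^\delta$ is discretely elliptic on $\Lambda_\epsilon$. Suppose $0<\alpha<\eta<m$ with $\alpha,\eta\notin\mathbb N$. There exists a constant $C>0$ such that for all $\epsilon>0$ and all germs $U$ over $\Lambda_\epsilon$ that are centered to order $\eta$ and satisfy $\|U\|_{G^\eta(\Lambda_\epsilon)}<\infty$ it holds $$\|U\|_{G^\eta(\Lambda_\epsilon)}\le C\big([\mathcal L_\epsilon U]_{G^{\eta-m}(\Lambda_\epsilon)}+[U]_{G^{\eta,\alpha}(\Lambda_\epsilon)}\big).$$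
   Context: Fix a scaling $\mathfrak s\in\mathbb N^d$; for $\beta\in\mathbb N_0^d$, $|\beta|:=\sum_i\mathfrak s_i\beta_i$; $d(x,y):=\sum_i|x_i-y_i|^{1/\mathfrak s_i}$, $B_R(x)$ the open ball for $d$, $\mathcal P_k$ the polynomials $\sum_{|\beta|\le k}c_\beta z^\beta$ on $\mathbb R^d$. $\Lambda_\epsilon:=\epsilon^{\mathfrak s_1}\mathbb Z\times\cdots\times\epsilon^{\mathfrak s_d}\mathbb Z$. Forward/backward differences: $D_{\epsilon,j}u(k):=\epsilon^{-\mathfrak s_j}(u(k+\epsilon^{\mathfrak s_j}\mathbf e_j)-u(k))$, $\overline D_{\epsilon,j}u(k):=\epsilon^{-\mathfrak s_j}(u(k)-u(k-\epsilon^{\mathfrak s_j}\mathbf e_j))$, $D_\epsilon^\gamma:=D_{\epsilon,1}^{\gamma_1}\cdots D_{\epsilon,d}^{\gamma_d}$, similarly $\overline D{}_\epsilon^\delta$. Let $\widehat\Lambda_\epsilon:=\prod_{j=1}^d\mathbb R/(2\pi\epsilon^{-\mathfrak s_j}\mathbb Z)$, $\xi^\epsilon_{\theta,j}:=i\epsilon^{-\mathfrak s_j}(1-e^{i\epsilon^{\mathfrak s_j}\theta_j})$, $(\xi^\epsilon_\theta)^\gamma:=\prod_j(\xi^\epsilon_{\theta,j})^{\gamma_j}$. $\mathcal L_\epsilon$ is discretely elliptic on $\Lambda_\epsilon$ if $\hat{\mathcal L}_\epsilon(\theta):=\sum_{|\gamma|+|\delta|=m}a_{\gamma,\delta}(i\xi^\epsilon_\theta)^\gamma(i\overline{\xi^\epsilon_\theta})^\delta\ne0$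 for all $\theta\in\widehat\Lambda_\epsilon\setminus\{0\}$ and $\hat{\mathcal L}(\xi):=\sum_{|\gamma|+|\delta|=m}a_{\gamma,\delta}(i\xi)^{\gamma+\delta}\ne0$ for all $\xi\in\mathbb R^d\setminus\{0\}$. A germ over $\Lambda_\epsilon$ is a family $U=(U_x)_{x\in\Lambda_\epsilon}$ of functions $U_x:\Lambda_\epsilon\to\mathbb C$. $\|U\|_{G^\eta(\Lambda_\epsilon)}$ is the infimum of $M>0$ with $|U_x(y)|\le M\,d(x,y)^\eta$ for all $x,y\in\Lambda_\epsilon$; $[U]_{G^{\eta,\alpha}(\Lambda_\epsilon)}$ is the infimum of $M>0$ such that for all $x,y\in\Lambda_\epsilon$ there is $P\in\mathcal P_{\lfloor\eta\rfloor}$ with $|(U_x-U_y-P)(z)|\le M\,d(y,z)^\alpha(d(x,y)+d(y,z))^{\eta-\alpha}$ for all $z\in\Lambda_\epsilon$. $U$ is centered to order $\eta$ if $D^\gamma_\epsilon U_x(x)=0$ for all $x\in\Lambda_\epsilon$ and all $|\gamma|\le\eta$. For $\gamma<0$, with $k:=\lceil|\gamma|\rceil$, $\mathcal B$ is the set of $\varphi\in C^\infty_c(\mathbb R^d)$ supported in $B_1(0)$ with $\sup_{|\beta|\le k}\sup|\partial^\beta\varphi|\le1$, $\varphi_x^\lambda(y):=\lambda^{-\sum_i\mathfrak s_i}\varphi(\lambda^{-\mathfrak s_1}(y_1-x_1),\dots,\lambda^{-\mathfrak s_d}(y_d-x_d))$; with $\langle f,g\rangle_\epsilon:=\epsilon^{\sum_j\mathfrak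 s_j}\sum_{x\in\Lambda_\epsilon}f(x)g(x)$, for a family $V=(V_x)_x$ of functions on $\Lambda_\epsilon$, $[V]_{G^\gamma(\Lambda_\epsilon)}:=\sup_{\varphi\in\mathcal B}\sup_{x\in\Lambda_\epsilon,\lambda\ge\epsilon}\lambda^{-\gamma}|\langle V_x,\varphi^\lambda_x\rangle_\epsilon|$. $\mathcal L_\epsilon U:=(\mathcal L_\epsilon U_x)_x$. *)

theory Defs
  imports "HOL-Analysis.Analysis"
begin

text \<open>Points of R^d are represented as functions nat => real vanishing at indices >= d.
  Multi-indices are functions nat => nat vanishing at indices >= d.
  The scaling is s :: nat => nat (only s 0, ..., s (d-1) matter).\<close>

definition Rd :: "nat \<Rightarrow> (nat \<Rightarrow> real) set" where
  "Rd d = {x. \<forall>i\<ge>d. x i = 0}"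

definition MI :: "nat \<Rightarrow> (nat \<Rightarrow> nat) set" where
  "MI d = {\<beta>. \<forall>i\<ge>d. \<beta> i = 0}"

definition sdeg :: "(nat \<Rightarrow> nat) \<Rightarrow> nat \<Rightarrow> (nat \<Rightarrow> nat) \<Rightarrow> nat" where
  "sdeg s d \<beta> = (\<Sum>i<d. s i * \<beta> i)"

definition sdist :: "(nat \<Rightarrow> nat) \<Rightarrow> nat \<Rightarrow> (nat \<Rightarrow> real) \<Rightarrow> (nat \<Rightarrow> real) \<Rightarrow> real" where
  "sdist s d x y = (\<Sum>i<d. \<bar>x i - y i\<bar> powr (1 / real (s i)))"

definition lattice :: "(nat \<Rightarrow> nat) \<Rightarrow> nat \<Rightarrow> real \<Rightarrow> (nat \<Rightarrow> real) set" where
  "lattice s d \<epsilon> = {x \<in> Rd d. \<forall>i<d. \<exists>n::int. x i = \<epsilon> ^ s i * of_int n}"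

definition fwd_diff :: "(nat \<Rightarrow> nat) \<Rightarrow> real \<Rightarrow> nat \<Rightarrow> ((nat \<Rightarrow> real) \<Rightarrow> complex) \<Rightarrow> (nat \<Rightarrow> real) \<Rightarrow> complex" where
  "fwd_diff s \<epsilon> j u k = (u (k(j := k j + \<epsilon> ^ s j)) - u k) / of_real (\<epsilon> ^ s j)"

definition bwd_diff :: "(nat \<Rightarrow> nat) \<Rightarrow> real \<Rightarrow> nat \<Rightarrow> ((nat \<Rightarrow> real) \<Rightarrow> complex) \<Rightarrow> (nat \<Rightarrow> real) \<Rightarrow> complex" where
  "bwd_diff s \<epsilon> j u k = (u k - u (k(j := k j - \<epsilon> ^ s j))) / of_real (\<epsilon> ^ s j)"

definition Dgam :: "(nat \<Rightarrow> nat) \<Rightarrow> nat \<Rightarrow> real \<Rightarrow> (nat \<Rightarrow> nat) \<Rightarrow> ((nat \<Rightarrow> real) \<Rightarrow> complex) \<Rightarrow> (nat \<Rightarrow> real) \<Rightarrow> complex" where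
  "Dgam s d \<epsilon> \<gamma> u = foldr (\<lambda>j f. (fwd_diff s \<epsilon> j ^^ \<gamma> j) f) [0..<d] u"

definition Dbar :: "(nat \<Rightarrow> nat) \<Rightarrow> nat \<Rightarrow> real \<Rightarrow> (nat \<Rightarrow> nat) \<Rightarrow> ((nat \<Rightarrow> real) \<Rightarrow> complex) \<Rightarrow> (nat \<Rightarrow> real) \<Rightarrow> complex" where
  "Dbar s d \<epsilon> \<delta> u = foldr (\<lambda>j f. (bwd_diff s \<epsilon> j ^^ \<delta> j) f) [0..<d] u"

definition Mset :: "(nat \<Rightarrow> nat) \<Rightarrow> nat \<Rightarrow> nat \<Rightarrow> ((nat \<Rightarrow> nat) \<times> (nat \<Rightarrow> nat)) set" where
  "Mset s d m = {(\<gamma>, \<delta>). \<gamma> \<in> MI d \<and> \<delta> \<in> MI d \<and> sdeg s d \<gamma> + sdeg s d \<delta> = m}"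

definition Lop :: "(nat \<Rightarrow> nat) \<Rightarrow> nat \<Rightarrow> nat \<Rightarrow> ((nat \<Rightarrow> nat) \<Rightarrow> (nat \<Rightarrow> nat) \<Rightarrow> complex) \<Rightarrow> real
    \<Rightarrow> ((nat \<Rightarrow> real) \<Rightarrow> complex) \<Rightarrow> (nat \<Rightarrow> real) \<Rightarrow> complex" where
  "Lop s d m a \<epsilon> u = (\<lambda>k. \<Sum>(\<gamma>, \<delta>)\<in>Mset s d m. a \<gamma> \<delta> * Dgam s d \<epsilon> \<gamma> (Dbar s d \<epsilon> \<delta> u) k)"

definition mpow :: "nat \<Rightarrow> (nat \<Rightarrow> complex) \<Rightarrow> (nat \<Rightarrow> nat) \<Rightarrow> complex" where
  "mpow d \<xi> \<gamma> = (\<Prod>j<d. \<xi> j ^ \<gamma> j)"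

definition xi_eps :: "(nat \<Rightarrow> nat) \<Rightarrow> real \<Rightarrow> (nat \<Rightarrow> real) \<Rightarrow> nat \<Rightarrow> complex" where
  "xi_eps s \<epsilon> \<theta> j = \<i> * of_real (1 / \<epsilon> ^ s j) * (1 - exp (\<i> * of_real (\<epsilon> ^ s j * \<theta> j)))"

definition symbol_disc :: "(nat \<Rightarrow> nat) \<Rightarrow> nat \<Rightarrow> nat \<Rightarrow> ((nat \<Rightarrow> nat) \<Rightarrow> (nat \<Rightarrow> nat) \<Rightarrow> complex) \<Rightarrow> real \<Rightarrow> (nat \<Rightarrow> real) \<Rightarrow> complex" where
  "symbol_disc s d m a \<epsilon> \<theta> = (\<Sum>(\<gamma>, \<delta>)\<in>Mset s d m.
      a \<gamma> \<delta> * mpow d (\<lambda>j. \<i> * xi_eps s \<epsilon> \<theta> j) \<gamma> * mpow d (\<lambda>j. \<i> * cnj (xi_eps s \<epsilon> \<theta> j)) \<delta>)"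

definition symbol_cont :: "(nat \<Rightarrow> nat) \<Rightarrow> nat \<Rightarrow> nat \<Rightarrow> ((nat \<Rightarrow> nat) \<Rightarrow> (nat \<Rightarrow> nat) \<Rightarrow> complex) \<Rightarrow> (nat \<Rightarrow> real) \<Rightarrow> complex" where
  "symbol_cont s d m a \<xi> = (\<Sum>(\<gamma>, \<delta>)\<in>Mset s d m.
      a \<gamma> \<delta> * mpow d (\<lambda>j. \<i> * of_real (\<xi> j)) (\<lambda>j. \<gamma> j + \<delta> j))"

text \<open>discrete ellipticity on Lambda_eps; theta ranges over the torus, theta /= 0 in the torus
  means some coordinate is not in 2 pi eps^{-s_j} Z\<close>
definition disc_elliptic :: "(nat \<Rightarrow> nat) \<Rightarrow> nat \<Rightarrow> nat \<Rightarrow> ((nat \<Rightarrow> nat) \<Rightarrow> (nat \<Rightarrow> nat) \<Rightarrow> complex) \<Rightarrow> real \<Rightarrow> bool" where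
  "disc_elliptic s d m a \<epsilon> \<longleftrightarrow>
     (\<forall>\<theta>. (\<exists>j<d. \<theta> j \<notin> {2 * pi / \<epsilon> ^ s j * of_int n | n. True}) \<longrightarrow> symbol_disc s d m a \<epsilon> \<theta> \<noteq> 0)
   \<and> (\<forall>\<xi>. (\<exists>j<d. \<xi> j \<noteq> 0) \<longrightarrow> symbol_cont s d m a \<xi> \<noteq> 0)"

type_synonym germ = "(nat \<Rightarrow> real) \<Rightarrow> (nat \<Rightarrow> real) \<Rightarrow> complex"

text \<open>||U||_{G^eta}, as an extended real (infimum of the empty set = infinity)\<close>
definition G_norm :: "(nat \<Rightarrow> nat) \<Rightarrow> nat \<Rightarrow> real \<Rightarrow> real \<Rightarrow> germ \<Rightarrow> ereal" where
  "G_norm s d \<epsilon> \<eta> U = Inf {ereal M | M. M > 0 \<and>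
      (\<forall>x\<in>lattice s d \<epsilon>. \<forall>y\<in>lattice s d \<epsilon>. cmod (U x y) \<le> M * sdist s d x y powr \<eta>)}"

definition poly_space :: "(nat \<Rightarrow> nat) \<Rightarrow> nat \<Rightarrow> nat \<Rightarrow> ((nat \<Rightarrow> real) \<Rightarrow> complex) set" where
  "poly_space s d k = {P. \<exists>c :: (nat \<Rightarrow> nat) \<Rightarrow> complex.
      P = (\<lambda>z. \<Sum>\<beta>\<in>{\<beta>\<in>MI d. sdeg s d \<beta> \<le> k}. c \<beta> * of_real (\<Prod>j<d. z j ^ \<beta> j))}"

definition G_semi :: "(nat \<Rightarrow> nat) \<Rightarrow> nat \<Rightarrow> real \<Rightarrow> real \<Rightarrow> real \<Rightarrow> germ \<Rightarrow> ereal" where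
  "G_semi s d \<epsilon> \<eta> \<alpha> U = Inf {ereal M | M. M > 0 \<and>
      (\<forall>x\<in>lattice s d \<epsilon>. \<forall>y\<in>lattice s d \<epsilon>. \<exists>P\<in>poly_space s d (nat \<lfloor>\<eta>\<rfloor>).
         \<forall>z\<in>lattice s d \<epsilon>. cmod (U x z - U y z - P z)
            \<le> M * sdist s d y z powr \<alpha> * (sdist s d x y + sdist s d y z) powr (\<eta> - \<alpha>))}"

definition centered :: "(nat \<Rightarrow> nat) \<Rightarrow> nat \<Rightarrow> real \<Rightarrow> real \<Rightarrow> germ \<Rightarrow> bool" where
  "centered s d \<epsilon> \<eta> U \<longleftrightarrow>
     (\<forall>x\<in>lattice s d \<epsilon>. \<forall>\<gamma>\<in>MI d. real (sdeg s d \<gamma>) \<le> \<eta> \<longrightarrow> Dgam s d \<epsilon> \<gamma> (U x) x = 0)"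

definition pd :: "nat \<Rightarrow> ((nat \<Rightarrow> real) \<Rightarrow> real) \<Rightarrow> (nat \<Rightarrow> real) \<Rightarrow> real" where
  "pd j f x = deriv (\<lambda>t. f (x(j := x j + t))) 0"

definition pdiff :: "nat \<Rightarrow> (nat \<Rightarrow> nat) \<Rightarrow> ((nat \<Rightarrow> real) \<Rightarrow> real) \<Rightarrow> (nat \<Rightarrow> real) \<Rightarrow> real" where
  "pdiff d \<beta> f = foldr (\<lambda>j g. (pd j ^^ \<beta> j) g) [0..<d] f"

definition smooth_Rd :: "nat \<Rightarrow> ((nat \<Rightarrow> real) \<Rightarrow> real) \<Rightarrow> bool" where
  "smooth_Rd d f \<longleftrightarrow> (\<forall>\<beta>\<in>MI d. continuous_on (Rd d) (pdiff d \<beta> f) \<and>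
      (\<forall>j<d. \<forall>x\<in>Rd d. (\<lambda>t. pdiff d \<beta> f (x(j := x j + t))) differentiable (at 0)))"

text \<open>the test function class B (with k = ceiling |gamma|)\<close>
definition testB :: "(nat \<Rightarrow> nat) \<Rightarrow> nat \<Rightarrow> nat \<Rightarrow> ((nat \<Rightarrow> real) \<Rightarrow> real) set" where
  "testB s d k = {\<phi>. smooth_Rd d \<phi>
      \<and> closure {x\<in>Rd d. \<phi> x \<noteq> 0} \<subseteq> {x\<in>Rd d. sdist s d x (\<lambda>_. 0) < 1}
      \<and> (\<forall>\<beta>\<in>MI d. sdeg s d \<beta> \<le> k \<longrightarrow> (\<forall>x\<in>Rd d. \<bar>pdiff d \<beta> \<phi> x\<bar> \<le> 1))}"

definition rescale :: "(nat \<Rightarrow> nat) \<Rightarrow> nat \<Rightarrow> ((nat \<Rightarrow> real) \<Rightarrow> real) \<Rightarrow> (nat \<Rightarrow> real) \<Rightarrow> real \<Rightarrow> (nat \<Rightarrow> real) \<Rightarrow> real" where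
  "rescale s d \<phi> x lam = (\<lambda>y. lam powr (- real (\<Sum>i<d. s i)) * \<phi> (\<lambda>i. lam powr (- real (s i)) * (y i - x i)))"

definition pair_eps :: "(nat \<Rightarrow> nat) \<Rightarrow> nat \<Rightarrow> real \<Rightarrow> ((nat \<Rightarrow> real) \<Rightarrow> complex) \<Rightarrow> ((nat \<Rightarrow> real) \<Rightarrow> complex) \<Rightarrow> complex" where
  "pair_eps s d \<epsilon> f g = of_real (\<epsilon> ^ (\<Sum>j<d. s j)) * infsum (\<lambda>x. f x * g x) (lattice s d \<epsilon>)"

definition G_neg :: "(nat \<Rightarrow> nat) \<Rightarrow> nat \<Rightarrow> real \<Rightarrow> real \<Rightarrow> germ \<Rightarrow> ereal" where
  "G_neg s d \<epsilon> \<gamma> V = (SUP (\<phi>, x, lam) \<in> {(\<phi>, x, lam). \<phi> \<in> testB s d (nat \<lceil>\<bar>\<gamma>\<bar>\<rceil>) \<and> x \<in> lattice s d \<epsilon> \<and> lam \<ge> \<epsilon>}.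
      ereal (lam powr (- \<gamma>) * cmod (pair_eps s d \<epsilon> (V x) (\<lambda>y. complex_of_real (rescale s d \<phi> x lam y)))))"

end

theory Submission
  imports Defs "HOL-Library.Multiset" "HOL-Computational_Algebra.Polynomial"
begin

text \<open>Everything is rescaled to the lattice \<open>\<int>\<^sup>d\<close> and to a germ recentred at the origin. Let \<open>N\<close> be
  the norm of the germ, \<open>A\<close> the negative norm of its image, \<open>M\<close> its seminorm, and \<open>r\<close> the distance of
  \<open>y\<close> from the origin. The value \<open>u(y)\<close> is compared with a mollification \<open>w\<close> of \<open>u\<close> at scale
  \<open>h = \<delta> r\<close> which reproduces polynomials of degree at most \<open>\<eta>\<close>; the error is at most
  \<open>C (M + \<delta>\<^sup>\<eta> N) r\<^sup>\<eta>\<close>. Interior elliptic regularity for \<open>w\<close> at a scale \<open>\<rho> = K r\<close> shows that its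
  differences of order \<open>k > \<eta>\<close> near the origin are small multiples of \<open>N r\<^bsup>\<eta> - k\<^esup>\<close> if \<open>K\<close> is large, up to a
  multiple of \<open>A\<close>, while those of order \<open>k < \<eta>\<close> at the origin are at most \<open>C N h\<^bsup>\<eta> - k\<^esup>\<close>, and vanish if \<open>h = 1\<close>
  because \<open>u\<close> is centered. Summing along lattice paths gives \<open>\<bar>u(y)\<bar> \<le> (N/2 + C (A + M)) r\<^sup>\<eta>\<close>,
  and the factor \<open>1/2\<close> absorbs \<open>N\<close>. The regularity estimate is an \<open>L\<^sup>2\<close> bound coming from
  Plancherel's identity, localised by weights that vary on a scale much larger than \<open>\<rho>\<close>.\<close>

section \<open>Difference operators on the unit lattice\<close>

type_synonym zfun = "(nat \<Rightarrow> int) \<Rightarrow> complex"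

text \<open>The image of the germ is known only through pairings with test functions at the base
  point, and their bound \<open>h powr (\<eta> - m)\<close> improves with the scale
  \<open>h\<close>; so \<open>u\<close> must be smoothed at a scale comparable to \<open>r\<close>
  before regularity is used. Since \<open>u\<close> and the germ at \<open>y\<close> agree only up
  to a polynomial, the smoothing has to reproduce polynomials exactly, and the germ at
  \<open>y\<close> is itself tiny near \<open>y\<close>. Small \<delta> tames the mollification
  error and the low orders, large \<open>K\<close> the high orders; the price is a power of
  \<open>K / \<delta>\<close> in front of \<open>A\<close>, which is harmless because
  \<open>A\<close> is not absorbed. The weights are products of rational functions rather than
  cut-offs: they never vanish, and their differences are bounded by the weight itself, so
  commutators can be absorbed in the same weighted norm, while their decay beats the polynomial
  growth of \<open>w\<close>. Rescaling turns the operator of mesh \<epsilon> into a multiple of one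
  fixed operator, whence a constant uniform in \<epsilon>.\<close>

definition df :: "nat \<Rightarrow> zfun \<Rightarrow> zfun" where
  "df j u = (\<lambda>n. u (n(j := n j + 1)) - u n)"

definition db :: "nat \<Rightarrow> zfun \<Rightarrow> zfun" where
  "db j u = (\<lambda>n. u n - u (n(j := n j - 1)))"

text \<open>Iterated differences are indexed by words; the letter \<open>(j, b)\<close> is the forward difference in
  direction \<open>j\<close> if \<open>b\<close> holds, and the backward difference otherwise.\<close>

definition dl :: "nat \<times> bool \<Rightarrow> zfun \<Rightarrow> zfun" where
  "dl l = (if snd l then df (fst l) else db (fst l))"

definition dop :: "(nat \<times> bool) list \<Rightarrow> zfun \<Rightarrow> zfun" where
  "dop w = foldr dl w"

lemma dop_simps [simp]: "dop [] u = u" "dop (l # w) u = dl l (dop w u)" "dop (w @ w') u = dop w (dop w' u)"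
  by (simp_all add: dop_def)

section \<open>Geometry of the anisotropic unit lattice and its translation-invariant
  operators\<close>

locale scaled =
  fixes d :: nat and s :: "nat \<Rightarrow> nat"
  assumes d_pos: "0 < d" and s_pos: "i < d \<Longrightarrow> 1 \<le> s i"
begin

definition Z :: "(nat \<Rightarrow> int) set" where
  "Z = {n. \<forall>i\<ge>d. n i = 0}"

definition nm :: "(nat \<Rightarrow> int) \<Rightarrow> real" where
  "nm n = (\<Sum>i<d. \<bar>real_of_int (n i)\<bar> powr (1 / real (s i)))"

text \<open>The homogeneous dimension: a box with side lengths \<open>h ^ s j\<close> contains
  \<open>h ^ S\<close> lattice points.\<close>

definition S :: nat where "S = (\<Sum>i<d. s i)"

definition wdeg :: "(nat \<times> bool) list \<Rightarrow> nat" where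
  "wdeg w = (\<Sum>l\<leftarrow>w. s (fst l))"

definition words :: "(nat \<times> bool) list set" where
  "words = lists ({..<d} \<times> UNIV)"

lemma wdeg_simps [simp]: "wdeg [] = 0" "wdeg (l # w) = s (fst l) + wdeg w" "wdeg (w @ w') = wdeg w + wdeg w'"
  by (simp_all add: wdeg_def)

lemma words_simps [simp]: "[] \<in> words" "l # w \<in> words \<longleftrightarrow> fst l < d \<and> w \<in> words"
  "w @ w' \<in> words \<longleftrightarrow> w \<in> words \<and> w' \<in> words"
  by (auto simp: words_def mem_Times_iff)

lemma length_le_wdeg: "w \<in> words \<Longrightarrow> length w \<le> wdeg w"
proof (induction w)
  case (Cons l w)
  then show ?case using s_pos[of "fst l"] by auto
qed simp

lemma Z_upd [simp]: "n \<in> Z \<Longrightarrow> j < d \<Longrightarrow> n(j := c) \<in> Z"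
  by (auto simp: Z_def)

lemma Z_add [simp]: "n \<in> Z \<Longrightarrow> x \<in> Z \<Longrightarrow> (\<lambda>i. n i + x i) \<in> Z"
  by (auto simp: Z_def)

lemma Z_diff [simp]: "n \<in> Z \<Longrightarrow> x \<in> Z \<Longrightarrow> (\<lambda>i. n i - x i) \<in> Z"
  by (auto simp: Z_def)

lemma Z_0 [simp]: "(\<lambda>_. 0) \<in> Z"
  by (auto simp: Z_def)

lemma nm_nonneg [simp]: "0 \<le> nm n"
  unfolding nm_def by (intro sum_nonneg) auto

lemma nm_0 [simp]: "nm (\<lambda>_. 0) = 0"
  by (simp add: nm_def)

text \<open>After division by \<open>a + b\<close> both summands lie in the unit interval, where
  \<open>t \<le> t powr p\<close>.\<close>

lemma powr_subadd:
  fixes a b p :: real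
  assumes "0 \<le> a" "0 \<le> b" "0 < p" "p \<le> 1"
  shows "(a + b) powr p \<le> a powr p + b powr p"
proof (cases "a + b = 0")
  case True then show ?thesis using assms by auto
next
  case False
  then have pos: "0 < a + b" using assms by auto
  have *: "c / (a + b) \<le> (c / (a + b)) powr p" if "0 \<le> c" "c \<le> a + b" for c
  proof (cases "c = 0")
    case False
    with that pos have "0 < c / (a+b)" "c/(a+b) \<le> 1" by auto
    then have "(c/(a+b)) powr 1 \<le> (c/(a+b)) powr p"
      using assms by (intro powr_mono') auto
    then show ?thesis using \<open>0 < c/(a+b)\<close> powr_one[of "c/(a+b)"] by linarith
  qed simp
  have "1 = a / (a + b) + b / (a+b)" using pos by (simp add: add_divide_distrib[symmetric])
  also have "\<dots> \<le> (a / (a + b)) powr p + (b / (a+b)) powr p"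
    using *[of a] *[of b] assms by auto
  also have "\<dots> = (a powr p + b powr p) / (a+b) powr p"
    using assms pos by (simp add: powr_divide add_divide_distrib)
  finally show ?thesis using pos by (simp add: field_simps)
qed

lemma nm_triangle: "nm (\<lambda>i. x i + y i) \<le> nm x + nm y"
  unfolding nm_def sum.distrib[symmetric]
proof (intro sum_mono)
  fix i assume "i \<in> {..<d}"
  then have s: "1 \<le> s i" using s_pos by auto
  have "\<bar>real_of_int (x i + y i)\<bar> powr (1 / real (s i)) \<le> (\<bar>real_of_int (x i)\<bar> + \<bar>real_of_int (y i)\<bar>) powr (1 / real (s i))"
    by (intro powr_mono2) auto
  also have "\<dots> \<le> \<bar>real_of_int (x i)\<bar> powr (1 / real (s i)) + \<bar>real_of_int (y i)\<bar> powr (1 / real (s i))"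
    using s by (intro powr_subadd) auto
  finally show "\<bar>real_of_int (x i + y i)\<bar> powr (1 / real (s i)) \<le> \<bar>real_of_int (x i)\<bar> powr (1 / real (s i)) + \<bar>real_of_int (y i)\<bar> powr (1 / real (s i))" .
qed

lemma nm_le_diff: "nm x \<le> nm y + nm (\<lambda>i. x i - y i)"
  using nm_triangle[of y "\<lambda>i. x i - y i"] by simp

lemma abs_le_nm_pow:
  assumes "i < d" shows "\<bar>real_of_int (n i)\<bar> \<le> nm n ^ s i"
proof -
  have s: "1 \<le> s i" using s_pos assms by auto
  have "\<bar>real_of_int (n i)\<bar> = (\<bar>real_of_int (n i)\<bar> powr (1 / real (s i))) ^ s i"
  proof (cases "n i = 0")
    case True then show ?thesis using s by simp
  next
    case False
    then have p: "0 < \<bar>real_of_int (n i)\<bar>" by simp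
    then have "(\<bar>real_of_int (n i)\<bar> powr (1 / real (s i))) ^ s i = (\<bar>real_of_int (n i)\<bar> powr (1 / real (s i))) powr real (s i)"
      by (subst powr_realpow) auto
    then show ?thesis using s p by (simp add: powr_powr)
  qed
  also have "\<dots> \<le> nm n ^ s i"
    unfolding nm_def by (intro power_mono member_le_sum) (use assms in auto)
  finally show ?thesis .
qed

lemma powr_inv_le:
  assumes "i < d" "0 \<le> h" "0 \<le> t" "t \<le> h ^ s i"
  shows "t powr (1 / real (s i)) \<le> h"
proof -
  have s: "1 \<le> s i" using s_pos assms by auto
  show ?thesis
  proof (cases "h = 0")
    case True then show ?thesis using assms s by (auto simp: power_0_left split: if_splits)
  next
    case False
    then have h: "0 < h" using assms by auto
    have "t powr (1 / real (s i)) \<le> (h ^ s i) powr (1 / real (s i))"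
      using assms by (intro powr_mono2) auto
    also have "\<dots> = h" using h s by (simp add: powr_realpow[symmetric] powr_powr)
    finally show ?thesis .
  qed
qed

text \<open>A nonzero integer coordinate has modulus at least 1. The distance \<open>r\<close> in
  the final estimate is therefore never below the mesh.\<close>

lemma nm_ge_1: 
  assumes "n \<in> Z" "n \<noteq> (\<lambda>_. 0)" shows "1 \<le> nm n"
proof -
  obtain i where i: "n i \<noteq> 0" "i < d" using assms by (fastforce simp: Z_def)
  have "1 \<le> \<bar>real_of_int (n i)\<bar>" using i by linarith
  also have "\<dots> \<le> nm n ^ s i" using abs_le_nm_pow i by auto
  finally have 1: "1 \<le> nm n ^ s i" .
  have "nm n ^ s i \<le> nm n ^ 1" if "nm n < 1"
    using that s_pos[OF i(2)] by (intro power_decreasing) auto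
  with 1 show ?thesis by force
qed

lemma nm_upd_le:
  assumes "j < d" "0 \<le> h" "\<bar>real_of_int c\<bar> \<le> h ^ s j"
  shows "nm (\<lambda>i. (n(j := n j + c)) i - n i) \<le> h"
proof -
  have "nm (\<lambda>i. (n(j := n j + c)) i - n i) = (\<Sum>i<d. if i = j then \<bar>real_of_int c\<bar> powr (1 / real (s j)) else 0)"
    unfolding nm_def by (intro sum.cong) auto
  also have "\<dots> = \<bar>real_of_int c\<bar> powr (1 / real (s j))" using assms by simp
  also have "\<dots> \<le> h" using assms by (intro powr_inv_le) auto
  finally show ?thesis .
qed

text \<open>The finite linear combinations of lattice translations. Any two of them commute.\<close>

inductive TI :: "(zfun \<Rightarrow> zfun) \<Rightarrow> bool" where
  shift: "x \<in> Z \<Longrightarrow> TI (\<lambda>u n. u (\<lambda>i. n i + x i))"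
| add: "TI A \<Longrightarrow> TI B \<Longrightarrow> TI (\<lambda>u n. A u n + B u n)"
| scale: "TI A \<Longrightarrow> TI (\<lambda>u n. c * A u n)"
| comp: "TI A \<Longrightarrow> TI B \<Longrightarrow> TI (\<lambda>u. A (B u))"

lemma TI_id: "TI (\<lambda>u. u)"
  using TI.shift[OF Z_0] by simp

lemma TI_zero: "TI (\<lambda>u n. 0)"
  using TI.scale[OF TI_id, of 0] by simp

lemma TI_sum: "(\<And>x. x \<in> F \<Longrightarrow> TI (T x)) \<Longrightarrow> TI (\<lambda>u n. \<Sum>x\<in>F. T x u n)"
proof (induction F rule: infinite_finite_induct)
  case (insert x F)
  then show ?case using TI.add[of "T x" "\<lambda>u n. \<Sum>x\<in>F. T x u n"] by auto
qed (auto simp: TI_zero)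

lemma TI_diff: "TI A \<Longrightarrow> TI B \<Longrightarrow> TI (\<lambda>u n. A u n - B u n)"
  using TI.add[OF _ TI.scale[of B "-1"], of A] by simp

lemma TI_upd: assumes "j < d" shows "TI (\<lambda>u n. u (n(j := n j + c)))"
proof -
  have "TI (\<lambda>u n. u (\<lambda>i. n i + ((\<lambda>_. 0)(j := c)) i))"
    using assms by (intro TI.shift) (auto simp: Z_def)
  moreover have "(\<lambda>i. n i + ((\<lambda>_. 0)(j := c)) i) = n(j := n j + c)" for n :: "nat \<Rightarrow> int"
    by auto
  ultimately show ?thesis by simp
qed

lemma TI_df: "j < d \<Longrightarrow> TI (df j)"
  unfolding df_def by (intro TI_diff TI_upd TI_id) 

lemma TI_db: "j < d \<Longrightarrow> TI (db j)"
  using TI_diff[OF TI_id TI_upd[of j "-1"]] unfolding db_def by simp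

lemma TI_dl: "fst l < d \<Longrightarrow> TI (dl l)"
  by (simp add: dl_def TI_df TI_db)

lemma TI_dop: "w \<in> words \<Longrightarrow> TI (dop w)"
proof (induction w)
  case Nil
  then show ?case using TI_id by (simp add: dop_def id_def)
next
  case (Cons l w)
  then show ?case using TI.comp[OF TI_dl[of l], of "dop w"] by (simp add: dop_def comp_def)
qed

lemma TI_funpow: "TI A \<Longrightarrow> TI (A ^^ k)"
proof (induction k)
  case 0 then show ?case using TI_id by (simp add: id_def)
next
  case (Suc k) then show ?case using TI.comp[of A "A ^^ k"] by (simp add: comp_def)
qed

lemma TI_lin_add: "TI A \<Longrightarrow> A (\<lambda>n. u n + v n) = (\<lambda>n. A u n + A v n)"
proof (induction A arbitrary: u v rule: TI.induct)
  case (comp A B) then show ?case by simp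
qed (auto simp: algebra_simps fun_eq_iff)

lemma TI_lin_scale: "TI A \<Longrightarrow> A (\<lambda>n. c * u n) = (\<lambda>n. c * A u n)"
proof (induction A arbitrary: u rule: TI.induct)
  case (comp A B) then show ?case by simp
qed (auto simp: algebra_simps fun_eq_iff)

lemma TI_lin_diff: "TI A \<Longrightarrow> A (\<lambda>n. u n - v n) = (\<lambda>n. A u n - A v n)"
  using TI_lin_add[of A u "\<lambda>n. -1 * v n"] TI_lin_scale[of A "-1" v] by (simp)

lemma TI_lin_0: "TI A \<Longrightarrow> A (\<lambda>n. 0) = (\<lambda>n. 0)"
  using TI_lin_scale[of A 0 "\<lambda>_. 0"] by simp

lemma TI_lin_sum: "TI A \<Longrightarrow> A (\<lambda>n. \<Sum>x\<in>F. f x n) = (\<lambda>n. \<Sum>x\<in>F. A (f x) n)"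
proof (induction F rule: infinite_finite_induct)
  case (insert x F)
  then show ?case using TI_lin_add[of A "f x" "\<lambda>n. \<Sum>x\<in>F. f x n"] by simp
qed (auto simp: TI_lin_0)

lemma TI_shift_comm: "TI A \<Longrightarrow> A (\<lambda>n. u (\<lambda>i. n i + x i)) = (\<lambda>n. A u (\<lambda>i. n i + x i))"
proof (induction A arbitrary: u rule: TI.induct)
  case (shift x)
  then show ?case by (simp add: algebra_simps)
next
  case (comp A B) then show ?case by simp
qed auto

text \<open>The case of a single translation is \<open>TI_shift_comm\<close>; the other closure
  operations pass through \<open>B\<close> because \<open>B\<close> is linear.\<close>

lemma TI_comm: "TI A \<Longrightarrow> TI B \<Longrightarrow> A (B u) = B (A u)"
proof (induction A arbitrary: u rule: TI.induct)
  case (shift x)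
  then show ?case by (simp add: TI_shift_comm)
next
  case (add A A')
  have "B (\<lambda>n. A u n + A' u n) = (\<lambda>n. B (A u) n + B (A' u) n)" by (rule TI_lin_add) fact
  with add show ?case by simp
next
  case (scale A c)
  have "B (\<lambda>n. c * A u n) = (\<lambda>n. c * B (A u) n)" by (rule TI_lin_scale) fact
  with scale show ?case by simp
next
  case (comp A A') then show ?case by simp
qed

text \<open>Letters commute, so the fold depends only on the multiset of letters. This allows any
  letter to be applied first or last.\<close>

lemma dop_perm:
  assumes "mset w = mset w'" "w \<in> words" shows "dop w = dop w'"
proof -
  have w': "set w = set w'" using assms(1) by (metis set_mset_mset)
  have c: "dl x \<circ> dl y = dl y \<circ> dl x" if "x \<in> set w" "y \<in> set w" for x y
  proof -
    have "fst x < d" "fst y < d" using that assms(2) by (auto simp: words_def mem_Times_iff)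
    then show ?thesis by (auto simp: fun_eq_iff TI_comm[OF TI_dl TI_dl])
  qed
  have "fold dl (rev w) = fold dl (rev w')"
    by (rule fold_multiset_equiv) (use c assms in auto)
  then show ?thesis by (simp add: dop_def foldr_conv_fold)
qed

lemma dop_Cons_comm: "l # w \<in> words \<Longrightarrow> dop (l # w) u = dop w (dl l u)"
proof -
  assume "l # w \<in> words"
  then have "dop (l # w) = dop (w @ [l])" by (intro dop_perm) auto
  then show ?thesis by simp
qed

text \<open>A bound for the \<open>\<ell>\<^sup>1\<close> norm of the kernel of \<open>T\<close> and for the radius of its support, phrased without
  mentioning the kernel.\<close>

definition avgc :: "real \<Rightarrow> real \<Rightarrow> (zfun \<Rightarrow> zfun) \<Rightarrow> bool" where
  "avgc c R T \<longleftrightarrow> (\<forall>u n B. n \<in> Z \<longrightarrow> (\<forall>k\<in>Z. nm (\<lambda>i. k i - n i) \<le> R \<longrightarrow> cmod (u k) \<le> B) \<longrightarrow> cmod (T u n) \<le> c * B)"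

lemma avgcD: "avgc c R T \<Longrightarrow> n \<in> Z \<Longrightarrow> (\<And>k. k \<in> Z \<Longrightarrow> nm (\<lambda>i. k i - n i) \<le> R \<Longrightarrow> cmod (u k) \<le> B) \<Longrightarrow> cmod (T u n) \<le> c * B"
  unfolding avgc_def by blast

lemma avgc_id: "0 \<le> R \<Longrightarrow> avgc 1 R (\<lambda>u. u)"
  unfolding avgc_def by auto

lemma avgc_comp:
  assumes "avgc c R A" "avgc c' R' B" shows "avgc (c * c') (R + R') (\<lambda>u. A (B u))"
  unfolding avgc_def
proof (intro allI impI)
  fix u n b assume n: "n \<in> Z" and b: "\<forall>k\<in>Z. nm (\<lambda>i. k i - n i) \<le> R + R' \<longrightarrow> cmod (u k) \<le> b"
  have "cmod (A (B u) n) \<le> c * (c' * b)"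
  proof (rule avgcD[OF assms(1) n])
    fix k assume k: "k \<in> Z" "nm (\<lambda>i. k i - n i) \<le> R"
    show "cmod (B u k) \<le> c' * b"
    proof (rule avgcD[OF assms(2) k(1)])
      fix l assume l: "l \<in> Z" "nm (\<lambda>i. l i - k i) \<le> R'"
      have "nm (\<lambda>i. l i - n i) \<le> nm (\<lambda>i. k i - n i) + nm (\<lambda>i. l i - k i)"
        using nm_triangle[of "\<lambda>i. k i - n i" "\<lambda>i. l i - k i"] by simp
      then show "cmod (u l) \<le> b" using b k l by auto
    qed
  qed
  then show "cmod (A (B u) n) \<le> c * c' * b" by simp
qed

lemma avgc_mono:
  assumes "avgc c R A" "c \<le> c'" "R \<le> R'" "0 \<le> R'" shows "avgc c' R' A"
  unfolding avgc_def
proof (intro allI impI)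
  fix u n b assume n: "n \<in> Z" and b: "\<forall>k\<in>Z. nm (\<lambda>i. k i - n i) \<le> R' \<longrightarrow> cmod (u k) \<le> b"
  \<comment> \<open>The centre itself lies in the ball because \<open>R'\<close> is nonnegative,
    which forces the bound \<open>b\<close> to be nonnegative.\<close>
  have "cmod (u n) \<le> b" using b n assms(4) by simp
  then have "0 \<le> b" using norm_ge_zero order_trans by blast
  have "cmod (A u n) \<le> c * b" by (rule avgcD[OF assms(1) n]) (use b assms in auto)
  also have "\<dots> \<le> c' * b" using \<open>0 \<le> b\<close> assms by (intro mult_right_mono) auto
  finally show "cmod (A u n) \<le> c' * b" .
qed

lemma avgc_add:
  assumes "avgc c R A" "avgc c' R B" shows "avgc (c + c') R (\<lambda>u n. A u n + B u n)"
  unfolding avgc_def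
proof (intro allI impI)
  fix u n b assume n: "n \<in> Z" and b: "\<forall>k\<in>Z. nm (\<lambda>i. k i - n i) \<le> R \<longrightarrow> cmod (u k) \<le> b"
  have "cmod (A u n) \<le> c * b" by (rule avgcD[OF assms(1) n]) (use b in auto)
  moreover have "cmod (B u n) \<le> c' * b" by (rule avgcD[OF assms(2) n]) (use b in auto)
  ultimately show "cmod (A u n + B u n) \<le> (c + c') * b"
    using norm_triangle_ineq[of "A u n" "B u n"] by (simp add: algebra_simps)
qed

lemma avgc_diff:
  assumes "avgc c R A" "avgc c' R B" shows "avgc (c + c') R (\<lambda>u n. A u n - B u n)"
  unfolding avgc_def
proof (intro allI impI)
  fix u n b assume n: "n \<in> Z" and b: "\<forall>k\<in>Z. nm (\<lambda>i. k i - n i) \<le> R \<longrightarrow> cmod (u k) \<le> b"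
  have "cmod (A u n) \<le> c * b" by (rule avgcD[OF assms(1) n]) (use b in auto)
  moreover have "cmod (B u n) \<le> c' * b" by (rule avgcD[OF assms(2) n]) (use b in auto)
  ultimately show "cmod (A u n - B u n) \<le> (c + c') * b"
    using norm_triangle_ineq4[of "A u n" "B u n"] by (simp add: algebra_simps)
qed

lemma avgc_funpow: "avgc c R A \<Longrightarrow> avgc (c ^ k) (real k * R) (A ^^ k)"
proof (induction k)
  case 0 then show ?case using avgc_id[of 0] by (simp add: id_def)
next
  case (Suc k)
  then show ?case using avgc_comp[OF Suc.prems Suc.IH[OF Suc.prems]] by (simp add: algebra_simps comp_def)
qed

lemma avgc_foldr: "(\<And>x. x \<in> set xs \<Longrightarrow> avgc 1 R (f x)) \<Longrightarrow> avgc 1 (real (length xs) * R) (foldr f xs)"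
proof (induction xs)
  case Nil then show ?case using avgc_id[of 0] by (simp add: id_def)
next
  case (Cons a xs)
  then show ?case using avgc_comp[of 1 R "f a" 1 "real (length xs) * R" "foldr f xs"] by (simp add: algebra_simps comp_def)
qed

lemma avgc_sum:
  assumes "finite F" "\<And>x. x \<in> F \<Longrightarrow> avgc (c x) R (T x)" "0 \<le> R"
  shows "avgc (\<Sum>x\<in>F. c x) R (\<lambda>u n. \<Sum>x\<in>F. T x u n)"
  using assms
proof (induction F rule: finite_induct)
  case empty then show ?case by (simp add: avgc_def)
next
  case (insert x F) then show ?case using avgc_add[of "c x" R "T x"] by simp
qed

lemma avgc_scale: "avgc c R T \<Longrightarrow> avgc (cmod k * c) R (\<lambda>u n. k * T u n)"
  unfolding avgc_def by (simp add: norm_mult mult.assoc mult_left_mono)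

lemma avgc_shift: "x \<in> Z \<Longrightarrow> nm x \<le> R \<Longrightarrow> avgc 1 R (\<lambda>u n. u (\<lambda>i. n i + x i))"
  unfolding avgc_def by auto

lemma avgc_upd: "j < d \<Longrightarrow> 0 \<le> R \<Longrightarrow> \<bar>real_of_int c\<bar> \<le> R ^ s j \<Longrightarrow> avgc 1 R (\<lambda>u n. u (n(j := n j + c)))"
  unfolding avgc_def using nm_upd_le by auto

lemma avgc_dl: "fst l < d \<Longrightarrow> avgc 2 1 (dl l)"
proof -
  assume l: "fst l < d"
  have 1: "avgc 1 1 (\<lambda>u n. u (n(fst l := n (fst l) + c)))" if "\<bar>c\<bar> \<le> 1" for c
    using that by (intro avgc_upd[OF l]) auto
  show ?thesis
    using avgc_diff[OF 1[of 1] avgc_id[of 1]] avgc_diff[OF avgc_id[of 1] 1[of "-1"]]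
    by (auto simp: dl_def df_def[abs_def] db_def[abs_def])
qed

lemma avgc_dop: "w \<in> words \<Longrightarrow> avgc (2 ^ length w) (real (length w)) (dop w)"
proof (induction w)
  case Nil then show ?case using avgc_id[of 0] by (simp add: dop_def id_def)
next
  case (Cons l w)
  then have "avgc (2 * 2 ^ length w) (1 + real (length w)) (\<lambda>u. dl l (dop w u))"
    by (intro avgc_comp avgc_dl) auto
  then show ?case by (simp add: dop_def comp_def)
qed

text \<open>On the ball of radius \<open>R\<close> about \<open>n\<close> the monotone majorant
  \<open>g\<close> is worst at \<open>nm n + R\<close>.\<close>

lemma avgc_growth:
  assumes "avgc c R T" "\<And>n. n \<in> Z \<Longrightarrow> cmod (u n) \<le> g (nm n)" "\<And>a b. 0 \<le> a \<Longrightarrow> a \<le> b \<Longrightarrow> g a \<le> g b" "n \<in> Z"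
  shows "cmod (T u n) \<le> c * g (nm n + R)"
proof (rule avgcD[OF assms(1,4)])
  fix k assume k: "k \<in> Z" "nm (\<lambda>i. k i - n i) \<le> R"
  have "cmod (u k) \<le> g (nm k)" using assms k by auto
  also have "\<dots> \<le> g (nm n + R)" using nm_le_diff[of k n] k by (intro assms) auto
  finally show "cmod (u k) \<le> g (nm n + R)" .
qed

end

section \<open>Plancherel's identity\<close>

text \<open>Coordinates from \<open>k\<close> on are 0, as in \<open>Z\<close>, so boxes are sets of
  lattice points and can be built up one coordinate at a time.\<close>

definition zbox :: "nat \<Rightarrow> (nat \<Rightarrow> int set) \<Rightarrow> (nat \<Rightarrow> int) set" where
  "zbox k G = {n. (\<forall>i<k. n i \<in> G i) \<and> (\<forall>i\<ge>k. n i = 0)}"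

lemma zbox_0: "zbox 0 G = {\<lambda>_. 0}"
  by (auto simp: zbox_def)

lemma zbox_Suc: "bij_betw (\<lambda>(n, t). n(k := t)) (zbox k G \<times> G k) (zbox (Suc k) G)"
proof (rule bij_betw_imageI)
  show "inj_on (\<lambda>(n, t). n(k := t)) (zbox k G \<times> G k)"
  proof (intro inj_onI, clarsimp)
    fix n t n' t' assume *: "n \<in> zbox k G" "n' \<in> zbox k G" and eq: "n(k := t) = (n'(k := t') :: nat \<Rightarrow> int)"
    have "t = t'" using fun_cong[OF eq, of k] by simp
    moreover have "n i = n' i" for i
      using fun_cong[OF eq, of i] * by (cases "i = k") (auto simp: zbox_def)
    ultimately show "n = n' \<and> t = t'" by auto
  qed
  show "(\<lambda>(n, t). n(k := t)) ` (zbox k G \<times> G k) = zbox (Suc k) G"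
  proof (intro equalityI subsetI)
    fix n assume n: "n \<in> zbox (Suc k) G"
    then have "n(k := 0) \<in> zbox k G" "n k \<in> G k" by (auto simp: zbox_def less_Suc_eq)
    moreover have "n = (\<lambda>(n, t). n(k := t)) (n(k := 0), n k)" by simp
    ultimately show "n \<in> (\<lambda>(n, t). n(k := t)) ` (zbox k G \<times> G k)" by blast
  qed (auto simp: zbox_def less_Suc_eq)
qed

lemma finite_zbox [simp]: "(\<And>i. i < k \<Longrightarrow> finite (G i)) \<Longrightarrow> finite (zbox k G)"
proof (induction k)
  case (Suc k)
  then have "finite (zbox k G \<times> G k)" by auto
  then show ?case using bij_betw_finite[OF zbox_Suc] by blast
qed (simp add: zbox_0)

text \<open>Fubini for products of one-variable functions, splitting off the last coordinate with
  \<open>zbox_Suc\<close>.\<close>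

lemma sum_prod_zbox:
  fixes g :: "nat \<Rightarrow> int \<Rightarrow> 'a :: comm_semiring_1"
  assumes "\<And>i. i < k \<Longrightarrow> finite (G i)"
  shows "(\<Sum>n\<in>zbox k G. \<Prod>i<k. g i (n i)) = (\<Prod>i<k. \<Sum>t\<in>G i. g i t)"
  using assms
proof (induction k)
  case (Suc k)
  have "(\<Sum>n\<in>zbox (Suc k) G. \<Prod>i<Suc k. g i (n i)) = (\<Sum>(n,t)\<in>zbox k G \<times> G k. \<Prod>i<Suc k. g i ((n(k := t)) i))"
    by (subst sum.reindex_bij_betw[OF zbox_Suc, symmetric]) (simp add: case_prod_unfold)
  also have "\<dots> = (\<Sum>n\<in>zbox k G. \<Sum>t\<in>G k. (\<Prod>i<k. g i (n i)) * g k t)"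
    by (subst sum.cartesian_product[symmetric]) (intro sum.cong refl, simp)
  also have "\<dots> = (\<Sum>n\<in>zbox k G. \<Prod>i<k. g i (n i)) * (\<Sum>t\<in>G k. g k t)"
    by (simp add: sum_product)
  finally show ?case using Suc by simp
qed (simp add: zbox_0)

text \<open>A geometric sum whose ratio has \<open>N\<close>-th power 1, and equals 1 exactly when
  \<open>N\<close> divides \<open>t\<close>.\<close>

lemma sum_cis_roots:
  fixes N :: nat and t :: int
  assumes "0 < N"
  shows "(\<Sum>k\<in>{0..<int N}. cis (2 * pi * real_of_int k / N * t)) = (if int N dvd t then of_nat N else 0)"
proof -
  define z where "z = cis (2 * pi * t / N)"
  have "(\<Sum>k\<in>{0..<int N}. cis (2 * pi * real_of_int k / N * t)) = (\<Sum>k<N. z ^ k)"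
  proof (rule sum.reindex_bij_witness[of _ int nat])
    fix k assume "k \<in> {0..<int N}"
    then have "real (nat k) = real_of_int k" by simp
    then have "real (nat k) * (2 * pi * t / N) = 2 * pi * real_of_int k / N * t"
      by (simp add: field_simps)
    then show "z ^ nat k = cis (2 * pi * real_of_int k / N * t)"
      by (simp only: z_def Complex.DeMoivre)
  qed auto
  also have "\<dots> = (if int N dvd t then of_nat N else 0)"
  proof (cases "int N dvd t")
    case True
    then obtain q where "t = int N * q" by auto
    then have "z = 1" using assms cis_multiple_2pi[of "real_of_int q"] by (auto simp: z_def mult_ac)
    with True show ?thesis by simp
  next
    case False
    have "z \<noteq> 1"
    proof
      assume "z = 1"
      then have "cos (2 * pi * t / N) = 1" by (auto simp: z_def complex_eq_iff)
      then obtain q :: int where "2 * pi * t / N = q * 2 * pi" by (auto simp: cos_one_2pi_int)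
      then have "real_of_int t = q * N" using assms by (simp add: field_simps)
      then have "t = q * int N" by (metis of_int_eq_iff of_int_mult of_int_of_nat_eq)
      with False show False by simp
    qed
    moreover have "z ^ N = 1"
      using assms cis_multiple_2pi[of "real_of_int t"] by (simp add: z_def Complex.DeMoivre mult_ac)
    ultimately show ?thesis using False by (simp add: geometric_sum)
  qed
  finally show ?thesis .
qed

context scaled begin

text \<open>\<open>K\<close> is an upper bound for the \<open>\<ell>\<^sup>2\<close> norm of \<open>v\<close> over the lattice.\<close>

definition l2b :: "zfun \<Rightarrow> real \<Rightarrow> bool" where
  "l2b v K \<longleftrightarrow> 0 \<le> K \<and> (\<forall>F. finite F \<and> F \<subseteq> Z \<longrightarrow> L2_set (\<lambda>n. cmod (v n)) F \<le> K)"

lemma l2b_nonneg: "l2b v K \<Longrightarrow> 0 \<le> K"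
  by (simp add: l2b_def)

lemma l2b_mono: "l2b v K \<Longrightarrow> K \<le> K' \<Longrightarrow> l2b v K'"
  by (force simp: l2b_def)

lemma l2b_le: "l2b v K \<Longrightarrow> (\<And>n. n \<in> Z \<Longrightarrow> cmod (u n) \<le> cmod (v n)) \<Longrightarrow> l2b u K"
  unfolding l2b_def
proof (intro conjI allI impI)
  fix F assume *: "0 \<le> K \<and> (\<forall>F. finite F \<and> F \<subseteq> Z \<longrightarrow> L2_set (\<lambda>n. cmod (v n)) F \<le> K)"
    "\<And>n. n \<in> Z \<Longrightarrow> cmod (u n) \<le> cmod (v n)" "finite F \<and> F \<subseteq> Z"
  have "L2_set (\<lambda>n. cmod (u n)) F \<le> L2_set (\<lambda>n. cmod (v n)) F"
    using * by (intro L2_set_mono) auto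
  also have "\<dots> \<le> K" using * by blast
  finally show "L2_set (\<lambda>n. cmod (u n)) F \<le> K" .
qed auto

lemma l2b_add: "l2b u K \<Longrightarrow> l2b v K' \<Longrightarrow> l2b (\<lambda>n. u n + v n) (K + K')"
  unfolding l2b_def
proof (intro conjI allI impI)
  fix F assume *: "0 \<le> K \<and> (\<forall>F. finite F \<and> F \<subseteq> Z \<longrightarrow> L2_set (\<lambda>n. cmod (u n)) F \<le> K)"
    "0 \<le> K' \<and> (\<forall>F. finite F \<and> F \<subseteq> Z \<longrightarrow> L2_set (\<lambda>n. cmod (v n)) F \<le> K')" "finite F \<and> F \<subseteq> Z"
  have "L2_set (\<lambda>n. cmod (u n + v n)) F \<le> L2_set (\<lambda>n. cmod (u n) + cmod (v n)) F"
    by (intro L2_set_mono norm_triangle_ineq) auto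
  also have "\<dots> \<le> L2_set (\<lambda>n. cmod (u n)) F + L2_set (\<lambda>n. cmod (v n)) F"
    by (rule L2_set_triangle_ineq)
  also have "\<dots> \<le> K + K'" using * by (intro add_mono) auto
  finally show "L2_set (\<lambda>n. cmod (u n + v n)) F \<le> K + K'" .
qed auto

lemma l2b_scale: "l2b u K \<Longrightarrow> l2b (\<lambda>n. c * u n) (cmod c * K)"
  unfolding l2b_def by (auto simp: norm_mult L2_set_right_distrib[symmetric] intro!: mult_left_mono)

lemma l2b_uminus: "l2b u K \<Longrightarrow> l2b (\<lambda>n. - u n) K"
  using l2b_le[of u K "\<lambda>n. - u n"] by simp

lemma l2b_diff: "l2b u K \<Longrightarrow> l2b v K' \<Longrightarrow> l2b (\<lambda>n. u n - v n) (K + K')"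
  using l2b_add[of u K "\<lambda>n. - v n"] l2b_uminus by simp

lemma l2b_0: "0 \<le> K \<Longrightarrow> l2b (\<lambda>n. 0) K"
  by (simp add: l2b_def L2_set_def)

lemma l2b_sum: "finite I \<Longrightarrow> (\<And>i. i \<in> I \<Longrightarrow> l2b (f i) (K i)) \<Longrightarrow> l2b (\<lambda>n. \<Sum>i\<in>I. f i n) (\<Sum>i\<in>I. K i)"
  by (induction I rule: finite_induct) (auto intro!: l2b_0 l2b_add)

lemma l2b_shift:
  assumes "l2b v K" "x \<in> Z" shows "l2b (\<lambda>n. v (\<lambda>i. n i + x i)) K"
  unfolding l2b_def
proof (intro conjI allI impI)
  show "0 \<le> K" using assms l2b_nonneg by auto
  fix F assume F: "finite F \<and> F \<subseteq> Z"
  let ?h = "\<lambda>n i. n i + x i"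
  have inj: "inj_on ?h F" by (auto simp: inj_on_def fun_eq_iff)
  have "L2_set (\<lambda>n. cmod (v (?h n))) F = L2_set (\<lambda>n. cmod (v n)) (?h ` F)"
    unfolding L2_set_def by (subst sum.reindex[OF inj]) (simp add: comp_def)
  also have "\<dots> \<le> K"
  proof -
    have "finite (?h ` F) \<and> ?h ` F \<subseteq> Z" using assms F by auto
    then show ?thesis using assms unfolding l2b_def by blast
  qed
  finally show "L2_set (\<lambda>n. cmod (v (\<lambda>i. n i + x i))) F \<le> K" .
qed

text \<open>Translations do not increase the norm, and the closure operations only change the
  constant. It serves as a crude bound on small tails, so its size does not matter.\<close>

lemma l2b_TI: "TI A \<Longrightarrow> \<exists>C\<ge>0. \<forall>v K. l2b v K \<longrightarrow> l2b (A v) (C * K)"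
proof (induction rule: TI.induct)
  case (shift x) then show ?case by (intro exI[of _ 1]) (auto intro: l2b_shift)
next
  case (add A B)
  then obtain C D where *: "0 \<le> C" "0 \<le> D" "\<forall>v K. l2b v K \<longrightarrow> l2b (A v) (C * K)" "\<forall>v K. l2b v K \<longrightarrow> l2b (B v) (D * K)"
    by blast
  then show ?case by (intro exI[of _ "C + D"]) (auto simp: distrib_right intro!: l2b_add)
next
  case (scale A c)
  then obtain C where *: "0 \<le> C" "\<forall>v K. l2b v K \<longrightarrow> l2b (A v) (C * K)" by blast
  then show ?case by (intro exI[of _ "cmod c * C"]) (auto simp: mult.assoc intro!: l2b_scale)
next
  case (comp A B)
  then obtain C D where *: "0 \<le> C" "0 \<le> D" "\<forall>v K. l2b v K \<longrightarrow> l2b (A v) (C * K)" "\<forall>v K. l2b v K \<longrightarrow> l2b (B v) (D * K)"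
    by blast
  then show ?case by (intro exI[of _ "C * D"]) (auto simp: mult.assoc)
qed

lemma l2b_lim: assumes "\<And>e. 0 < e \<Longrightarrow> l2b v (K + e)" "0 \<le> K" shows "l2b v K"
  unfolding l2b_def using assms by (auto simp: l2b_def intro: field_le_epsilon)

lemma l2b_finite_supp:
  assumes "finite F" "\<And>n. n \<in> Z \<Longrightarrow> n \<notin> F \<Longrightarrow> v n = 0" "L2_set (\<lambda>n. cmod (v n)) F \<le> K" "0 \<le> K"
  shows "l2b v K"
  unfolding l2b_def
proof (intro conjI allI impI)
  fix G assume G: "finite G \<and> G \<subseteq> Z"
  have "(\<Sum>n\<in>G. (cmod (v n))\<^sup>2) = (\<Sum>n\<in>G \<inter> F. (cmod (v n))\<^sup>2)"
    using G assms(2) by (intro sum.mono_neutral_right) (auto simp: subset_iff)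
  also have "\<dots> \<le> (\<Sum>n\<in>F. (cmod (v n))\<^sup>2)"
    using assms by (intro sum_mono2) auto
  finally have "L2_set (\<lambda>n. cmod (v n)) G \<le> L2_set (\<lambda>n. cmod (v n)) F"
    by (simp add: L2_set_def)
  with assms show "L2_set (\<lambda>n. cmod (v n)) G \<le> K" by simp
qed fact

text \<open>\<open>F\<close> almost attains the supremum of the finite sums of squares; a finite set
  disjoint from \<open>F\<close> can then add at most \<open>e\<close> squared. This reduces
  estimates for square-summable functions to finitely supported ones.\<close>

lemma l2b_tail:
  assumes "l2b v K" "0 < e"
  obtains F where "finite F" "F \<subseteq> Z" "l2b (\<lambda>n. if n \<in> F then 0 else v n) e"
proof -
  let ?s = "\<lambda>F. \<Sum>n\<in>F. (cmod (v n))\<^sup>2"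
  let ?A = "{F. finite F \<and> F \<subseteq> Z}"
  have sq: "?s F \<le> K\<^sup>2" if "F \<in> ?A" for F
  proof -
    have "L2_set (\<lambda>n. cmod (v n)) F \<le> K" using that assms(1) unfolding l2b_def by blast
    then have "(L2_set (\<lambda>n. cmod (v n)) F)\<^sup>2 \<le> K\<^sup>2" by (intro power_mono) auto
    then show ?thesis by (simp add: L2_set_def sum_nonneg)
  qed
  then have bdd: "bdd_above (?s ` ?A)" by (intro bdd_aboveI[of _ "K\<^sup>2"]) blast
  have ne: "?A \<noteq> {}" by auto
  obtain F where F: "F \<in> ?A" "(SUP F\<in>?A. ?s F) - e\<^sup>2 < ?s F"
    using less_cSUP_iff[OF ne bdd, of "(SUP F\<in>?A. ?s F) - e\<^sup>2"] assms(2) by auto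
  have "l2b (\<lambda>n. if n \<in> F then 0 else v n) e"
    unfolding l2b_def
  proof (intro conjI allI impI)
    fix G assume G: "finite G \<and> G \<subseteq> Z"
    have "(\<Sum>n\<in>G. (cmod (if n \<in> F then 0 else v n))\<^sup>2) = ?s (G - F)"
      using G by (intro sum.mono_neutral_cong_right) auto
    also have "\<dots> = ?s (G \<union> F) - ?s F"
    proof -
      have "?s (G \<union> F) = ?s (G - F) + ?s F" using G F
        by (subst sum.union_disjoint[symmetric]) (auto intro!: sum.cong)
      then show ?thesis by simp
    qed
    also have "\<dots> \<le> (SUP F\<in>?A. ?s F) - ?s F"
      using G F by (intro diff_right_mono cSUP_upper bdd) auto
    also have "\<dots> \<le> e\<^sup>2" using F by simp
    finally show "L2_set (\<lambda>n. cmod (if n \<in> F then 0 else v n)) G \<le> e"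
      unfolding L2_set_def using assms(2) by (simp add: real_le_lsqrt)
  qed (use assms in auto)
  with F show ?thesis by (intro that[of F]) auto
qed

section \<open>The discrete Fourier transform of finitely supported functions\<close>

definition dot :: "(nat \<Rightarrow> real) \<Rightarrow> (nat \<Rightarrow> int) \<Rightarrow> real" where
  "dot \<theta> n = (\<Sum>i<d. \<theta> i * real_of_int (n i))"

text \<open>A trigonometric polynomial. For infinite support the sum would be 0 by convention, so
  the rules below come with finite support.\<close>

definition hat :: "zfun \<Rightarrow> (nat \<Rightarrow> real) \<Rightarrow> complex" where
  "hat v \<theta> = (\<Sum>n | v n \<noteq> 0. v n * cis (- dot \<theta> n))"

definition fsupp :: "zfun \<Rightarrow> bool" where
  "fsupp v \<longleftrightarrow> finite {n. v n \<noteq> 0} \<and> {n. v n \<noteq> 0} \<subseteq> Z"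

text \<open>The Fourier multiplier of the difference \<open>dl l\<close>, by
  \<open>hat_dl\<close>.\<close>

definition sym :: "nat \<times> bool \<Rightarrow> (nat \<Rightarrow> real) \<Rightarrow> complex" where
  "sym l \<theta> = (if snd l then cis (\<theta> (fst l)) - 1 else 1 - cis (- \<theta> (fst l)))"

lemma hat_eq: "finite F \<Longrightarrow> {n. v n \<noteq> 0} \<subseteq> F \<Longrightarrow> hat v \<theta> = (\<Sum>n\<in>F. v n * cis (- dot \<theta> n))"
  unfolding hat_def by (intro sum.mono_neutral_left) auto

lemma fsupp_shift: assumes "fsupp v" "x \<in> Z" shows "fsupp (\<lambda>n. v (\<lambda>i. n i + x i))"
proof -
  have eq: "{n. v (\<lambda>i. n i + x i) \<noteq> 0} = (\<lambda>n i. n i - x i) ` {n. v n \<noteq> 0}" (is "?A = ?f ` ?B")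
  proof (intro equalityI subsetI)
    fix n assume "n \<in> ?A"
    then show "n \<in> ?f ` ?B" by (intro image_eqI[of _ _ "\<lambda>i. n i + x i"]) auto
  qed auto
  show ?thesis using assms unfolding fsupp_def eq by auto
qed

lemma fsupp_add: "fsupp u \<Longrightarrow> fsupp v \<Longrightarrow> fsupp (\<lambda>n. u n + v n)"
proof -
  assume *: "fsupp u" "fsupp v"
  have "{n. u n + v n \<noteq> 0} \<subseteq> {n. u n \<noteq> 0} \<union> {n. v n \<noteq> 0}" by auto
  with * show ?thesis unfolding fsupp_def by (meson finite_Un finite_subset order_trans Un_least)
qed

lemma fsupp_scale: "fsupp u \<Longrightarrow> fsupp (\<lambda>n. c * u n)"
  unfolding fsupp_def by (auto intro: finite_subset[of _ "{n. u n \<noteq> 0}"])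

lemma fsupp_TI: "TI A \<Longrightarrow> fsupp v \<Longrightarrow> fsupp (A v)"
  by (induction A arbitrary: v rule: TI.induct) (auto intro: fsupp_shift fsupp_add fsupp_scale)

lemma hat_add:
  assumes "fsupp u" "fsupp v" shows "hat (\<lambda>n. u n + v n) \<theta> = hat u \<theta> + hat v \<theta>"
proof -
  let ?F = "{n. u n \<noteq> 0} \<union> {n. v n \<noteq> 0}"
  have F: "finite ?F" using assms by (auto simp: fsupp_def)
  show ?thesis
    by (subst (1 2 3) hat_eq[OF F]) (auto simp: sum.distrib distrib_right)
qed

lemma hat_scale: assumes "fsupp u" shows "hat (\<lambda>n. c * u n) \<theta> = c * hat u \<theta>"
proof -
  let ?F = "{n. u n \<noteq> 0}"
  have F: "finite ?F" using assms by (auto simp: fsupp_def)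
  show ?thesis
    by (subst (1 2) hat_eq[OF F]) (auto simp: sum_distrib_left mult.assoc)
qed

lemma hat_sum: "finite I \<Longrightarrow> (\<And>i. i \<in> I \<Longrightarrow> fsupp (f i)) \<Longrightarrow>
    hat (\<lambda>n. \<Sum>i\<in>I. f i n) \<theta> = (\<Sum>i\<in>I. hat (f i) \<theta>) \<and> fsupp (\<lambda>n. \<Sum>i\<in>I. f i n)"
proof (induction I rule: finite_induct)
  case empty then show ?case by (simp add: hat_def fsupp_def)
next
  case (insert i I)
  then show ?case using hat_add[of "f i" "\<lambda>n. \<Sum>i\<in>I. f i n"] by (auto intro: fsupp_add)
qed

lemma hat_shift:
  assumes "fsupp v" "x \<in> Z" shows "hat (\<lambda>n. v (\<lambda>i. n i + x i)) \<theta> = cis (dot \<theta> x) * hat v \<theta>"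
proof -
  have "hat (\<lambda>n. v (\<lambda>i. n i + x i)) \<theta> = (\<Sum>n | v n \<noteq> 0. v n * cis (- dot \<theta> (\<lambda>i. n i - x i)))"
    unfolding hat_def
    by (rule sum.reindex_bij_witness[of _ "\<lambda>n i. n i - x i" "\<lambda>n i. n i + x i"]) auto
  also have "\<dots> = (\<Sum>n | v n \<noteq> 0. cis (dot \<theta> x) * (v n * cis (- dot \<theta> n)))"
  proof (intro sum.cong refl)
    fix n
    have "dot \<theta> (\<lambda>i. n i - x i) = dot \<theta> n - dot \<theta> x"
      by (simp add: dot_def sum_subtractf algebra_simps)
    then have "cis (- dot \<theta> (\<lambda>i. n i - x i)) = cis (dot \<theta> x) * cis (- dot \<theta> n)"
      by (simp add: cis_mult)
    then show "v n * cis (- dot \<theta> (\<lambda>i. n i - x i)) = cis (dot \<theta> x) * (v n * cis (- dot \<theta> n))" by simp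
  qed
  finally show ?thesis by (simp add: hat_def sum_distrib_left)
qed

lemma hat_upd:
  assumes "fsupp v" "j < d" 
  shows "hat (\<lambda>n. v (n(j := n j + c))) \<theta> = cis (\<theta> j * c) * hat v \<theta> \<and> fsupp (\<lambda>n. v (n(j := n j + c)))"
proof -
  have eq: "(\<lambda>i. n i + ((\<lambda>_. 0)(j := c)) i) = n(j := n j + c)" for n :: "nat \<Rightarrow> int" by auto
  have x: "(\<lambda>_. 0)(j := c) \<in> Z" using assms by (simp add: Z_def)
  have "dot \<theta> ((\<lambda>_. 0)(j := c)) = (\<Sum>i<d. if i = j then \<theta> j * c else 0)"
    unfolding dot_def by (intro sum.cong) auto
  then have "dot \<theta> ((\<lambda>_. 0)(j := c)) = \<theta> j * c" using assms by simp
  with hat_shift[OF assms(1) x] fsupp_shift[OF assms(1) x] show ?thesis by (simp only: eq)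
qed

lemma hat_dl:
  assumes "fsupp v" "fst l < d" shows "hat (dl l v) \<theta> = sym l \<theta> * hat v \<theta>"
proof -
  note m = fsupp_scale[OF assms(1), of "-1"] hat_scale[OF assms(1), of "-1" \<theta>]
  show ?thesis
  proof (cases "snd l")
    case True
    have "hat (\<lambda>n. v (n(fst l := n (fst l) + 1)) + -1 * v n) \<theta> = cis (\<theta> (fst l)) * hat v \<theta> + -1 * hat v \<theta>"
      using hat_upd[OF assms, of 1] m by (subst hat_add) auto
    with True show ?thesis by (simp add: dl_def df_def sym_def algebra_simps)
  next
    case False
    let ?u = "\<lambda>n. v (n(fst l := n (fst l) + (-1)))"
    have u: "fsupp ?u" "hat ?u \<theta> = cis (\<theta> (fst l) * (-1)) * hat v \<theta>" using hat_upd[OF assms, of "-1" \<theta>] by auto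
    have "hat (\<lambda>n. v n + -1 * ?u n) \<theta> = hat v \<theta> + -1 * (cis (- \<theta> (fst l)) * hat v \<theta>)"
      by (subst hat_add[OF assms(1) fsupp_scale[OF u(1)]], subst hat_scale[OF u(1)], subst u(2)) simp
    with False show ?thesis by (simp add: dl_def db_def sym_def algebra_simps)
  qed
qed

lemma hat_dop:
  "w \<in> words \<Longrightarrow> fsupp v \<Longrightarrow> hat (dop w v) \<theta> = (\<Prod>l\<leftarrow>w. sym l \<theta>) * hat v \<theta>"
proof (induction w)
  case (Cons l w)
  then show ?case using hat_dl[of "dop w v" l \<theta>] fsupp_TI[OF TI_dop, of w v] by auto
qed simp

text \<open>An equispaced grid on the torus, which replaces the integral over it; each use takes
  \<open>N\<close> large compared with the supports involved.\<close>

definition freqs :: "nat \<Rightarrow> (nat \<Rightarrow> real) set" where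
  "freqs N = (\<lambda>k i. 2 * pi * real_of_int (k i) / real N) ` zbox d (\<lambda>_. {0..<int N})"

text \<open>Two points of the support differ by less than \<open>2*M+1\<close> in every coordinate,
  so distinct points yield characters that are exactly orthogonal on the grid.\<close>

lemma plancherel:
  fixes M :: nat
  assumes v: "fsupp v" and M: "\<And>n i. v n \<noteq> 0 \<Longrightarrow> i < d \<Longrightarrow> \<bar>n i\<bar> \<le> int M"
  shows "(\<Sum>\<theta>\<in>freqs (2*M+1). (cmod (hat v \<theta>))\<^sup>2) = real (2*M+1) ^ d * (\<Sum>n | v n \<noteq> 0. (cmod (v n))\<^sup>2)"
proof -
  define N where "N = 2*M+1"
  let ?F = "{n. v n \<noteq> 0}"
  let ?K = "zbox d (\<lambda>_. {0..<int N})"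
  let ?t = "\<lambda>k i. 2 * pi * real_of_int (k i) / real N"
  have N: "0 < N" by (simp add: N_def)
  have inj: "inj_on ?t ?K"
    using N by (auto simp: inj_on_def fun_eq_iff)
  have orth: "(\<Sum>k\<in>?K. cis (dot (?t k) n' - dot (?t k) n)) = (if n = n' then of_nat N ^ d else 0)"
    if n: "n \<in> ?F" "n' \<in> ?F" for n n'
  proof -
    have "cis (dot (?t k) n' - dot (?t k) n) = (\<Prod>i<d. cis (2 * pi * real_of_int (k i) / N * (n' i - n i)))" for k
    proof -
      have "cis (\<Sum>i<e. f i) = (\<Prod>i<e. cis (f i))" for e and f :: "nat \<Rightarrow> real"
        by (induction e) (auto simp: cis_mult[symmetric])
      then show ?thesis
        by (simp add: dot_def sum_subtractf[symmetric] algebra_simps diff_divide_distrib)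
    qed
    then have "(\<Sum>k\<in>?K. cis (dot (?t k) n' - dot (?t k) n)) =
        (\<Sum>k\<in>?K. \<Prod>i<d. cis (2 * pi * real_of_int (k i) / N * (n' i - n i)))" by simp
    also have "\<dots> = (\<Prod>i<d. \<Sum>t\<in>{0..<int N}. cis (2 * pi * real_of_int t / N * (n' i - n i)))"
      by (subst sum_prod_zbox[of d "\<lambda>_. {0..<int N}" "\<lambda>i t. cis (2 * pi * real_of_int t / N * (n' i - n i))"]) auto
    also have "\<dots> = (\<Prod>i<d. if n' i = n i then of_nat N else 0)"
    proof (intro prod.cong refl)
      fix i assume i: "i \<in> {..<d}"
      have "\<bar>n' i - n i\<bar> < int N" using M[of n i] M[of n' i] n i by (simp add: N_def)
      then have "int N dvd n' i - n i \<longleftrightarrow> n' i = n i"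
        using zdvd_imp_le[of "int N" "\<bar>n' i - n i\<bar>"] by auto
      then show "(\<Sum>t\<in>{0..<int N}. cis (2 * pi * real_of_int t / N * (n' i - n i))) = (if n' i = n i then of_nat N else 0)"
        using sum_cis_roots[OF N, of "n' i - n i"] by simp
    qed
    also have "\<dots> = (if n = n' then of_nat N ^ d else 0)"
    proof (cases "n = n'")
      case False
      have "n \<in> Z" "n' \<in> Z" using v n by (auto simp: fsupp_def)
      moreover obtain i where "n' i \<noteq> n i" using False by (metis ext)
      ultimately have "i < d" "n' i \<noteq> n i" by (auto simp: Z_def not_le[symmetric])
      then have "(\<Prod>i<d. if n' i = n i then of_nat N else 0 :: complex) = 0" by (intro prod_zero) auto
      with False show ?thesis by simp
    qed simp
    finally show ?thesis .
  qed
  have fin: "finite ?F" using v by (simp add: fsupp_def)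
  have sq: "complex_of_real ((cmod (hat v \<theta>))\<^sup>2) = (\<Sum>n\<in>?F. \<Sum>n'\<in>?F. v n * cnj (v n') * cis (dot \<theta> n' - dot \<theta> n))" for \<theta>
  proof -
    have "complex_of_real ((cmod (hat v \<theta>))\<^sup>2) = hat v \<theta> * cnj (hat v \<theta>)"
      using complex_norm_square by blast
    also have "\<dots> = (\<Sum>n\<in>?F. v n * cis (- dot \<theta> n)) * (\<Sum>n\<in>?F. cnj (v n) * cis (dot \<theta> n))"
      by (simp add: hat_def cis_cnj)
    also have "\<dots> = (\<Sum>n\<in>?F. \<Sum>n'\<in>?F. (v n * cis (- dot \<theta> n)) * (cnj (v n') * cis (dot \<theta> n')))"
      by (rule sum_product)
    also have "\<dots> = (\<Sum>n\<in>?F. \<Sum>n'\<in>?F. v n * cnj (v n') * cis (dot \<theta> n' - dot \<theta> n))"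
    proof (intro sum.cong refl)
      fix n n'
      have "cis (dot \<theta> n' - dot \<theta> n) = cis (- dot \<theta> n) * cis (dot \<theta> n')" by (simp add: cis_mult)
      then show "v n * cis (- dot \<theta> n) * (cnj (v n') * cis (dot \<theta> n')) = v n * cnj (v n') * cis (dot \<theta> n' - dot \<theta> n)"
        by (simp only: mult_ac)
    qed
    finally show ?thesis .
  qed
  have "complex_of_real (\<Sum>\<theta>\<in>freqs N. (cmod (hat v \<theta>))\<^sup>2) = (\<Sum>k\<in>?K. complex_of_real ((cmod (hat v (?t k)))\<^sup>2))"
    unfolding freqs_def by (subst sum.reindex[OF inj]) (simp add: comp_def)
  also have "\<dots> = (\<Sum>k\<in>?K. \<Sum>n\<in>?F. \<Sum>n'\<in>?F. v n * cnj (v n') * cis (dot (?t k) n' - dot (?t k) n))"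
    by (simp only: sq)
  also have "\<dots> = (\<Sum>n\<in>?F. \<Sum>k\<in>?K. \<Sum>n'\<in>?F. v n * cnj (v n') * cis (dot (?t k) n' - dot (?t k) n))"
    by (rule sum.swap)
  also have "\<dots> = (\<Sum>n\<in>?F. \<Sum>n'\<in>?F. \<Sum>k\<in>?K. v n * cnj (v n') * cis (dot (?t k) n' - dot (?t k) n))"
    by (intro sum.cong refl sum.swap)
  also have "\<dots> = (\<Sum>n\<in>?F. \<Sum>n'\<in>?F. if n = n' then v n * cnj (v n) * of_nat N ^ d else 0)"
  proof (intro sum.cong refl)
    fix n n' assume "n \<in> ?F" "n' \<in> ?F"
    then show "(\<Sum>k\<in>?K. v n * cnj (v n') * cis (dot (?t k) n' - dot (?t k) n)) = (if n = n' then v n * cnj (v n) * of_nat N ^ d else 0)"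
      by (subst sum_distrib_left[symmetric]) (simp add: orth)
  qed
  also have "\<dots> = (\<Sum>n\<in>?F. v n * cnj (v n) * of_nat N ^ d)"
    using fin by (intro sum.cong refl) (simp add: sum.delta)
  also have "\<dots> = complex_of_real (real N ^ d * (\<Sum>n\<in>?F. (cmod (v n))\<^sup>2))"
    by (simp add: sum_distrib_left complex_norm_square[symmetric] mult_ac)
  finally show ?thesis unfolding N_def of_real_eq_iff .
qed

lemma L2_hat:
  assumes "fsupp v" "\<And>n i. v n \<noteq> 0 \<Longrightarrow> i < d \<Longrightarrow> \<bar>n i\<bar> \<le> int M" 
  shows "L2_set (\<lambda>\<theta>. cmod (hat v \<theta>)) (freqs (2*M+1)) = sqrt (real (2*M+1) ^ d) * L2_set (\<lambda>n. cmod (v n)) {n. v n \<noteq> 0}"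
  using plancherel[of v M] assms unfolding L2_set_def by (simp add: real_sqrt_mult)

end

section \<open>The elliptic estimate\<close>

text \<open>Bolzano-Weierstrass, refining the subsequence once for each coordinate.\<close>

lemma convergent_subseq_finite:
  fixes f :: "nat \<Rightarrow> nat \<Rightarrow> complex"
  assumes "\<And>n j. j < k \<Longrightarrow> cmod (f n j) \<le> B"
  shows "\<exists>r l. strict_mono (r :: nat \<Rightarrow> nat) \<and> (\<forall>j<k. (\<lambda>n. f (r n) j) \<longlonglongrightarrow> l j)"
  using assms
proof (induction k)
  case 0
  show ?case by (intro exI[of _ id]) (auto simp: strict_mono_def)
next
  case (Suc k)
  then obtain r l where r: "strict_mono (r :: nat \<Rightarrow> nat)" "\<forall>j<k. (\<lambda>n. f (r n) j) \<longlonglongrightarrow> l j"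
    by (meson less_Suc_eq)
  have "\<forall>n. f (r n) k \<in> cball 0 B" using Suc.prems by simp
  moreover have "seq_compact (cball (0::complex) B)"
    by (intro compact_imp_seq_compact compact_cball)
  ultimately obtain y q where q: "strict_mono (q :: nat \<Rightarrow> nat)" "((\<lambda>n. f (r n) k) \<circ> q) \<longlonglongrightarrow> y"
    by (metis (mono_tags, lifting) seq_compactE)
  have "(\<lambda>n. f ((r \<circ> q) n) j) \<longlonglongrightarrow> (l(k := y)) j" if "j < Suc k" for j
  proof (cases "j = k")
    case True then show ?thesis using q(2) by (simp add: comp_def)
  next
    case False
    then have "(\<lambda>n. f (r n) j) \<longlonglongrightarrow> l j" using r that by auto
    from LIMSEQ_subseq_LIMSEQ[OF this q(1)] show ?thesis using False by (simp add: comp_def)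
  qed
  moreover have "strict_mono (r \<circ> q)" using r q by (intro strict_mono_o)
  ultimately show ?case by blast
qed

context scaled begin

text \<open>Up to a power of the mesh, \<open>dop\<close> of this word is \<open>Dgam\<close> or
  \<open>Dbar\<close> of the multi-index, according to \<open>b\<close>.\<close>

definition mw :: "(nat \<Rightarrow> nat) \<Rightarrow> bool \<Rightarrow> (nat \<times> bool) list" where
  "mw \<gamma> b = concat (map (\<lambda>j. replicate (\<gamma> j) (j, b)) [0..<d])"

lemma mw_aux:
  fixes k :: nat
  shows "k \<le> d \<Longrightarrow> concat (map (\<lambda>j. replicate (\<gamma> j) (j, b)) [0..<k]) \<in> words"
    "wdeg (concat (map (\<lambda>j. replicate (\<gamma> j) (j, b)) [0..<k])) = (\<Sum>i<k. s i * \<gamma> i)"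
    "(\<Prod>l\<leftarrow>concat (map (\<lambda>j. replicate (\<gamma> j) (j, b)) [0..<k]). f l) = (\<Prod>j<k. f (j, b) ^ \<gamma> j :: complex)"
proof (induction k)
  case (Suc k)
  have r: "replicate n (j, b) \<in> words" if "j < d" for j n using that by (induction n) auto
  have wr: "wdeg (replicate n (j, b)) = s j * n" for j n by (induction n) auto
  { case 1 then show ?case using Suc(1) r[of k] by auto }
  { case 2 then show ?case using Suc(2) wr[of "\<gamma> k" k] by simp }
  { case 3 then show ?case using Suc(3) by (simp add: prod_list_replicate) }
qed simp_all

lemma mw_words: "mw \<gamma> b \<in> words" and wdeg_mw: "wdeg (mw \<gamma> b) = sdeg s d \<gamma>"
  and prod_mw: "(\<Prod>l\<leftarrow>mw \<gamma> b. f l) = (\<Prod>j<d. f (j, b) ^ \<gamma> j :: complex)"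
  using mw_aux[where k = d] by (simp_all add: mw_def sdeg_def)

text \<open>All \<open>s i\<close> are at least 1, so each entry of a multi-index is bounded by its
  scaled degree.\<close>

lemma finite_Mset: "finite (Mset s d m)"
proof -
  let ?A = "{f. \<forall>x. (x \<in> {..<d} \<longrightarrow> f x \<in> {..m}) \<and> (x \<notin> {..<d} \<longrightarrow> f x = (0::nat))}"
  have le: "\<gamma> i \<le> sdeg s d \<gamma>" if "i < d" for \<gamma> i
  proof -
    have "\<gamma> i \<le> s i * \<gamma> i" using s_pos[OF that] by simp
    also have "\<dots> \<le> sdeg s d \<gamma>" unfolding sdeg_def using that by (intro member_le_sum) auto
    finally show ?thesis .
  qed
  have "Mset s d m \<subseteq> ?A \<times> ?A"
  proof
    fix p assume p: "p \<in> Mset s d m"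
    then have "fst p i \<le> m" "snd p i \<le> m" if "i < d" for i
      using le[OF that, of "fst p"] le[OF that, of "snd p"] by (auto simp: Mset_def)
    with p show "p \<in> ?A \<times> ?A" by (cases p) (auto simp: Mset_def MI_def)
  qed
  moreover have "finite ?A" by (rule finite_set_of_finite_funs) auto
  ultimately show ?thesis by (meson finite_SigmaI finite_subset)
qed

lemma le_sum_powr_pow:
  assumes "i < d" "\<And>j. j < d \<Longrightarrow> 0 \<le> r j"
  shows "r i \<le> (\<Sum>j<d. r j powr (1 / real (s j))) ^ s i"
proof -
  have s: "1 \<le> s i" using s_pos assms by auto
  have "r i = (r i powr (1 / real (s i))) ^ s i"
  proof (cases "r i = 0")
    case True then show ?thesis using s by simp
  next
    case False
    then have p: "0 < r i" using assms by (simp add: order_less_le)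
    then have "(r i powr (1 / real (s i))) ^ s i = (r i powr (1 / real (s i))) powr real (s i)"
      by (subst powr_realpow) auto
    then show ?thesis using s p by (simp add: powr_powr)
  qed
  also have "\<dots> \<le> (\<Sum>j<d. r j powr (1 / real (s j))) ^ s i"
    by (intro power_mono member_le_sum) (use assms in auto)
  finally show ?thesis .
qed

end

section \<open>The symbol of the operator and its lower bound\<close>

locale elliptic = scaled +
  fixes m :: nat and a :: "(nat \<Rightarrow> nat) \<Rightarrow> (nat \<Rightarrow> nat) \<Rightarrow> complex"
  assumes m_pos: "0 < m" and ell: "disc_elliptic s d m a 1"
begin

text \<open>By \<open>Lop_emb\<close> the operator of any mesh \<epsilon> is
  \<open>1 / \<epsilon> ^ m\<close> times this one.\<close>

definition Lz :: "zfun \<Rightarrow> zfun" where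
  "Lz u = (\<lambda>n. \<Sum>p\<in>Mset s d m. a (fst p) (snd p) * dop (mw (fst p) True @ mw (snd p) False) u n)"

text \<open>The symbol as a polynomial in independent variables for the forward and the backward
  differences. The discrete and the continuum symbol are both values of it, so homogeneity and
  continuity are proved once.\<close>

definition PL :: "(nat \<Rightarrow> complex) \<Rightarrow> (nat \<Rightarrow> complex) \<Rightarrow> complex" where
  "PL z w = (\<Sum>p\<in>Mset s d m. a (fst p) (snd p) * (\<Prod>j<d. z j ^ fst p j) * (\<Prod>j<d. w j ^ snd p j))"

definition Ls :: "(nat \<Rightarrow> real) \<Rightarrow> complex" where
  "Ls \<theta> = PL (\<lambda>j. cis (\<theta> j) - 1) (\<lambda>j. 1 - cis (- \<theta> j))"

text \<open>The anisotropic size of a frequency, measured by chord lengths so that it is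
  periodic.\<close>

definition Xi :: "(nat \<Rightarrow> real) \<Rightarrow> real" where
  "Xi \<theta> = (\<Sum>j<d. cmod (cis (\<theta> j) - 1) powr (1 / real (s j)))"

lemma TI_Lz: "TI Lz"
  unfolding Lz_def by (intro TI_sum TI.scale TI_dop) (simp add: mw_words)

lemma symbol_disc_eq: "symbol_disc s d m a 1 \<theta> = Ls \<theta>"
  unfolding symbol_disc_def Ls_def PL_def case_prod_unfold
proof (intro sum.cong refl arg_cong2[where f = "(*)"])
  fix p :: "(nat \<Rightarrow> nat) \<times> (nat \<Rightarrow> nat)"
  have 1: "\<i> * xi_eps s 1 \<theta> j = cis (\<theta> j) - 1" for j
    by (simp add: xi_eps_def cis_conv_exp)
  have 2: "\<i> * cnj (xi_eps s 1 \<theta> j) = 1 - cis (- \<theta> j)" for j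
  proof -
    have "xi_eps s 1 \<theta> j = \<i> * (1 - cis (\<theta> j))" by (simp add: xi_eps_def cis_conv_exp)
    then have "cnj (xi_eps s 1 \<theta> j) = - \<i> * (1 - cis (- \<theta> j))" by (simp add: cis_cnj)
    then show ?thesis by simp
  qed
  show "mpow d (\<lambda>j. \<i> * xi_eps s 1 \<theta> j) (fst p) = (\<Prod>j<d. (cis (\<theta> j) - 1) ^ fst p j)"
    unfolding mpow_def 1 ..
  show "mpow d (\<lambda>j. \<i> * cnj (xi_eps s 1 \<theta> j)) (snd p) = (\<Prod>j<d. (1 - cis (- \<theta> j)) ^ snd p j)"
    unfolding mpow_def 2 ..
qed

lemma symbol_cont_eq: "symbol_cont s d m a \<xi> = PL (\<lambda>j. \<i> * of_real (\<xi> j)) (\<lambda>j. \<i> * of_real (\<xi> j))"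
  unfolding symbol_cont_def PL_def case_prod_unfold mpow_def
  by (simp only: power_add prod.distrib mult.assoc)

lemma ell_disc: "\<exists>j<d. \<theta> j \<notin> {2 * pi / 1 ^ s j * real_of_int n | n. True} \<Longrightarrow> Ls \<theta> \<noteq> 0"
  using ell unfolding disc_elliptic_def symbol_disc_eq by (elim conjE allE[of _ \<theta>]) (erule mp)

lemma ell_cont: "\<exists>j<d. \<xi> j \<noteq> 0 \<Longrightarrow> symbol_cont s d m a \<xi> \<noteq> 0"
  using ell unfolding disc_elliptic_def by (elim conjE allE[of _ \<xi>]) (erule mp)

text \<open>On the \<open>j\<close>-th coordinate axis only monomials in that variable alone
  survive. As the continuum symbol does not vanish there, such a monomial occurs, and
  \<open>m\<close> is a positive multiple of \<open>s j\<close>.\<close>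

lemma s_le_m: assumes "j < d" shows "s j \<le> m"
proof -
  let ?\<xi> = "\<lambda>i. if i = j then 1 else 0 :: real"
  have "symbol_cont s d m a ?\<xi> \<noteq> 0" using ell assms unfolding disc_elliptic_def by auto
  then obtain p where p: "p \<in> Mset s d m" "(\<Prod>i<d. (\<i> * of_real (?\<xi> i)) ^ fst p i) * (\<Prod>i<d. (\<i> * of_real (?\<xi> i)) ^ snd p i) \<noteq> 0"
    unfolding symbol_cont_eq PL_def by (smt (verit) mult_zero_right mult.assoc sum.neutral)
  have z: "fst p i = 0" "snd p i = 0" if "i < d" "i \<noteq> j" for i
    using p(2) that by auto
  have "(\<Sum>i<d. s i * fst p i) = (\<Sum>i<d. if i = j then s j * fst p j else 0)"
    by (rule sum.cong) (use z in auto)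
  moreover have "(\<Sum>i<d. s i * snd p i) = (\<Sum>i<d. if i = j then s j * snd p j else 0)"
    by (rule sum.cong) (use z in auto)
  ultimately have "m = s j * (fst p j + snd p j)"
    using p(1) assms by (auto simp: Mset_def sdeg_def distrib_left)
  with m_pos show ?thesis by (simp add: dvd_imp_le)
qed

lemma PL_homog: "PL (\<lambda>j. of_real (t ^ s j) * z j) (\<lambda>j. of_real (t ^ s j) * w j) = of_real (t ^ m) * PL z w"
proof -
  have h: "(\<Prod>j<d. (of_real (t ^ s j) * y j) ^ \<gamma> j) = of_real (t ^ sdeg s d \<gamma>) * (\<Prod>j<d. y j ^ \<gamma> j)" for y \<gamma>
    by (simp add: power_mult_distrib prod.distrib sdeg_def power_sum power_mult)
  show ?thesis
    unfolding PL_def h sum_distrib_left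
  proof (intro sum.cong refl)
    fix p assume "p \<in> Mset s d m"
    then have "m = sdeg s d (fst p) + sdeg s d (snd p)" by (auto simp: Mset_def)
    then show "a (fst p) (snd p) * (of_real (t ^ sdeg s d (fst p)) * (\<Prod>j<d. z j ^ fst p j)) * (of_real (t ^ sdeg s d (snd p)) * (\<Prod>j<d. w j ^ snd p j)) =
        of_real (t ^ m) * (a (fst p) (snd p) * (\<Prod>j<d. z j ^ fst p j) * (\<Prod>j<d. w j ^ snd p j))"
      by (simp add: power_add)
  qed
qed

lemma PL_cong: "(\<And>j. j < d \<Longrightarrow> z j = z' j) \<Longrightarrow> (\<And>j. j < d \<Longrightarrow> w j = w' j) \<Longrightarrow> PL z w = PL z' w'"
  unfolding PL_def by (intro sum.cong prod.cong refl arg_cong2[where f = "(*)"]) auto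

lemma PL_tendsto:
  assumes "\<And>j. j < d \<Longrightarrow> (\<lambda>n. z n j) \<longlonglongrightarrow> z' j" "\<And>j. j < d \<Longrightarrow> (\<lambda>n. w n j) \<longlonglongrightarrow> w' j"
  shows "(\<lambda>n. PL (z n) (w n)) \<longlonglongrightarrow> PL z' w'"
  unfolding PL_def using assms by (intro tendsto_intros) auto

lemma Xi_nonneg [simp]: "0 \<le> Xi \<theta>"
  unfolding Xi_def by (intro sum_nonneg) auto

lemma sym_bound: "j < d \<Longrightarrow> cmod (cis (\<theta> j) - 1) \<le> Xi \<theta> ^ s j"
  unfolding Xi_def by (rule le_sum_powr_pow) auto

text \<open>The unit circle is tangent to the imaginary direction at 1, to second order; this makes
  the blow-up limit in \<open>Ls_lower\<close> purely imaginary.\<close>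

lemma Re_unit_circle: assumes "cmod z = 1" shows "Re (z - 1) = - (cmod (z - 1))\<^sup>2 / 2"
proof -
  have "(Re z)\<^sup>2 + (Im z)\<^sup>2 = 1" using assms by (simp add: cmod_def)
  then show ?thesis by (simp add: cmod_power2 power2_diff field_simps)
qed

text \<open>Otherwise there are frequencies along which the quotient tends to \<open>0\<close>. If a subsequence stays away from
  \<open>0\<close> this contradicts the discrete ellipticity; if not, blowing up by the anisotropic size yields a
  nontrivial zero of the continuum symbol.\<close>

lemma Ls_lower: "\<exists>c>0. \<forall>\<theta>. c * Xi \<theta> ^ m \<le> cmod (Ls \<theta>)"
proof (rule ccontr)
  assume neg: "\<not> ?thesis"
  have "\<forall>n::nat. \<exists>\<theta>. cmod (Ls \<theta>) < (1 / real (Suc n)) * Xi \<theta> ^ m"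
  proof
    fix n :: nat
    have "0 < 1 / real (Suc n)" by simp
    with neg show "\<exists>\<theta>. cmod (Ls \<theta>) < (1 / real (Suc n)) * Xi \<theta> ^ m" by (meson not_le)
  qed
  then obtain \<theta> where \<theta>: "\<And>n. cmod (Ls (\<theta> n)) < (1 / real (Suc n)) * Xi (\<theta> n) ^ m" by metis
  define t where "t n = Xi (\<theta> n)" for n
  have t_pos: "0 < t n" for n
  proof -
    have "t n \<noteq> 0" using \<theta>[of n] m_pos norm_ge_zero[of "Ls (\<theta> n)"] by (auto simp: t_def zero_power)
    then show ?thesis using Xi_nonneg[of "\<theta> n"] unfolding t_def by linarith
  qed
  \<comment> \<open>Points of the circle replace the angles because they range over a compact set;
    \<open>\<zeta>\<close> is the forward symbol divided by its anisotropic scale.\<close>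
  define z where "z n j = cis (\<theta> n j)" for n j
  define \<zeta> where "\<zeta> n j = (z n j - 1) / of_real (t n ^ s j)" for n j
  have z1: "cmod (z n j) = 1" for n j by (simp add: z_def)
  have \<zeta>1: "cmod (\<zeta> n j) \<le> 1" if "j < d" for n j
    using sym_bound[OF that, of "\<theta> n"] t_pos[of n]
    by (simp add: \<zeta>_def norm_divide z_def t_def norm_power)
  obtain r1 z' where r1: "strict_mono (r1 :: nat \<Rightarrow> nat)" "\<forall>j<d. (\<lambda>n. z (r1 n) j) \<longlonglongrightarrow> z' j"
    using convergent_subseq_finite[of d z 1] z1 by (auto simp: less_imp_le)
  obtain r2 \<zeta>' where r2: "strict_mono (r2 :: nat \<Rightarrow> nat)" "\<forall>j<d. (\<lambda>n. \<zeta> (r1 (r2 n)) j) \<longlonglongrightarrow> \<zeta>' j"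
    using convergent_subseq_finite[of d "\<lambda>n. \<zeta> (r1 n)" 1] \<zeta>1 by auto
  define r where "r n = r1 (r2 n)" for n
  have r: "strict_mono r" using strict_mono_o[OF r1(1) r2(1)] by (simp add: r_def[abs_def] comp_def)
  have lz: "(\<lambda>n. z (r n) j) \<longlonglongrightarrow> z' j" if "j < d" for j
    using LIMSEQ_subseq_LIMSEQ[OF r1(2)[rule_format, OF that] r2(1)] by (simp add: r_def comp_def)
  have l\<zeta>: "(\<lambda>n. \<zeta> (r n) j) \<longlonglongrightarrow> \<zeta>' j" if "j < d" for j
    using r2(2) that by (simp add: r_def)
  have Lsz: "Ls (\<theta> n) = PL (\<lambda>j. z n j - 1) (\<lambda>j. 1 - cnj (z n j))" for n
    by (simp add: Ls_def z_def cis_cnj)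
  have z'1: "cmod (z' j) = 1" if "j < d" for j
    using tendsto_norm[OF lz[OF that]] z1 by (simp add: LIMSEQ_const_iff)
  have inv0: "(\<lambda>n. 1 / real (Suc (r n))) \<longlonglongrightarrow> 0"
    using LIMSEQ_subseq_LIMSEQ[OF LIMSEQ_inverse_real_of_nat r] by (simp add: comp_def inverse_eq_divide)
  show False
  proof (cases "\<exists>j<d. z' j \<noteq> 1")
    case True
    have tb: "t n \<le> 2 * real d" for n
    proof -
      have "cmod (cis (\<theta> n j) - 1) powr (1 / real (s j)) \<le> 2" if "j < d" for j
      proof (rule powr_inv_le[OF that])
        have "cmod (cis (\<theta> n j) - 1) \<le> 2" using norm_triangle_ineq4[of "cis (\<theta> n j)" 1] by simp
        also have "\<dots> \<le> 2 ^ s j" using s_pos[OF that] self_le_power[of "2::real" "s j"] by simp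
        finally show "cmod (cis (\<theta> n j) - 1) \<le> 2 ^ s j" .
      qed auto
      then have "t n \<le> (\<Sum>j<d. 2)" unfolding t_def Xi_def by (intro sum_mono) auto
      then show ?thesis by simp
    qed
    have "(\<lambda>n. PL (\<lambda>j. z (r n) j - 1) (\<lambda>j. 1 - cnj (z (r n) j))) \<longlonglongrightarrow> PL (\<lambda>j. z' j - 1) (\<lambda>j. 1 - cnj (z' j))"
      by (intro PL_tendsto tendsto_intros lz)
    moreover have "(\<lambda>n. PL (\<lambda>j. z (r n) j - 1) (\<lambda>j. 1 - cnj (z (r n) j))) \<longlonglongrightarrow> 0"
    proof (rule Lim_null_comparison)
      show "(\<lambda>n. 1 / real (Suc (r n)) * (2 * real d) ^ m) \<longlonglongrightarrow> 0"
        using tendsto_mult_right[OF inv0, of "(2 * real d) ^ m"] by simp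
      show "eventually (\<lambda>n. norm (PL (\<lambda>j. z (r n) j - 1) (\<lambda>j. 1 - cnj (z (r n) j))) \<le> 1 / real (Suc (r n)) * (2 * real d) ^ m) sequentially"
      proof (intro always_eventually allI)
        fix n
        have "norm (PL (\<lambda>j. z (r n) j - 1) (\<lambda>j. 1 - cnj (z (r n) j))) \<le> 1 / real (Suc (r n)) * t (r n) ^ m"
          using \<theta>[of "r n"] by (simp only: Lsz t_def less_imp_le)
        also have "\<dots> \<le> 1 / real (Suc (r n)) * (2 * real d) ^ m"
        proof -
          have "t (r n) ^ m \<le> (2 * real d) ^ m" using tb[of "r n"] t_pos[of "r n"] by (intro power_mono) (auto simp: less_imp_le)
          then show ?thesis by (intro mult_left_mono) auto
        qed
        finally show "norm (PL (\<lambda>j. z (r n) j - 1) (\<lambda>j. 1 - cnj (z (r n) j))) \<le> 1 / real (Suc (r n)) * (2 * real d) ^ m" by simp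
      qed
    qed
    ultimately have "PL (\<lambda>j. z' j - 1) (\<lambda>j. 1 - cnj (z' j)) = 0" using LIMSEQ_unique by blast
    \<comment> \<open>The limit lies on the circle, so it comes from actual angles, to which
      discrete ellipticity applies.\<close>
    moreover have "cis (Arg (z' j)) = z' j" if "j < d" for j
    proof -
      have "z' j \<noteq> 0" using z'1[OF that] by auto
      then show ?thesis using z'1[OF that] cis_Arg[of "z' j"] by (simp add: sgn_eq)
    qed
    ultimately have "Ls (\<lambda>j. Arg (z' j)) = 0"
      unfolding Ls_def by (subst PL_cong[where z' = "\<lambda>j. z' j - 1" and w' = "\<lambda>j. 1 - cnj (z' j)"]) (auto simp: cis_cnj[symmetric])
    moreover have "\<exists>j<d. Arg (z' j) \<notin> {2 * pi / 1 ^ s j * of_int n | n. True}"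
    proof -
      obtain j where j: "j < d" "z' j \<noteq> 1" using True by auto
      have "Arg (z' j) \<noteq> 2 * pi * of_int n" for n :: int
      proof
        assume "Arg (z' j) = 2 * pi * of_int n"
        then have "cis (Arg (z' j)) = 1" by (simp add: cis_multiple_2pi)
        with \<open>\<And>j. j < d \<Longrightarrow> cis (Arg (z' j)) = z' j\<close>[OF j(1)] j show False by simp
      qed
      then show ?thesis using j by auto
    qed
    ultimately show False using ell_disc[of "\<lambda>j. Arg (z' j)"] by iprover
  next
    case False
    have t0: "(\<lambda>n. t (r n)) \<longlonglongrightarrow> 0"
    proof -
      have "(\<lambda>n. cmod (z (r n) j - 1) powr (1 / real (s j))) \<longlonglongrightarrow> 0 powr (1 / real (s j))" if "j < d" for j
      proof (intro tendsto_powr' tendsto_const)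
        show "(\<lambda>n. cmod (z (r n) j - 1)) \<longlonglongrightarrow> 0"
          using tendsto_norm[OF tendsto_diff[OF lz[OF that] tendsto_const[of 1]]] False that by simp
        show "0 \<noteq> (0::real) \<or> 0 < 1 / real (s j) \<and> (\<forall>\<^sub>F n in sequentially. 0 \<le> cmod (z (r n) j - 1))"
          using s_pos[OF that] by simp
      qed
      then have "(\<lambda>n. t (r n)) \<longlonglongrightarrow> (\<Sum>j<d. 0 powr (1 / real (s j)))"
        unfolding t_def Xi_def z_def by (intro tendsto_sum) auto
      then show ?thesis by simp
    qed
    \<comment> \<open>By tangency the real part is of order \<open>t ^ s j\<close> and disappears in
      the limit.\<close>
    have re: "Re (\<zeta>' j) = 0" if "j < d" for j
    proof -
      have eq: "Re (\<zeta> n j) = - (t n ^ s j) * (cmod (\<zeta> n j))\<^sup>2 / 2" for n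
      proof -
        have "Re (\<zeta> n j) = Re (z n j - 1) / t n ^ s j" unfolding \<zeta>_def by (rule Re_divide_of_real)
        also have "\<dots> = - (cmod (z n j - 1))\<^sup>2 / 2 / t n ^ s j" using Re_unit_circle[OF z1[of n j]] by simp
        also have "cmod (z n j - 1) = t n ^ s j * cmod (\<zeta> n j)"
          using t_pos[of n] by (simp add: \<zeta>_def norm_divide norm_power)
        finally show ?thesis using t_pos[of n] by (simp add: power2_eq_square field_simps)
      qed
      have "(\<lambda>n. - (t (r n) ^ s j) * (cmod (\<zeta> (r n) j))\<^sup>2 / 2) \<longlonglongrightarrow> - (0 ^ s j) * (cmod (\<zeta>' j))\<^sup>2 / 2"
        by (intro tendsto_intros t0 l\<zeta> that) simp
      moreover have "(0::real) ^ s j = 0" using s_pos[OF that] by (simp add: zero_power)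
      ultimately have "(\<lambda>n. Re (\<zeta> (r n) j)) \<longlonglongrightarrow> 0" by (simp add: eq)
      moreover have "(\<lambda>n. Re (\<zeta> (r n) j)) \<longlonglongrightarrow> Re (\<zeta>' j)" by (intro tendsto_intros l\<zeta> that)
      ultimately show ?thesis using LIMSEQ_unique by blast
    qed
    \<comment> \<open>The rescaled points have anisotropic size exactly 1; this passes to the limit
      and keeps it from vanishing.\<close>
    have one: "(\<Sum>j<d. cmod (\<zeta> n j) powr (1 / real (s j))) = 1" for n
    proof -
      have "cmod (\<zeta> n j) powr (1 / real (s j)) = cmod (cis (\<theta> n j) - 1) powr (1 / real (s j)) / t n" if "j < d" for j
      proof -
        have "(t n ^ s j) powr (1 / real (s j)) = t n"
          using t_pos[of n] s_pos[OF that] by (simp add: powr_realpow[symmetric] powr_powr)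
        then show ?thesis
          using t_pos[of n] by (simp add: \<zeta>_def z_def norm_divide norm_power powr_divide)
      qed
      then have "(\<Sum>j<d. cmod (\<zeta> n j) powr (1 / real (s j))) = Xi (\<theta> n) / t n"
        by (simp add: Xi_def sum_divide_distrib)
      then show ?thesis using t_pos[of n] by (simp add: t_def)
    qed
    have "(\<lambda>n. \<Sum>j<d. cmod (\<zeta> (r n) j) powr (1 / real (s j))) \<longlonglongrightarrow> (\<Sum>j<d. cmod (\<zeta>' j) powr (1 / real (s j)))"
    proof (intro tendsto_sum tendsto_powr' tendsto_const tendsto_norm l\<zeta>)
      fix j assume "j \<in> {..<d}"
      then show "cmod (\<zeta>' j) \<noteq> 0 \<or> 0 < 1 / real (s j) \<and> (\<forall>\<^sub>F n in sequentially. 0 \<le> cmod (\<zeta> (r n) j))"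
        using s_pos[of j] by simp
    qed auto
    then have s1: "(\<Sum>j<d. cmod (\<zeta>' j) powr (1 / real (s j))) = 1" by (simp add: one LIMSEQ_const_iff)
    have "\<exists>j<d. \<zeta>' j \<noteq> 0"
    proof (rule ccontr)
      assume "\<not> ?thesis"
      then have "(\<Sum>j<d. cmod (\<zeta>' j) powr (1 / real (s j))) = 0" by (intro sum.neutral) auto
      with s1 show False by simp
    qed
    then have nz: "\<exists>j<d. Im (\<zeta>' j) \<noteq> 0" using re by (auto simp: complex_eq_iff)
    \<comment> \<open>As \<open>1 - cnj z\<close> is \<open>- cnj (z - 1)\<close>, the backward
      symbol rescales to \<open>- cnj \<zeta>\<close>. For the imaginary limit this is
      \<open>\<zeta>'\<close> again, so both arguments of \<open>PL\<close> become those of the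
      continuum symbol.\<close>
    have "(\<lambda>n. PL (\<zeta> (r n)) (\<lambda>j. - cnj (\<zeta> (r n) j))) \<longlonglongrightarrow> PL \<zeta>' (\<lambda>j. - cnj (\<zeta>' j))"
      by (intro PL_tendsto tendsto_intros l\<zeta>)
    moreover have "(\<lambda>n. PL (\<zeta> (r n)) (\<lambda>j. - cnj (\<zeta> (r n) j))) \<longlonglongrightarrow> 0"
    proof (rule Lim_null_comparison[OF _ inv0], intro always_eventually allI)
      fix n'
      let ?n = "r n'"
      have "Ls (\<theta> ?n) = PL (\<lambda>j. of_real (t ?n ^ s j) * \<zeta> ?n j) (\<lambda>j. of_real (t ?n ^ s j) * (- cnj (\<zeta> ?n j)))"
        unfolding Lsz using t_pos[of ?n] by (intro PL_cong) (auto simp: \<zeta>_def)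
      also have "\<dots> = of_real (t ?n ^ m) * PL (\<zeta> ?n) (\<lambda>j. - cnj (\<zeta> ?n j))" by (rule PL_homog)
      finally have "cmod (PL (\<zeta> ?n) (\<lambda>j. - cnj (\<zeta> ?n j))) * t ?n ^ m < 1 / real (Suc ?n) * t ?n ^ m"
        using \<theta>[of ?n] t_pos[of ?n] by (simp add: norm_mult norm_power t_def mult.commute)
      then have "cmod (PL (\<zeta> ?n) (\<lambda>j. - cnj (\<zeta> ?n j))) < 1 / real (Suc ?n)"
        using t_pos[of ?n] by (meson mult_less_cancel_right_pos zero_less_power)
      then show "norm (PL (\<zeta> ?n) (\<lambda>j. - cnj (\<zeta> ?n j))) \<le> 1 / real (Suc ?n)" by simp
    qed
    ultimately have "PL \<zeta>' (\<lambda>j. - cnj (\<zeta>' j)) = 0" using LIMSEQ_unique by blast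
    also have "PL \<zeta>' (\<lambda>j. - cnj (\<zeta>' j)) = symbol_cont s d m a (\<lambda>j. Im (\<zeta>' j))"
      unfolding symbol_cont_eq using re by (intro PL_cong) (auto simp: complex_eq_iff)
    finally show False using ell_cont[OF nz] by iprover
  qed
qed

text \<open>With \<open>t = \<rho> * Xi \<theta>\<close> the left side is at most
  \<open>t ^ wdeg w\<close>, hence at most \<open>1 + t ^ m\<close>, and \<open>Ls_lower\<close>
  turns \<open>t ^ m\<close> into the symbol.\<close>

lemma symbol_bound:
  "\<exists>C\<ge>1. \<forall>w\<in>words. wdeg w \<le> m \<longrightarrow> (\<forall>\<rho>>0. \<forall>\<theta>. \<rho> ^ wdeg w * cmod (\<Prod>l\<leftarrow>w. sym l \<theta>) \<le> C * (1 + \<rho> ^ m * cmod (Ls \<theta>)))"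
proof -
  obtain c where c: "0 < c" "\<And>\<theta>. c * Xi \<theta> ^ m \<le> cmod (Ls \<theta>)" using Ls_lower by blast
  define C where "C = max 1 (1 / c)"
  have s: "cmod (sym l \<theta>) \<le> Xi \<theta> ^ s (fst l)" if "fst l < d" for l \<theta>
  proof -
    have "cmod (1 - cis (- \<theta> (fst l))) = cmod (cnj (1 - cis (\<theta> (fst l))))" by (simp add: cis_cnj)
    then have "cmod (sym l \<theta>) = cmod (cis (\<theta> (fst l)) - 1)"
      unfolding complex_mod_cnj by (simp add: sym_def norm_minus_commute)
    then show ?thesis using sym_bound[OF that] by simp
  qed
  have p: "cmod (\<Prod>l\<leftarrow>w. sym l \<theta>) \<le> Xi \<theta> ^ wdeg w" if "w \<in> words" for w \<theta>
    using that
  proof (induction w)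
    case (Cons l w)
    then show ?case using s[of l \<theta>] by (auto simp: norm_mult power_add intro!: mult_mono)
  qed simp
  show ?thesis
  proof (intro exI[of _ C] conjI ballI impI allI)
    fix w \<rho> \<theta> assume w: "w \<in> words" "wdeg w \<le> m" and \<rho>: "0 < (\<rho>::real)"
    have "\<rho> ^ wdeg w * cmod (\<Prod>l\<leftarrow>w. sym l \<theta>) \<le> \<rho> ^ wdeg w * Xi \<theta> ^ wdeg w"
      using p[OF w(1)] \<rho> by (intro mult_left_mono) auto
    also have "\<dots> = (\<rho> * Xi \<theta>) ^ wdeg w" by (simp add: power_mult_distrib)
    also have "\<dots> \<le> 1 + (\<rho> * Xi \<theta>) ^ m"
    proof (cases "\<rho> * Xi \<theta> \<le> 1")
      case True
      then have "(\<rho> * Xi \<theta>) ^ wdeg w \<le> 1" using \<rho> by (intro power_le_one) auto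
      moreover have "0 \<le> (\<rho> * Xi \<theta>) ^ m" using \<rho> by simp
      ultimately show ?thesis by linarith
    next
      case False
      then have "(\<rho> * Xi \<theta>) ^ wdeg w \<le> (\<rho> * Xi \<theta>) ^ m" using w by (intro power_increasing) auto
      then show ?thesis by simp
    qed
    also have "(\<rho> * Xi \<theta>) ^ m \<le> C * (\<rho> ^ m * cmod (Ls \<theta>))"
    proof -
      have "Xi \<theta> ^ m \<le> 1 / c * cmod (Ls \<theta>)" using c(1) c(2)[of \<theta>] by (simp add: field_simps)
      also have "\<dots> \<le> C * cmod (Ls \<theta>)" by (intro mult_right_mono) (auto simp: C_def)
      finally have "\<rho> ^ m * Xi \<theta> ^ m \<le> \<rho> ^ m * (C * cmod (Ls \<theta>))" using \<rho> by (intro mult_left_mono) auto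
      then show ?thesis by (simp add: power_mult_distrib mult_ac)
    qed
    also have "1 + C * (\<rho> ^ m * cmod (Ls \<theta>)) \<le> C * (1 + \<rho> ^ m * cmod (Ls \<theta>))"
      by (simp add: distrib_left C_def)
    finally show "\<rho> ^ wdeg w * cmod (\<Prod>l\<leftarrow>w. sym l \<theta>) \<le> C * (1 + \<rho> ^ m * cmod (Ls \<theta>))" by simp
  qed (simp add: C_def)
qed

lemma hat_Lz: assumes "fsupp v" shows "hat (Lz v) \<theta> = Ls \<theta> * hat v \<theta>"
proof -
  have f: "fsupp (\<lambda>n. a (fst p) (snd p) * dop (mw (fst p) True @ mw (snd p) False) v n)" for p
  proof (rule fsupp_scale)
    have w: "mw (fst p) True @ mw (snd p) False \<in> words" by (simp add: mw_words)
    show "fsupp (dop (mw (fst p) True @ mw (snd p) False) v)" by (rule fsupp_TI[OF TI_dop[OF w] assms])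
  qed
  have "hat (Lz v) \<theta> = (\<Sum>p\<in>Mset s d m. hat (\<lambda>n. a (fst p) (snd p) * dop (mw (fst p) True @ mw (snd p) False) v n) \<theta>)"
    unfolding Lz_def
    by (rule conjunct1[OF hat_sum[OF finite_Mset]]) (rule f)
  also have "\<dots> = (\<Sum>p\<in>Mset s d m. a (fst p) (snd p) * (\<Prod>j<d. (cis (\<theta> j) - 1) ^ fst p j) * (\<Prod>j<d. (1 - cis (- \<theta> j)) ^ snd p j) * hat v \<theta>)"
  proof (intro sum.cong refl)
    fix p :: "(nat \<Rightarrow> nat) \<times> (nat \<Rightarrow> nat)"
    have w: "mw (fst p) True @ mw (snd p) False \<in> words" by (simp add: mw_words)
    have "hat (\<lambda>n. a (fst p) (snd p) * dop (mw (fst p) True @ mw (snd p) False) v n) \<theta> =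
      a (fst p) (snd p) * ((\<Prod>l\<leftarrow>mw (fst p) True @ mw (snd p) False. sym l \<theta>) * hat v \<theta>)"
      by (subst hat_scale[OF fsupp_TI[OF TI_dop[OF w] assms]], subst hat_dop[OF w assms]) simp
    then show "hat (\<lambda>n. a (fst p) (snd p) * dop (mw (fst p) True @ mw (snd p) False) v n) \<theta> =
      a (fst p) (snd p) * (\<Prod>j<d. (cis (\<theta> j) - 1) ^ fst p j) * (\<Prod>j<d. (1 - cis (- \<theta> j)) ^ snd p j) * hat v \<theta>"
      by (simp add: prod_mw sym_def)
  qed
  finally show ?thesis by (simp add: Ls_def PL_def sum_distrib_right)
qed

text \<open>\<open>symbol_bound\<close> is multiplied by the transform of \<open>v\<close> and
  summed over the frequency grid; Plancherel translates each term back.\<close>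

lemma elliptic_estimate_fsupp:
  "\<exists>C\<ge>1. \<forall>w\<in>words. wdeg w \<le> m \<longrightarrow> (\<forall>\<rho>>0. \<forall>v K0 K1. fsupp v \<and> l2b v K0 \<and> l2b (Lz v) K1 \<longrightarrow>
      l2b (\<lambda>n. of_real (\<rho> ^ wdeg w) * dop w v n) (C * (K0 + \<rho> ^ m * K1)))"
proof -
  obtain C where C: "C \<ge> 1" "\<And>w \<rho> \<theta>. w \<in> words \<Longrightarrow> wdeg w \<le> m \<Longrightarrow> 0 < \<rho> \<Longrightarrow>
     \<rho> ^ wdeg w * cmod (\<Prod>l\<leftarrow>w. sym l \<theta>) \<le> C * (1 + \<rho> ^ m * cmod (Ls \<theta>))" using symbol_bound by blast
  show ?thesis
  proof (intro exI[of _ C] conjI ballI impI allI C(1))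
    fix w \<rho> v K0 K1
    assume w: "w \<in> words" "wdeg w \<le> m" and \<rho>: "0 < (\<rho>::real)" and v: "fsupp v \<and> l2b v K0 \<and> l2b (Lz v) K1"
    have fs: "fsupp v" "fsupp (Lz v)" "fsupp (dop w v)"
      using v fsupp_TI[OF TI_Lz] fsupp_TI[OF TI_dop[OF w(1)]] by auto
    \<comment> \<open>One grid has to serve \<open>v\<close>, \<open>Lz v\<close> and
      \<open>dop w v\<close> simultaneously, so \<open>M\<close> bounds the coordinates of all three
      supports.\<close>
    let ?A = "{n. v n \<noteq> 0} \<union> {n. Lz v n \<noteq> 0} \<union> {n. dop w v n \<noteq> 0}"
    let ?B = "(\<lambda>(n, i). nat \<bar>n i\<bar>) ` (?A \<times> {..<d})"
    have finB: "finite ?B" using fs by (auto simp: fsupp_def)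
    define M where "M = Max (insert 0 ?B)"
    have M: "\<bar>n i\<bar> \<le> int M" if "n \<in> ?A" "i < d" for n i
    proof -
      have "nat \<bar>n i\<bar> \<in> ?B" using that by (intro image_eqI[of _ _ "(n, i)"]) auto
      then have "nat \<bar>n i\<bar> \<le> M" unfolding M_def using finB by (intro Max_ge) auto
      then show ?thesis by simp
    qed
    let ?N = "sqrt (real (2*M+1) ^ d)"
    let ?f = "freqs (2*M+1)"
    have N: "0 < ?N" by simp
    have e: "L2_set (\<lambda>\<theta>. cmod (hat u \<theta>)) ?f = ?N * L2_set (\<lambda>n. cmod (u n)) {n. u n \<noteq> 0}"
      if "u \<in> {v, Lz v, dop w v}" for u
      by (rule L2_hat) (use that fs M in auto)
    have le: "L2_set (\<lambda>n. cmod (u n)) {n. u n \<noteq> 0} \<le> K" if "l2b u K" "fsupp u" for u K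
      using that unfolding l2b_def fsupp_def by blast
    have "\<rho> ^ wdeg w * (?N * L2_set (\<lambda>n. cmod (dop w v n)) {n. dop w v n \<noteq> 0}) = L2_set (\<lambda>\<theta>. \<rho> ^ wdeg w * cmod (hat (dop w v) \<theta>)) ?f"
      using \<rho> by (subst e[symmetric]) (auto simp: L2_set_right_distrib)
    also have "\<dots> \<le> L2_set (\<lambda>\<theta>. C * (cmod (hat v \<theta>) + \<rho> ^ m * cmod (hat (Lz v) \<theta>))) ?f"
    proof (rule L2_set_mono)
      fix \<theta>
      have "\<rho> ^ wdeg w * cmod (hat (dop w v) \<theta>) = (\<rho> ^ wdeg w * cmod (\<Prod>l\<leftarrow>w. sym l \<theta>)) * cmod (hat v \<theta>)"
        by (simp add: hat_dop[OF w(1) fs(1)] norm_mult)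
      also have "\<dots> \<le> C * (1 + \<rho> ^ m * cmod (Ls \<theta>)) * cmod (hat v \<theta>)"
        by (intro mult_right_mono C w \<rho>) auto
      also have "\<dots> = C * (cmod (hat v \<theta>) + \<rho> ^ m * cmod (hat (Lz v) \<theta>))"
        by (simp add: hat_Lz[OF fs(1)] norm_mult algebra_simps)
      finally show "\<rho> ^ wdeg w * cmod (hat (dop w v) \<theta>) \<le> C * (cmod (hat v \<theta>) + \<rho> ^ m * cmod (hat (Lz v) \<theta>))" .
    qed (use \<rho> in auto)
    also have "\<dots> = C * L2_set (\<lambda>\<theta>. cmod (hat v \<theta>) + \<rho> ^ m * cmod (hat (Lz v) \<theta>)) ?f"
      using C(1) by (simp add: L2_set_right_distrib)
    also have "\<dots> \<le> C * (L2_set (\<lambda>\<theta>. cmod (hat v \<theta>)) ?f + L2_set (\<lambda>\<theta>. \<rho> ^ m * cmod (hat (Lz v) \<theta>)) ?f)"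
      using C(1) by (intro mult_left_mono L2_set_triangle_ineq) auto
    also have "L2_set (\<lambda>\<theta>. \<rho> ^ m * cmod (hat (Lz v) \<theta>)) ?f = \<rho> ^ m * L2_set (\<lambda>\<theta>. cmod (hat (Lz v) \<theta>)) ?f"
      using \<rho> by (simp add: L2_set_right_distrib)
    also have "C * (L2_set (\<lambda>\<theta>. cmod (hat v \<theta>)) ?f + \<rho> ^ m * L2_set (\<lambda>\<theta>. cmod (hat (Lz v) \<theta>)) ?f) =
       ?N * (C * (L2_set (\<lambda>n. cmod (v n)) {n. v n \<noteq> 0} + \<rho> ^ m * L2_set (\<lambda>n. cmod (Lz v n)) {n. Lz v n \<noteq> 0}))"
      by (subst (1 2) e) (auto simp: algebra_simps)
    also have "\<dots> \<le> ?N * (C * (K0 + \<rho> ^ m * K1))"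
      using v fs C(1) \<rho> by (intro mult_left_mono add_mono le) auto
    finally have "?N * (\<rho> ^ wdeg w * L2_set (\<lambda>n. cmod (dop w v n)) {n. dop w v n \<noteq> 0}) \<le> ?N * (C * (K0 + \<rho> ^ m * K1))"
      by (simp only: mult_ac)
    then have main: "\<rho> ^ wdeg w * L2_set (\<lambda>n. cmod (dop w v n)) {n. dop w v n \<noteq> 0} \<le> C * (K0 + \<rho> ^ m * K1)"
      using N mult_le_cancel_left_pos by blast
    show "l2b (\<lambda>n. of_real (\<rho> ^ wdeg w) * dop w v n) (C * (K0 + \<rho> ^ m * K1))"
    proof (rule l2b_finite_supp[of "{n. dop w v n \<noteq> 0}"])
      show "L2_set (\<lambda>n. cmod (of_real (\<rho> ^ wdeg w) * dop w v n)) {n. dop w v n \<noteq> 0} \<le> C * (K0 + \<rho> ^ m * K1)"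
        using main \<rho> by (simp add: norm_mult norm_power L2_set_right_distrib)
      show "0 \<le> C * (K0 + \<rho> ^ m * K1)" using C(1) \<rho> v l2b_nonneg by auto
    qed (use fs in \<open>auto simp: fsupp_def\<close>)
  qed
qed

text \<open>Density: the estimate is applied to a finite truncation of \<open>v\<close>, and the
  tail enters only through crude operator bounds times its arbitrarily small norm.\<close>

lemma elliptic_estimate:
  "\<exists>C\<ge>1. \<forall>w\<in>words. wdeg w \<le> m \<longrightarrow> (\<forall>\<rho>>0. \<forall>v K0 K1. l2b v K0 \<and> l2b (Lz v) K1 \<longrightarrow>
      l2b (\<lambda>n. of_real (\<rho> ^ wdeg w) * dop w v n) (C * (K0 + \<rho> ^ m * K1)))"
proof -
  obtain C where C: "C \<ge> 1" "\<And>w \<rho> v K0 K1. w \<in> words \<Longrightarrow> wdeg w \<le> m \<Longrightarrow> 0 < \<rho> \<Longrightarrow> fsupp v \<Longrightarrow> l2b v K0 \<Longrightarrow> l2b (Lz v) K1 \<Longrightarrow>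
      l2b (\<lambda>n. of_real (\<rho> ^ wdeg w) * dop w v n) (C * (K0 + \<rho> ^ m * K1))"
    using elliptic_estimate_fsupp by blast
  obtain CL where CL: "0 \<le> CL" "\<And>v K. l2b v K \<Longrightarrow> l2b (Lz v) (CL * K)" using l2b_TI[OF TI_Lz] by blast
  show ?thesis
  proof (intro exI[of _ C] conjI ballI impI allI C(1))
    fix w \<rho> v K0 K1
    assume w: "w \<in> words" "wdeg w \<le> m" and \<rho>: "0 < (\<rho>::real)" and v: "l2b v K0 \<and> l2b (Lz v) K1"
    have "TI (\<lambda>u n. of_real (\<rho> ^ wdeg w) * dop w u n)" by (intro TI.scale TI_dop w)
    then obtain D where D: "0 \<le> D" "\<And>v K. l2b v K \<Longrightarrow> l2b (\<lambda>n. of_real (\<rho> ^ wdeg w) * dop w v n) (D * K)"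
      using l2b_TI by blast
    \<comment> \<open>Dominates the total factor with which the norm \<open>e'\<close> of the tail
      enters; the extra 1 makes it positive.\<close>
    let ?E = "C * (\<rho> ^ m * CL + 1) + D"
    have K: "0 \<le> K0" "0 \<le> K1" using v l2b_nonneg by auto
    have "0 < \<rho> ^ m * CL + 1" using \<rho> CL(1) by (intro add_nonneg_pos) auto
    then have "0 < C * (\<rho> ^ m * CL + 1)" using C(1) by (intro mult_pos_pos) linarith+
    then have E: "0 < ?E" using D(1) by linarith
    show "l2b (\<lambda>n. of_real (\<rho> ^ wdeg w) * dop w v n) (C * (K0 + \<rho> ^ m * K1))"
    proof (rule l2b_lim)
      show "0 \<le> C * (K0 + \<rho> ^ m * K1)" using C(1) K \<rho> by simp
      fix e :: real assume e: "0 < e"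
      define e' where "e' = e / ?E"
      have e': "0 < e'" using e E by (simp add: e'_def)
      obtain F where F: "finite F" "F \<subseteq> Z" "l2b (\<lambda>n. if n \<in> F then 0 else v n) e'"
        using l2b_tail[OF conjunct1[OF v] e'] by blast
      let ?t = "\<lambda>n. if n \<in> F then 0 else v n" and ?g = "\<lambda>n. if n \<in> F then v n else 0"
      have eq: "?g = (\<lambda>n. v n - ?t n)" "v = (\<lambda>n. ?g n + ?t n)" by auto
      have fs: "fsupp ?g" using F unfolding fsupp_def by (auto intro: finite_subset)
      have g0: "l2b ?g K0" by (rule l2b_le[OF conjunct1[OF v]]) auto
      have "l2b (\<lambda>n. Lz v n - Lz ?t n) (K1 + CL * e')" using v CL(2)[OF F(3)] by (intro l2b_diff) auto
      then have "l2b (Lz ?g) (K1 + CL * e')" by (subst eq(1)) (simp only: TI_lin_diff[OF TI_Lz])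
      from C(2)[OF w \<rho> fs g0 this]
      have "l2b (\<lambda>n. of_real (\<rho> ^ wdeg w) * dop w ?g n + of_real (\<rho> ^ wdeg w) * dop w ?t n) (C * (K0 + \<rho> ^ m * (K1 + CL * e')) + D * e')"
        by (intro l2b_add D F(3))
      moreover have "(\<lambda>n. of_real (\<rho> ^ wdeg w) * dop w ?g n + of_real (\<rho> ^ wdeg w) * dop w ?t n) = (\<lambda>n. of_real (\<rho> ^ wdeg w) * dop w v n)"
        by (subst (3) eq(2), subst TI_lin_add[OF TI_dop[OF w(1)]]) (simp add: distrib_left)
      moreover have "C * (K0 + \<rho> ^ m * (K1 + CL * e')) + D * e' \<le> C * (K0 + \<rho> ^ m * K1) + e"
      proof -
        have "C * (K0 + \<rho> ^ m * (K1 + CL * e')) + D * e' = C * (K0 + \<rho> ^ m * K1) + (C * (\<rho> ^ m * CL) + D) * e'"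
          by (simp add: algebra_simps)
        also have "(C * (\<rho> ^ m * CL) + D) * e' \<le> ?E * e'"
          using C(1) e' by (intro mult_right_mono) (auto simp: distrib_left)
        also have "?E * e' = e" using E unfolding e'_def by simp
        finally show ?thesis by simp
      qed
      ultimately show "l2b (\<lambda>n. of_real (\<rho> ^ wdeg w) * dop w v n) (C * (K0 + \<rho> ^ m * K1) + e)"
        using l2b_mono by simp
    qed
  qed
qed

end

section \<open>Slowly varying weights\<close>

text \<open>A difference maps the weight \<open>om a T\<close> to a multiple of \<open>om (Suc a) T\<close>, so every difference of it gains a
  factor \<open>1/T\<close> while staying bounded by the weight itself.\<close>

definition omq :: "real \<Rightarrow> int \<Rightarrow> complex" where
  "omq T t = of_real T / (of_int t + \<i> * of_real T)"

text \<open>Up to the factor \<open>T ^ a\<close> the reciprocal of a rising factorial, the discrete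
  analogue of a negative power. The imaginary shift keeps the denominators of modulus at least
  \<open>T\<close>.\<close>

definition om :: "nat \<Rightarrow> real \<Rightarrow> int \<Rightarrow> complex" where
  "om a T t = (\<Prod>i<a. omq T (t + int i))"

lemma norm_den_ge:
  fixes t :: int assumes "0 < T"
  shows "T \<le> cmod (of_int t + \<i> * of_real T)" "\<bar>real_of_int t\<bar> \<le> cmod (of_int t + \<i> * of_real T)"
    "cmod (of_int t + \<i> * of_real T) \<le> \<bar>real_of_int t\<bar> + T"
proof -
  show "T \<le> cmod (of_int t + \<i> * of_real T)" using abs_Im_le_cmod[of "of_int t + \<i> * of_real T"] assms by simp
  show "\<bar>real_of_int t\<bar> \<le> cmod (of_int t + \<i> * of_real T)" using abs_Re_le_cmod[of "of_int t + \<i> * of_real T"] by simp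
  show "cmod (of_int t + \<i> * of_real T) \<le> \<bar>real_of_int t\<bar> + T"
    using norm_triangle_ineq[of "of_int t" "\<i> * of_real T"] assms by (simp add: norm_mult)
qed

lemma den_nz: "0 < T \<Longrightarrow> of_int t + \<i> * of_real T \<noteq> (0::complex)"
  using norm_den_ge(1)[of T t] by auto

lemma omq_norm: "0 < T \<Longrightarrow> cmod (omq T t) = T / cmod (of_int t + \<i> * of_real T)"
  by (simp add: omq_def norm_divide)

lemma omq_le_1: "0 < T \<Longrightarrow> cmod (omq T t) \<le> 1"
  using norm_den_ge(1)[of T t] by (simp add: omq_norm divide_le_eq)

lemma om_Suc: "om (Suc a) T t = om a T t * omq T (t + int a)"
  by (simp add: om_def)

lemma om_Suc': "om (Suc a) T t = om a T (t + 1) * omq T t"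
  unfolding om_def by (simp add: prod.lessThan_Suc_shift algebra_simps del: prod.lessThan_Suc)

text \<open>Both values are \<open>om (Suc a) T t\<close> times one missing denominator over
  \<open>T\<close>, and the two denominators differ by \<open>a\<close>.\<close>

lemma om_step:
  assumes "0 < T" shows "om a T (t + 1) - om a T t = - (of_nat a / of_real T) * om (Suc a) T t"
proof -
  have nz: "of_int t + \<i> * of_real T \<noteq> 0" "of_int (t + int a) + \<i> * of_real T \<noteq> 0" "of_real T \<noteq> (0::complex)"
    using den_nz[OF assms, of t] den_nz[OF assms, of "t + int a"] assms by (simp_all del: of_int_add)
  have 1: "om a T (t + 1) = om (Suc a) T t * (of_int t + \<i> * of_real T) / of_real T"
    unfolding om_Suc' using nz by (simp add: omq_def)
  have 2: "om a T t = om (Suc a) T t * (of_int (t + int a) + \<i> * of_real T) / of_real T"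
    unfolding om_Suc using nz by (simp add: omq_def)
  have "om a T (t + 1) - om a T t = om (Suc a) T t * ((of_int t + \<i> * of_real T) - (of_int (t + int a) + \<i> * of_real T)) / of_real T"
    unfolding 1 2 right_diff_distrib diff_divide_distrib ..
  then show ?thesis using nz by (simp add: field_simps)
qed

lemma om_mono: "0 < T \<Longrightarrow> cmod (om (a + p) T t) \<le> cmod (om a T t)"
proof (induction p)
  case (Suc p)
  have "cmod (om (a + Suc p) T t) = cmod (om (a + p) T t) * cmod (omq T (t + int (a + p)))"
    by (simp add: om_Suc norm_mult)
  also have "\<dots> \<le> cmod (om (a + p) T t) * 1" by (intro mult_left_mono omq_le_1 Suc) auto
  finally show ?case using Suc by simp
qed simp

text \<open>Each denominator changes by at most \<open>q\<close>, while its modulus is at least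
  \<open>T \<ge> 1\<close>. Needed because backward differences shift the argument.\<close>

lemma om_shift: assumes "1 \<le> T" shows "cmod (om a T (t - int q)) \<le> (1 + real q) ^ a * cmod (om a T t)"
proof -
  have T: "0 < T" using assms by simp
  have 1: "cmod (omq T (t - int q)) \<le> (1 + real q) * cmod (omq T t)" for t
  proof -
    let ?A = "cmod (of_int t + \<i> * of_real T)" and ?B = "cmod (of_int (t - int q) + \<i> * of_real T)"
    have "of_int t + \<i> * of_real T = (of_int (t - int q) + \<i> * of_real T) + of_nat q" by simp
    then have "?A \<le> ?B + real q" by (metis norm_of_nat norm_triangle_ineq)
    moreover have "1 * real q \<le> ?B * real q" using norm_den_ge(1)[OF T, of "t - int q"] assms by (intro mult_right_mono) auto
    ultimately have "?A \<le> (1 + real q) * ?B" by (simp add: algebra_simps)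
    moreover have "0 < ?A" "0 < ?B"
      using den_nz[OF T, of t] den_nz[OF T, of "t - int q"] by (simp_all del: of_int_diff)
    ultimately have "1 / ?B \<le> (1 + real q) / ?A" by (simp add: field_simps)
    then have "T * (1 / ?B) \<le> T * ((1 + real q) / ?A)" using T by (intro mult_left_mono) auto
    then show ?thesis using T by (simp add: omq_norm mult.commute)
  qed
  have "cmod (om a T (t - int q)) = (\<Prod>i<a. cmod (omq T ((t + int i) - int q)))"
    by (simp add: om_def prod_norm[symmetric] algebra_simps)
  also have "\<dots> \<le> (\<Prod>i<a. (1 + real q) * cmod (omq T (t + int i)))"
    by (intro prod_mono conjI 1) auto
  finally show ?thesis by (simp add: om_def prod.distrib prod_norm)
qed

text \<open>Each of the \<open>a\<close> factors decays like \<open>T / (T + \<bar>t\<bar>)\<close>;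
  the offsets \<open>i < a\<close> cost only the constant because \<open>T \<ge> 1\<close>.\<close>

lemma om_decay: assumes "1 \<le> T" shows "cmod (om a T t) \<le> (2 * real a) ^ a / (1 + \<bar>real_of_int t\<bar> / T) ^ a"
proof -
  have T: "0 < T" using assms by simp
  have 1: "cmod (omq T (t + int i)) \<le> 2 * real a / (1 + \<bar>real_of_int t\<bar> / T)" if "i < a" for i
  proof -
    let ?A = "cmod (of_int (t + int i) + \<i> * of_real T)"
    have A: "T \<le> ?A" "\<bar>real_of_int (t + int i)\<bar> \<le> ?A"
      using norm_den_ge(1,2)[OF T, of "t + int i"] by (simp_all del: of_int_add)
    have "T + \<bar>real_of_int t\<bar> \<le> T + \<bar>real_of_int (t + int i)\<bar> + real i" by simp
    also have "\<dots> \<le> 2 * ?A + real i" using A by simp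
    also have "real i \<le> real i * ?A" using A assms mult_left_mono[of 1 ?A "real i"] by simp
    also have "2 * ?A + real i * ?A \<le> 2 * (real a * ?A)"
    proof -
      have "(2 + real i) * ?A \<le> (2 * real a) * ?A" using that A T by (intro mult_right_mono) auto
      then show ?thesis by (simp add: algebra_simps)
    qed
    finally have *: "T + \<bar>real_of_int t\<bar> \<le> 2 * real a * ?A" by simp
    have p: "0 < ?A" "0 < T + \<bar>real_of_int t\<bar>" using A T by auto
    have "cmod (omq T (t + int i)) = T / ?A" by (simp add: omq_norm[OF T])
    also have "\<dots> \<le> T * (2 * real a / (T + \<bar>real_of_int t\<bar>))"
    proof -
      have "1 / ?A \<le> 2 * real a / (T + \<bar>real_of_int t\<bar>)" using * p by (simp add: field_simps)
      then have "T * (1 / ?A) \<le> T * (2 * real a / (T + \<bar>real_of_int t\<bar>))" using T by (intro mult_left_mono) auto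
      then show ?thesis by simp
    qed
    also have "\<dots> = 2 * real a / (1 + \<bar>real_of_int t\<bar> / T)" using T p by (simp add: field_simps)
    finally show ?thesis .
  qed
  have "cmod (om a T t) = (\<Prod>i<a. cmod (omq T (t + int i)))" by (simp add: om_def prod_norm[symmetric])
  also have "\<dots> \<le> (\<Prod>i<a. 2 * real a / (1 + \<bar>real_of_int t\<bar> / T))"
    by (intro prod_mono conjI 1) auto
  finally show ?thesis by (simp add: power_divide)
qed

lemma om_lower: assumes "1 \<le> T" "\<bar>real_of_int t\<bar> \<le> 2 * T" shows "(1 / (3 + real a)) ^ a \<le> cmod (om a T t)"
proof -
  have T: "0 < T" using assms by simp
  have 1: "1 / (3 + real a) \<le> cmod (omq T (t + int i))" if "i < a" for i
  proof -
    let ?A = "cmod (of_int (t + int i) + \<i> * of_real T)"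
    have "?A \<le> \<bar>real_of_int (t + int i)\<bar> + T" by (rule norm_den_ge[OF T])
    also have "\<dots> \<le> 3 * T + real a" using assms that by auto
    also have "real a \<le> real a * T" using assms mult_left_mono[of 1 T "real a"] by simp
    finally have "?A \<le> (3 + real a) * T" by (simp add: algebra_simps)
    moreover have "0 < ?A" using den_nz[OF T, of "t + int i"] by (simp del: of_int_add)
    ultimately show ?thesis unfolding omq_norm[OF T] by (simp add: field_simps)
  qed
  have "(1 / (3 + real a)) ^ a = (\<Prod>i<a. 1 / (3 + real a))" by simp
  also have "\<dots> \<le> (\<Prod>i<a. cmod (omq T (t + int i)))" by (intro prod_mono conjI 1) auto
  finally show ?thesis by (simp add: om_def prod_norm)
qed

text \<open>The square in the denominator is replaced by the product of two consecutive terms, after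
  which the sum telescopes.\<close>

lemma sum_inverse_sq:
  fixes T :: real assumes "1 \<le> T" shows "(\<Sum>t\<le>n. 1 / (T + real t)\<^sup>2) \<le> 1 / T\<^sup>2 + 1 / T - 1 / (T + real n)"
proof (induction n)
  case (Suc n)
  have p: "0 < T + real n" "0 < T + real (Suc n)" using assms by auto
  have "1 / (T + real (Suc n))\<^sup>2 \<le> 1 / ((T + real n) * (T + real (Suc n)))"
    using p unfolding power2_eq_square by (intro divide_left_mono mult_right_mono mult_pos_pos) auto
  also have "\<dots> = 1 / (T + real n) - 1 / (T + real (Suc n))" using p by (simp add: field_simps)
  finally show ?case using Suc by simp
qed simp

lemma sum_weight_1d:
  fixes T :: real assumes "1 \<le> T" shows "(\<Sum>t\<in>{-int M..int M}. 1 / (1 + \<bar>real_of_int t\<bar> / T)\<^sup>2) \<le> 4 * T"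
proof -
  let ?f = "\<lambda>t::int. 1 / (1 + \<bar>real_of_int t\<bar> / T)\<^sup>2"
  have f: "?f (int t) = T\<^sup>2 * (1 / (T + real t)\<^sup>2)" "?f (- int t) = T\<^sup>2 * (1 / (T + real t)\<^sup>2)" for t
    using assms by (simp_all add: field_simps power2_eq_square)
  have "{-int M..int M} = int ` {..M} \<union> (\<lambda>t. - int t) ` {..M}"
  proof (intro equalityI subsetI)
    fix t assume t: "t \<in> {-int M..int M}"
    show "t \<in> int ` {..M} \<union> (\<lambda>t. - int t) ` {..M}"
    proof (cases "0 \<le> t")
      case True then have "t = int (nat t)" "nat t \<in> {..M}" using t by auto
      then show ?thesis by blast
    next
      case False then have "t = - int (nat (-t))" "nat (-t) \<in> {..M}" using t by auto
      then show ?thesis by blast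
    qed
  qed auto
  then have "(\<Sum>t\<in>{-int M..int M}. ?f t) \<le> (\<Sum>t\<in>int ` {..M}. ?f t) + (\<Sum>t\<in>(\<lambda>t. - int t) ` {..M}. ?f t)"
    using sum.union_inter[of "int ` {..M}" "(\<lambda>t. - int t) ` {..M}" ?f] sum_nonneg[of "int ` {..M} \<inter> (\<lambda>t. - int t) ` {..M}" ?f]
    by (simp only: finite_imageI finite_atMost) fastforce
  also have "\<dots> = (\<Sum>t\<le>M. ?f (int t)) + (\<Sum>t\<le>M. ?f (- int t))"
    by (subst (1 2) sum.reindex) (auto simp: inj_on_def)
  also have "\<dots> = 2 * T\<^sup>2 * (\<Sum>t\<le>M. 1 / (T + real t)\<^sup>2)" unfolding f by (simp add: sum_distrib_left)
  also have "\<dots> \<le> 2 * T\<^sup>2 * (1 / T\<^sup>2 + 1 / T - 1 / (T + real M))"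
    by (intro mult_left_mono sum_inverse_sq assms) auto
  also have "\<dots> \<le> 2 * T\<^sup>2 * (1 / T\<^sup>2 + 1 / T)"
    using assms by (intro mult_left_mono) auto
  also have "\<dots> = 2 + 2 * T" using assms by (simp add: field_simps power2_eq_square)
  also have "\<dots> \<le> 4 * T" using assms by simp
  finally show ?thesis .
qed

lemma sum_le_prod_1p: "(\<And>j. j < k \<Longrightarrow> 0 \<le> x j) \<Longrightarrow> 1 + (\<Sum>j<k. x j) \<le> (\<Prod>j<(k::nat). 1 + x j :: real)"
proof (induction k)
  case (Suc k)
  have "1 + (\<Sum>j<k. x j) \<le> (\<Prod>j<k. 1 + x j)" "1 \<le> (\<Prod>j<k. 1 + x j)" using Suc by (auto intro: prod_ge_1)
  moreover have "x k * 1 \<le> x k * (\<Prod>j<k. 1 + x j)" using Suc.prems[of k] calculation(2) by (intro mult_left_mono) auto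
  ultimately show ?case by (simp add: algebra_simps)
qed simp

section \<open>Product weights on the lattice and their commutators with differences\<close>

context scaled begin

text \<open>The family generated from \<open>W\<close> by differences, up to scalars:
  \<open>p j\<close> counts the differences taken in direction \<open>j\<close>, \<open>q j\<close>
  the shifts caused by backward ones.\<close>

definition Wpq :: "nat \<Rightarrow> real \<Rightarrow> (nat \<Rightarrow> nat) \<Rightarrow> (nat \<Rightarrow> nat) \<Rightarrow> zfun" where
  "Wpq a \<tau> p q n = (\<Prod>j<d. om (a + p j) (\<tau> ^ s j) (n j - int (q j)))"

definition W :: "nat \<Rightarrow> real \<Rightarrow> zfun" where
  "W a \<tau> n = (\<Prod>j<d. om a (\<tau> ^ s j) (n j))"

lemma W_Wpq: "W a \<tau> = Wpq a \<tau> (\<lambda>_. 0) (\<lambda>_. 0)"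
  by (simp add: W_def[abs_def] Wpq_def[abs_def])

lemma prod_upd:
  assumes "j < d"
  shows "(\<Prod>i<d. F i ((n(j := c)) i)) = F j c * (\<Prod>i\<in>{..<d} - {j}. F i (n i) :: complex)"
  using assms by (subst prod.remove[of _ j]) (auto intro!: prod.cong)

text \<open>Only the factor in the direction of the letter changes, by \<open>om_step\<close>. A
  backward difference is a forward one read one point earlier, which increases
  \<open>q\<close>.\<close>

lemma dl_Wpq:
  assumes "1 \<le> \<tau>" "fst l < d"
  shows "\<exists>q'. dl l (Wpq a \<tau> p q) = (\<lambda>n. - (of_nat (a + p (fst l)) / of_real (\<tau> ^ s (fst l))) * Wpq a \<tau> (p(fst l := Suc (p (fst l)))) q' n)
     \<and> (\<forall>i. q' i \<le> Suc (q i))"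
proof -
  let ?j = "fst l"
  let ?q = "if snd l then q else q(?j := Suc (q ?j))"
  let ?p = "p(?j := Suc (p ?j))"
  let ?T = "\<tau> ^ s ?j"
  have T: "0 < ?T" using assms by simp
  have "dl l (Wpq a \<tau> p q) n = - (of_nat (a + p ?j) / of_real ?T) * Wpq a \<tau> ?p ?q n" for n
  proof -
    let ?F = "\<lambda>i t. om (a + p i) (\<tau> ^ s i) (t - int (q i))"
    let ?R = "\<Prod>i\<in>{..<d} - {?j}. ?F i (n i)"
    have R: "(\<Prod>i\<in>{..<d} - {?j}. om (a + ?p i) (\<tau> ^ s i) (n i - int (?q i))) = ?R"
      by (intro prod.cong) auto
    have W1: "Wpq a \<tau> p q (n(?j := c)) = ?F ?j c * ?R" for c
      unfolding Wpq_def by (rule prod_upd[OF assms(2), of ?F])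
    have W0: "Wpq a \<tau> p q n = ?F ?j (n ?j) * ?R" using W1[of "n ?j"] by simp
    have W2: "Wpq a \<tau> ?p ?q n = om (Suc (a + p ?j)) ?T (n ?j - int (?q ?j)) * ?R"
      unfolding Wpq_def using assms(2) by (subst prod.remove[of _ ?j]) (auto simp: R[symmetric])
    show ?thesis
    proof (cases "snd l")
      case True
      have "dl l (Wpq a \<tau> p q) n = (?F ?j (n ?j + 1) - ?F ?j (n ?j)) * ?R"
        using True by (simp add: dl_def df_def W1 W0 left_diff_distrib)
      also have "?F ?j (n ?j + 1) - ?F ?j (n ?j) = - (of_nat (a + p ?j) / of_real ?T) * om (Suc (a + p ?j)) ?T (n ?j - int (q ?j))"
        using om_step[OF T, of "a + p ?j" "n ?j - int (q ?j)"] by (simp add: algebra_simps)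
      finally show ?thesis unfolding W2 using True by simp
    next
      case False
      have "dl l (Wpq a \<tau> p q) n = (?F ?j (n ?j) - ?F ?j (n ?j - 1)) * ?R"
        using False by (simp add: dl_def db_def W1 W0 left_diff_distrib)
      also have "?F ?j (n ?j) - ?F ?j (n ?j - 1) = - (of_nat (a + p ?j) / of_real ?T) * om (Suc (a + p ?j)) ?T (n ?j - int (Suc (q ?j)))"
        using om_step[OF T, of "a + p ?j" "n ?j - int (Suc (q ?j))"] by (simp add: algebra_simps)
      finally show ?thesis unfolding W2 using False by simp
    qed
  qed
  then show ?thesis by (intro exI[of _ ?q]) auto
qed

text \<open>The extra factors counted by \<open>p\<close> have modulus at most 1, and the shifts
  counted by \<open>q\<close> are undone by \<open>om_shift\<close>.\<close>

lemma Wpq_le: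
  assumes "1 \<le> \<tau>" "\<And>j. j < d \<Longrightarrow> q j \<le> k"
  shows "cmod (Wpq a \<tau> p q n) \<le> (1 + real k) ^ (a * d) * cmod (W a \<tau> n)"
proof -
  have "cmod (Wpq a \<tau> p q n) = (\<Prod>j<d. cmod (om (a + p j) (\<tau> ^ s j) (n j - int (q j))))"
    by (simp add: Wpq_def prod_norm)
  also have "\<dots> \<le> (\<Prod>j<d. (1 + real k) ^ a * cmod (om a (\<tau> ^ s j) (n j)))"
  proof (intro prod_mono conjI norm_ge_zero)
    fix j assume j: "j \<in> {..<d}"
    have T: "1 \<le> \<tau> ^ s j" using assms by simp
    have "cmod (om (a + p j) (\<tau> ^ s j) (n j - int (q j))) \<le> cmod (om a (\<tau> ^ s j) (n j - int (q j)))"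
      using T by (intro om_mono) auto
    also have "\<dots> \<le> (1 + real (q j)) ^ a * cmod (om a (\<tau> ^ s j) (n j))" by (rule om_shift[OF T])
    also have "\<dots> \<le> (1 + real k) ^ a * cmod (om a (\<tau> ^ s j) (n j))"
      using assms(2)[of j] j by (intro mult_right_mono power_mono) auto
    finally show "cmod (om (a + p j) (\<tau> ^ s j) (n j - int (q j))) \<le> (1 + real k) ^ a * cmod (om a (\<tau> ^ s j) (n j))" .
  qed
  also have "\<dots> = (1 + real k) ^ (a * d) * cmod (W a \<tau> n)"
    by (simp add: prod.distrib W_def prod_norm power_mult)
  finally show ?thesis .
qed

lemma dop_W:
  assumes "1 \<le> \<tau>"
  shows "w \<in> words \<Longrightarrow> \<exists>c p q. dop w (W a \<tau>) = (\<lambda>n. c * Wpq a \<tau> p q n) \<and> cmod c \<le> real (a + length w) ^ length w / \<tau> ^ wdeg w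
     \<and> (\<forall>j. p j \<le> length w) \<and> (\<forall>j. q j \<le> length w)"
proof (induction w)
  case Nil
  show ?case by (intro exI[of _ 1] exI[of _ "\<lambda>_. 0"]) (simp add: W_Wpq)
next
  case (Cons l w)
  then obtain c p q where IH: "dop w (W a \<tau>) = (\<lambda>n. c * Wpq a \<tau> p q n)" "cmod c \<le> real (a + length w) ^ length w / \<tau> ^ wdeg w"
     "\<forall>j. p j \<le> length w" "\<forall>j. q j \<le> length w" by auto
  have l: "fst l < d" using Cons by simp
  obtain q' where q': "dl l (Wpq a \<tau> p q) = (\<lambda>n. - (of_nat (a + p (fst l)) / of_real (\<tau> ^ s (fst l))) * Wpq a \<tau> (p(fst l := Suc (p (fst l)))) q' n)"
     "\<forall>i. q' i \<le> Suc (q i)" using dl_Wpq[OF assms l] by blast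
  let ?e = "- (of_nat (a + p (fst l)) / of_real (\<tau> ^ s (fst l))) :: complex"
  have eq: "dop (l # w) (W a \<tau>) = (\<lambda>n. (c * ?e) * Wpq a \<tau> (p(fst l := Suc (p (fst l)))) q' n)"
    by (simp only: dop_simps IH(1) TI_lin_scale[OF TI_dl[OF l]] q'(1) mult.assoc)
  have "cmod (c * ?e) = cmod c * (real (a + p (fst l)) / \<tau> ^ s (fst l))"
    using assms by (simp add: norm_mult norm_divide norm_power del: of_nat_add)
  also have "\<dots> \<le> (real (a + length w) ^ length w / \<tau> ^ wdeg w) * (real (a + length w) / \<tau> ^ s (fst l))"
    using IH assms by (intro mult_mono divide_right_mono) auto
  also have "\<dots> = real (a + length w) ^ Suc (length w) / \<tau> ^ wdeg (l # w)"
    by (simp add: power_add mult.commute)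
  also have "\<dots> \<le> real (a + length (l # w)) ^ length (l # w) / \<tau> ^ wdeg (l # w)"
    using assms by (intro divide_right_mono) (auto intro!: power_mono mult_mono simp del: wdeg_simps)
  finally have b: "cmod (c * ?e) \<le> real (a + length (l # w)) ^ length (l # w) / \<tau> ^ wdeg (l # w)" .
  have pq: "\<forall>j. (p(fst l := Suc (p (fst l)))) j \<le> length (l # w)" "\<forall>j. q' j \<le> length (l # w)"
    using IH(3,4) q'(2) by (auto intro: le_SucI) (meson Suc_le_mono order_trans)
  show ?case using eq b pq by blast
qed

text \<open>All differences of \<open>b\<close> up to length \<open>k\<close> are those of a function of size \<open>W / \<tau>\<^sup>e\<close> varying on the scale \<open>\<tau>\<close>.\<close>

definition adm :: "nat \<Rightarrow> real \<Rightarrow> real \<Rightarrow> nat \<Rightarrow> nat \<Rightarrow> zfun \<Rightarrow> bool" where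
  "adm a \<tau> c e k b \<longleftrightarrow> (\<forall>w\<in>words. length w \<le> k \<longrightarrow> (\<forall>n. cmod (dop w b n) \<le> c * cmod (W a \<tau> n) / \<tau> ^ (e + wdeg w)))"

lemma adm_W: "\<exists>c\<ge>0. \<forall>\<tau>\<ge>1. adm a \<tau> c 0 k (W a \<tau>)"
proof (intro exI conjI allI impI)
  let ?c = "real (Suc (a + k)) ^ k * (1 + real k) ^ (a * d)"
  show "0 \<le> ?c" by simp
  fix \<tau> :: real assume \<tau>: "1 \<le> \<tau>"
  show "adm a \<tau> ?c 0 k (W a \<tau>)" unfolding adm_def
  proof (intro ballI impI allI)
    fix w n assume w: "w \<in> words" "length w \<le> k"
    obtain c p q where *: "dop w (W a \<tau>) = (\<lambda>n. c * Wpq a \<tau> p q n)" "cmod c \<le> real (a + length w) ^ length w / \<tau> ^ wdeg w"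
     "\<forall>j. q j \<le> length w" using dop_W[OF \<tau> w(1)] by blast
    have "cmod (dop w (W a \<tau>) n) = cmod c * cmod (Wpq a \<tau> p q n)" by (simp add: *(1) norm_mult)
    also have "\<dots> \<le> (real (Suc (a + k)) ^ k / \<tau> ^ wdeg w) * ((1 + real k) ^ (a * d) * cmod (W a \<tau> n))"
    proof (intro mult_mono Wpq_le \<tau>)
      have "real (a + length w) ^ length w \<le> real (Suc (a + k)) ^ length w" using w by (intro power_mono) auto
      also have "\<dots> \<le> real (Suc (a + k)) ^ k" using w by (intro power_increasing) auto
      finally have "real (a + length w) ^ length w / \<tau> ^ wdeg w \<le> real (Suc (a + k)) ^ k / \<tau> ^ wdeg w"
        using \<tau> by (intro divide_right_mono) auto
      with *(2) show "cmod c \<le> real (Suc (a + k)) ^ k / \<tau> ^ wdeg w" by linarith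
      show "q j \<le> k" for j using *(3) w(2) order_trans by blast
    qed (use \<tau> in auto)
    finally show "cmod (dop w (W a \<tau>) n) \<le> ?c * cmod (W a \<tau> n) / \<tau> ^ (0 + wdeg w)" by simp
  qed
qed

lemma adm_mono: "adm a \<tau> c e k b \<Longrightarrow> k' \<le> k \<Longrightarrow> adm a \<tau> c e k' b"
  unfolding adm_def by auto

lemma adm_dl:
  assumes "adm a \<tau> c e (Suc k) b" "fst l < d" shows "adm a \<tau> c (e + s (fst l)) k (dl l b)"
  unfolding adm_def
proof (intro ballI impI allI)
  fix w n assume w: "w \<in> words" "length w \<le> k"
  then have lw: "l # w \<in> words" using assms by simp
  have "cmod (dop (l # w) b n) \<le> c * cmod (W a \<tau> n) / \<tau> ^ (e + wdeg (l # w))"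
    using assms(1) lw w(2) unfolding adm_def by (auto dest!: bspec[of _ _ "l # w"])
  then show "cmod (dop w (dl l b) n) \<le> c * cmod (W a \<tau> n) / \<tau> ^ (e + s (fst l) + wdeg w)"
    unfolding dop_Cons_comm[OF lw, of b] by (simp add: add.assoc)
qed

text \<open>The discrete Leibniz rule; the sign of the quadratic correction distinguishes forward
  from backward differences.\<close>

lemma dl_mult:
  "dl l (\<lambda>n. b n * g n) = (\<lambda>n. b n * dl l g n + ((if snd l then 1 else -1) * (dl l b n * dl l g n) + dl l b n * g n))"
  by (auto simp: dl_def df_def db_def fun_eq_iff algebra_simps)

lemma dop_mult_Cons:
  assumes "l # w \<in> words"
  shows "dop (l # w) (\<lambda>n. b n * g n) = (\<lambda>n. dop w (\<lambda>n. b n * dl l g n) n + ((if snd l then 1 else -1) * dop w (\<lambda>n. dl l b n * dl l g n) n + dop w (\<lambda>n. dl l b n * g n) n))"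
proof -
  have w: "TI (dop w)" using assms TI_dop by simp
  show ?thesis
    unfolding dop_Cons_comm[OF assms] dl_mult TI_lin_add[OF w] TI_lin_scale[OF w] ..
qed

text \<open>The Leibniz rule gives three terms per letter, hence the power of 3. Letters on
  \<open>b\<close> are recorded in the exponent \<open>e\<close> as powers of
  \<open>1/\<tau>\<close>, letters on \<open>g\<close> are covered by the hypothesis, and
  \<open>\<rho> \<le> \<tau>\<close> makes both kinds worth at least \<open>1/\<rho>\<close> per
  unit of degree.\<close>

lemma dop_mult_bound:
  assumes \<rho>: "1 \<le> \<rho>" "\<rho> \<le> \<tau>" and c: "0 \<le> c"
  shows "w \<in> words \<Longrightarrow> adm a \<tau> c e (length w) b \<Longrightarrow> 0 \<le> X \<Longrightarrow>
    (\<And>w'. w' \<in> words \<Longrightarrow> wdeg w' \<le> wdeg w \<Longrightarrow> l2b (\<lambda>n. W a \<tau> n * dop w' g n) (X / \<rho> ^ wdeg w')) \<Longrightarrow>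
    l2b (dop w (\<lambda>n. b n * g n)) (c * 3 ^ length w * X / (\<tau> ^ e * \<rho> ^ wdeg w))"
proof (induction w arbitrary: b g e X)
  case Nil
  have "l2b (\<lambda>n. of_real (c / \<tau> ^ e) * (W a \<tau> n * g n)) (cmod (of_real (c / \<tau> ^ e)) * X)"
    using Nil(4)[of "[]"] by (intro l2b_scale) simp
  moreover have "cmod (of_real (c / \<tau> ^ e)) * X = c * 3 ^ length ([] :: (nat \<times> bool) list) * X / (\<tau> ^ e * \<rho> ^ wdeg [])"
    using c \<rho> by (simp add: norm_divide norm_power)
  ultimately have "l2b (\<lambda>n. of_real (c / \<tau> ^ e) * (W a \<tau> n * g n)) (c * 3 ^ length ([] :: (nat \<times> bool) list) * X / (\<tau> ^ e * \<rho> ^ wdeg []))"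
    by (simp only:)
  then show ?case
  proof (rule l2b_le)
    fix n assume "n \<in> Z"
    have "cmod (b n) \<le> c * cmod (W a \<tau> n) / \<tau> ^ e"
      using Nil(2) unfolding adm_def by (auto dest: bspec[of _ _ "[]"])
    then have "cmod (b n) * cmod (g n) \<le> (c * cmod (W a \<tau> n) / \<tau> ^ e) * cmod (g n)" by (intro mult_right_mono) auto
    then show "cmod (dop [] (\<lambda>n. b n * g n) n) \<le> cmod (of_real (c / \<tau> ^ e) * (W a \<tau> n * g n))"
      using c \<rho> by (simp add: norm_mult norm_divide norm_power mult_ac)
  qed
next
  case (Cons l w)
  have l: "fst l < d" and w: "w \<in> words" using Cons.prems(1) by auto
  have X: "0 \<le> X" by fact
  let ?s = "s (fst l)"
  let ?B = "c * 3 ^ length w * X / (\<tau> ^ e * \<rho> ^ wdeg (l # w))"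
  have pos: "0 < \<rho>" "0 < \<tau>" "1 \<le> \<tau>" using \<rho> by auto
  have X1: "l2b (\<lambda>n. W a \<tau> n * dop w' (dl l g) n) ((X / \<rho> ^ ?s) / \<rho> ^ wdeg w')"
    if "w' \<in> words" "wdeg w' \<le> wdeg w" for w'
  proof -
    have "l # w' \<in> words" using that l by simp
    from Cons.prems(4)[OF this] dop_Cons_comm[OF this, of g] that show ?thesis
      by (simp add: power_add)
  qed
  have X2: "l2b (\<lambda>n. W a \<tau> n * dop w' g n) (X / \<rho> ^ wdeg w')"
    if "w' \<in> words" "wdeg w' \<le> wdeg w" for w'
    using Cons.prems(4)[OF that(1)] that by simp
  have ab: "adm a \<tau> c e (length w) b" by (rule adm_mono[OF Cons.prems(2)]) simp
  have adl: "adm a \<tau> c (e + ?s) (length w) (dl l b)"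
    by (rule adm_dl[OF _ l]) (use Cons.prems(2) in simp)
  have X': "0 \<le> X / \<rho> ^ ?s" using X pos by simp
  have "l2b (dop w (\<lambda>n. b n * dl l g n)) (c * 3 ^ length w * (X / \<rho> ^ ?s) / (\<tau> ^ e * \<rho> ^ wdeg w))"
    by (rule Cons.IH[OF w ab X']) (rule X1)
  then have t1: "l2b (dop w (\<lambda>n. b n * dl l g n)) ?B"
    by (simp add: power_add mult_ac)
  have le: "1 / \<tau> ^ ?s \<le> 1" "1 / \<tau> ^ ?s \<le> 1 / \<rho> ^ ?s"
    using pos \<rho> by (auto intro!: divide_left_mono power_mono mult_pos_pos)
  have N: "0 \<le> c * 3 ^ length w * X / (\<tau> ^ e * \<rho> ^ wdeg w)" using c X pos by simp
  have t2: "l2b (dop w (\<lambda>n. dl l b n * dl l g n)) ?B"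
  proof (rule l2b_mono)
    show "l2b (dop w (\<lambda>n. dl l b n * dl l g n)) (c * 3 ^ length w * (X / \<rho> ^ ?s) / (\<tau> ^ (e + ?s) * \<rho> ^ wdeg w))"
      by (rule Cons.IH[OF w adl X']) (rule X1)
    have "?B * (1 / \<tau> ^ ?s) \<le> ?B * 1" using le c X pos by (intro mult_left_mono) auto
    then show "c * 3 ^ length w * (X / \<rho> ^ ?s) / (\<tau> ^ (e + ?s) * \<rho> ^ wdeg w) \<le> ?B"
      by (simp add: power_add mult_ac)
  qed
  have t3: "l2b (dop w (\<lambda>n. dl l b n * g n)) ?B"
  proof (rule l2b_mono)
    show "l2b (dop w (\<lambda>n. dl l b n * g n)) (c * 3 ^ length w * X / (\<tau> ^ (e + ?s) * \<rho> ^ wdeg w))"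
      by (rule Cons.IH[OF w adl X]) (rule X2)
    have "c * 3 ^ length w * X / (\<tau> ^ e * \<rho> ^ wdeg w) * (1 / \<tau> ^ ?s) \<le> c * 3 ^ length w * X / (\<tau> ^ e * \<rho> ^ wdeg w) * (1 / \<rho> ^ ?s)"
      by (intro mult_left_mono le N)
    then show "c * 3 ^ length w * X / (\<tau> ^ (e + ?s) * \<rho> ^ wdeg w) \<le> ?B"
      by (simp add: power_add mult_ac)
  qed
  have t2': "l2b (\<lambda>n. (if snd l then 1 else -1) * dop w (\<lambda>n. dl l b n * dl l g n) n) ?B"
    using l2b_scale[OF t2, of "if snd l then 1 else -1"] by (cases "snd l") simp_all
  have "l2b (dop (l # w) (\<lambda>n. b n * g n)) (?B + (?B + ?B))"
    unfolding dop_mult_Cons[OF Cons.prems(1)] by (intro l2b_add t1 t2' t3)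
  moreover have "?B + (?B + ?B) = c * 3 ^ length (l # w) * X / (\<tau> ^ e * \<rho> ^ wdeg (l # w))"
    by (simp add: field_simps)
  ultimately show ?case by (simp only:)
qed

text \<open>The term with all letters on \<open>g\<close> cancels. In each remaining term some
  letter hits \<open>b\<close> and gains a power of \<open>1/\<tau>\<close> where only
  \<open>1/\<rho>\<close> is required, which leaves a spare factor
  \<open>1/\<kappa>\<close>.\<close>

lemma dop_commutator_bound:
  assumes \<rho>: "1 \<le> \<rho>" "1 \<le> \<kappa>" and \<tau>: "\<tau> = \<kappa> * \<rho>" and c: "0 \<le> c"
  shows "w \<in> words \<Longrightarrow> adm a \<tau> c 0 (length w) b \<Longrightarrow> 0 \<le> X \<Longrightarrow>
    (\<And>w'. w' \<in> words \<Longrightarrow> wdeg w' \<le> wdeg w \<Longrightarrow> l2b (\<lambda>n. W a \<tau> n * dop w' g n) (X / \<rho> ^ wdeg w')) \<Longrightarrow>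
    l2b (\<lambda>n. dop w (\<lambda>n. b n * g n) n - b n * dop w g n) (c * 3 ^ length w * X / (\<kappa> * \<rho> ^ wdeg w))"
proof (induction w arbitrary: b g X)
  case Nil
  then show ?case using c \<rho> by (simp add: l2b_0)
next
  case (Cons l w)
  have l: "fst l < d" and w: "w \<in> words" using Cons.prems(1) by auto
  have X: "0 \<le> X" by fact
  let ?s = "s (fst l)"
  let ?B = "c * 3 ^ length w * X / (\<kappa> * \<rho> ^ wdeg (l # w))"
  have pos: "0 < \<rho>" "0 < \<kappa>" "0 < \<tau>" using \<rho> \<tau> by auto
  have rt: "\<rho> \<le> \<tau>" using \<rho> mult_right_mono[of 1 \<kappa> \<rho>] by (simp add: \<tau>)
  have s1: "1 \<le> ?s" using s_pos[OF l] .
  have X1: "l2b (\<lambda>n. W a \<tau> n * dop w' (dl l g) n) ((X / \<rho> ^ ?s) / \<rho> ^ wdeg w')"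
    if "w' \<in> words" "wdeg w' \<le> wdeg w" for w'
  proof -
    have "l # w' \<in> words" using that l by simp
    from Cons.prems(4)[OF this] dop_Cons_comm[OF this, of g] that show ?thesis
      by (simp add: power_add)
  qed
  have X2: "l2b (\<lambda>n. W a \<tau> n * dop w' g n) (X / \<rho> ^ wdeg w')"
    if "w' \<in> words" "wdeg w' \<le> wdeg w" for w'
    using Cons.prems(4)[OF that(1)] that by simp
  have ab: "adm a \<tau> c 0 (length w) b" by (rule adm_mono[OF Cons.prems(2)]) simp
  have adl: "adm a \<tau> c (0 + ?s) (length w) (dl l b)"
    by (rule adm_dl[OF _ l]) (use Cons.prems(2) in simp)
  have X': "0 \<le> X / \<rho> ^ ?s" using X pos by simp
  have "l2b (\<lambda>n. dop w (\<lambda>n. b n * dl l g n) n - b n * dop w (dl l g) n) (c * 3 ^ length w * (X / \<rho> ^ ?s) / (\<kappa> * \<rho> ^ wdeg w))"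
    by (rule Cons.IH[OF w ab X']) (rule X1)
  then have t1: "l2b (\<lambda>n. dop w (\<lambda>n. b n * dl l g n) n - b n * dop w (dl l g) n) ?B"
    by (simp add: power_add mult_ac)
  \<comment> \<open>The spare factor is really \<open>1 / \<kappa> ^ ?s\<close>; one power of it is
    kept.\<close>
  have k: "\<kappa> \<le> \<kappa> ^ ?s" using \<rho> s1 by (intro self_le_power) auto
  have "1 / \<tau> ^ ?s = (1 / \<kappa> ^ ?s) * (1 / \<rho> ^ ?s)" by (simp add: \<tau> power_mult_distrib)
  moreover have "1 / \<kappa> ^ ?s \<le> 1 / \<kappa>" using k pos by (intro divide_left_mono) auto
  ultimately have le1: "1 / \<tau> ^ ?s \<le> (1 / \<kappa>) * (1 / \<rho> ^ ?s)"
    using pos by (simp only:) (intro mult_right_mono, auto)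
  also have "\<dots> \<le> (1 / \<kappa>) * 1" using \<rho> pos by (intro mult_left_mono) auto
  finally have "1 / \<tau> ^ ?s \<le> 1 / \<kappa>" by simp
  note le = le1 this
  have t2: "l2b (dop w (\<lambda>n. dl l b n * dl l g n)) ?B"
  proof (rule l2b_mono)
    show "l2b (dop w (\<lambda>n. dl l b n * dl l g n)) (c * 3 ^ length w * (X / \<rho> ^ ?s) / (\<tau> ^ (0 + ?s) * \<rho> ^ wdeg w))"
      by (rule dop_mult_bound[OF \<rho>(1) rt c w adl X']) (rule X1)
    have "c * 3 ^ length w * X / \<rho> ^ wdeg (l # w) * (1 / \<tau> ^ ?s) \<le> c * 3 ^ length w * X / \<rho> ^ wdeg (l # w) * (1 / \<kappa>)"
      using c X pos by (intro mult_left_mono le) auto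
    then show "c * 3 ^ length w * (X / \<rho> ^ ?s) / (\<tau> ^ (0 + ?s) * \<rho> ^ wdeg w) \<le> ?B"
      by (simp add: power_add mult_ac)
  qed
  have t3: "l2b (dop w (\<lambda>n. dl l b n * g n)) ?B"
  proof (rule l2b_mono)
    show "l2b (dop w (\<lambda>n. dl l b n * g n)) (c * 3 ^ length w * X / (\<tau> ^ (0 + ?s) * \<rho> ^ wdeg w))"
      by (rule dop_mult_bound[OF \<rho>(1) rt c w adl X]) (rule X2)
    have "c * 3 ^ length w * X / \<rho> ^ wdeg w * (1 / \<tau> ^ ?s) \<le> c * 3 ^ length w * X / \<rho> ^ wdeg w * ((1 / \<kappa>) * (1 / \<rho> ^ ?s))"
      using c X pos by (intro mult_left_mono le) auto
    then show "c * 3 ^ length w * X / (\<tau> ^ (0 + ?s) * \<rho> ^ wdeg w) \<le> ?B"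
      by (simp add: power_add mult_ac)
  qed
  have t2': "l2b (\<lambda>n. (if snd l then 1 else -1) * dop w (\<lambda>n. dl l b n * dl l g n) n) ?B"
    using l2b_scale[OF t2, of "if snd l then 1 else -1"] by (cases "snd l") simp_all
  have "l2b (\<lambda>n. (dop w (\<lambda>n. b n * dl l g n) n - b n * dop w (dl l g) n) + ((if snd l then 1 else -1) * dop w (\<lambda>n. dl l b n * dl l g n) n + dop w (\<lambda>n. dl l b n * g n) n)) (?B + (?B + ?B))"
    by (intro l2b_add t1 t2' t3)
  moreover have "?B + (?B + ?B) = c * 3 ^ length (l # w) * X / (\<kappa> * \<rho> ^ wdeg (l # w))"
    by (simp add: field_simps)
  moreover have "(\<lambda>n. (dop w (\<lambda>n. b n * dl l g n) n - b n * dop w (dl l g) n) + ((if snd l then 1 else -1) * dop w (\<lambda>n. dl l b n * dl l g n) n + dop w (\<lambda>n. dl l b n * g n) n))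
     = (\<lambda>n. dop (l # w) (\<lambda>n. b n * g n) n - b n * dop (l # w) g n)"
    unfolding dop_mult_Cons[OF Cons.prems(1)] dop_Cons_comm[OF Cons.prems(1), of g] by (simp add: algebra_simps)
  ultimately show ?case by (simp only:)
qed

end

section \<open>Interior regularity\<close>

text \<open>The sum of \<open>\<bar>D v\<bar>\<^sup>2\<close> over a box with side lengths \<open>L\<close>, for all mixed first differences \<open>D\<close> in the first \<open>k\<close>
  directions, weighted so that it dominates \<open>\<bar>v\<bar>\<^sup>2\<close> at the corner of the box.\<close>

fun Qf :: "(nat \<Rightarrow> nat) \<Rightarrow> nat \<Rightarrow> zfun \<Rightarrow> (nat \<Rightarrow> int) \<Rightarrow> real" where
  "Qf L 0 v x = (cmod (v x))\<^sup>2"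
| "Qf L (Suc k) v x = (\<Sum>t<L k. Qf L k v (x(k := x k + int t)) + (real (L k))\<^sup>2 * Qf L k (df k v) (x(k := x k + int t)))"

text \<open>Telescoping bounds \<open>v x\<close> by \<open>v\<close> at any point of the segment
  plus the sum of differences; averaging over that point and Cauchy-Schwarz give the square
  form.\<close>

lemma sobolev_1d:
  fixes v :: zfun
  shows "real l * (cmod (v x))\<^sup>2 \<le> 2 * (\<Sum>t<l. (cmod (v (x(k := x k + int t))))\<^sup>2 + (real l)\<^sup>2 * (cmod (df k v (x(k := x k + int t))))\<^sup>2)"
proof -
  let ?x = "\<lambda>t. x(k := x k + int t)"
  let ?D = "\<Sum>i<l. cmod (df k v (?x i))"
  have tel: "cmod (v x) \<le> cmod (v (?x t)) + (\<Sum>i<t. cmod (df k v (?x i)))" for t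
  proof (induction t)
    case (Suc t)
    have "df k v (?x t) = v (?x (Suc t)) - v (?x t)" by (simp add: df_def algebra_simps)
    then have "cmod (v (?x t)) \<le> cmod (v (?x (Suc t))) + cmod (df k v (?x t))"
      using norm_triangle_sub[of "v (?x t)" "v (?x (Suc t))"] by (simp add: norm_minus_commute)
    with Suc show ?case by (simp only: sum.lessThan_Suc)
  qed simp
  have CS: "?D\<^sup>2 \<le> real l * (\<Sum>i<l. (cmod (df k v (?x i)))\<^sup>2)"
    using Cauchy_Schwarz_ineq_sum[of "\<lambda>_. 1" "\<lambda>i. cmod (df k v (?x i))" "{..<l}"] by simp
  have one: "(cmod (v x))\<^sup>2 \<le> 2 * (cmod (v (?x t)))\<^sup>2 + 2 * ?D\<^sup>2" if "t < l" for t
  proof -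
    have "(\<Sum>i<t. cmod (df k v (?x i))) \<le> ?D" using that by (intro sum_mono2) auto
    then have "cmod (v x) \<le> cmod (v (?x t)) + ?D" using tel[of t] by simp
    then have "(cmod (v x))\<^sup>2 \<le> (cmod (v (?x t)) + ?D)\<^sup>2" by (intro power_mono) auto
    also have "\<dots> \<le> 2 * (cmod (v (?x t)))\<^sup>2 + 2 * ?D\<^sup>2"
      using sum_squares_bound[of "cmod (v (?x t))" ?D] by (simp add: power2_sum)
    finally show ?thesis .
  qed
  have "real l * (cmod (v x))\<^sup>2 = (\<Sum>t<l. (cmod (v x))\<^sup>2)" by simp
  also have "\<dots> \<le> (\<Sum>t<l. 2 * (cmod (v (?x t)))\<^sup>2 + 2 * ?D\<^sup>2)" by (intro sum_mono one) simp
  also have "\<dots> = 2 * (\<Sum>t<l. (cmod (v (?x t)))\<^sup>2) + 2 * real l * ?D\<^sup>2"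
    by (simp add: sum.distrib sum_distrib_left)
  also have "\<dots> \<le> 2 * (\<Sum>t<l. (cmod (v (?x t)))\<^sup>2) + 2 * real l * (real l * (\<Sum>i<l. (cmod (df k v (?x i)))\<^sup>2))"
    by (intro add_left_mono mult_left_mono CS) auto
  also have "\<dots> = 2 * (\<Sum>t<l. (cmod (v (?x t)))\<^sup>2 + (real l)\<^sup>2 * (cmod (df k v (?x t)))\<^sup>2)"
    by (simp add: sum.distrib sum_distrib_left algebra_simps power2_eq_square)
  finally show ?thesis .
qed

text \<open>A discrete Sobolev embedding: \<open>sobolev_1d\<close> in each direction in turn,
  applied to the terms with \<open>v\<close> and with its difference.\<close>

lemma Qf_lower: "(\<Prod>i<k. real (L i)) * (cmod (v x))\<^sup>2 \<le> 2 ^ k * Qf L k v x"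
proof (induction k arbitrary: v x)
  case (Suc k)
  let ?x = "\<lambda>t. x(k := x k + int t)"
  let ?P = "\<Prod>i<k. real (L i)"
  have P: "0 \<le> ?P" by (intro prod_nonneg) auto
  have "(\<Prod>i<Suc k. real (L i)) * (cmod (v x))\<^sup>2 = ?P * (real (L k) * (cmod (v x))\<^sup>2)" by simp
  also have "\<dots> \<le> ?P * (2 * (\<Sum>t<L k. (cmod (v (?x t)))\<^sup>2 + (real (L k))\<^sup>2 * (cmod (df k v (?x t)))\<^sup>2))"
    by (intro mult_left_mono sobolev_1d P)
  also have "\<dots> = 2 * (\<Sum>t<L k. ?P * (cmod (v (?x t)))\<^sup>2 + (real (L k))\<^sup>2 * (?P * (cmod (df k v (?x t)))\<^sup>2))"
    by (simp add: sum_distrib_left algebra_simps)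
  also have "\<dots> \<le> 2 * (\<Sum>t<L k. 2 ^ k * Qf L k v (?x t) + (real (L k))\<^sup>2 * (2 ^ k * Qf L k (df k v) (?x t)))"
    by (intro mult_left_mono sum_mono add_mono Suc) auto
  also have "\<dots> = 2 ^ Suc k * Qf L (Suc k) v x"
    by (simp add: sum_distrib_left algebra_simps)
  finally show ?case .
qed simp

context scaled begin

text \<open>All points of \<open>X\<close> share the base value in the directions still to be
  summed, so their translates are distinct and stay in the box. Each level therefore sums over a set
  without repetition, for \<open>v\<close> and for one more difference of it.\<close>

lemma Qf_upper:
  assumes "k \<le> d" "finite X" "X \<subseteq> B" "\<And>x i. x \<in> X \<Longrightarrow> i < k \<Longrightarrow> x i = x0 i"
    and B: "B = {x\<in>Z. \<forall>i<d. x0 i \<le> x i \<and> x i < x0 i + int (L i)}"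
    and K: "\<And>w F. w \<in> words \<Longrightarrow> length w \<le> k \<Longrightarrow> finite F \<Longrightarrow> F \<subseteq> B \<Longrightarrow>
       (\<Prod>l\<leftarrow>w. real (L (fst l)))\<^sup>2 * (\<Sum>n\<in>F. (cmod (dop w v n))\<^sup>2) \<le> K"
  shows "(\<Sum>x\<in>X. Qf L k v x) \<le> 2 ^ k * K"
  using assms(1-4) K
proof (induction k arbitrary: X v K)
  case 0
  then show ?case using 0(5)[of "[]" X] by simp
next
  case (Suc k)
  have k: "k < d" using Suc.prems(1) by simp
  show ?case
  proof (cases "X = {} \<or> L k = 0")
    case True
    moreover have "0 \<le> K" using Suc.prems(5)[of "[]" "{}"] by simp
    ultimately show ?thesis by auto
  next
    case False
    then have Lk: "0 < real (L k)" by simp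
    let ?f = "\<lambda>(x, t). x(k := x k + int t)"
    let ?X = "?f ` (X \<times> {..<L k})"
    have inj: "inj_on ?f (X \<times> {..<L k})"
    proof (rule inj_onI)
      fix p q assume pq: "p \<in> X \<times> {..<L k}" "q \<in> X \<times> {..<L k}" "?f p = ?f q"
      obtain x t y r where p: "p = (x, t)" and q: "q = (y, r)" by (cases p, cases q)
      have *: "x \<in> X" "y \<in> X" and eq: "x(k := x k + int t) = y(k := y k + int r)" using pq by (auto simp: p q)
      have xy: "x k = y k" using Suc.prems(4)[of x k] Suc.prems(4)[of y k] * by simp
      have "x i = y i" for i using fun_cong[OF eq, of i] xy by (cases "i = k") auto
      then show "p = q" using fun_cong[OF eq, of k] xy by (auto simp: p q)
    qed
    have XB: "?X \<subseteq> B"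
    proof
      fix y assume "y \<in> ?X"
      then obtain x t where *: "x \<in> X" "t \<in> {..<L k}" and y: "y = x(k := x k + int t)" by auto
      have "x \<in> B" using * Suc.prems(3) by auto
      moreover have "x k = x0 k" using Suc.prems(4)[of x k] * by simp
      ultimately show "y \<in> B" using * k unfolding B y by auto
    qed
    have X0: "y i = x0 i" if "y \<in> ?X" "i < k" for y i
      using that Suc.prems(4) by (auto simp: less_Suc_eq)
    have fin: "finite ?X" using Suc.prems(2) by simp
    have 1: "(\<Sum>x\<in>?X. Qf L k v x) \<le> 2 ^ k * K"
      using Suc.prems(1) by (intro Suc.IH XB fin X0 Suc.prems(5)) auto
    have K2: "(\<Prod>l\<leftarrow>w. real (L (fst l)))\<^sup>2 * (\<Sum>n\<in>F. (cmod (dop w (df k v) n))\<^sup>2) \<le> K / (real (L k))\<^sup>2"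
      if *: "w \<in> words" "length w \<le> k" "finite F" "F \<subseteq> B" for w F
    proof -
      have w: "(k, True) # w \<in> words" using * k by simp
      have eq: "dop w (df k v) = dop ((k, True) # w) v"
        using dop_Cons_comm[OF w, of v] by (simp add: dl_def)
      have "(\<Prod>l\<leftarrow>((k, True) # w). real (L (fst l)))\<^sup>2 * (\<Sum>n\<in>F. (cmod (dop ((k, True) # w) v n))\<^sup>2) \<le> K"
        using * w by (intro Suc.prems(5)) auto
      then show ?thesis
        unfolding eq using Lk by (simp add: power_mult_distrib field_simps)
    qed
    have 2: "(\<Sum>x\<in>?X. Qf L k (df k v) x) \<le> 2 ^ k * (K / (real (L k))\<^sup>2)"
    proof (rule Suc.IH[OF _ fin XB])
      show "k \<le> d" using k by simp
    qed (rule X0 K2; assumption)+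
    have "(\<Sum>x\<in>X. Qf L (Suc k) v x) = (\<Sum>x\<in>X. \<Sum>t<L k. Qf L k v (?f (x, t)) + (real (L k))\<^sup>2 * Qf L k (df k v) (?f (x, t)))"
      by simp
    also have "\<dots> = (\<Sum>p\<in>X \<times> {..<L k}. Qf L k v (?f p) + (real (L k))\<^sup>2 * Qf L k (df k v) (?f p))"
      by (subst sum.cartesian_product) (simp add: case_prod_unfold)
    also have "\<dots> = (\<Sum>x\<in>?X. Qf L k v x + (real (L k))\<^sup>2 * Qf L k (df k v) x)"
      by (subst sum.reindex[OF inj]) simp
    also have "\<dots> = (\<Sum>x\<in>?X. Qf L k v x) + (real (L k))\<^sup>2 * (\<Sum>x\<in>?X. Qf L k (df k v) x)"
      by (simp add: sum.distrib sum_distrib_left)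
    also have "\<dots> \<le> 2 ^ k * K + (real (L k))\<^sup>2 * (2 ^ k * (K / (real (L k))\<^sup>2))"
      by (intro add_mono 1 mult_left_mono 2) auto
    also have "\<dots> = 2 ^ Suc k * K" using Lk by simp
    finally show ?thesis .
  qed
qed

text \<open>With exponent \<open>Suc b\<close> the weight beats growth of order \<open>b\<close> by
  one power in each direction. The squares are then summable, with sum of the order of the volume
  \<open>\<rho> ^ S\<close>; the ratio of the two scales only affects the constant.\<close>

lemma l2b_W_growth:
  "\<exists>C\<ge>0. \<forall>\<rho>\<ge>1. \<forall>g G. (\<forall>n\<in>Z. cmod (g n) \<le> G * (1 + nm n / \<rho>) ^ b) \<longrightarrow>
     l2b (\<lambda>n. W (Suc b) (real (Suc k) * \<rho>) n * g n) (C * G * sqrt (\<rho> ^ S))"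
proof -
  define \<kappa> where "\<kappa> = real (Suc k)"
  have \<kappa>: "1 \<le> \<kappa>" by (simp add: \<kappa>_def)
  define a where "a = Suc b"
  define C1 where "C1 = (\<kappa> * (1 + real d)) ^ b * ((2 * real a) ^ a) ^ d"
  define C where "C = C1 * sqrt (4 ^ d * \<kappa> ^ S)"
  have C1: "0 \<le> C1" using \<kappa> by (simp add: C1_def)
  show ?thesis
  proof (intro exI[of _ C] conjI allI impI)
    show "0 \<le> C" using C1 \<kappa> by (simp add: C_def)
    fix \<rho> g G assume \<rho>: "1 \<le> (\<rho>::real)" and g: "\<forall>n\<in>Z. cmod (g n) \<le> G * (1 + nm n / \<rho>) ^ b"
    have "cmod (g (\<lambda>_. 0)) \<le> G" using bspec[OF g Z_0] by simp
    then have G: "0 \<le> G" using norm_ge_zero order_trans by blast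
    define \<tau> where "\<tau> = \<kappa> * \<rho>"
    have \<tau>: "1 \<le> \<tau>" using \<kappa> \<rho> mult_mono[of 1 \<kappa> 1 \<rho>] by (simp add: \<tau>_def)
    have T: "1 \<le> \<tau> ^ s j" for j using \<tau> by simp
    let ?x = "\<lambda>n j. \<bar>real_of_int (n j)\<bar> / \<tau> ^ s j"
    \<comment> \<open>The sum defining \<open>nm\<close> is traded for a product over the
      coordinates, the form in which the weight decays.\<close>
    have nm_le: "1 + nm n / \<rho> \<le> \<kappa> * (1 + real d) * (\<Prod>j<d. 1 + ?x n j)" for n
    proof -
      have "nm n / \<tau> = (\<Sum>j<d. \<bar>real_of_int (n j)\<bar> powr (1 / real (s j)) / \<tau>)"
        by (simp add: nm_def sum_divide_distrib)
      also have "\<dots> \<le> (\<Sum>j<d. 1 + ?x n j)"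
      proof (intro sum_mono)
        fix j assume j: "j \<in> {..<d}"
        have sj: "1 \<le> s j" using s_pos j by simp
        have x0: "0 \<le> ?x n j" using \<tau> by simp
        have "\<bar>real_of_int (n j)\<bar> powr (1 / real (s j)) / \<tau> = ?x n j powr (1 / real (s j))"
        proof -
          have "(\<tau> ^ s j) powr (1 / real (s j)) = \<tau>"
            using \<tau> sj by (simp add: powr_realpow[symmetric] powr_powr)
          then show ?thesis using \<tau> by (simp add: powr_divide)
        qed
        also have "\<dots> \<le> (1 + ?x n j) powr (1 / real (s j))" using x0 by (intro powr_mono2) auto
        also have "\<dots> \<le> (1 + ?x n j) powr 1" using x0 sj by (intro powr_mono) auto
        also have "\<dots> = 1 + ?x n j" using x0 by simp
        finally show "\<bar>real_of_int (n j)\<bar> powr (1 / real (s j)) / \<tau> \<le> 1 + ?x n j" .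
      qed
      also have "\<dots> = real d + (\<Sum>j<d. ?x n j)" by (simp add: sum.distrib)
      finally have 1: "1 + nm n / \<tau> \<le> real d + (1 + (\<Sum>j<d. ?x n j))" by simp
      have 2: "1 + (\<Sum>j<d. ?x n j) \<le> (\<Prod>j<d. 1 + ?x n j)" using \<tau> by (intro sum_le_prod_1p) auto
      have 3: "1 \<le> (\<Prod>j<d. 1 + ?x n j)" using \<tau> by (intro prod_ge_1) auto
      have "real d * 1 \<le> real d * (\<Prod>j<d. 1 + ?x n j)" using 3 by (intro mult_left_mono) auto
      with 1 2 have 4: "1 + nm n / \<tau> \<le> (1 + real d) * (\<Prod>j<d. 1 + ?x n j)" by (simp add: distrib_right)
      have "1 + nm n / \<rho> \<le> \<kappa> * (1 + nm n / \<tau>)"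
        using \<kappa> \<rho> by (simp add: \<tau>_def distrib_left)
      also have "\<dots> \<le> \<kappa> * ((1 + real d) * (\<Prod>j<d. 1 + ?x n j))" using 4 \<kappa> by (intro mult_left_mono) auto
      finally show ?thesis by (simp add: mult.assoc)
    qed
    have pt: "cmod (W a \<tau> n * g n) \<le> G * C1 * (\<Prod>j<d. 1 / (1 + ?x n j))" if "n \<in> Z" for n
    proof -
      have xp: "0 < 1 + ?x n j" for j using \<tau> by (intro add_pos_nonneg) auto
      have "cmod (W a \<tau> n) = (\<Prod>j<d. cmod (om a (\<tau> ^ s j) (n j)))" by (simp add: W_def prod_norm)
      also have "\<dots> \<le> (\<Prod>j<d. (2 * real a) ^ a / (1 + ?x n j) ^ a)"
        by (intro prod_mono conjI om_decay T) auto
      also have "\<dots> = ((2 * real a) ^ a) ^ d * (\<Prod>j<d. 1 / (1 + ?x n j) ^ a)"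
        by (simp add: divide_inverse prod.distrib)
      finally have w: "cmod (W a \<tau> n) \<le> ((2 * real a) ^ a) ^ d * (\<Prod>j<d. 1 / (1 + ?x n j) ^ a)" .
      have "cmod (g n) \<le> G * (1 + nm n / \<rho>) ^ b" using g that by blast
      also have "\<dots> \<le> G * (\<kappa> * (1 + real d) * (\<Prod>j<d. 1 + ?x n j)) ^ b"
        using \<rho> by (intro mult_left_mono power_mono nm_le G) (auto intro!: add_nonneg_nonneg)
      finally have "cmod (W a \<tau> n) * cmod (g n) \<le> (((2 * real a) ^ a) ^ d * (\<Prod>j<d. 1 / (1 + ?x n j) ^ a)) * (G * (\<kappa> * (1 + real d) * (\<Prod>j<d. 1 + ?x n j)) ^ b)"
        using xp by (intro mult_mono w) (auto intro!: mult_nonneg_nonneg prod_nonneg simp: less_imp_le)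
      also have "\<dots> = G * C1 * ((\<Prod>j<d. 1 / (1 + ?x n j) ^ a) * (\<Prod>j<d. (1 + ?x n j) ^ b))"
        by (simp add: C1_def power_mult_distrib prod_power_distrib mult_ac)
      also have "(\<Prod>j<d. 1 / (1 + ?x n j) ^ a) * (\<Prod>j<d. (1 + ?x n j) ^ b) = (\<Prod>j<d. 1 / (1 + ?x n j))"
      proof (subst prod.distrib[symmetric], intro prod.cong refl)
        fix j
        have "1 + ?x n j \<noteq> 0" using xp[of j] by simp
        then show "1 / (1 + ?x n j) ^ a * (1 + ?x n j) ^ b = 1 / (1 + ?x n j)" by (simp add: a_def)
      qed
      finally show ?thesis by (simp add: norm_mult)
    qed
    show "l2b (\<lambda>n. W (Suc b) (real (Suc k) * \<rho>) n * g n) (C * G * sqrt (\<rho> ^ S))"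
      unfolding l2b_def a_def[symmetric] \<kappa>_def[symmetric] \<tau>_def[symmetric]
    proof (intro conjI allI impI)
      show "0 \<le> C * G * sqrt (\<rho> ^ S)" using \<open>0 \<le> C\<close> G \<rho> by simp
      fix F assume F: "finite F \<and> F \<subseteq> Z"
      let ?B = "(\<lambda>(n, i). nat \<bar>n i\<bar>) ` (F \<times> {..<d})"
      have finB: "finite ?B" using F by auto
      define M where "M = Max (insert 0 ?B)"
      have M: "\<bar>n i\<bar> \<le> int M" if "n \<in> F" "i < d" for n i
      proof -
        have "nat \<bar>n i\<bar> \<in> ?B" using that by (intro image_eqI[of _ _ "(n, i)"]) auto
        then have "nat \<bar>n i\<bar> \<le> M" unfolding M_def using finB by (intro Max_ge) auto
        then show ?thesis by simp
      qed
      let ?Q = "zbox d (\<lambda>_. {- int M..int M})"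
      have FQ: "F \<subseteq> ?Q" using F M by (auto simp: zbox_def Z_def abs_le_iff minus_le_iff)
      have "(\<Sum>n\<in>F. (cmod (W a \<tau> n * g n))\<^sup>2) \<le> (\<Sum>n\<in>F. (G * C1)\<^sup>2 * (\<Prod>j<d. 1 / (1 + ?x n j)\<^sup>2))"
      proof (intro sum_mono)
        fix n assume "n \<in> F"
        then have "n \<in> Z" using F by auto
        then have "(cmod (W a \<tau> n * g n))\<^sup>2 \<le> (G * C1 * (\<Prod>j<d. 1 / (1 + ?x n j)))\<^sup>2" by (intro power_mono pt) auto
        then show "(cmod (W a \<tau> n * g n))\<^sup>2 \<le> (G * C1)\<^sup>2 * (\<Prod>j<d. 1 / (1 + ?x n j)\<^sup>2)"
          by (simp only: power_mult_distrib prod_power_distrib power_divide power_one)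
      qed
      also have "\<dots> \<le> (\<Sum>n\<in>?Q. (G * C1)\<^sup>2 * (\<Prod>j<d. 1 / (1 + ?x n j)\<^sup>2))"
        using FQ by (intro sum_mono2) (auto intro!: mult_nonneg_nonneg prod_nonneg)
      also have "\<dots> = (G * C1)\<^sup>2 * (\<Prod>j<d. \<Sum>t\<in>{- int M..int M}. 1 / (1 + \<bar>real_of_int t\<bar> / \<tau> ^ s j)\<^sup>2)"
        by (subst sum_distrib_left[symmetric], subst sum_prod_zbox[symmetric]) auto
      also have "\<dots> \<le> (G * C1)\<^sup>2 * (\<Prod>j<d. 4 * \<tau> ^ s j)"
        by (intro mult_left_mono prod_mono conjI sum_weight_1d T sum_nonneg) auto
      also have "(\<Prod>j<d. 4 * \<tau> ^ s j) = 4 ^ d * \<kappa> ^ S * \<rho> ^ S"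
        by (simp add: prod.distrib S_def power_sum[symmetric] \<tau>_def power_mult_distrib)
      finally have "L2_set (\<lambda>n. cmod (W a \<tau> n * g n)) F \<le> sqrt ((G * C1)\<^sup>2 * (4 ^ d * \<kappa> ^ S * \<rho> ^ S))"
        unfolding L2_set_def by (rule real_sqrt_le_mono)
      also have "\<dots> = C * G * sqrt (\<rho> ^ S)"
        using G C1 by (simp add: real_sqrt_mult C_def)
      finally show "L2_set (\<lambda>n. cmod (W a \<tau> n * g n)) F \<le> C * G * sqrt (\<rho> ^ S)" .
    qed
  qed
qed

end

context elliptic begin

text \<open>For \<open>\<kappa> = Suc k\<close> large the commutators of \<open>Lz\<close> with the weight cost at most half of the left-hand side, which is
  absorbed. The a priori bound \<open>X0\<close> serves only to make this absorption legitimate.\<close>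

lemma weighted_elliptic:
  "\<exists>k. \<exists>C\<ge>1. \<forall>\<rho>\<ge>1. \<forall>g Y Y' X0. 0 \<le> X0 \<and> (\<forall>w\<in>words. wdeg w \<le> m \<longrightarrow> l2b (\<lambda>n. W a0 (real (Suc k) * \<rho>) n * dop w g n) (X0 / \<rho> ^ wdeg w))
     \<and> l2b (\<lambda>n. W a0 (real (Suc k) * \<rho>) n * g n) Y \<and> l2b (\<lambda>n. W a0 (real (Suc k) * \<rho>) n * Lz g n) Y' \<longrightarrow>
     (\<forall>w\<in>words. wdeg w \<le> m \<longrightarrow> l2b (\<lambda>n. W a0 (real (Suc k) * \<rho>) n * dop w g n) (C * (Y + \<rho> ^ m * Y') / \<rho> ^ wdeg w))"
proof -
  obtain c where c: "0 \<le> c" "\<And>\<tau>. 1 \<le> \<tau> \<Longrightarrow> adm a0 \<tau> c 0 m (W a0 \<tau>)" using adm_W[of a0 m] by blast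
  obtain CP where CP: "1 \<le> CP" "\<And>w \<rho> v K0 K1. w \<in> words \<Longrightarrow> wdeg w \<le> m \<Longrightarrow> 0 < \<rho> \<Longrightarrow> l2b v K0 \<Longrightarrow> l2b (Lz v) K1 \<Longrightarrow>
      l2b (\<lambda>n. of_real (\<rho> ^ wdeg w) * dop w v n) (CP * (K0 + \<rho> ^ m * K1))"
    using elliptic_estimate by blast
  define La where "La = (\<Sum>p\<in>Mset s d m. cmod (a (fst p) (snd p)))"
  have La: "0 \<le> La" unfolding La_def by (intro sum_nonneg) auto
  define C2 where "C2 = c * 3 ^ m"
  have C2: "0 \<le> C2" using c by (simp add: C2_def)
  \<comment> \<open>\<open>CP * La * C2\<close> comes from commuting the operator with the weight,
    the other \<open>C2\<close> from commuting \<open>dop w\<close> with it; both are divided by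
    \<open>\<kappa>\<close> in the end.\<close>
  obtain k :: nat where k: "2 * (CP * La * C2 + C2) \<le> real k" using real_arch_simple by blast
  define \<kappa> where "\<kappa> = real (Suc k)"
  have \<kappa>: "1 \<le> \<kappa>" "2 * (CP * La * C2 + C2) \<le> \<kappa>" using k by (auto simp: \<kappa>_def)
  show ?thesis
  proof (intro exI[of _ k] exI[of _ "2 * CP"] conjI allI impI ballI)
    show "1 \<le> 2 * CP" using CP by simp
    fix \<rho> g Y Y' X0
    assume \<rho>: "1 \<le> (\<rho>::real)"
      and A: "0 \<le> X0 \<and> (\<forall>w\<in>words. wdeg w \<le> m \<longrightarrow> l2b (\<lambda>n. W a0 (real (Suc k) * \<rho>) n * dop w g n) (X0 / \<rho> ^ wdeg w))
     \<and> l2b (\<lambda>n. W a0 (real (Suc k) * \<rho>) n * g n) Y \<and> l2b (\<lambda>n. W a0 (real (Suc k) * \<rho>) n * Lz g n) Y'"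
    define \<tau> where "\<tau> = \<kappa> * \<rho>"
    define V where "V = W a0 \<tau>"
    have \<tau>: "1 \<le> \<tau>" using \<kappa> \<rho> mult_mono[of 1 \<kappa> 1 \<rho>] by (simp add: \<tau>_def)
    have V: "W a0 (real (Suc k) * \<rho>) = V" by (simp add: V_def \<tau>_def \<kappa>_def)
    have X0: "0 \<le> X0" and AX: "\<And>w. w \<in> words \<Longrightarrow> wdeg w \<le> m \<Longrightarrow> l2b (\<lambda>n. V n * dop w g n) (X0 / \<rho> ^ wdeg w)"
      and Y: "l2b (\<lambda>n. V n * g n) Y" and Y': "l2b (\<lambda>n. V n * Lz g n) Y'"
      using A unfolding V by auto
    define c0 where "c0 = CP * (Y + \<rho> ^ m * Y')"
    have c0: "0 \<le> c0" using CP l2b_nonneg[OF Y] l2b_nonneg[OF Y'] \<rho> by (simp add: c0_def)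
    \<comment> \<open>Any bound \<open>X\<close> valid for all words up to degree \<open>m\<close>
      improves to \<open>c0 + X / 2\<close>; this needs the bound at all lower orders
      simultaneously, as commutators involve them.\<close>
    have step: "l2b (\<lambda>n. V n * dop w g n) ((c0 + X / 2) / \<rho> ^ wdeg w)"
      if X: "0 \<le> X" "\<And>w. w \<in> words \<Longrightarrow> wdeg w \<le> m \<Longrightarrow> l2b (\<lambda>n. V n * dop w g n) (X / \<rho> ^ wdeg w)" and w: "w \<in> words" "wdeg w \<le> m" for X w
    proof -
      have cm: "l2b (\<lambda>n. dop w (\<lambda>n. V n * g n) n - V n * dop w g n) (C2 * X / (\<kappa> * \<rho> ^ wdeg w))"
        if w: "w \<in> words" "wdeg w \<le> m" for w
      proof -
        have lw: "length w \<le> m" using length_le_wdeg[OF w(1)] w(2) by simp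
        have "l2b (\<lambda>n. dop w (\<lambda>n. V n * g n) n - V n * dop w g n) (c * 3 ^ length w * X / (\<kappa> * \<rho> ^ wdeg w))"
          unfolding V_def
        proof (rule dop_commutator_bound[OF \<rho> \<kappa>(1) \<tau>_def c(1) w(1) _ X(1)])
          show "adm a0 \<tau> c 0 (length w) (W a0 \<tau>)" by (rule adm_mono[OF c(2)[OF \<tau>] lw])
          fix w' assume "w' \<in> words" "wdeg w' \<le> wdeg w"
          then show "l2b (\<lambda>n. W a0 \<tau> n * dop w' g n) (X / \<rho> ^ wdeg w')"
            using X(2)[of w'] w(2) unfolding V_def by simp
        qed
        moreover have "c * 3 ^ length w * X / (\<kappa> * \<rho> ^ wdeg w) \<le> C2 * X / (\<kappa> * \<rho> ^ wdeg w)"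
          unfolding C2_def using lw c(1) X(1) \<kappa> \<rho> by (intro divide_right_mono mult_right_mono mult_left_mono power_increasing) auto
        ultimately show ?thesis by (rule l2b_mono)
      qed
      let ?e = "C2 * X / (\<kappa> * \<rho> ^ m)"
      have "l2b (\<lambda>n. \<Sum>p\<in>Mset s d m. a (fst p) (snd p) * (dop (mw (fst p) True @ mw (snd p) False) (\<lambda>n. V n * g n) n - V n * dop (mw (fst p) True @ mw (snd p) False) g n))
         (\<Sum>p\<in>Mset s d m. cmod (a (fst p) (snd p)) * ?e)"
      proof (intro l2b_sum finite_Mset l2b_scale)
        fix p assume "p \<in> Mset s d m"
        then have "wdeg (mw (fst p) True @ mw (snd p) False) = m" by (auto simp: Mset_def wdeg_mw)
        then show "l2b (\<lambda>n. dop (mw (fst p) True @ mw (snd p) False) (\<lambda>n. V n * g n) n - V n * dop (mw (fst p) True @ mw (snd p) False) g n) ?e"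
          using cm[of "mw (fst p) True @ mw (snd p) False"] mw_words by simp
      qed
      moreover have "(\<lambda>n. \<Sum>p\<in>Mset s d m. a (fst p) (snd p) * (dop (mw (fst p) True @ mw (snd p) False) (\<lambda>n. V n * g n) n - V n * dop (mw (fst p) True @ mw (snd p) False) g n))
         = (\<lambda>n. Lz (\<lambda>n. V n * g n) n - V n * Lz g n)"
        by (simp add: Lz_def sum_subtractf sum_distrib_left algebra_simps del: dop_simps)
      ultimately have "l2b (\<lambda>n. Lz (\<lambda>n. V n * g n) n - V n * Lz g n) (La * ?e)"
        by (simp only: La_def sum_distrib_right)
      from l2b_add[OF this Y'] have L1: "l2b (Lz (\<lambda>n. V n * g n)) (La * ?e + Y')" by simp
      have rp: "0 < \<rho> ^ wdeg w" using \<rho> by simp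
      have "l2b (\<lambda>n. of_real (\<rho> ^ wdeg w) * dop w (\<lambda>n. V n * g n) n) (CP * (Y + \<rho> ^ m * (La * ?e + Y')))"
        using \<rho> by (intro CP(2) w Y L1) auto
      from l2b_scale[OF this, of "of_real (1 / \<rho> ^ wdeg w)"]
      have "l2b (dop w (\<lambda>n. V n * g n)) ((1 / \<rho> ^ wdeg w) * (CP * (Y + \<rho> ^ m * (La * ?e + Y'))))"
        using \<rho> by (simp add: norm_divide norm_power)
      from l2b_diff[OF this cm[OF w]]
      have "l2b (\<lambda>n. V n * dop w g n) ((1 / \<rho> ^ wdeg w) * (CP * (Y + \<rho> ^ m * (La * ?e + Y'))) + C2 * X / (\<kappa> * \<rho> ^ wdeg w))"
        by simp
      moreover have "(1 / \<rho> ^ wdeg w) * (CP * (Y + \<rho> ^ m * (La * ?e + Y'))) + C2 * X / (\<kappa> * \<rho> ^ wdeg w)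
         = (c0 + (CP * La * C2 + C2) * X / \<kappa>) / \<rho> ^ wdeg w"
      proof -
        have "\<rho> ^ m * ?e = C2 * X / \<kappa>" using \<rho> by simp
        moreover have "\<rho> ^ m * (La * ?e + Y') = La * (\<rho> ^ m * ?e) + \<rho> ^ m * Y'"
          by (simp only: distrib_left mult.left_commute)
        ultimately have "\<rho> ^ m * (La * ?e + Y') = La * (C2 * X / \<kappa>) + \<rho> ^ m * Y'" by (simp only:)
        then show ?thesis unfolding c0_def by (simp add: add_divide_distrib distrib_left distrib_right mult_ac)
      qed
      moreover have "(CP * La * C2 + C2) * X / \<kappa> \<le> X / 2"
      proof -
        have "(2 * (CP * La * C2 + C2)) * X \<le> \<kappa> * X" using \<kappa> X by (intro mult_right_mono) auto
        then show ?thesis using \<kappa> by (simp add: field_simps)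
      qed
      ultimately show ?thesis using rp by (elim l2b_mono ssubst) (auto intro!: divide_right_mono)
    qed
    \<comment> \<open>Iterating the improvement tends to its fixed point \<open>2 * c0\<close>,
      whatever the initial bound \<open>X0\<close>.\<close>
    have iter: "w \<in> words \<Longrightarrow> wdeg w \<le> m \<Longrightarrow> l2b (\<lambda>n. V n * dop w g n) ((2 * c0 + X0 / 2 ^ i) / \<rho> ^ wdeg w)" for w i
    proof (induction i arbitrary: w)
      case 0
      then show ?case using c0 \<rho> by (intro l2b_mono[OF AX]) (auto intro!: divide_right_mono)
    next
      case (Suc i)
      have "0 \<le> 2 * c0 + X0 / 2 ^ i" using c0 X0 by simp
      from step[OF this Suc.IH Suc.prems]
      show ?case by (simp add: field_simps)
    qed
    fix w assume w: "w \<in> words" "wdeg w \<le> m"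
    have rp: "0 < \<rho> ^ wdeg w" "1 \<le> \<rho> ^ wdeg w" using \<rho> by auto
    show "l2b (\<lambda>n. W a0 (real (Suc k) * \<rho>) n * dop w g n) (2 * CP * (Y + \<rho> ^ m * Y') / \<rho> ^ wdeg w)"
      unfolding V
    proof (rule l2b_lim)
      show "0 \<le> 2 * CP * (Y + \<rho> ^ m * Y') / \<rho> ^ wdeg w" using c0 rp by (simp add: c0_def mult.assoc)
      fix e :: real assume e: "0 < e"
      obtain i where i: "X0 / e < 2 ^ i" using real_arch_pow[of 2] by auto
      then have "X0 / 2 ^ i \<le> e" using e by (simp add: field_simps)
      also have "e \<le> e * \<rho> ^ wdeg w" using e rp mult_left_mono[of 1 "\<rho> ^ wdeg w" e] by simp
      finally have "X0 / 2 ^ i / \<rho> ^ wdeg w \<le> e" using rp by (simp add: divide_le_eq mult_ac)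
      then have "(2 * c0 + X0 / 2 ^ i) / \<rho> ^ wdeg w \<le> 2 * CP * (Y + \<rho> ^ m * Y') / \<rho> ^ wdeg w + e"
        unfolding c0_def by (simp add: add_divide_distrib mult.assoc)
      then show "l2b (\<lambda>n. V n * dop w g n) (2 * CP * (Y + \<rho> ^ m * Y') / \<rho> ^ wdeg w + e)"
        by (rule l2b_mono[OF iter[OF w]])
    qed
  qed
qed

end

context scaled begin

text \<open>A difference sees \<open>g\<close> only within distance \<open>length w\<close>, so
  growth persists at the same order. This supplies the a priori bound in
  \<open>interior_regularity\<close>, whose size is immaterial.\<close>

lemma growth_dop:
  assumes "1 \<le> \<rho>" "\<And>n. n \<in> Z \<Longrightarrow> cmod (g n) \<le> G * (1 + nm n / \<rho>) ^ b" "w \<in> words" "length w \<le> N" "n \<in> Z"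
  shows "cmod (dop w g n) \<le> (2 ^ N * (1 + real N) ^ b) * G * (1 + nm n / \<rho>) ^ b"
proof -
  have "cmod (g (\<lambda>_. 0)) \<le> G" using assms(2)[OF Z_0] by simp
  then have G: "0 \<le> G" using norm_ge_zero order_trans by blast
  have "cmod (dop w g n) \<le> 2 ^ length w * (G * (1 + (nm n + real (length w)) / \<rho>) ^ b)"
    by (rule avgc_growth[OF avgc_dop[OF assms(3)], where g = "\<lambda>t. G * (1 + t / \<rho>) ^ b"])
      (use assms G in \<open>auto intro!: mult_left_mono power_mono divide_right_mono\<close>)
  also have "\<dots> \<le> 2 ^ N * (G * ((1 + real N) * (1 + nm n / \<rho>)) ^ b)"
  proof (intro mult_mono power_mono power_increasing mult_left_mono G)
    have "real (length w) / \<rho> \<le> real N / 1" using assms by (intro frac_le) auto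
    moreover have "0 \<le> real N * (nm n / \<rho>)" using assms by simp
    ultimately show "1 + (nm n + real (length w)) / \<rho> \<le> (1 + real N) * (1 + nm n / \<rho>)"
      by (simp add: add_divide_distrib algebra_simps)
  qed (use assms G in \<open>auto intro!: add_nonneg_nonneg mult_nonneg_nonneg\<close>)
  finally show ?thesis by (simp add: power_mult_distrib mult_ac)
qed

lemma W_lower:
  assumes "1 \<le> \<tau>" "\<And>j. j < d \<Longrightarrow> \<bar>real_of_int (n j)\<bar> \<le> 2 * \<tau> ^ s j"
  shows "((1 / (3 + real a)) ^ a) ^ d \<le> cmod (W a \<tau> n)"
proof -
  have "((1 / (3 + real a)) ^ a) ^ d = (\<Prod>j<d. (1 / (3 + real a)) ^ a)" by simp
  also have "\<dots> \<le> (\<Prod>j<d. cmod (om a (\<tau> ^ s j) (n j)))"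
    using assms by (intro prod_mono conjI om_lower) auto
  finally show ?thesis by (simp add: W_def prod_norm)
qed

lemma words_prod: "w \<in> words \<Longrightarrow> (\<Prod>l\<leftarrow>w. real (r ^ s (fst l))) = real r ^ wdeg w"
  by (induction w) (auto simp: power_add)

end

section \<open>From weighted square sums to pointwise bounds\<close>

context elliptic begin

text \<open>The weighted estimate bounds square sums of the differences of \<open>u\<close>, and the
  Sobolev inequality on a box with corner \<open>x\<close> makes the bounds pointwise. The latter
  consumes up to \<open>d\<close> additional differences, which is why the equation is controlled up
  to length \<open>P + d\<close>.\<close>

lemma interior_regularity:
  "\<exists>C\<ge>0. \<forall>r::nat. \<forall>u G H. 1 \<le> r \<and> 0 \<le> G \<and> 0 \<le> H \<and> (\<forall>n\<in>Z. cmod (u n) \<le> G * (1 + nm n / real r) ^ b) \<and>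
     (\<forall>w\<in>words. length w \<le> P + d \<longrightarrow> (\<forall>n\<in>Z. cmod (dop w (Lz u) n) \<le> H / real r ^ (m + wdeg w) * (1 + nm n / real r) ^ b)) \<longrightarrow>
     (\<forall>w\<in>words. length w \<le> P \<longrightarrow> (\<forall>x\<in>Z. (\<forall>j<d. \<bar>x j\<bar> \<le> int (r ^ s j)) \<longrightarrow> cmod (dop w u x) \<le> C * (G + H) / real r ^ wdeg w))"
proof -
  obtain k CE where CE: "1 \<le> CE" "\<And>\<rho> g Y Y' X0 w. 1 \<le> \<rho> \<Longrightarrow> 0 \<le> X0 \<Longrightarrow> (\<And>w. w \<in> words \<Longrightarrow> wdeg w \<le> m \<Longrightarrow> l2b (\<lambda>n. W (Suc b) (real (Suc k) * \<rho>) n * dop w g n) (X0 / \<rho> ^ wdeg w))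
     \<Longrightarrow> l2b (\<lambda>n. W (Suc b) (real (Suc k) * \<rho>) n * g n) Y \<Longrightarrow> l2b (\<lambda>n. W (Suc b) (real (Suc k) * \<rho>) n * Lz g n) Y' \<Longrightarrow>
     w\<in>words \<Longrightarrow> wdeg w \<le> m \<Longrightarrow> l2b (\<lambda>n. W (Suc b) (real (Suc k) * \<rho>) n * dop w g n) (CE * (Y + \<rho> ^ m * Y') / \<rho> ^ wdeg w)"
    using weighted_elliptic[of "Suc b"] by blast
  obtain Cg where Cg: "0 \<le> Cg" "\<And>\<rho> g G. 1 \<le> \<rho> \<Longrightarrow> (\<And>n. n \<in> Z \<Longrightarrow> cmod (g n) \<le> G * (1 + nm n / \<rho>) ^ b) \<Longrightarrow>
     l2b (\<lambda>n. W (Suc b) (real (Suc k) * \<rho>) n * g n) (Cg * G * sqrt (\<rho> ^ S))"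
    using l2b_W_growth[of b k] by blast
  define K0 where "K0 = 1 + Cg"
  \<comment> \<open>The cost per letter: one use of the weighted estimate, with both terms on its
    right bounded by the same quantity.\<close>
  define E where "E = 2 * CE"
  have K0: "1 \<le> K0" "Cg \<le> K0" and E: "1 \<le> E" using Cg CE by (auto simp: K0_def E_def)
  define cW where "cW = ((1 / (3 + real (Suc b))) ^ Suc b) ^ d"
  have cW: "0 < cW" by (simp add: cW_def)
  define K1 where "K1 = K0 * E ^ (P + d)"
  have K1: "0 \<le> K1" using K0 E by (simp add: K1_def)
  show ?thesis
  proof (intro exI[of _ "2 ^ d * K1 / cW"] conjI allI impI ballI)
    show "0 \<le> 2 ^ d * K1 / cW" using K1 cW by simp
    fix r :: nat and u G H w x
    assume A: "1 \<le> r \<and> 0 \<le> G \<and> 0 \<le> H \<and> (\<forall>n\<in>Z. cmod (u n) \<le> G * (1 + nm n / real r) ^ b) \<and>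
     (\<forall>w\<in>words. length w \<le> P + d \<longrightarrow> (\<forall>n\<in>Z. cmod (dop w (Lz u) n) \<le> H / real r ^ (m + wdeg w) * (1 + nm n / real r) ^ b))"
      and w: "w \<in> words" "length w \<le> P" and x: "x \<in> Z" "\<forall>j<d. \<bar>x j\<bar> \<le> int (r ^ s j)"
    define \<rho> where "\<rho> = real r"
    define V where "V = W (Suc b) (real (Suc k) * \<rho>)"
    have \<rho>: "1 \<le> \<rho>" using A by (simp add: \<rho>_def)
    have GH: "0 \<le> G" "0 \<le> H" and gu: "\<And>n. n \<in> Z \<Longrightarrow> cmod (u n) \<le> G * (1 + nm n / \<rho>) ^ b"
      and gL: "\<And>w n. w \<in> words \<Longrightarrow> length w \<le> P + d \<Longrightarrow> n \<in> Z \<Longrightarrow> cmod (dop w (Lz u) n) \<le> H / \<rho> ^ (m + wdeg w) * (1 + nm n / \<rho>) ^ b"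
      using A by (auto simp: \<rho>_def)
    define Q where "Q = (G + H) * sqrt (\<rho> ^ S)"
    have Q: "0 \<le> Q" "G * sqrt (\<rho> ^ S) \<le> Q" "H * sqrt (\<rho> ^ S) \<le> Q"
      using GH \<rho> unfolding Q_def by (auto intro!: mult_right_mono)
    \<comment> \<open>The words may have degree above \<open>m\<close>, so they are treated letter
      by letter: \<open>Lz\<close> commutes with \<open>dop w\<close>, and a single letter has
      degree at most \<open>m\<close> by \<open>s_le_m\<close>.\<close>
    have chain: "l2b (\<lambda>n. V n * dop w u n) (K0 * E ^ length w * Q / \<rho> ^ wdeg w)"
      if "w \<in> words" "length w \<le> P + d" for w
      using that
    proof (induction w)
      case Nil
      have "l2b (\<lambda>n. V n * u n) (Cg * G * sqrt (\<rho> ^ S))" unfolding V_def by (rule Cg(2)[OF \<rho> gu])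
      moreover have "Cg * G * sqrt (\<rho> ^ S) \<le> K0 * Q"
        using Q K0 Cg GH \<rho> unfolding mult.assoc by (intro mult_mono) auto
      ultimately show ?case by (auto intro: l2b_mono)
    next
      case (Cons l w)
      have l: "fst l < d" and w: "w \<in> words" "length w \<le> P + d" using Cons.prems by auto
      let ?g = "dop w u"
      let ?Y = "K0 * E ^ length w * Q / \<rho> ^ wdeg w" and ?Y' = "Cg * (H / \<rho> ^ (m + wdeg w)) * sqrt (\<rho> ^ S)"
      define N where "N = m + (P + d)"
      define X0 where "X0 = Cg * ((2 ^ N * (1 + real N) ^ b) * G) * sqrt (\<rho> ^ S) * \<rho> ^ m"
      have X0: "0 \<le> X0" using Cg GH \<rho> by (simp add: X0_def)
      have "l2b (\<lambda>n. V n * dop [l] ?g n) (CE * (?Y + \<rho> ^ m * ?Y') / \<rho> ^ wdeg [l])"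
        unfolding V_def
      proof (rule CE(2)[OF \<rho> X0])
        fix w' assume w': "w' \<in> words" "wdeg w' \<le> m"
        have ww: "w' @ w \<in> words" "length (w' @ w) \<le> N"
          using w w' length_le_wdeg[OF w'(1)] by (auto simp: N_def)
        have "l2b (\<lambda>n. W (Suc b) (real (Suc k) * \<rho>) n * dop (w' @ w) u n) (Cg * ((2 ^ N * (1 + real N) ^ b) * G) * sqrt (\<rho> ^ S))"
          by (rule Cg(2)[OF \<rho> growth_dop[OF \<rho> gu ww]])
        moreover have "Cg * ((2 ^ N * (1 + real N) ^ b) * G) * sqrt (\<rho> ^ S) \<le> X0 / \<rho> ^ wdeg w'"
        proof -
          have "\<rho> ^ wdeg w' \<le> \<rho> ^ m" using \<rho> w' by (intro power_increasing) auto
          then have "Cg * ((2 ^ N * (1 + real N) ^ b) * G) * sqrt (\<rho> ^ S) * \<rho> ^ wdeg w' \<le> X0"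
            unfolding X0_def using Cg GH \<rho> by (intro mult_left_mono) auto
          then show ?thesis using \<rho> by (simp add: le_divide_eq)
        qed
        ultimately show "l2b (\<lambda>n. W (Suc b) (real (Suc k) * \<rho>) n * dop w' ?g n) (X0 / \<rho> ^ wdeg w')"
          using l2b_mono by simp
      next
        show "l2b (\<lambda>n. W (Suc b) (real (Suc k) * \<rho>) n * ?g n) ?Y" using Cons.IH[OF w] by (simp add: V_def)
        have "Lz ?g = dop w (Lz u)" by (rule TI_comm[OF TI_Lz TI_dop[OF w(1)]])
        then show "l2b (\<lambda>n. W (Suc b) (real (Suc k) * \<rho>) n * Lz ?g n) ?Y'"
          using Cg(2)[OF \<rho> gL[OF w]] by simp
        show "[l] \<in> words" "wdeg [l] \<le> m" using l s_le_m by auto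
      qed
      moreover have "CE * (?Y + \<rho> ^ m * ?Y') / \<rho> ^ wdeg [l] \<le> K0 * E ^ length (l # w) * Q / \<rho> ^ wdeg (l # w)"
      proof -
        have "\<rho> ^ m * ?Y' = Cg * (H * sqrt (\<rho> ^ S)) / \<rho> ^ wdeg w"
          using \<rho> by (simp add: power_add)
        also have "\<dots> \<le> (K0 * E ^ length w) * Q / \<rho> ^ wdeg w"
        proof (intro divide_right_mono mult_mono Q)
          have "K0 * 1 \<le> K0 * E ^ length w" using K0 E by (intro mult_left_mono) auto
          then show "Cg \<le> K0 * E ^ length w" using K0 by linarith
        qed (use GH \<rho> K0 E in auto)
        finally have "?Y + \<rho> ^ m * ?Y' \<le> ?Y + ?Y" by (rule add_left_mono)
        then have "CE * (?Y + \<rho> ^ m * ?Y') \<le> CE * (?Y + ?Y)" by (rule mult_left_mono) (use CE(1) in simp)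
        then have "CE * (?Y + \<rho> ^ m * ?Y') / \<rho> ^ wdeg [l] \<le> CE * (?Y + ?Y) / \<rho> ^ wdeg [l]"
          by (rule divide_right_mono) (use \<rho> in simp)
        also have "\<dots> = K0 * E ^ length (l # w) * Q / \<rho> ^ wdeg (l # w)"
          using \<rho> by (simp add: E_def power_add field_simps)
        finally show ?thesis .
      qed
      ultimately have "l2b (\<lambda>n. V n * dop [l] ?g n) (K0 * E ^ length (l # w) * Q / \<rho> ^ wdeg (l # w))" by (rule l2b_mono)
      then show ?case by simp
    qed
    let ?L = "\<lambda>j. r ^ s j"
    \<comment> \<open>Starting at a corner \<open>x\<close> with coordinates at most
      \<open>r ^ s j\<close>, the box reaches at most twice that size, where the weight is still
      bounded below.\<close>
    define B where "B = {n\<in>Z. \<forall>i<d. x i \<le> n i \<and> n i < x i + int (?L i)}"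
    define K where "K = (K1 * Q / (cW * \<rho> ^ wdeg w))\<^sup>2"
    have \<tau>: "1 \<le> real (Suc k) * \<rho>" using \<rho> mult_mono[of 1 "real (Suc k)" 1 \<rho>] by simp
    have VB: "cW \<le> cmod (V n)" if "n \<in> B" for n
      unfolding V_def cW_def
    proof (rule W_lower[OF \<tau>])
      fix j assume j: "j < d"
      have "\<bar>n j\<bar> \<le> 2 * int (r ^ s j)" using that x(2) j unfolding B_def by fastforce
      then have "real_of_int \<bar>n j\<bar> \<le> real_of_int (2 * int (r ^ s j))" by (simp only: of_int_le_iff)
      then have "\<bar>real_of_int (n j)\<bar> \<le> 2 * \<rho> ^ s j" by (simp add: \<rho>_def)
      also have "\<dots> \<le> 2 * (real (Suc k) * \<rho>) ^ s j"
        using \<rho> by (intro mult_left_mono power_mono) (auto simp: algebra_simps)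
      finally show "\<bar>real_of_int (n j)\<bar> \<le> 2 * (real (Suc k) * \<rho>) ^ s j" .
    qed
    have "(\<Sum>y\<in>{x}. Qf ?L d (dop w u) y) \<le> 2 ^ d * K"
    proof (rule Qf_upper[OF _ _ _ _ B_def])
      show "{x} \<subseteq> B" using x A by (auto simp: B_def)
      fix w' F assume w': "w' \<in> words" "length w' \<le> d" "finite F" "F \<subseteq> B"
      have ww: "w' @ w \<in> words" "length (w' @ w) \<le> P + d" using w w' by auto
      let ?z = "dop (w' @ w) u"
      have "L2_set (\<lambda>n. cmod (V n * ?z n)) F \<le> K0 * E ^ length (w' @ w) * Q / \<rho> ^ wdeg (w' @ w)"
        using chain[OF ww] w' unfolding l2b_def B_def by blast
      also have "\<dots> \<le> K1 * Q / \<rho> ^ wdeg (w' @ w)"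
        unfolding K1_def using ww(2) K0 E Q \<rho> by (intro divide_right_mono mult_right_mono mult_left_mono power_increasing) auto
      finally have 1: "L2_set (\<lambda>n. cmod (V n * ?z n)) F \<le> K1 * Q / \<rho> ^ wdeg (w' @ w)" .
      have "cW * L2_set (\<lambda>n. cmod (?z n)) F = L2_set (\<lambda>n. cW * cmod (?z n)) F"
        using cW by (simp add: L2_set_right_distrib)
      also have "\<dots> \<le> L2_set (\<lambda>n. cmod (V n * ?z n)) F"
        using w' VB cW by (intro L2_set_mono) (auto simp: norm_mult intro!: mult_right_mono)
      finally have "cW * L2_set (\<lambda>n. cmod (?z n)) F \<le> K1 * Q / \<rho> ^ wdeg (w' @ w)" using 1 by simp
      then have "\<rho> ^ wdeg w' * L2_set (\<lambda>n. cmod (?z n)) F \<le> K1 * Q / (cW * \<rho> ^ wdeg w)"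
        using cW \<rho> by (simp add: power_add field_simps)
      then have "(\<rho> ^ wdeg w' * L2_set (\<lambda>n. cmod (?z n)) F)\<^sup>2 \<le> K"
        unfolding K_def using \<rho> by (intro power_mono) auto
      then show "(\<Prod>l\<leftarrow>w'. real (?L (fst l)))\<^sup>2 * (\<Sum>n\<in>F. (cmod (dop w' (dop w u) n))\<^sup>2) \<le> K"
        unfolding words_prod[OF w'(1)] by (simp add: power_mult_distrib L2_set_def sum_nonneg \<rho>_def)
    qed auto
    then have q: "Qf ?L d (dop w u) x \<le> 2 ^ d * K" by simp
    have "\<rho> ^ S = (\<Prod>i<d. real (?L i))" by (simp add: S_def power_sum \<rho>_def)
    then have "\<rho> ^ S * (cmod (dop w u x))\<^sup>2 = (\<Prod>i<d. real (?L i)) * (cmod (dop w u x))\<^sup>2" by (simp only:)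
    also have "\<dots> \<le> 2 ^ d * Qf ?L d (dop w u) x" by (rule Qf_lower)
    also have "\<dots> \<le> 2 ^ d * (2 ^ d * K)" by (rule mult_left_mono[OF q]) simp
    also have "2 ^ d * (2 ^ d * K) = \<rho> ^ S * (2 ^ d * K1 * (G + H) / (cW * \<rho> ^ wdeg w))\<^sup>2"
    proof -
      have "Q\<^sup>2 = (G + H)\<^sup>2 * \<rho> ^ S" using \<rho> by (simp add: Q_def power_mult_distrib)
      then have K: "K = K1\<^sup>2 * ((G + H)\<^sup>2 * \<rho> ^ S) / (cW * \<rho> ^ wdeg w)\<^sup>2"
        by (simp only: K_def power_divide power_mult_distrib[of K1])
      have R: "(2 ^ d * K1 * (G + H) / (cW * \<rho> ^ wdeg w))\<^sup>2 = (2 ^ d)\<^sup>2 * K1\<^sup>2 * (G + H)\<^sup>2 / (cW * \<rho> ^ wdeg w)\<^sup>2"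
        by (simp only: power_divide power_mult_distrib[of _ "G + H"] power_mult_distrib[of _ K1])
      have "t * (t * (k * (g * q) / c)) = q * (t\<^sup>2 * k * g / c)" for t k g q c :: real
        by (simp add: power2_eq_square)
      then show ?thesis unfolding K R by blast
    qed
    finally have "(cmod (dop w u x))\<^sup>2 \<le> (2 ^ d * K1 * (G + H) / (cW * \<rho> ^ wdeg w))\<^sup>2"
      by (rule mult_left_le_imp_le) (use \<rho> in simp)
    then have "cmod (dop w u x) \<le> 2 ^ d * K1 * (G + H) / (cW * \<rho> ^ wdeg w)"
    proof (rule power2_le_imp_le)
      show "0 \<le> 2 ^ d * K1 * (G + H) / (cW * \<rho> ^ wdeg w)" using K1 GH cW \<rho> by simp
    qed
    then show "cmod (dop w u x) \<le> 2 ^ d * K1 / cW * (G + H) / real r ^ wdeg w"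
      by (simp add: \<rho>_def)
  qed
qed

end

context scaled begin

section \<open>Smoothing operators\<close>

text \<open>Polynomial functions of degree less than \<open>k\<close>, as the functions annihilated by any \<open>k\<close> successive differences.\<close>

primrec Pol :: "nat \<Rightarrow> zfun \<Rightarrow> bool" where
  "Pol 0 f \<longleftrightarrow> (\<forall>n\<in>Z. f n = 0)"
| "Pol (Suc k) f \<longleftrightarrow> (\<forall>x\<in>Z. Pol k (\<lambda>n. f (\<lambda>i. n i + x i) - f n))"

lemma Pol_zero: "(\<And>n. n \<in> Z \<Longrightarrow> f n = 0) \<Longrightarrow> Pol k f"
  by (induction k arbitrary: f) auto

lemma Pol_Suc: "Pol k f \<Longrightarrow> Pol (Suc k) f"
  by (induction k arbitrary: f) auto

lemma Pol_mono: "k \<le> l \<Longrightarrow> Pol k f \<Longrightarrow> Pol l f"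
  by (induction l rule: dec_induct) (blast intro: Pol_Suc)+

lemma Pol_add: "Pol k f \<Longrightarrow> Pol k g \<Longrightarrow> Pol k (\<lambda>n. f n + g n)"
proof (induction k arbitrary: f g)
  case (Suc k)
  have "Pol k (\<lambda>n. (f (\<lambda>i. n i + x i) - f n) + (g (\<lambda>i. n i + x i) - g n))" if "x \<in> Z" for x
    using Suc that by auto
  then show ?case by (simp add: algebra_simps)
qed simp

lemma Pol_scale: "Pol k f \<Longrightarrow> Pol k (\<lambda>n. c * f n)"
proof (induction k arbitrary: f)
  case (Suc k)
  have "Pol k (\<lambda>n. c * (f (\<lambda>i. n i + x i) - f n))" if "x \<in> Z" for x
    using Suc that by auto
  then show ?case by (simp add: algebra_simps)
qed simp

lemma Pol_sum: "(\<And>x. x \<in> I \<Longrightarrow> Pol k (f x)) \<Longrightarrow> Pol k (\<lambda>n. \<Sum>x\<in>I. f x n)"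
  by (induction I rule: infinite_finite_induct) (auto intro: Pol_zero Pol_add)

lemma Pol_shift: "Pol k f \<Longrightarrow> x \<in> Z \<Longrightarrow> Pol k (\<lambda>n. f (\<lambda>i. n i + x i))"
proof (induction k arbitrary: f)
  case (Suc k)
  show ?case unfolding Pol.simps
  proof
    fix y assume "y \<in> Z"
    then have "Pol k (\<lambda>n. (\<lambda>n. f (\<lambda>i. n i + y i) - f n) (\<lambda>i. n i + x i))" using Suc by auto
    then show "Pol k (\<lambda>n. f (\<lambda>i. n i + y i + x i) - f (\<lambda>i. n i + x i))" by (simp add: algebra_simps)
  qed
qed simp

lemma Pol_TI: "TI T \<Longrightarrow> Pol k f \<Longrightarrow> Pol k (T f)"
  by (induction T arbitrary: f rule: TI.induct) (auto intro: Pol_shift Pol_add Pol_scale)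

lemma Pol_const: "Pol (Suc 0) (\<lambda>n. c)"
  by simp

text \<open>The difference of a product is a difference of \<open>f\<close> times a translate of
  \<open>g\<close> plus \<open>f\<close> times a difference of \<open>g\<close>. Each lowers one of
  the two degrees, or vanishes if that degree was 0.\<close>

lemma Pol_mult: "Pol (Suc a) f \<Longrightarrow> Pol (Suc b) g \<Longrightarrow> Pol (Suc (a + b)) (\<lambda>n. f n * g n)"
proof (induction "a + b" arbitrary: a b f g rule: less_induct)
  case less
  show ?case unfolding Pol.simps(2)[of "a + b"]
  proof
    fix x assume x: "x \<in> Z"
    let ?sh = "\<lambda>n i. n i + x i"
    let ?df = "\<lambda>n. f (?sh n) - f n" and ?dg = "\<lambda>n. g (?sh n) - g n"
    have 1: "Pol (a + b) (\<lambda>n. ?df n * g (?sh n))"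
    proof (cases a)
      case 0
      then have "\<And>n. n \<in> Z \<Longrightarrow> ?df n = 0" using less.prems(1) x by simp
      then show ?thesis by (intro Pol_zero) simp
    next
      case (Suc a')
      have "Pol (Suc (a' + b)) (\<lambda>n. ?df n * g (?sh n))"
        using less.prems x Suc by (intro less.hyps Pol_shift[of "Suc b" g]) auto
      then show ?thesis using Suc by simp
    qed
    have 2: "Pol (a + b) (\<lambda>n. f n * ?dg n)"
    proof (cases b)
      case 0
      then have "\<And>n. n \<in> Z \<Longrightarrow> ?dg n = 0" using less.prems(2) x by simp
      then show ?thesis by (intro Pol_zero) simp
    next
      case (Suc b')
      have "Pol (Suc (a + b')) (\<lambda>n. f n * ?dg n)"
        using less.prems x Suc by (intro less.hyps) auto
      then show ?thesis using Suc by simp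
    qed
    show "Pol (a + b) (\<lambda>n. f (?sh n) * g (?sh n) - f n * g n)"
      using Pol_add[OF 1 2] by (simp add: algebra_simps)
  qed
qed

lemma Pol_coord: "Pol (Suc (Suc 0)) (\<lambda>n. of_real (c + e * real_of_int (n i)))"
proof -
  have "of_real (c + e * real_of_int (n i + x i)) - of_real (c + e * real_of_int (n i)) = (of_real (e * real_of_int (x i)) :: complex)"
    for n x :: "nat \<Rightarrow> int"
    unfolding of_real_diff[symmetric] by (simp add: distrib_left)
  then show ?thesis by (simp only: Pol.simps) simp
qed

lemma Pol_power: "Pol (Suc (Suc 0)) f \<Longrightarrow> Pol (Suc k) (\<lambda>n. f n ^ k)"
proof (induction k)
  case 0 then show ?case using Pol_const[of 1] by simp
next
  case (Suc k)
  then show ?case using Pol_mult[of "Suc 0" f k "\<lambda>n. f n ^ k"] by simp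
qed

lemma Pol_prod_power: "(\<And>j. j < (l::nat) \<Longrightarrow> Pol (Suc (Suc 0)) (f j)) \<Longrightarrow> Pol (Suc (\<Sum>j<l. \<beta> j)) (\<lambda>n. \<Prod>j<l. f j n ^ \<beta> j)"
proof (induction l)
  case 0 then show ?case using Pol_const[of 1] by simp
next
  case (Suc l)
  then show ?case using Pol_mult[OF Suc.IH Pol_power[of "f l" "\<beta> l"]] by simp
qed

text \<open>Averaging operators differ from the identity by an operator lowering the degree of polynomials.\<close>

definition aff :: "(zfun \<Rightarrow> zfun) \<Rightarrow> bool" where
  "aff T \<longleftrightarrow> TI T \<and> (\<forall>k f. Pol (Suc k) f \<longrightarrow> Pol k (\<lambda>n. f n - T f n))"

lemma aff_TI: "aff A \<Longrightarrow> TI A"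
  by (simp only: aff_def)

lemma aff_id: "aff (\<lambda>u. u)"
  unfolding aff_def
proof (intro conjI allI impI TI_id)
  show "Pol k (\<lambda>n. f n - f n)" for k f by (rule Pol_zero) simp
qed

text \<open>\<open>f - A (B f)\<close> is \<open>f - B f\<close> plus the same expression for
  \<open>A\<close> at \<open>B f\<close>, and \<open>B\<close> does not raise degrees.\<close>

lemma aff_comp: assumes "aff A" "aff B" shows "aff (\<lambda>u. A (B u))"
  unfolding aff_def
proof (intro conjI allI impI)
  have T: "TI A" "TI B" using assms by (simp_all only: aff_def)
  have P: "Pol (Suc k) f \<Longrightarrow> Pol k (\<lambda>n. f n - A f n)" "Pol (Suc k) f \<Longrightarrow> Pol k (\<lambda>n. f n - B f n)" for k f
    using assms unfolding aff_def by blast+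
  show "TI (\<lambda>u. A (B u))" by (rule TI.comp[OF T])
  fix k f assume f: "Pol (Suc k) f"
  have "Pol (Suc k) (B f)" by (rule Pol_TI[OF T(2) f])
  then have "Pol k (\<lambda>n. (f n - B f n) + (B f n - A (B f) n))"
    by (intro Pol_add P f)
  then show "Pol k (\<lambda>n. f n - A (B f) n)" by simp
qed

lemma aff_foldr: "(\<And>x. x \<in> set xs \<Longrightarrow> aff (f x)) \<Longrightarrow> aff (foldr f xs)"
proof (induction xs)
  case Nil then show ?case using aff_id by (simp add: id_def)
next
  case (Cons a xs) then show ?case using aff_comp[of "f a" "foldr f xs"] by (simp add: comp_def)
qed

lemma aff_funpow: "aff A \<Longrightarrow> aff (A ^^ k)"
proof (induction k)
  case 0 then show ?case using aff_id by (simp add: id_def)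
next
  case (Suc k) then show ?case using aff_comp[of A "A ^^ k"] by (simp add: comp_def)
qed

text \<open>The weights sum to 1, so \<open>f - T f\<close> is a combination of differences of
  \<open>f\<close>, each of lower degree.\<close>

lemma convex_comb:
  assumes "finite I" "\<And>i. i \<in> I \<Longrightarrow> x i \<in> Z" "\<And>i. i \<in> I \<Longrightarrow> 0 \<le> c i" "(\<Sum>i\<in>I. c i) = (1::real)"
    "\<And>i. i \<in> I \<Longrightarrow> nm (x i) \<le> R" "0 \<le> R"
  shows "aff (\<lambda>u n. \<Sum>i\<in>I. of_real (c i) * u (\<lambda>j. n j + x i j))" (is "aff ?T") and
    "avgc 1 R (\<lambda>u n. \<Sum>i\<in>I. of_real (c i) * u (\<lambda>j. n j + x i j))"
proof -
  show "aff ?T" unfolding aff_def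
  proof (intro conjI allI impI)
    show "TI ?T" by (intro TI_sum TI.scale TI.shift assms)
    fix k f assume f: "Pol (Suc k) f"
    have "Pol k (\<lambda>n. \<Sum>i\<in>I. (- of_real (c i)) * (f (\<lambda>j. n j + x i j) - f n))"
      using f assms(2) by (intro Pol_sum Pol_scale) auto
    moreover have "(\<Sum>i\<in>I. (- of_real (c i)) * (f (\<lambda>j. n j + x i j) - f n)) = f n - (\<Sum>i\<in>I. of_real (c i) * f (\<lambda>j. n j + x i j))" for n
    proof -
      have "(\<Sum>i\<in>I. of_real (c i) * f n) = of_real (\<Sum>i\<in>I. c i) * f n" by (simp add: sum_distrib_right)
      then show ?thesis by (simp add: algebra_simps sum_subtractf assms(4))
    qed
    ultimately show "Pol k (\<lambda>n. f n - (\<Sum>i\<in>I. of_real (c i) * f (\<lambda>j. n j + x i j)))" by simp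
  qed
  have "avgc (\<Sum>i\<in>I. cmod (of_real (c i)) * 1) R ?T"
    using assms by (intro avgc_sum avgc_scale avgc_shift) auto
  moreover have "(\<Sum>i\<in>I. cmod (of_real (c i)) * 1) = 1" using assms by simp
  ultimately show "avgc 1 R ?T" by simp
qed

lemma Pol_kill:
  assumes "aff A" shows "Pol k f \<Longrightarrow> n \<in> Z \<Longrightarrow> ((\<lambda>u n. u n - A u n) ^^ k) f n = 0"
proof (induction k arbitrary: f)
  case (Suc k)
  have "Pol k (\<lambda>n. f n - A f n)" using assms Suc.prems unfolding aff_def by blast
  from Suc.IH[OF this Suc.prems(2)] show ?case by (simp only: funpow_Suc_right comp_def)
qed auto

section \<open>Box averages, which trade a difference for a negative power of the scale\<close>

definition bx :: "nat \<Rightarrow> nat \<Rightarrow> zfun \<Rightarrow> zfun" where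
  "bx j l u n = (\<Sum>i<l. of_real (1 / real l) * u (n(j := n j + int i)))"

lemma bx_props:
  assumes "j < d" "1 \<le> h"
  shows "aff (bx j (h ^ s j))" "avgc 1 (real h) (bx j (h ^ s j))"
    "avgc (2 / real h ^ s j) (real h) (\<lambda>u. df j (bx j (h ^ s j) u))"
proof -
  let ?l = "h ^ s j"
  let ?x = "\<lambda>i. (\<lambda>_. 0 :: int)(j := int i)"
  have l: "0 < ?l" using assms by simp
  have eq: "(\<lambda>k. n k + ?x i k) = n(j := n j + int i)" for n :: "nat \<Rightarrow> int" and i by auto
  have bxe: "bx j ?l = (\<lambda>u n. \<Sum>i<?l. of_real (1 / real ?l) * u (\<lambda>k. n k + ?x i k))"
    unfolding bx_def[abs_def] eq ..
  have nm: "nm (?x i) \<le> real h" if "i \<in> {..<?l}" for i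
  proof -
    have "nm (\<lambda>k. ((\<lambda>_. 0)(j := (\<lambda>_. 0 :: int) j + int i)) k - (\<lambda>_. 0 :: int) k) \<le> real h"
      using that assms by (intro nm_upd_le) (auto simp flip: of_nat_power simp: less_imp_le)
    moreover have "(\<lambda>k. ((\<lambda>_. 0)(j := (\<lambda>_. 0 :: int) j + int i)) k - (\<lambda>_. 0 :: int) k) = ?x i" by auto
    ultimately show ?thesis by (simp only:)
  qed
  have cc: "finite {..<?l}" "\<And>i. i \<in> {..<?l} \<Longrightarrow> ?x i \<in> Z" "\<And>i. i \<in> {..<?l} \<Longrightarrow> 0 \<le> 1 / real ?l" "(\<Sum>i<?l. 1 / real ?l) = 1" "0 \<le> real h"
    using assms l by auto
  show "aff (bx j ?l)" unfolding bxe by (rule convex_comb(1)[OF cc(1-4) nm cc(5)])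
  show "avgc 1 (real h) (bx j ?l)" unfolding bxe by (rule convex_comb(2)[OF cc(1-4) nm cc(5)])
  \<comment> \<open>The difference of a moving average telescopes to its two end points, each with
    weight \<open>1 / ?l\<close>.\<close>
  have tel: "df j (bx j ?l u) n = of_real (1 / real ?l) * u (n(j := n j + int ?l)) - of_real (1 / real ?l) * u n" for u n
  proof -
    let ?f = "\<lambda>i. u (n(j := n j + int i))"
    have "df j (bx j ?l u) n = of_real (1 / real ?l) * (\<Sum>i<?l. ?f (Suc i) - ?f i)"
      unfolding df_def bx_def by (simp add: sum_distrib_left sum_subtractf right_diff_distrib add.assoc)
    also have "(\<Sum>i<?l. ?f (Suc i) - ?f i) = ?f ?l - ?f 0" by (rule sum_lessThan_telescope)
    finally show ?thesis by (simp add: right_diff_distrib)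
  qed
  have "avgc (cmod (of_real (1 / real ?l)) * 1 + cmod (of_real (1 / real ?l)) * 1) (real h)
     (\<lambda>u n. of_real (1 / real ?l) * u (n(j := n j + int ?l)) - of_real (1 / real ?l) * u n)"
    using assms by (intro avgc_diff avgc_scale avgc_upd avgc_id) auto
  then show "avgc (2 / real h ^ s j) (real h) (\<lambda>u. df j (bx j ?l u))"
    unfolding tel[abs_def] by (simp add: norm_divide norm_power)
qed

definition bxs :: "nat \<Rightarrow> zfun \<Rightarrow> zfun" where
  "bxs h = foldr (\<lambda>j. bx j (h ^ s j)) [0..<d]"

lemma bxs_props:
  assumes "1 \<le> h"
  shows "aff (bxs h)" "avgc 1 (real d * real h) (bxs h)"
    "fst l < d \<Longrightarrow> avgc (2 / real h ^ s (fst l)) ((real d + 1) * real h) (\<lambda>u. dl l (bxs h u))"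
proof -
  show "aff (bxs h)" unfolding bxs_def using assms by (intro aff_foldr bx_props) auto
  show "avgc 1 (real d * real h) (bxs h)"
    using avgc_foldr[of "[0..<d]" "real h" "\<lambda>j. bx j (h ^ s j)"] bx_props(2)[OF _ assms] unfolding bxs_def by simp
  assume l: "fst l < d"
  \<comment> \<open>The difference commutes past the averages in other directions until it meets the
    one in its own direction.\<close>
  have main: "avgc (2 / real h ^ s j) (real (length xs) * real h) (\<lambda>u. df j (foldr (\<lambda>j. bx j (h ^ s j)) xs u))"
    if "j \<in> set xs" "set xs \<subseteq> {..<d}" for j xs
    using that
  proof (induction xs)
    case (Cons a xs)
    have a: "a < d" using Cons by simp
    have tail: "avgc 1 (real (length xs) * real h) (foldr (\<lambda>j. bx j (h ^ s j)) xs)"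
      using Cons.prems by (intro avgc_foldr bx_props(2) assms) auto
    show ?case
    proof (cases "a = j")
      case True
      have "avgc (2 / real h ^ s j * 1) (real h + real (length xs) * real h) (\<lambda>u. df j (bx j (h ^ s j) (foldr (\<lambda>j. bx j (h ^ s j)) xs u)))"
        using avgc_comp[OF bx_props(3)[OF a assms] tail] True by simp
      then show ?thesis using True by (simp add: distrib_right)
    next
      case False
      have j: "j < d" using Cons.prems by auto
      have IH: "avgc (2 / real h ^ s j) (real (length xs) * real h) (\<lambda>u. df j (foldr (\<lambda>j. bx j (h ^ s j)) xs u))"
        using Cons False by auto
      have "avgc (1 * (2 / real h ^ s j)) (real h + real (length xs) * real h) (\<lambda>u. bx a (h ^ s a) (df j (foldr (\<lambda>j. bx j (h ^ s j)) xs u)))"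
        by (rule avgc_comp[OF bx_props(2)[OF a assms] IH])
      moreover have "bx a (h ^ s a) (df j v) = df j (bx a (h ^ s a) v)" for v
        using bx_props(1)[OF a assms] TI_df[OF j] unfolding aff_def by (intro TI_comm) auto
      ultimately show ?thesis by (simp add: distrib_right)
    qed
  qed simp
  have m: "avgc (2 / real h ^ s (fst l)) (real d * real h) (\<lambda>u. df (fst l) (bxs h u))"
    using main[of "fst l" "[0..<d]"] l by (simp add: bxs_def atLeast0LessThan)
  show "avgc (2 / real h ^ s (fst l)) ((real d + 1) * real h) (\<lambda>u. dl l (bxs h u))"
  proof (cases "snd l")
    case True
    have "avgc (2 / real h ^ s (fst l)) ((real d + 1) * real h) (\<lambda>u. df (fst l) (bxs h u))"
      by (rule avgc_mono[OF m]) (auto simp: distrib_right)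
    then show ?thesis using True by (simp add: dl_def)
  next
    \<comment> \<open>A backward difference is the forward one translated by one point; this is the
      reason for \<open>d + 1\<close> in the radius.\<close>
    case False
    have sh: "avgc 1 (real h) (\<lambda>u n. u (n(fst l := n (fst l) + (-1))))"
      using assms by (intro avgc_upd l) auto
    have "avgc (1 * (2 / real h ^ s (fst l))) (real h + real d * real h) (\<lambda>u n. df (fst l) (bxs h u) (n(fst l := n (fst l) + (-1))))"
      by (rule avgc_comp[OF sh m])
    then show ?thesis using False by (simp add: dl_def db_def[abs_def] df_def distrib_right add.commute)
  qed
qed

text \<open>Each of the \<open>p\<close> averages absorbs one letter of the word, so up to
  \<open>p\<close> differences may be taken.\<close>

lemma dop_bxs:
  assumes "1 \<le> h"
  shows "w \<in> words \<Longrightarrow> length w \<le> p \<Longrightarrow> avgc (2 ^ length w / real h ^ wdeg w) (real p * ((real d + 1) * real h)) (\<lambda>u. dop w ((bxs h ^^ p) u))"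
proof (induction p arbitrary: w)
  case 0
  then show ?case using avgc_id[of 0] by simp
next
  case (Suc p)
  have TB: "TI (bxs h)" using bxs_props(1)[OF assms] by (simp add: aff_def)
  show ?case
  proof (cases w)
    case Nil
    have "avgc (1 ^ Suc p) (real (Suc p) * (real d * real h)) (bxs h ^^ Suc p)"
      by (rule avgc_funpow[OF bxs_props(2)[OF assms]])
    then have "avgc 1 (real (Suc p) * ((real d + 1) * real h)) (bxs h ^^ Suc p)"
      by (rule avgc_mono) (auto intro!: mult_mono)
    then show ?thesis using Nil by (simp add: comp_def)
  next
    case (Cons l w')
    have l: "fst l < d" and w': "w' \<in> words" "length w' \<le> p" using Suc.prems Cons by auto
    have eq: "dop w ((bxs h ^^ Suc p) u) = dl l (bxs h (dop w' ((bxs h ^^ p) u)))" for u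
      using TI_comm[OF TI_dop[OF w'(1)] TB] by (simp add: Cons)
    have "avgc (2 / real h ^ s (fst l) * (2 ^ length w' / real h ^ wdeg w')) ((real d + 1) * real h + real p * ((real d + 1) * real h))
       (\<lambda>u. dl l (bxs h (dop w' ((bxs h ^^ p) u))))"
      by (rule avgc_comp[OF bxs_props(3)[OF assms l] Suc.IH[OF w']])
    then show ?thesis unfolding eq by (simp add: Cons power_add distrib_right)
  qed
qed

lemma bxs_1: "bxs 1 u = u"
proof -
  have "foldr (\<lambda>j. bx j (1 ^ s j)) xs u = u" for xs
    by (induction xs) (auto simp: bx_def)
  then show ?thesis by (simp add: bxs_def)
qed

end

section \<open>Test functions\<close>

text \<open>A class closed under differentiation that contains the standard flat function, so that
  all its derivatives are available explicitly.\<close>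

definition expf :: "real poly \<Rightarrow> real \<Rightarrow> real" where
  "expf p t = (if 0 < t then poly p (inverse t) * exp (- inverse t) else 0)"

lemma poly_exp_lim: "((\<lambda>x. poly q x * exp (- x)) \<longlongrightarrow> (0::real)) at_top"
proof -
  have "((\<lambda>x. \<Sum>i\<le>degree q. coeff q i * (x ^ i / exp x)) \<longlongrightarrow> (\<Sum>i\<le>degree q. coeff q i * 0)) at_top"
    by (intro tendsto_intros tendsto_power_div_exp_0)
  then show ?thesis
    by (simp add: poly_altdef sum_distrib_right exp_minus divide_inverse mult.assoc)
qed

lemma expf_deriv: "(expf p has_real_derivative expf (monom 1 2 * (p - pderiv p)) t) (at t)"
proof -
  consider "t < 0" | "0 < t" | "t = 0" by linarith
  then show ?thesis
  proof cases
    case 1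
    have "((\<lambda>_. 0) has_real_derivative 0) (at t)" by simp
    then have "(expf p has_real_derivative 0) (at t)"
      by (rule has_field_derivative_transform_within_open[of _ _ _ "{..<0}"]) (use 1 in \<open>auto simp: expf_def\<close>)
    then show ?thesis using 1 by (simp add: expf_def)
  next
    case 2
    have "((\<lambda>t. poly p (inverse t) * exp (- inverse t)) has_real_derivative
       poly (monom 1 2 * (p - pderiv p)) (inverse t) * exp (- inverse t)) (at t)"
      using 2 by (auto intro!: derivative_eq_intros DERIV_chain2[OF poly_DERIV] simp: poly_monom power2_eq_square algebra_simps)
    then have "(expf p has_real_derivative poly (monom 1 2 * (p - pderiv p)) (inverse t) * exp (- inverse t)) (at t)"
      by (rule has_field_derivative_transform_within_open[of _ _ _ "{0<..}"]) (use 2 in \<open>auto simp: expf_def\<close>)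
    then show ?thesis using 2 by (simp add: expf_def)
  next
    \<comment> \<open>At 0 the difference quotient from the right is a polynomial in
      \<open>1/h\<close> times \<open>exp (- 1/h)\<close>, and the exponential wins.\<close>
    case 3
    have "((\<lambda>h. (expf p (0 + h) - expf p 0) / h) \<longlongrightarrow> 0) (at 0)"
    proof (rule filterlim_split_at)
      show "((\<lambda>h. (expf p (0 + h) - expf p 0) / h) \<longlongrightarrow> 0) (at_left 0)"
        by (rule tendsto_eventually) (auto simp: eventually_at_left_field expf_def intro!: exI[of _ "-1"])
      have "((\<lambda>h. poly (p * monom 1 1) (inverse h) * exp (- inverse h)) \<longlongrightarrow> 0) (at_right 0)"
        by (rule filterlim_compose[OF poly_exp_lim filterlim_inverse_at_top_right])
      then show "((\<lambda>h. (expf p (0 + h) - expf p 0) / h) \<longlongrightarrow> 0) (at_right 0)"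
        by (rule Lim_transform_eventually)
           (auto simp: eventually_at_right_field expf_def poly_monom field_simps intro!: exI[of _ 1])
    qed
    then show ?thesis using 3 by (simp add: DERIV_def expf_def)
  qed
qed

lemma iterated_deriv_expf:
  "\<exists>F :: nat \<Rightarrow> real \<Rightarrow> real. (\<forall>t. F 0 t = (if 0 < t then exp (- inverse t) else 0)) \<and> (\<forall>k t. (F k has_real_derivative F (Suc k) t) (at t)) \<and> (\<forall>k t. t \<le> 0 \<longrightarrow> F k t = 0)"
proof -
  define P where "P = rec_nat (1 :: real poly) (\<lambda>_ p. monom 1 2 * (p - pderiv p))"
  have P: "P 0 = 1" "P (Suc k) = monom 1 2 * (P k - pderiv (P k))" for k by (simp_all add: P_def)
  show ?thesis
    by (rule exI[of _ "\<lambda>k. expf (P k)"]) (auto simp: expf_deriv P(2), auto simp: expf_def P(1))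
qed

text \<open>Leibniz without binomial coefficients: a derivative is a list of pairs of orders, and
  differentiation replaces each pair by its two successors. The last clause carries the supports
  over to the product.\<close>

lemma iterated_deriv_mult:
  fixes F H :: "nat \<Rightarrow> real \<Rightarrow> real"
  assumes "\<And>k t. (F k has_real_derivative F (Suc k) t) (at t)" "\<And>k t. (H k has_real_derivative H (Suc k) t) (at t)"
  shows "\<exists>G :: nat \<Rightarrow> real \<Rightarrow> real. (\<forall>t. G 0 t = F 0 t * H 0 t) \<and> (\<forall>k t. (G k has_real_derivative G (Suc k) t) (at t)) \<and>
    (\<forall>k t. (\<forall>i. F i t = 0) \<or> (\<forall>i. H i t = 0) \<longrightarrow> G k t = 0)"
proof -
  define st where "st xs = concat (map (\<lambda>p. [(Suc (fst p), snd p), (fst p, Suc (snd p))]) xs)" for xs :: "(nat \<times> nat) list"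
  define X where "X = rec_nat [(0, 0)] (\<lambda>_. st)"
  have X: "X 0 = [(0,0)]" "X (Suc k) = st (X k)" for k by (simp_all add: X_def)
  define V where "V xs t = (\<Sum>p\<leftarrow>xs. F (fst p) t * H (snd p) t)" for xs t
  have D: "(V xs has_real_derivative V (st xs) t) (at t)" for xs t
  proof (induction xs)
    case Nil
    show ?case by (simp add: V_def[abs_def] st_def)
  next
    case (Cons p xs)
    have "((\<lambda>t. F (fst p) t * H (snd p) t + V xs t) has_real_derivative
       F (Suc (fst p)) t * H (snd p) t + H (Suc (snd p)) t * F (fst p) t + V (st xs) t) (at t)"
      by (intro DERIV_add DERIV_mult assms Cons)
    then show ?case by (simp add: V_def[abs_def] st_def algebra_simps)
  qed
  have 0: "V xs t = 0" if "(\<forall>i. F i t = 0) \<or> (\<forall>i. H i t = 0)" for xs t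
    using that unfolding V_def by (induction xs) auto
  show ?thesis
    by (rule exI[of _ "\<lambda>k. V (X k)"]) (use D 0 in \<open>auto simp: X V_def[of "[(0,0)]"]\<close>)
qed

lemma bump_exists:
  fixes c :: real
  assumes "0 < c"
  shows "\<exists>D b. 0 < b \<and> (\<forall>k t. (D k has_real_derivative D (Suc k) t) (at t)) \<and> (\<forall>k t. c \<le> \<bar>t\<bar> \<longrightarrow> D k t = 0) \<and> (\<forall>t. 0 \<le> D 0 t)
    \<and> (\<forall>t. \<bar>t\<bar> \<le> c / 2 \<longrightarrow> b \<le> D (0::nat) t) \<and> (\<forall>k. \<exists>C. \<forall>t. \<bar>D k t\<bar> \<le> C)"
proof -
  obtain F :: "nat \<Rightarrow> real \<Rightarrow> real" where F: "\<And>t. F 0 t = (if 0 < t then exp (- inverse t) else 0)"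
    "\<And>k t. (F k has_real_derivative F (Suc k) t) (at t)" "\<And>k t. t \<le> 0 \<Longrightarrow> F k t = 0"
    using iterated_deriv_expf by blast
  \<comment> \<open>The bump is the product of the flat function read from the two end points of its
    support.\<close>
  define A where "A k t = F k (t + c)" for k t
  define B where "B k t = (-1) ^ k * F k (c - t)" for k t
  have "(A k has_real_derivative A (Suc k) t) (at t)" for k t
    unfolding A_def[abs_def] by (rule DERIV_shift[THEN iffD1, OF F(2)])
  moreover have "(B k has_real_derivative B (Suc k) t) (at t)" for k t
    unfolding B_def[abs_def] by (auto intro!: derivative_eq_intros DERIV_chain2[OF F(2)])
  ultimately obtain D :: "nat \<Rightarrow> real \<Rightarrow> real" where D: "\<And>t. D 0 t = A 0 t * B 0 t" "\<And>k t. (D k has_real_derivative D (Suc k) t) (at t)"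
    "\<And>k t. (\<forall>i. A i t = 0) \<or> (\<forall>i. B i t = 0) \<Longrightarrow> D k t = 0"
    using iterated_deriv_mult[of A B] by blast
  have z: "D k t = 0" if "c \<le> \<bar>t\<bar>" for k t
  proof (rule D(3))
    show "(\<forall>i. A i t = 0) \<or> (\<forall>i. B i t = 0)"
      using that assms F(3) by (cases "0 \<le> t") (auto simp: A_def B_def)
  qed
  have cont: "continuous_on T (D k)" for k T
    using D(2) by (meson DERIV_isCont continuous_at_imp_continuous_on)
  have pos: "0 < D 0 t" if "\<bar>t\<bar> \<le> c / 2" for t
    using that assms by (auto simp: D(1) A_def B_def F(1) abs_le_iff)
  have "compact {- (c/2)..c/2}" "{- (c/2)..c/2} \<noteq> {}" using assms by auto
  then obtain t0 where t0: "t0 \<in> {- (c/2)..c/2}" "\<And>t. t \<in> {- (c/2)..c/2} \<Longrightarrow> D 0 t0 \<le> D 0 t"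
    using continuous_attains_inf[OF _ _ cont] by metis
  have bd: "\<exists>C. \<forall>t. \<bar>D k t\<bar> \<le> C" for k
  proof -
    have "compact (D k ` {-c..c})" by (intro compact_continuous_image cont compact_Icc)
    then have "bounded (D k ` {-c..c})" by (rule compact_imp_bounded)
    then obtain C where "\<forall>x\<in>D k ` {-c..c}. norm x \<le> C" unfolding bounded_iff by blast
    then have C: "\<bar>D k t\<bar> \<le> C" if "t \<in> {-c..c}" for t using that by fastforce
    have "0 \<le> \<bar>D k 0\<bar>" by simp
    also have "\<dots> \<le> C" using assms by (intro C) auto
    finally have "0 \<le> C" .
    have "\<bar>D k t\<bar> \<le> C" for t
    proof (cases "c \<le> \<bar>t\<bar>")
      case False
      then have "t \<in> {-c..c}" by auto
      then show ?thesis by (rule C)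
    qed (use z \<open>0 \<le> C\<close> in simp)
    then show ?thesis by blast
  qed
  have a: "0 < D 0 t0" using t0(1) by (intro pos) auto
  have b: "0 \<le> D 0 t" for t by (simp add: D(1) A_def B_def F(1))
  have c: "D 0 t0 \<le> D 0 t" if "\<bar>t\<bar> \<le> c / 2" for t using that by (intro t0(2)) (auto simp: abs_le_iff)
  show ?thesis
    by (rule exI[of _ D], rule exI[of _ "D 0 t0"]) (use a b c D(2) bd z in blast)
qed

text \<open>A product of one-variable functions with all its partial derivatives:
  \<open>G j k\<close> is the \<open>k\<close>-th derivative of the \<open>j\<close>-th factor, and
  \<open>\<beta>\<close> selects the orders.\<close>

definition PF :: "nat \<Rightarrow> real \<Rightarrow> (nat \<Rightarrow> nat \<Rightarrow> real \<Rightarrow> real) \<Rightarrow> (nat \<Rightarrow> nat) \<Rightarrow> (nat \<Rightarrow> real) \<Rightarrow> real" where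
  "PF d c G \<beta> y = c * (\<Prod>j<d. G j (\<beta> j) (y j))"

locale deriv_family =
  fixes d :: nat and G :: "nat \<Rightarrow> nat \<Rightarrow> real \<Rightarrow> real"
  assumes G: "j < d \<Longrightarrow> (G j k has_real_derivative G j (Suc k) t) (at t)"
begin

lemma PF_deriv:
  assumes "j < d"
  shows "((\<lambda>t. PF d c G \<beta> (x(j := x j + t))) has_real_derivative PF d c G (\<beta>(j := Suc (\<beta> j))) x) (at 0)"
proof -
  let ?R = "\<Prod>i\<in>{..<d} - {j}. G i (\<beta> i) (x i)"
  have 1: "PF d c G \<beta> (x(j := x j + t)) = c * (G j (\<beta> j) (t + x j) * ?R)" for t
    unfolding PF_def using assms by (subst prod.remove[of _ j]) (auto intro!: prod.cong simp: add.commute)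
  have 2: "PF d c G (\<beta>(j := Suc (\<beta> j))) x = c * (G j (Suc (\<beta> j)) (x j) * ?R)"
    unfolding PF_def using assms by (subst prod.remove[of _ j]) (auto intro!: prod.cong)
  have "((\<lambda>t. G j (\<beta> j) (t + x j)) has_real_derivative G j (Suc (\<beta> j)) (x j)) (at 0)"
    using DERIV_shift[of "G j (\<beta> j)" _ 0 "x j"] G[OF assms, of "\<beta> j" "x j"] by simp
  from DERIV_cmult[OF DERIV_cmult_right[OF this, of ?R], of c] show ?thesis unfolding 1 2 .
qed

lemma pd_PF: "j < d \<Longrightarrow> pd j (PF d c G \<beta>) = PF d c G (\<beta>(j := Suc (\<beta> j)))"
  unfolding pd_def by (intro ext DERIV_imp_deriv PF_deriv)

lemma pd_pow_PF: "j < d \<Longrightarrow> (pd j ^^ k) (PF d c G \<beta>) = PF d c G (\<beta>(j := \<beta> j + k))"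
  by (induction k) (auto simp: pd_PF)

lemma pdiff_PF: "pdiff d \<gamma> (PF d c G (\<lambda>_. 0)) = PF d c G \<gamma>"
proof -
  have "foldr (\<lambda>j g. (pd j ^^ \<gamma> j) g) xs (PF d c G (\<lambda>_. 0)) = PF d c G (\<lambda>i. if i \<in> set xs then \<gamma> i else 0)"
    if "set xs \<subseteq> {..<d}" "distinct xs" for xs
    using that
  proof (induction xs)
    case (Cons j xs)
    have eq: "(\<lambda>i. if i \<in> set xs then \<gamma> i else 0)(j := \<gamma> j) = (\<lambda>i. if i \<in> set (j # xs) then \<gamma> i else 0)"
      by auto
    show ?case using Cons by (simp add: pd_pow_PF eq)
  qed simp
  from this[of "[0..<d]"] have "pdiff d \<gamma> (PF d c G (\<lambda>_. 0)) = PF d c G (\<lambda>i. if i < d then \<gamma> i else 0)"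
    by (simp add: pdiff_def atLeast0LessThan)
  also have "\<dots> = PF d c G \<gamma>" by (auto simp: PF_def fun_eq_iff intro!: prod.cong)
  finally show ?thesis .
qed

lemma smooth_PF: "smooth_Rd d (PF d c G (\<lambda>_. 0))"
  unfolding smooth_Rd_def pdiff_PF
proof (intro ballI conjI allI impI)
  fix \<beta>
  have "continuous_on (Rd d) (\<lambda>y. G j (\<beta> j) (y j))" if "j < d" for j
  proof (rule continuous_on_compose2[of UNIV "G j (\<beta> j)" "Rd d" "\<lambda>y. y j"])
    show "continuous_on UNIV (G j (\<beta> j))"
      using G[OF that] by (meson DERIV_isCont continuous_at_imp_continuous_on)
    show "continuous_on (Rd d) (\<lambda>y. y j)"
      by (rule continuous_on_subset[OF continuous_on_product_coordinates]) simp
  qed simp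
  then show "continuous_on (Rd d) (PF d c G \<beta>)"
    unfolding PF_def[abs_def] by (intro continuous_on_mult continuous_on_const continuous_on_prod) simp
  fix j x assume "j < d"
  from PF_deriv[OF this] show "(\<lambda>t. PF d c G \<beta> (x(j := x j + t))) differentiable at 0"
    unfolding real_differentiable_def by blast
qed

end

context scaled begin

text \<open>A function supported in the cube of side \<open>csup\<close> is supported in the ball of radius \<open>1/2\<close> for the scaled distance;
  moreover \<open>csup < 1\<close>, so at scale \<open>1\<close> the bump only sees the origin.\<close>

definition csup :: real where "csup = (1 / (2 * real d)) ^ S"

lemma csup: "0 < csup" "csup \<le> 1 / 2" "j < d \<Longrightarrow> 0 \<le> t \<Longrightarrow> t \<le> csup \<Longrightarrow> t powr (1 / real (s j)) \<le> 1 / (2 * real d)"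
proof -
  have r: "0 < 1 / (2 * real d)" "1 / (2 * real d) \<le> 1 / 2" using d_pos by auto
  show "0 < csup" using r by (simp add: csup_def)
  have sS: "s j \<le> S" if "j < d" for j unfolding S_def using that by (intro member_le_sum) auto
  have "csup \<le> (1 / (2 * real d)) ^ 1"
    unfolding csup_def using r sS[OF d_pos] s_pos[OF d_pos] by (intro power_decreasing) auto
  then have "csup \<le> 1 / (2 * real d)" by simp
  then show "csup \<le> 1 / 2" using r(2) by (rule order_trans)
  assume j: "j < d" and t: "0 \<le> t" "t \<le> csup"
  have "csup \<le> (1 / (2 * real d)) ^ s j"
    unfolding csup_def using r sS[OF j] by (intro power_decreasing) auto
  then show "t powr (1 / real (s j)) \<le> 1 / (2 * real d)"
    using r t by (intro powr_inv_le[OF j]) auto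
qed

text \<open>Chosen once and for all, so that the profile and its lower bound are fixed constants
  rather than parameters of each estimate.\<close>

definition bump :: "(nat \<Rightarrow> real \<Rightarrow> real) \<times> real" where
  "bump = (SOME p. 0 < snd p \<and> (\<forall>k t. (fst p k has_real_derivative fst p (Suc k) t) (at t)) \<and> (\<forall>k t. csup \<le> \<bar>t\<bar> \<longrightarrow> fst p k t = 0) \<and> (\<forall>t. 0 \<le> fst p 0 t)
    \<and> (\<forall>t. \<bar>t\<bar> \<le> csup / 2 \<longrightarrow> snd p \<le> fst p (0::nat) t) \<and> (\<forall>k. \<exists>C. \<forall>t. \<bar>fst p k t\<bar> \<le> C))"

definition Db :: "nat \<Rightarrow> real \<Rightarrow> real" where "Db = fst bump"
definition b0 :: real where "b0 = snd bump"

lemma bump_props: "0 < b0" "(Db k has_real_derivative Db (Suc k) t) (at t)" "csup \<le> \<bar>t\<bar> \<Longrightarrow> Db k t = 0" "0 \<le> Db 0 t"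
    "\<bar>t\<bar> \<le> csup / 2 \<Longrightarrow> b0 \<le> Db 0 t" "\<exists>C. \<forall>t. \<bar>Db k t\<bar> \<le> C"
proof -
  obtain D b where "0 < b \<and> (\<forall>k t. (D k has_real_derivative D (Suc k) t) (at t)) \<and> (\<forall>k t. csup \<le> \<bar>t\<bar> \<longrightarrow> D k t = 0) \<and> (\<forall>t. 0 \<le> D 0 t)
    \<and> (\<forall>t. \<bar>t\<bar> \<le> csup / 2 \<longrightarrow> b \<le> D (0::nat) t) \<and> (\<forall>k. \<exists>C. \<forall>t. \<bar>D k t\<bar> \<le> C)"
    using bump_exists[OF csup(1)] by blast
  then have "0 < snd (D, b) \<and> (\<forall>k t. (fst (D, b) k has_real_derivative fst (D, b) (Suc k) t) (at t)) \<and> (\<forall>k t. csup \<le> \<bar>t\<bar> \<longrightarrow> fst (D, b) k t = 0) \<and> (\<forall>t. 0 \<le> fst (D, b) 0 t)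
    \<and> (\<forall>t. \<bar>t\<bar> \<le> csup / 2 \<longrightarrow> snd (D, b) \<le> fst (D, b) (0::nat) t) \<and> (\<forall>k. \<exists>C. \<forall>t. \<bar>fst (D, b) k t\<bar> \<le> C)"
    by simp
  from someI[of "\<lambda>p. 0 < snd p \<and> (\<forall>k t. (fst p k has_real_derivative fst p (Suc k) t) (at t)) \<and> (\<forall>k t. csup \<le> \<bar>t\<bar> \<longrightarrow> fst p k t = 0) \<and> (\<forall>t. 0 \<le> fst p 0 t)
    \<and> (\<forall>t. \<bar>t\<bar> \<le> csup / 2 \<longrightarrow> snd p \<le> fst p (0::nat) t) \<and> (\<forall>k. \<exists>C. \<forall>t. \<bar>fst p k t\<bar> \<le> C)", OF this]
  have *: "0 < b0 \<and> (\<forall>k t. (Db k has_real_derivative Db (Suc k) t) (at t)) \<and> (\<forall>k t. csup \<le> \<bar>t\<bar> \<longrightarrow> Db k t = 0) \<and> (\<forall>t. 0 \<le> Db 0 t)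
    \<and> (\<forall>t. \<bar>t\<bar> \<le> csup / 2 \<longrightarrow> b0 \<le> Db 0 t) \<and> (\<forall>k. \<exists>C. \<forall>t. \<bar>Db k t\<bar> \<le> C)"
    unfolding b0_def Db_def bump_def .
  show "0 < b0" "(Db k has_real_derivative Db (Suc k) t) (at t)" "csup \<le> \<bar>t\<bar> \<Longrightarrow> Db k t = 0" "0 \<le> Db 0 t"
    "\<bar>t\<bar> \<le> csup / 2 \<Longrightarrow> b0 \<le> Db 0 t" "\<exists>C. \<forall>t. \<bar>Db k t\<bar> \<le> C"
    using * by blast+
qed

lemma Db_bound: "\<exists>M\<ge>1. \<forall>i\<le>k. \<forall>t. \<bar>Db i t\<bar> \<le> M"
proof (induction k)
  case 0
  obtain C where "\<And>t. \<bar>Db 0 t\<bar> \<le> C" using bump_props(6) by blast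
  then show ?case by (intro exI[of _ "max 1 C"]) (auto simp: le_max_iff_disj)
next
  case (Suc k)
  then obtain M where M: "1 \<le> M" "\<forall>i\<le>k. \<forall>t. \<bar>Db i t\<bar> \<le> M" by blast
  obtain C where "\<And>t. \<bar>Db (Suc k) t\<bar> \<le> C" using bump_props(6) by blast
  with M show ?case by (intro exI[of _ "max M C"]) (auto simp: le_max_iff_disj le_Suc_eq)
qed

text \<open>The bump at scale \<open>h\<close> centred at \<open>z\<close>, seen from the origin at the larger scale \<open>h + nm z\<close>.\<close>

definition tfam :: "real \<Rightarrow> (nat \<Rightarrow> int) \<Rightarrow> nat \<Rightarrow> nat \<Rightarrow> real \<Rightarrow> real" where
  "tfam h z j k t = (((h + nm z) / h) ^ s j) ^ k * Db k (((h + nm z) / h) ^ s j * t - real_of_int (z j) / h ^ s j)"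

lemma deriv_family_tfam: "deriv_family d (tfam h z)"
proof
  fix j k t
  let ?K = "((h + nm z) / h) ^ s j" and ?z = "real_of_int (z j) / h ^ s j"
  have "((\<lambda>t. Db k (?K * t - ?z)) has_real_derivative Db (Suc k) (?K * t - ?z) * ?K) (at t)"
    by (rule DERIV_chain2[OF bump_props(2)]) (auto intro!: derivative_eq_intros)
  from DERIV_cmult[OF this, of "?K ^ k"]
  show "(tfam h z j k has_real_derivative tfam h z j (Suc k) t) (at t)"
    unfolding tfam_def[abs_def] by (simp add: mult_ac)
qed

text \<open>Test functions need the closure of their support in the open unit ball; it is placed in
  a closed ball of smaller radius.\<close>

lemma closed_sdist_ball: "closed {x\<in>Rd d. sdist s d x (\<lambda>_. 0) \<le> q}"
proof -
  have "Rd d = (\<Inter>i\<in>{d..}. {x. x i = 0})" by (auto simp: Rd_def)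
  then have 1: "closed (Rd d)"
    by (simp add: closed_INT closed_Collect_eq[OF continuous_on_product_coordinates continuous_on_const])
  have "continuous_on UNIV (\<lambda>x. sdist s d x (\<lambda>_. 0))"
    unfolding sdist_def
  proof (intro continuous_on_sum)
    fix i assume i: "i \<in> {..<d}"
    show "continuous_on UNIV (\<lambda>x. \<bar>x i - 0\<bar> powr (1 / real (s i)))"
      using s_pos[of i] i by (intro continuous_on_powr' continuous_intros continuous_on_product_coordinates) auto
  qed
  then have "closed {x. sdist s d x (\<lambda>_. 0) \<le> q}" by (intro closed_Collect_le continuous_on_const)
  with 1 have "closed (Rd d \<inter> {x. sdist s d x (\<lambda>_. 0) \<le> q})" by (rule closed_Int)
  moreover have "Rd d \<inter> {x. sdist s d x (\<lambda>_. 0) \<le> q} = {x\<in>Rd d. sdist s d x (\<lambda>_. 0) \<le> q}" by auto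
  ultimately show ?thesis by simp
qed

text \<open>By the chain rule a derivative of scaled order at most \<open>k\<close> costs at most
  the \<open>k\<close>-th power of the ratio of the two scales, which the prefactor
  compensates.\<close>

lemma tfam_testB:
  "\<exists>M\<ge>1. \<forall>h\<ge>1. \<forall>z\<in>Z. PF d (1 / (M * ((h + nm z) / h) ^ k)) (tfam h z) (\<lambda>_. 0) \<in> testB s d k"
proof -
  obtain M where M: "1 \<le> M" "\<And>i t. i \<le> k \<Longrightarrow> \<bar>Db i t\<bar> \<le> M" using Db_bound by blast
  show ?thesis
  proof (intro exI[of _ "M ^ d"] conjI allI impI ballI)
    show "1 \<le> M ^ d" using M by simp
    fix h z assume h: "1 \<le> (h::real)" and z: "z \<in> Z"
    define K where "K = (h + nm z) / h"
    have K: "1 \<le> K" using h by (simp add: K_def)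
    interpret deriv_family d "tfam h z" by (rule deriv_family_tfam)
    define c where "c = 1 / (M ^ d * K ^ k)"
    have c: "0 < c" using M K by (simp add: c_def)
    let ?\<phi> = "PF d c (tfam h z) (\<lambda>_. 0)"
    \<comment> \<open>Seen from the origin, a bump of radius \<open>h / 2\<close> at
      \<open>z\<close> reaches distance \<open>h / 2 + nm z\<close>, to be compared with the scale
      \<open>h + nm z\<close>.\<close>
    define q where "q = (h / 2 + nm z) / (h + nm z)"
    have q: "q < 1" using h nm_nonneg[of z] by (simp add: q_def divide_less_eq add_pos_nonneg)
    have hz: "0 < h + nm z" using h nm_nonneg[of z] by linarith
    have "{x\<in>Rd d. ?\<phi> x \<noteq> 0} \<subseteq> {x\<in>Rd d. sdist s d x (\<lambda>_. 0) \<le> q}"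
    proof (intro subsetI CollectI conjI)
      fix x assume x: "x \<in> {x\<in>Rd d. ?\<phi> x \<noteq> 0}"
      then show "x \<in> Rd d" by simp
      have j: "\<bar>x j\<bar> powr (1 / real (s j)) \<le> (1 / (2 * real d) * h + \<bar>real_of_int (z j)\<bar> powr (1 / real (s j))) / (h + nm z)" if j: "j < d" for j
      proof -
        let ?p = "1 / real (s j)"
        have p: "0 < ?p" "?p \<le> 1" using s_pos[OF j] by auto
        have "tfam h z j 0 (x j) \<noteq> 0" using x j by (auto simp: PF_def)
        then have "\<bar>K ^ s j * x j - real_of_int (z j) / h ^ s j\<bar> < csup"
          using bump_props(3)[of "K ^ s j * x j - real_of_int (z j) / h ^ s j" 0] by (force simp: tfam_def K_def)
        then have "\<bar>K ^ s j * x j - real_of_int (z j) / h ^ s j\<bar> powr ?p \<le> 1 / (2 * real d)"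
          by (intro csup(3)[OF j]) auto
        moreover have "\<bar>K ^ s j * x j\<bar> powr ?p \<le> \<bar>K ^ s j * x j - real_of_int (z j) / h ^ s j\<bar> powr ?p + \<bar>real_of_int (z j) / h ^ s j\<bar> powr ?p"
        proof -
          have "\<bar>K ^ s j * x j\<bar> powr ?p \<le> (\<bar>K ^ s j * x j - real_of_int (z j) / h ^ s j\<bar> + \<bar>real_of_int (z j) / h ^ s j\<bar>) powr ?p"
            using p by (intro powr_mono2 order_trans[OF _ abs_triangle_ineq]) (auto simp del: abs_divide)
          also have "\<dots> \<le> \<bar>K ^ s j * x j - real_of_int (z j) / h ^ s j\<bar> powr ?p + \<bar>real_of_int (z j) / h ^ s j\<bar> powr ?p"
            using p by (intro powr_subadd) auto
          finally show ?thesis .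
        qed
        moreover have "\<bar>K ^ s j * x j\<bar> powr ?p = K * \<bar>x j\<bar> powr ?p"
        proof -
          have "(K ^ s j) powr ?p = K" using K s_pos[OF j] by (simp add: powr_realpow[symmetric] powr_powr)
          then show ?thesis using K by (simp add: abs_mult powr_mult)
        qed
        moreover have "\<bar>real_of_int (z j) / h ^ s j\<bar> powr ?p = \<bar>real_of_int (z j)\<bar> powr ?p / h"
        proof -
          have "(h ^ s j) powr ?p = h" using h s_pos[OF j] by (simp add: powr_realpow[symmetric] powr_powr)
          then show ?thesis using h by (simp add: powr_divide)
        qed
        ultimately have "K * \<bar>x j\<bar> powr ?p \<le> 1 / (2 * real d) + \<bar>real_of_int (z j)\<bar> powr ?p / h" by linarith
        then have "h * (K * \<bar>x j\<bar> powr ?p) \<le> h * (1 / (2 * real d) + \<bar>real_of_int (z j)\<bar> powr ?p / h)"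
          using h by (intro mult_left_mono) auto
        then have "(h + nm z) * \<bar>x j\<bar> powr ?p \<le> 1 / (2 * real d) * h + \<bar>real_of_int (z j)\<bar> powr ?p"
          using h by (simp add: K_def distrib_left mult.commute)
        then show ?thesis using hz by (simp add: le_divide_eq mult.commute)
      qed
      have "sdist s d x (\<lambda>_. 0) \<le> (\<Sum>j<d. (1 / (2 * real d) * h + \<bar>real_of_int (z j)\<bar> powr (1 / real (s j))) / (h + nm z))"
        unfolding sdist_def using j by (intro sum_mono) auto
      also have "\<dots> = (\<Sum>j<d. 1 / (2 * real d) * h + \<bar>real_of_int (z j)\<bar> powr (1 / real (s j))) / (h + nm z)"
        by (simp only: sum_divide_distrib)
      also have "(\<Sum>j<d. 1 / (2 * real d) * h + \<bar>real_of_int (z j)\<bar> powr (1 / real (s j))) = h / 2 + nm z"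
        using d_pos by (simp add: sum.distrib nm_def)
      finally show "sdist s d x (\<lambda>_. 0) \<le> q" by (simp add: q_def)
    qed
    then have "closure {x\<in>Rd d. ?\<phi> x \<noteq> 0} \<subseteq> {x\<in>Rd d. sdist s d x (\<lambda>_. 0) \<le> q}"
      by (rule closure_minimal[OF _ closed_sdist_ball])
    then have cl: "closure {x\<in>Rd d. ?\<phi> x \<noteq> 0} \<subseteq> {x\<in>Rd d. sdist s d x (\<lambda>_. 0) < 1}"
      using q by fastforce
    have bd: "\<bar>pdiff d \<beta> ?\<phi> x\<bar> \<le> 1" if "sdeg s d \<beta> \<le> k" for \<beta> x
    proof -
      have b: "\<bar>tfam h z j (\<beta> j) (x j)\<bar> \<le> K ^ (s j * \<beta> j) * M" if j: "j < d" for j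
      proof -
        have "\<beta> j \<le> s j * \<beta> j" using s_pos[OF j] by simp
        also have "\<dots> \<le> sdeg s d \<beta>" unfolding sdeg_def using j by (intro member_le_sum) auto
        finally have "\<beta> j \<le> k" using \<open>sdeg s d \<beta> \<le> k\<close> by simp
        then have "\<bar>Db (\<beta> j) t\<bar> \<le> M" for t by (rule M)
        then show ?thesis
          using K unfolding tfam_def K_def[symmetric] power_mult[symmetric] by (simp add: abs_mult mult_left_mono)
      qed
      have "\<bar>pdiff d \<beta> ?\<phi> x\<bar> = c * (\<Prod>j<d. \<bar>tfam h z j (\<beta> j) (x j)\<bar>)"
        using c unfolding pdiff_PF by (simp add: PF_def abs_mult abs_prod)
      also have "\<dots> \<le> c * (\<Prod>j<d. K ^ (s j * \<beta> j) * M)"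
        using c b by (intro mult_left_mono prod_mono) auto
      also have "(\<Prod>j<d. K ^ (s j * \<beta> j) * M) = K ^ sdeg s d \<beta> * M ^ d"
        by (simp add: prod.distrib sdeg_def power_sum)
      also have "c * (K ^ sdeg s d \<beta> * M ^ d) \<le> c * (K ^ k * M ^ d)"
        using c K M that by (intro mult_left_mono mult_right_mono power_increasing) auto
      also have "\<dots> = 1" using K M by (simp add: c_def)
      finally show ?thesis .
    qed
    have "?\<phi> \<in> testB s d k" unfolding testB_def using smooth_PF cl bd by blast
    then show "PF d (1 / (M ^ d * ((h + nm z) / h) ^ k)) (tfam h z) (\<lambda>_. 0) \<in> testB s d k"
      by (simp only: c_def K_def)
  qed
qed

section \<open>The test functions as mollifiers on the unit lattice\<close>

definition emb :: "real \<Rightarrow> (nat \<Rightarrow> real) \<Rightarrow> (nat \<Rightarrow> int) \<Rightarrow> nat \<Rightarrow> real" where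
  "emb \<epsilon> x n = (\<lambda>i. x i + \<epsilon> ^ s i * real_of_int (n i))"

lemma bij_emb: assumes "0 < \<epsilon>" "x \<in> lattice s d \<epsilon>" shows "bij_betw (emb \<epsilon> x) Z (lattice s d \<epsilon>)"
proof (rule bij_betw_imageI)
  show "inj_on (emb \<epsilon> x) Z"
    using assms(1) by (auto simp: inj_on_def emb_def fun_eq_iff)
  show "emb \<epsilon> x ` Z = lattice s d \<epsilon>"
  proof (intro equalityI subsetI)
    fix y assume "y \<in> emb \<epsilon> x ` Z"
    then obtain n where n: "n \<in> Z" "y = emb \<epsilon> x n" by auto
    have "\<exists>k::int. y i = \<epsilon> ^ s i * of_int k" if i: "i < d" for i
    proof -
      obtain k :: int where "x i = \<epsilon> ^ s i * of_int k" using assms(2) i by (auto simp: lattice_def)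
      then have "y i = \<epsilon> ^ s i * of_int (k + n i)" by (simp add: n emb_def distrib_left)
      then show ?thesis by blast
    qed
    moreover have "y \<in> Rd d" using assms(2) n by (auto simp: lattice_def Rd_def emb_def Z_def)
    ultimately show "y \<in> lattice s d \<epsilon>" by (auto simp: lattice_def)
  next
    fix y assume y: "y \<in> lattice s d \<epsilon>"
    have "\<exists>k::int. y i - x i = \<epsilon> ^ s i * of_int k" if i: "i < d" for i
    proof -
      obtain k :: int where "x i = \<epsilon> ^ s i * of_int k" using assms(2) i by (auto simp: lattice_def)
      moreover obtain k' :: int where "y i = \<epsilon> ^ s i * of_int k'" using y i by (auto simp: lattice_def)
      ultimately
      have "y i - x i = \<epsilon> ^ s i * of_int (k' - k)" by (simp add: right_diff_distrib)
      then show ?thesis by blast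
    qed
    then obtain k :: "nat \<Rightarrow> int" where k: "\<And>i. i < d \<Longrightarrow> y i - x i = \<epsilon> ^ s i * of_int (k i)" by metis
    let ?n = "\<lambda>i. if i < d then k i else 0"
    have "y = emb \<epsilon> x ?n"
    proof
      fix i show "y i = emb \<epsilon> x ?n i"
        using k[of i] y assms(2) by (cases "i < d") (auto simp: emb_def lattice_def Rd_def)
    qed
    moreover have "?n \<in> Z" by (simp add: Z_def)
    ultimately show "y \<in> emb \<epsilon> x ` Z" by blast
  qed
qed

definition cube :: "nat \<Rightarrow> (nat \<Rightarrow> int) set" where
  "cube h = zbox d (\<lambda>j. {- int (h ^ s j)..int (h ^ s j)})"

definition psi :: "nat \<Rightarrow> (nat \<Rightarrow> int) \<Rightarrow> real" where
  "psi h n = (\<Prod>j<d. Db 0 (real_of_int (n j) / real h ^ s j))"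

text \<open>Normalised by the discrete mass of the sampled bump rather than its integral, so that
  constants are reproduced exactly on the lattice.\<close>

definition mu :: "nat \<Rightarrow> zfun \<Rightarrow> zfun" where
  "mu h u n = (\<Sum>x\<in>cube h. of_real (psi h x / (\<Sum>y\<in>cube h. psi h y)) * u (\<lambda>j. n j + x j))"

lemma finite_cube [simp]: "finite (cube h)" by (simp add: cube_def)

lemma cube_Z: "cube h \<subseteq> Z" by (auto simp: cube_def zbox_def Z_def)

lemma psi_nonneg: "0 \<le> psi h n" unfolding psi_def by (intro prod_nonneg) (simp add: bump_props)

text \<open>In direction \<open>j\<close> the bump is at least \<open>b0\<close> at more than
  \<open>csup / 2 * h ^ s j\<close> lattice points; the sum over the cube factors.\<close>

lemma psi_sum_lower: assumes "1 \<le> h" shows "(b0 * csup / 2) ^ d * real h ^ S \<le> (\<Sum>y\<in>cube h. psi h y)"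
proof -
  have one: "b0 * csup / 2 * real h ^ s j \<le> (\<Sum>t\<in>{- int (h ^ s j)..int (h ^ s j)}. Db 0 (real_of_int t / real h ^ s j))" for j
  proof -
    define T where "T = real h ^ s j"
    have T: "1 \<le> T" using assms by (simp add: T_def)
    define N where "N = nat \<lfloor>csup / 2 * T\<rfloor>"
    have N: "real N \<le> csup / 2 * T" "csup / 2 * T \<le> real (Suc N)"
    proof -
      have "0 \<le> csup / 2 * T" using csup(1) T by simp
      then have "real N = real_of_int \<lfloor>csup / 2 * T\<rfloor>" unfolding N_def by (intro of_nat_nat) simp
      then show "real N \<le> csup / 2 * T" "csup / 2 * T \<le> real (Suc N)" by linarith+
    qed
    have "csup / 2 * T \<le> 1 * T" using csup T by (intro mult_right_mono) auto
    then have "real N \<le> T" using N by linarith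
    then have "real N \<le> real (h ^ s j)" by (simp add: T_def)
    then have NT: "int N \<le> int (h ^ s j)" by (simp only: of_nat_le_iff)
    have "b0 * csup / 2 * T = b0 * (csup / 2 * T)" by simp
    also have "\<dots> \<le> b0 * real (Suc N)" using N bump_props(1) by (intro mult_left_mono) auto
    also have "\<dots> = (\<Sum>t\<in>{0..int N}. b0)" by simp
    also have "\<dots> \<le> (\<Sum>t\<in>{0..int N}. Db 0 (real_of_int t / T))"
    proof (intro sum_mono bump_props(5))
      fix t assume t: "t \<in> {0..int N}"
      then have "real_of_int t \<le> real N" by simp
      then have "real_of_int t \<le> csup / 2 * T" using N by linarith
      then show "\<bar>real_of_int t / T\<bar> \<le> csup / 2" using T t by (simp add: divide_le_eq)
    qed
    also have "\<dots> \<le> (\<Sum>t\<in>{- int (h ^ s j)..int (h ^ s j)}. Db 0 (real_of_int t / T))"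
      using NT by (intro sum_mono2) (auto simp: bump_props)
    finally show ?thesis by (simp add: T_def)
  qed
  have "(b0 * csup / 2) ^ d * real h ^ S = (\<Prod>j<d. b0 * csup / 2 * real h ^ s j)"
    by (simp only: prod.distrib prod_constant card_lessThan S_def power_sum)
  also have "\<dots> \<le> (\<Prod>j<d. \<Sum>t\<in>{- int (h ^ s j)..int (h ^ s j)}. Db 0 (real_of_int t / real h ^ s j))"
    using bump_props(1) csup(1) by (intro prod_mono conjI one) auto
  also have "\<dots> = (\<Sum>y\<in>cube h. psi h y)"
    unfolding cube_def psi_def by (subst sum_prod_zbox) auto
  finally show ?thesis .
qed

lemma psi_sum_pos: "1 \<le> h \<Longrightarrow> 0 < (\<Sum>y\<in>cube h. psi h y)"
  by (rule less_le_trans[OF _ psi_sum_lower]) (auto simp: bump_props csup)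

lemma nm_cube: assumes "x \<in> cube h" shows "nm x \<le> real d * real h"
proof -
  have "nm x \<le> (\<Sum>i<d. real h)"
    unfolding nm_def
  proof (intro sum_mono powr_inv_le)
    fix i assume "i \<in> {..<d}"
    then have "\<bar>x i\<bar> \<le> int (h ^ s i)" using assms by (auto simp: cube_def zbox_def abs_le_iff minus_le_iff)
    then have "real_of_int \<bar>x i\<bar> \<le> real_of_int (int (h ^ s i))" by (simp only: of_int_le_iff)
    then show "\<bar>real_of_int (x i)\<bar> \<le> real h ^ s i" by simp
  qed auto
  then show ?thesis by simp
qed

lemma mu_props:
  assumes "1 \<le> h"
  shows "aff (mu h)" "avgc 1 (real d * real h) (mu h)"
proof -
  have 1: "(\<Sum>x\<in>cube h. psi h x / (\<Sum>y\<in>cube h. psi h y)) = 1"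
    using psi_sum_pos[OF assms] by (simp add: sum_divide_distrib[symmetric])
  have 2: "0 \<le> psi h x / (\<Sum>y\<in>cube h. psi h y)" for x
    using psi_sum_pos[OF assms] psi_nonneg by simp
  note cc = convex_comb[OF finite_cube subsetD[OF cube_Z] 2 1 nm_cube]
  show "aff (mu h)" unfolding mu_def[abs_def] by (rule cc) auto
  show "avgc 1 (real d * real h) (mu h)" unfolding mu_def[abs_def] by (rule cc) auto
qed

text \<open>The support of the bump is smaller than the mesh, so only the origin carries
  weight.\<close>

lemma mu_1: "mu 1 u n = u n"
proof -
  have z: "psi 1 x = 0" if "x \<in> cube 1" "x \<noteq> (\<lambda>_. 0)" for x
  proof -
    have "x \<in> Z" using that cube_Z by auto
    moreover have "\<exists>i. x i \<noteq> 0" using that by (auto simp: fun_eq_iff)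
    then obtain i where "x i \<noteq> 0" by blast
    ultimately have i: "i < d" "x i \<noteq> 0" by (auto simp: Z_def not_le[symmetric])
    have "csup \<le> \<bar>real_of_int (x i) / real 1 ^ s i\<bar>" using i csup(2) by (simp add: abs_if)
    then have "Db 0 (real_of_int (x i) / real 1 ^ s i) = 0" by (rule bump_props(3))
    then show ?thesis unfolding psi_def using i by (intro prod_zero) auto
  qed
  have 0: "(\<lambda>_. 0) \<in> cube 1" by (simp add: cube_def zbox_def)
  have S1: "(\<Sum>y\<in>cube 1. psi 1 y) = psi 1 (\<lambda>_. 0)"
    using z 0 by (subst sum.remove[OF finite_cube 0]) (auto intro!: sum.neutral)
  have "psi 1 (\<lambda>_. 0) \<noteq> 0" using psi_sum_pos[of 1] S1 by simp
  moreover have "mu 1 u n = of_real (psi 1 (\<lambda>_. 0) / (\<Sum>y\<in>cube 1. psi 1 y)) * u (\<lambda>j. n j + 0)"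
    unfolding mu_def using z by (subst sum.remove[OF finite_cube 0]) (auto intro!: sum.neutral)
  ultimately show ?thesis unfolding S1 by simp
qed

text \<open>Only test functions centred at \<open>x\<close> are available, so the average about
  \<open>z\<close> is read as a test at \<open>x\<close> of the larger scale
  \<open>\<epsilon> * (h + nm z)\<close>. The growth exponent \<open>k + S\<close> consists of
  \<open>k\<close> from the normalisation of the test function and \<open>S\<close> from the larger
  volume.\<close>

lemma mu_test_bound:
  "\<exists>C\<ge>0. \<forall>\<epsilon>>0. \<forall>f x \<gamma> A. \<gamma> \<le> 0 \<and> x \<in> lattice s d \<epsilon> \<and> 
     (\<forall>\<phi>\<in>testB s d k. \<forall>lam\<ge>\<epsilon>. lam powr (- \<gamma>) * cmod (pair_eps s d \<epsilon> f (\<lambda>y. complex_of_real (rescale s d \<phi> x lam y))) \<le> A) \<longrightarrow>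
     (\<forall>h\<ge>1. \<forall>z\<in>Z. cmod (mu h (\<lambda>n. f (emb \<epsilon> x n)) z) \<le> C * A * \<epsilon> powr \<gamma> * real h powr \<gamma> * (1 + nm z / real h) ^ (k + S))"
proof -
  obtain M where M: "1 \<le> M" "\<And>h z. 1 \<le> h \<Longrightarrow> z \<in> Z \<Longrightarrow> PF d (1 / (M * ((h + nm z) / h) ^ k)) (tfam h z) (\<lambda>_. 0) \<in> testB s d k"
    using tfam_testB by blast
  define c1 where "c1 = (b0 * csup / 2) ^ d"
  have c1: "0 < c1" using bump_props(1) csup(1) by (simp add: c1_def)
  show ?thesis
  proof (intro exI[of _ "M / c1"] conjI allI impI ballI)
    show "0 \<le> M / c1" using M c1 by simp
    fix \<epsilon> f x \<gamma> A h z
    assume \<epsilon>: "0 < \<epsilon>" and h: "1 \<le> (h::nat)" and z: "z \<in> Z"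
      and as: "\<gamma> \<le> 0 \<and> x \<in> lattice s d \<epsilon> \<and> 
     (\<forall>\<phi>\<in>testB s d k. \<forall>lam\<ge>\<epsilon>. lam powr (- \<gamma>) * cmod (pair_eps s d \<epsilon> f (\<lambda>y. complex_of_real (rescale s d \<phi> x lam y))) \<le> A)"
    have \<gamma>: "\<gamma> \<le> 0" and x: "x \<in> lattice s d \<epsilon>" using as by auto
    define L where "L = real h + nm z"
    define K where "K = L / real h"
    have L: "1 \<le> L" "real h \<le> L" 
    proof -
      have "1 \<le> real h" using h by simp
      then show "1 \<le> L" "real h \<le> L" using nm_nonneg[of z] unfolding L_def by linarith+
    qed
    have K: "1 \<le> K" "K = 1 + nm z / real h" using h by (auto simp: K_def L_def add_divide_distrib)
    define c where "c = 1 / (M * K ^ k)"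
    have c: "0 < c" using M K(1) by (simp add: c_def)
    define \<phi> where "\<phi> = PF d c (tfam (real h) z) (\<lambda>_. 0)"
    have \<phi>B: "\<phi> \<in> testB s d k" unfolding \<phi>_def c_def K_def L_def using h z by (intro M) auto
    let ?lam = "\<epsilon> * L"
    have "\<epsilon> * 1 \<le> ?lam" using L \<epsilon> by (intro mult_left_mono) auto
    then have t: "?lam powr (- \<gamma>) * cmod (pair_eps s d \<epsilon> f (\<lambda>y. complex_of_real (rescale s d \<phi> x ?lam y))) \<le> A"
      using as \<phi>B by auto
    have \<lambda>: "0 < ?lam" using \<epsilon> L by simp
    have lp: "?lam powr (- real k) = 1 / ?lam ^ k" for k using \<lambda> by (simp add: powr_minus powr_realpow inverse_eq_divide)
    have val: "rescale s d \<phi> x ?lam (emb \<epsilon> x n) = c / ?lam ^ S * psi h (\<lambda>j. n j - z j)" for n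
    proof -
      have "K ^ s j * (1 / ?lam ^ s j * (emb \<epsilon> x n j - x j)) - real_of_int (z j) / real h ^ s j = real_of_int (n j - z j) / real h ^ s j" for j
      proof -
        have "K ^ s j * (1 / ?lam ^ s j * (emb \<epsilon> x n j - x j)) = real_of_int (n j) / real h ^ s j"
          using \<epsilon> L by (simp add: emb_def K_def power_divide power_mult_distrib)
        then show ?thesis by (simp add: diff_divide_distrib)
      qed
      then show ?thesis
        unfolding rescale_def lp S_def[symmetric] \<phi>_def PF_def psi_def tfam_def K_def[symmetric] L_def[symmetric]
        by (simp add: lp)
    qed
    let ?N = "(\<lambda>y j. z j + y j) ` cube h"
    have inj: "inj_on (\<lambda>y j. z j + y j) (cube h)" by (auto simp: inj_on_def fun_eq_iff)
    have NZ: "?N \<subseteq> Z" using z cube_Z[of h] by (auto simp: Z_def)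
    \<comment> \<open>The profile vanishes well before the faces of the cube, so the infinite
      pairing is a finite sum.\<close>
    have out: "psi h (\<lambda>j. n j - z j) = 0" if n: "n \<in> Z - ?N" for n
    proof -
      have "(\<lambda>j. n j - z j) \<notin> cube h"
      proof
        assume a: "(\<lambda>j. n j - z j) \<in> cube h"
        have "n \<in> ?N" by (rule image_eqI[OF _ a]) auto
        then show False using n by simp
      qed
      moreover have "(\<lambda>j. n j - z j) \<in> Z" using n z by simp
      ultimately obtain j where j: "j < d" "\<not> \<bar>n j - z j\<bar> \<le> int (h ^ s j)"
        by (auto simp: cube_def zbox_def Z_def abs_le_iff)
      then have "int (h ^ s j) \<le> \<bar>n j - z j\<bar>" by simp
      then have "real_of_int (int (h ^ s j)) \<le> real_of_int \<bar>n j - z j\<bar>" by (simp only: of_int_le_iff)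
      then have "1 \<le> \<bar>real_of_int (n j - z j) / real h ^ s j\<bar>" using h by (simp add: le_divide_eq)
      then have "Db 0 (real_of_int (n j - z j) / real h ^ s j) = 0" using csup(2) by (intro bump_props(3)) auto
      then show ?thesis unfolding psi_def using j by (intro prod_zero) auto
    qed
    define \<Sigma> where "\<Sigma> = (\<Sum>y\<in>cube h. f (emb \<epsilon> x (\<lambda>j. z j + y j)) * of_real (psi h y))"
    have "infsum (\<lambda>y. f y * complex_of_real (rescale s d \<phi> x ?lam y)) (lattice s d \<epsilon>) =
        infsum (\<lambda>n. f (emb \<epsilon> x n) * of_real (c / ?lam ^ S * psi h (\<lambda>j. n j - z j))) Z"
      by (subst infsum_reindex_bij_betw[OF bij_emb[OF \<epsilon> x], symmetric]) (simp only: val)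
    also have "\<dots> = infsum (\<lambda>n. f (emb \<epsilon> x n) * of_real (c / ?lam ^ S * psi h (\<lambda>j. n j - z j))) ?N"
      using out NZ by (intro infsum_cong_neutral) auto
    also have "\<dots> = (\<Sum>n\<in>?N. f (emb \<epsilon> x n) * of_real (c / ?lam ^ S * psi h (\<lambda>j. n j - z j)))"
      by (rule infsum_finite) simp
    also have "\<dots> = of_real (c / ?lam ^ S) * \<Sigma>"
      by (subst sum.reindex[OF inj]) (simp add: \<Sigma>_def sum_distrib_left mult_ac)
    finally have "pair_eps s d \<epsilon> f (\<lambda>y. complex_of_real (rescale s d \<phi> x ?lam y)) = of_real (\<epsilon> ^ S * (c / ?lam ^ S)) * \<Sigma>"
      by (simp add: pair_eps_def S_def[symmetric])
    moreover have "\<epsilon> ^ S * (c / ?lam ^ S) = c / L ^ S" using \<epsilon> by (simp add: power_mult_distrib)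
    ultimately have "cmod (pair_eps s d \<epsilon> f (\<lambda>y. complex_of_real (rescale s d \<phi> x ?lam y))) = c / L ^ S * cmod \<Sigma>"
      using c L by (simp only: norm_mult norm_of_real) simp
    with t have t2: "?lam powr (- \<gamma>) * (c / L ^ S * cmod \<Sigma>) \<le> A" by simp
    have "?lam powr \<gamma> * ?lam powr (- \<gamma>) = 1" using \<epsilon> L by (simp add: powr_add[symmetric])
    then have "cmod \<Sigma> = (?lam powr \<gamma> * L ^ S / c) * (?lam powr (- \<gamma>) * (c / L ^ S * cmod \<Sigma>))"
      using c L by (simp add: field_simps)
    also have "\<dots> \<le> (?lam powr \<gamma> * L ^ S / c) * A"
      using t2 c L by (intro mult_left_mono) auto
    finally have S1: "cmod \<Sigma> \<le> (?lam powr \<gamma> * L ^ S / c) * A" .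
    have A: "0 \<le> A" using t by (rule order_trans[rotated]) simp
    have "?lam powr \<gamma> = \<epsilon> powr \<gamma> * L powr \<gamma>" using \<epsilon> L by (intro powr_mult)
    also have "\<dots> \<le> \<epsilon> powr \<gamma> * real h powr \<gamma>" using L h \<gamma> by (intro mult_left_mono powr_mono2') auto
    finally have "(?lam powr \<gamma> * L ^ S / c) * A \<le> (\<epsilon> powr \<gamma> * real h powr \<gamma> * L ^ S / c) * A"
      using c L A by (intro mult_right_mono divide_right_mono) auto
    also have "\<dots> = M * A * \<epsilon> powr \<gamma> * real h powr \<gamma> * K ^ (k + S) * real h ^ S"
    proof -
      have "L = K * real h" using h by (simp add: K_def)
      then have "L ^ S = K ^ S * real h ^ S" by (simp add: power_mult_distrib)
      then show ?thesis by (simp add: c_def power_add)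
    qed
    finally have S2: "cmod \<Sigma> \<le> M * A * \<epsilon> powr \<gamma> * real h powr \<gamma> * K ^ (k + S) * real h ^ S" using S1 by simp
    let ?P = "\<Sum>y\<in>cube h. psi h y"
    have "mu h (\<lambda>n. f (emb \<epsilon> x n)) z = \<Sigma> / of_real ?P"
      by (simp add: mu_def \<Sigma>_def sum_divide_distrib mult.commute)
    then have "cmod (mu h (\<lambda>n. f (emb \<epsilon> x n)) z) = cmod \<Sigma> / ?P"
      using psi_sum_pos[OF h] by (simp only: norm_divide norm_of_real abs_of_pos)
    also have "\<dots> \<le> (M * A * \<epsilon> powr \<gamma> * real h powr \<gamma> * K ^ (k + S) * real h ^ S) / (c1 * real h ^ S)"
    proof (rule frac_le[OF _ S2])
      show "0 \<le> M * A * \<epsilon> powr \<gamma> * real h powr \<gamma> * K ^ (k + S) * real h ^ S"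
        using order_trans[OF norm_ge_zero S2] .
    qed (use psi_sum_lower[OF h] c1 h in \<open>auto simp: c1_def\<close>)
    also have "\<dots> = M / c1 * A * \<epsilon> powr \<gamma> * real h powr \<gamma> * K ^ (k + S)"
      using h c1 by simp
    finally show "cmod (mu h (\<lambda>n. f (emb \<epsilon> x n)) z) \<le> M / c1 * A * \<epsilon> powr \<gamma> * real h powr \<gamma> * (1 + nm z / real h) ^ (k + S)"
      by (simp only: K(2))
  qed
qed

end

context scaled begin

section \<open>The Schauder estimate\<close>

text \<open>Since \<open>Ah\<close> fixes polynomials up to lower order, \<open>1 - (1 - Ah)\<^bsup>q+1\<^esup> = Ah (\<Sum>i\<le>q. (1 - Ah)\<^sup>i)\<close> reproduces
  polynomials of degree at most \<open>q\<close>.\<close>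

definition Ah :: "nat \<Rightarrow> nat \<Rightarrow> zfun \<Rightarrow> zfun" where
  "Ah p h u = (bxs h ^^ p) (mu h u)"

definition Dh :: "nat \<Rightarrow> nat \<Rightarrow> zfun \<Rightarrow> zfun" where
  "Dh p h u = (\<lambda>n. u n - Ah p h u n)"

definition Th :: "nat \<Rightarrow> nat \<Rightarrow> nat \<Rightarrow> zfun \<Rightarrow> zfun" where
  "Th p q h u = (\<lambda>n. \<Sum>i\<le>q. (Dh p h ^^ i) u n)"

text \<open>The radius of \<open>Ah\<close> in units of \<open>h\<close>: \<open>p\<close> box
  averages and one \<open>mu\<close>. Each box average counts \<open>d + 1\<close> instead of
  \<open>d\<close>, to match \<open>dop_bxs\<close>.\<close>

definition cA :: "nat \<Rightarrow> real" where
  "cA p = real p * (real d + 1) + real d"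

lemma cA_nonneg: "0 \<le> cA p" by (simp add: cA_def)

lemma TI_bxs_mu: assumes "1 \<le> h" shows "TI (bxs h ^^ p)" "TI (mu h)"
  by (rule TI_funpow[OF aff_TI[OF bxs_props(1)[OF assms]]], rule aff_TI[OF mu_props(1)[OF assms]])

lemma Ah_props:
  assumes "1 \<le> h" shows "aff (Ah p h)" "avgc 1 (cA p * real h) (Ah p h)" "TI (Ah p h)"
proof -
  show 1: "aff (Ah p h)"
    unfolding Ah_def[abs_def] by (rule aff_comp[OF aff_funpow[OF bxs_props(1)[OF assms]] mu_props(1)[OF assms]])
  then show "TI (Ah p h)" by (rule aff_TI)
  have "avgc (1 ^ p * 1) (real p * (real d * real h) + real d * real h) (Ah p h)"
    unfolding Ah_def[abs_def] by (rule avgc_comp[OF avgc_funpow[OF bxs_props(2)[OF assms]] mu_props(2)[OF assms]])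
  then show "avgc 1 (cA p * real h) (Ah p h)"
    by (rule avgc_mono) (auto simp: cA_def algebra_simps)
qed

lemma Dh_props:
  assumes "1 \<le> h" shows "TI (Dh p h)" "avgc (2 ^ i) (real i * (cA p * real h)) (Dh p h ^^ i)"
proof -
  show "TI (Dh p h)" unfolding Dh_def[abs_def] by (rule TI_diff[OF TI_id Ah_props(3)[OF assms]])
  have "avgc (1 + 1) (cA p * real h) (Dh p h)"
    unfolding Dh_def[abs_def] using cA_nonneg by (intro avgc_diff[OF avgc_id Ah_props(2)[OF assms]]) auto
  then show "avgc (2 ^ i) (real i * (cA p * real h)) (Dh p h ^^ i)"
    using avgc_funpow by simp
qed

lemma Th_props:
  assumes "1 \<le> h" shows "TI (Th p q h)" "avgc (real (Suc q) * 2 ^ q) (real q * (cA p * real h)) (Th p q h)"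
proof -
  show "TI (Th p q h)" unfolding Th_def[abs_def] by (rule TI_sum) (rule TI_funpow[OF Dh_props(1)[OF assms]])
  have "avgc (\<Sum>i\<le>q. 2 ^ q) (real q * (cA p * real h)) (Th p q h)"
    unfolding Th_def[abs_def]
  proof (rule avgc_sum)
    fix i assume i: "i \<in> {..q}"
    show "avgc (2 ^ q) (real q * (cA p * real h)) ((Dh p h ^^ i))"
      using i cA_nonneg by (intro avgc_mono[OF Dh_props(2)[OF assms]]) (auto intro!: mult_right_mono power_increasing)
  qed (use cA_nonneg in auto)
  then show "avgc (real (Suc q) * 2 ^ q) (real q * (cA p * real h)) (Th p q h)" by simp
qed

text \<open>\<open>Ah\<close> is \<open>1 - Dh\<close>, so the sum telescopes and the mollification
  error is a power of \<open>Dh\<close>.\<close>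

lemma Ah_Th: assumes "1 \<le> h" shows "Ah p h (Th p q h u) = (\<lambda>n. u n - (Dh p h ^^ Suc q) u n)"
proof
  fix n
  have "Ah p h (Th p q h u) n = (\<Sum>i\<le>q. Ah p h ((Dh p h ^^ i) u) n)"
    unfolding Th_def TI_lin_sum[OF Ah_props(3)[OF assms]] ..
  also have "\<dots> = (\<Sum>i\<le>q. (Dh p h ^^ i) u n - (Dh p h ^^ Suc i) u n)"
    by (intro sum.cong refl) (simp add: Dh_def)
  also have "\<dots> = u n - (Dh p h ^^ Suc q) u n"
    by (induction q) simp_all
  finally show "Ah p h (Th p q h u) n = u n - (Dh p h ^^ Suc q) u n" .
qed

text \<open>At scale 1 both averages are the identity. The mollified function then equals
  \<open>u\<close>, and the centering of \<open>u\<close> applies to it.\<close>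

lemma Dh_1: "(Dh p 1 ^^ Suc q) u = (\<lambda>n. 0)"
proof -
  have b: "(bxs 1 ^^ p) v = v" for v by (induction p) (simp_all add: bxs_1[unfolded One_nat_def])
  have "mu 1 u = u" by (rule ext) (rule mu_1)
  then have "Dh p 1 u = (\<lambda>n. u n - u n)" by (simp only: Dh_def Ah_def b)
  then have "Dh p 1 u = (\<lambda>n. 0)" by simp
  then have "(Dh p 1 ^^ Suc q) u = (Dh p 1 ^^ q) (\<lambda>n. 0)" by (simp only: funpow_Suc_right comp_def)
  also have "\<dots> = (\<lambda>n. 0)" by (rule TI_lin_0[OF TI_funpow[OF Dh_props(1)]]) simp
  finally show ?thesis .
qed

lemma Dh_kill: assumes "1 \<le> h" "Pol (Suc q) P" "n \<in> Z" shows "(Dh p h ^^ Suc q) P n = 0"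
  using Pol_kill[OF Ah_props(1)[OF assms(1)] assms(2,3), of p] by (simp only: Dh_def[abs_def])

text \<open>The path from the origin to \<open>x\<close> runs parallel to the axes, one coordinate
  after the other, and takes at most \<open>a j\<close> steps in direction \<open>j\<close>.\<close>

lemma path_bound:
  fixes g :: zfun
  assumes x: "x \<in> Z" "\<And>j. j < d \<Longrightarrow> \<bar>real_of_int (x j)\<bar> \<le> a j"
    and B: "\<And>j z. j < d \<Longrightarrow> z \<in> Z \<Longrightarrow> (\<And>i. i < d \<Longrightarrow> \<bar>real_of_int (z i)\<bar> \<le> a i) \<Longrightarrow> cmod (df j g z) \<le> B j"
  shows "cmod (g x) \<le> cmod (g (\<lambda>_. 0)) + (\<Sum>j<d. a j * B j)"
proof -
  let ?x = "\<lambda>k i. if i < k then x i else 0"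
  have a0: "0 \<le> a j" if "j < d" for j using x(2)[OF that] by linarith
  \<comment> \<open>\<open>e\<close> is the orientation of the segment; running backwards, the
    forward difference is taken at the new point instead of the old one.\<close>
  have line: "cmod (g z') \<le> cmod (g z) + real t * B j"
    if j: "j < d" and z: "z \<in> Z" "\<And>i. i < d \<Longrightarrow> \<bar>real_of_int (z i)\<bar> \<le> a i" "z j = 0" and t: "real t \<le> a j" and z': "z' = z(j := e * int t)" "e = 1 \<or> e = -1" for z z' j t e
    using t z'
  proof (induction t arbitrary: z')
    case 0
    have "z(j := 0) = z" using z(3) by auto
    then show ?case using 0 by simp
  next
    case (Suc t)
    let ?y = "z(j := e * int t)"
    have IH: "cmod (g ?y) \<le> cmod (g z) + real t * B j" by (rule Suc.IH[OF _ refl Suc.prems(3)]) (use Suc.prems(1) in simp)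
    have "cmod (g z') \<le> cmod (g ?y) + B j"
    proof (cases "e = 1")
      case True
      have "?y(j := ?y j + 1) = z'" using Suc.prems(2) True by (auto simp: fun_eq_iff)
      then have "df j g ?y = g z' - g ?y" by (simp only: df_def)
      moreover have "cmod (df j g ?y) \<le> B j"
        using Suc.prems True z j by (intro B j) (auto simp: Z_def)
      ultimately show ?thesis using norm_triangle_sub[of "g z'" "g ?y"] by simp
    next
      case False
      then have e: "e = -1" using Suc.prems by simp
      have "z'(j := z' j + 1) = ?y" using Suc.prems(2) e by (auto simp: fun_eq_iff)
      then have "df j g z' = g ?y - g z'" by (simp only: df_def)
      moreover have "cmod (df j g z') \<le> B j"
        using Suc.prems e z j by (intro B j) (auto simp: fun_eq_iff Z_def)
      ultimately show ?thesis using norm_triangle_sub[of "g z'" "g ?y"] by (simp add: norm_minus_commute)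
    qed
    with IH show ?case by (simp add: distrib_right)
  qed
  have "k \<le> d \<Longrightarrow> cmod (g (?x k)) \<le> cmod (g (\<lambda>_. 0)) + (\<Sum>j<k. a j * B j)" for k
  proof (induction k)
    case (Suc k)
    then have k: "k < d" by simp
    have zb: "\<bar>real_of_int (?x k i)\<bar> \<le> a i" if "i < d" for i using x(2)[OF that] a0[OF that] by auto
    have zZ: "?x k \<in> Z" using k by (auto simp: Z_def)
    define e where "e = (if 0 \<le> x k then 1 else -1 :: int)"
    have eq: "?x (Suc k) = (?x k)(k := e * int (nat \<bar>x k\<bar>))"
      by (auto simp: e_def less_Suc_eq fun_eq_iff)
    have t: "real (nat \<bar>x k\<bar>) \<le> a k" using x(2)[OF k] by simp
    have "cmod (g (?x (Suc k))) \<le> cmod (g (?x k)) + real (nat \<bar>x k\<bar>) * B k"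
      by (rule line[OF k zZ zb _ t eq]) (auto simp: e_def)
    also have "real (nat \<bar>x k\<bar>) * B k \<le> a k * B k"
    proof (rule mult_right_mono[OF t])
      have "0 \<le> cmod (df k g (?x k))" by simp
      also have "\<dots> \<le> B k" by (rule B[OF k zZ zb])
      finally show "0 \<le> B k" .
    qed
    finally show ?case using Suc by simp
  qed simp
  from this[of d] have "cmod (g (?x d)) \<le> cmod (g (\<lambda>_. 0)) + (\<Sum>j<d. a j * B j)" by simp
  moreover have "?x d = x" using x(1) by (auto simp: Z_def fun_eq_iff)
  ultimately show ?thesis by simp
qed

lemma df_mw: assumes "j < d" shows "df j (dop (mw \<gamma> True) u) = dop (mw (\<gamma>(j := Suc (\<gamma> j))) True) u"
proof -
  have "mset (concat (map (\<lambda>i. replicate ((\<gamma>(j := Suc (\<gamma> j))) i) (i, True)) [0..<k])) =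
     mset (concat (map (\<lambda>i. replicate (\<gamma> i) (i, True)) [0..<k])) + (if j < k then {#(j, True)#} else {#})" for k
    by (induction k) (auto simp: less_Suc_eq)
  then have "mset ((j, True) # mw \<gamma> True) = mset (mw (\<gamma>(j := Suc (\<gamma> j))) True)"
    using assms by (simp add: mw_def)
  then have "dop ((j, True) # mw \<gamma> True) = dop (mw (\<gamma>(j := Suc (\<gamma> j))) True)"
    using assms mw_words by (intro dop_perm) auto
  then have "dop ((j, True) # mw \<gamma> True) u = dop (mw (\<gamma>(j := Suc (\<gamma> j))) True) u" by simp
  then show ?thesis by (simp add: dl_def)
qed

lemma sdeg_upd: assumes "j < d" shows "sdeg s d (\<gamma>(j := Suc (\<gamma> j))) = sdeg s d \<gamma> + s j"
proof -
  have "sdeg s d (\<gamma>(j := Suc (\<gamma> j))) = s j * Suc (\<gamma> j) + (\<Sum>i\<in>{..<d} - {j}. s i * \<gamma> i)"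
    unfolding sdeg_def using assms by (subst sum.remove[of _ j]) (auto intro!: sum.cong)
  moreover have "sdeg s d \<gamma> = s j * \<gamma> j + (\<Sum>i\<in>{..<d} - {j}. s i * \<gamma> i)"
    unfolding sdeg_def using assms by (subst sum.remove[of _ j]) auto
  ultimately show ?thesis by simp
qed

text \<open>Path summation reduces a difference at \<open>x\<close> to its value at 0 and to
  differences of higher order. Each letter raises the degree by at least 1, so after
  \<open>Suc q\<close> rounds only orders above \<open>q\<close> remain, and by at most
  \<open>m\<close>, so they do not exceed \<open>q + m\<close>. A round costs the factor
  \<open>1 + d\<close>.\<close>

lemma taylor_bound:
  fixes g :: zfun and r :: real
  assumes r: "1 \<le> r" and E: "0 \<le> E0" "0 \<le> E1"
    and low: "\<And>\<gamma>. \<gamma> \<in> MI d \<Longrightarrow> sdeg s d \<gamma> \<le> q \<Longrightarrow> cmod (dop (mw \<gamma> True) g (\<lambda>_. 0)) \<le> E0 * r powr (\<eta> - real (sdeg s d \<gamma>))"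
    and high: "\<And>\<gamma> x. \<gamma> \<in> MI d \<Longrightarrow> q < sdeg s d \<gamma> \<Longrightarrow> sdeg s d \<gamma> \<le> q + m \<Longrightarrow> x \<in> Z \<Longrightarrow> (\<And>j. j < d \<Longrightarrow> \<bar>real_of_int (x j)\<bar> \<le> r ^ s j) \<Longrightarrow>
       cmod (dop (mw \<gamma> True) g x) \<le> E1 * r powr (\<eta> - real (sdeg s d \<gamma>))"
    and sm: "\<And>j. j < d \<Longrightarrow> s j \<le> m"
    and x: "x \<in> Z" "\<And>j. j < d \<Longrightarrow> \<bar>real_of_int (x j)\<bar> \<le> r ^ s j"
  shows "cmod (g x) \<le> (E0 + E1) * (1 + real d) ^ Suc q * r powr \<eta>"
proof -
  have main: "cmod (dop (mw \<gamma> True) g x) \<le> (E0 + E1) * (1 + real d) ^ k * r powr (\<eta> - real (sdeg s d \<gamma>))"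
    if "\<gamma> \<in> MI d" "sdeg s d \<gamma> \<le> q + m" "Suc q \<le> sdeg s d \<gamma> + k" "x \<in> Z" "\<And>j. j < d \<Longrightarrow> \<bar>real_of_int (x j)\<bar> \<le> r ^ s j" for \<gamma> k x
    using that
  proof (induction k arbitrary: \<gamma> x)
    case 0
    then have "cmod (dop (mw \<gamma> True) g x) \<le> E1 * r powr (\<eta> - real (sdeg s d \<gamma>))" by (intro high) auto
    also have "\<dots> \<le> (E0 + E1) * r powr (\<eta> - real (sdeg s d \<gamma>))" using E by (intro mult_right_mono) auto
    finally show ?case by simp
  next
    case (Suc k)
    let ?R = "r powr (\<eta> - real (sdeg s d \<gamma>))"
    have c1: "1 \<le> (1 + real d) ^ Suc k" by (intro one_le_power) auto
    show ?case
    proof (cases "sdeg s d \<gamma> \<le> q")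
      case False
      then have "cmod (dop (mw \<gamma> True) g x) \<le> E1 * ?R" using Suc.prems by (intro high) auto
      also have "\<dots> \<le> (E0 + E1) * (1 + real d) ^ Suc k * ?R"
        using E c1 mult_mono[of E1 "E0 + E1" 1 "(1 + real d) ^ Suc k"] by (intro mult_right_mono) auto
      finally show ?thesis .
    next
      case True
      let ?B = "\<lambda>j. (E0 + E1) * (1 + real d) ^ k * r powr (\<eta> - real (sdeg s d \<gamma>) - real (s j))"
      have "cmod (dop (mw \<gamma> True) g x) \<le> cmod (dop (mw \<gamma> True) g (\<lambda>_. 0)) + (\<Sum>j<d. r ^ s j * ?B j)"
      proof (rule path_bound[OF Suc.prems(4,5)])
        fix j z assume j: "j < d" and z: "z \<in> Z" "\<And>i. i < d \<Longrightarrow> \<bar>real_of_int (z i)\<bar> \<le> r ^ s i"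
        have "cmod (dop (mw (\<gamma>(j := Suc (\<gamma> j))) True) g z) \<le> (E0 + E1) * (1 + real d) ^ k * r powr (\<eta> - real (sdeg s d (\<gamma>(j := Suc (\<gamma> j)))))"
        proof (rule Suc.IH[OF _ _ _ z])
          show "\<gamma>(j := Suc (\<gamma> j)) \<in> MI d" using Suc.prems(1) j by (auto simp: MI_def)
          show "sdeg s d (\<gamma>(j := Suc (\<gamma> j))) \<le> q + m" using True sm[OF j] by (simp add: sdeg_upd[OF j])
          show "Suc q \<le> sdeg s d (\<gamma>(j := Suc (\<gamma> j))) + k"
            using Suc.prems(3) s_pos[OF j] by (simp add: sdeg_upd[OF j])
        qed
        then show "cmod (df j (dop (mw \<gamma> True) g) z) \<le> ?B j"
          unfolding df_mw[OF j] sdeg_upd[OF j] by (simp add: diff_diff_eq)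
      qed
      also have "(\<Sum>j<d. r ^ s j * ?B j) = (\<Sum>j<d. (E0 + E1) * (1 + real d) ^ k * ?R)"
      proof (intro sum.cong refl)
        fix j
        have "r ^ s j = r powr real (s j)" using r by (simp add: powr_realpow)
        then have "r ^ s j * r powr (\<eta> - real (sdeg s d \<gamma>) - real (s j)) = ?R" by (simp add: powr_add[symmetric])
        then show "r ^ s j * ?B j = (E0 + E1) * (1 + real d) ^ k * ?R" by (simp add: mult.left_commute)
      qed
      also have "\<dots> = real d * ((E0 + E1) * (1 + real d) ^ k * ?R)" by simp
      also have "cmod (dop (mw \<gamma> True) g (\<lambda>_. 0)) \<le> (E0 + E1) * (1 + real d) ^ k * ?R"
      proof -
        have "cmod (dop (mw \<gamma> True) g (\<lambda>_. 0)) \<le> E0 * ?R" by (rule low[OF Suc.prems(1) True])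
        also have "\<dots> \<le> (E0 + E1) * (1 + real d) ^ k * ?R"
        proof (rule mult_right_mono)
          have "1 \<le> (1 + real d) ^ k" by (intro one_le_power) auto
          then show "E0 \<le> (E0 + E1) * (1 + real d) ^ k"
            using E mult_mono[of E0 "E0 + E1" 1 "(1 + real d) ^ k"] by auto
        qed simp
        finally show ?thesis .
      qed
      finally show ?thesis by (simp add: algebra_simps)
    qed
  qed
  have z: "(\<lambda>_. 0) \<in> MI d" "sdeg s d (\<lambda>_. 0) = 0" "mw (\<lambda>_. 0) True = []" 
    by (auto simp: MI_def sdeg_def mw_def)
  show ?thesis using main[OF z(1), of "Suc q" x] x by (simp add: z(2,3))
qed

end

text \<open>Two such eighths, one for each parameter, remain below the factor one half to be
  reached.\<close>

lemma small_powr: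
  fixes B e :: real assumes "0 \<le> B" "0 < e"
  shows "\<exists>\<delta>. 0 < \<delta> \<and> \<delta> \<le> 1 \<and> B * \<delta> powr e \<le> 1 / 8"
proof -
  let ?t = "1 / (8 * (B + 1))"
  have t: "0 < ?t" "?t \<le> 1" using assms by (auto simp: divide_le_eq)
  show ?thesis
  proof (intro exI[of _ "?t powr (1 / e)"] conjI)
    show "0 < ?t powr (1 / e)" using t by simp
    have "?t powr (1 / e) \<le> 1 powr (1 / e)" using t assms by (intro powr_mono2) auto
    then show "?t powr (1 / e) \<le> 1" by simp
    have "(?t powr (1 / e)) powr e = ?t" using t assms by (simp add: powr_powr)
    moreover have "B * ?t \<le> 1 / 8" using assms by (simp add: divide_le_eq)
    ultimately show "B * (?t powr (1 / e)) powr e \<le> 1 / 8" by (simp only:)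
  qed
qed

section \<open>The estimate on the unit lattice\<close>

context elliptic begin

text \<open>\<open>u\<close> and \<open>v\<close> are the germ at two base points, both in
  coordinates centred at the first, and \<open>y\<close> is the second. Comparison with
  \<open>v\<close> makes the mollification error at \<open>y\<close> small: \<open>u - v - P\<close>
  is bounded by \<open>M\<close>, \<open>P\<close> is reproduced, and \<open>v\<close> vanishes at
  \<open>y\<close> to order \<open>\<eta>\<close>.\<close>

lemma unit_lattice_step:
  assumes \<alpha>: "0 < \<alpha>" "\<alpha> < \<eta>" and \<eta>: "\<eta> < real m" "\<eta> \<notin> \<nat>" and q: "q = nat \<lfloor>\<eta>\<rfloor>"
  shows "\<exists>C\<ge>0. \<forall>u v P y N A M. 0 \<le> N \<and> 0 \<le> A \<and> 0 \<le> M \<and> y \<in> Z \<and>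
     (\<forall>n\<in>Z. cmod (u n) \<le> N * nm n powr \<eta>) \<and>
     (\<forall>\<gamma>\<in>MI d. real (sdeg s d \<gamma>) \<le> \<eta> \<longrightarrow> dop (mw \<gamma> True) u (\<lambda>_. 0) = 0) \<and>
     (\<forall>h\<ge>1. \<forall>z\<in>Z. cmod (mu h (Lz u) z) \<le> A * real h powr (\<eta> - real m) * (1 + nm z / real h) ^ b) \<and>
     (\<forall>n\<in>Z. cmod (v n) \<le> N * nm (\<lambda>i. n i - y i) powr \<eta>) \<and> Pol (Suc q) P \<and>
     (\<forall>n\<in>Z. cmod (u n - v n - P n) \<le> M * nm (\<lambda>i. n i - y i) powr \<alpha> * (nm y + nm (\<lambda>i. n i - y i)) powr (\<eta> - \<alpha>)) \<longrightarrow>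
     cmod (u y) \<le> (N / 2 + C * (A + M)) * nm y powr \<eta>"
proof -
  have q1: "real q < \<eta>" "\<eta> < real q + 1"
  proof -
    have "0 \<le> \<eta>" using \<alpha> by simp
    then have "real q = of_int \<lfloor>\<eta>\<rfloor>" by (simp add: q)
    moreover have "real q \<noteq> \<eta>" using \<eta>(2) by (metis of_nat_in_Nats)
    ultimately show "real q < \<eta>" "\<eta> < real q + 1" by linarith+
  qed
  have qm: "q < m" using q1(1) \<eta>(1) by linarith
  \<comment> \<open>The Taylor argument needs orders up to \<open>q + m\<close>, which is below
    \<open>2 * m\<close>. Interior regularity then places up to \<open>P0 + d\<close> letters on the
    equation, one for each of the \<open>p\<close> box averages.\<close>
  define P0 where "P0 = 2 * m"
  define p where "p = P0 + d"
  \<comment> \<open>The growth exponent has to dominate both that of the equation and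
    \<open>\<eta>\<close>, which lies below \<open>Suc q\<close>.\<close>
  define b' where "b' = max b (Suc q)"
  obtain CR where CR: "0 \<le> CR" "\<And>r u G H w x. 1 \<le> r \<Longrightarrow> 0 \<le> G \<Longrightarrow> 0 \<le> H \<Longrightarrow> (\<And>n. n \<in> Z \<Longrightarrow> cmod (u n) \<le> G * (1 + nm n / real r) ^ b') \<Longrightarrow>
     (\<And>w n. w\<in>words \<Longrightarrow> length w \<le> P0 + d \<Longrightarrow> n \<in> Z \<Longrightarrow> cmod (dop w (Lz u) n) \<le> H / real r ^ (m + wdeg w) * (1 + nm n / real r) ^ b') \<Longrightarrow>
     w \<in> words \<Longrightarrow> length w \<le> P0 \<Longrightarrow> x\<in>Z \<Longrightarrow> (\<And>j. j < d \<Longrightarrow> \<bar>x j\<bar> \<le> int (r ^ s j)) \<Longrightarrow> cmod (dop w u x) \<le> CR * (G + H) / real r ^ wdeg w"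
    using interior_regularity[of b' P0]
  proof (elim exE conjE)
    fix C assume C: "0 \<le> C" and R: "\<forall>r::nat. \<forall>u G H. 1 \<le> r \<and> 0 \<le> G \<and> 0 \<le> H \<and> (\<forall>n\<in>Z. cmod (u n) \<le> G * (1 + nm n / real r) ^ b') \<and>
     (\<forall>w\<in>words. length w \<le> P0 + d \<longrightarrow> (\<forall>n\<in>Z. cmod (dop w (Lz u) n) \<le> H / real r ^ (m + wdeg w) * (1 + nm n / real r) ^ b')) \<longrightarrow>
     (\<forall>w\<in>words. length w \<le> P0 \<longrightarrow> (\<forall>x\<in>Z. (\<forall>j<d. \<bar>x j\<bar> \<le> int (r ^ s j)) \<longrightarrow> cmod (dop w u x) \<le> C * (G + H) / real r ^ wdeg w))"
    show thesis by (rule that[OF C], rule R[rule_format]) auto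
  qed
  define c2 where "c2 = real (Suc q) * 2 ^ q"
  define c3 where "c3 = real (Suc q) * cA p"
  define c4 where "c4 = 2 ^ p * c2 * (1 + c3) ^ b'"
  define c5 where "c5 = c2 * (1 + c3) powr \<eta>"
  define c7 where "c7 = 2 ^ p * c2 * c3 powr \<eta>"
  have c3: "0 \<le> c3" using cA_nonneg by (simp add: c3_def)
  have c2: "0 \<le> c2" by (simp add: c2_def)
  have c457: "0 \<le> c4" "0 \<le> c5" "0 \<le> c7" using c2 c3 by (auto simp: c4_def c5_def c7_def)
  define D1 where "D1 = (1 + real d) ^ Suc q"
  have D1: "0 \<le> D1" by (simp add: D1_def)
  \<comment> \<open>Makes two contributions proportional to \<open>N\<close> small: the error from
    \<open>v\<close> and the low-order differences of \<open>w\<close> at the origin. The exponent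
    \<open>\<eta> - q\<close> is the least gain among the orders up to \<open>q\<close>.\<close>
  obtain \<delta> where \<delta>: "0 < \<delta>" "\<delta> \<le> 1" "(2 ^ Suc q * c3 powr \<eta> + D1 * c7) * \<delta> powr (\<eta> - real q) \<le> 1 / 8"
    using small_powr[of "2 ^ Suc q * c3 powr \<eta> + D1 * c7" "\<eta> - real q"] D1 c457 q1 by auto
  \<comment> \<open>The reciprocal of the future \<open>K\<close>. Orders above \<open>q\<close>
    gain at least the power \<open>q + 1 - \<eta>\<close> of it, which is positive.\<close>
  obtain \<delta>' where \<delta>': "0 < \<delta>'" "\<delta>' \<le> 1" "D1 * (CR * c5) * \<delta>' powr (real q + 1 - \<eta>) \<le> 1 / 8"
    using small_powr[of "D1 * (CR * c5)" "real q + 1 - \<eta>"] D1 c457 CR(1) q1 by auto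
  obtain K :: nat where K: "1 / \<delta>' \<le> real K" using real_arch_simple by blast
  have K1: "1 \<le> K"
  proof (rule ccontr)
    assume "\<not> 1 \<le> K"
    then have "K = 0" by simp
    then show False using K \<delta>'(1) by simp
  qed
  have Ksmall: "D1 * (CR * c5) * real K powr (\<eta> - (real q + 1)) \<le> 1 / 8"
  proof -
    have "1 / real K \<le> \<delta>'" using K K1 \<delta>' by (simp add: field_simps)
    then have "(1 / real K) powr (real q + 1 - \<eta>) \<le> \<delta>' powr (real q + 1 - \<eta>)" using q1 by (intro powr_mono2) auto
    moreover have "(1 / real K) powr (real q + 1 - \<eta>) = real K powr (\<eta> - (real q + 1))"
      using K1 by (simp add: powr_divide powr_minus_divide[symmetric])
    ultimately have "D1 * (CR * c5) * real K powr (\<eta> - (real q + 1)) \<le> D1 * (CR * c5) * \<delta>' powr (real q + 1 - \<eta>)"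
      using D1 CR(1) c457 by (intro mult_left_mono) auto
    with \<delta>' show ?thesis by simp
  qed
  \<comment> \<open>Bounds \<open>\<rho> / h\<close>, as \<open>\<rho> \<le> 2 * K * r\<close> and
    \<open>\<delta> * r \<le> 2 * h\<close>.\<close>
  define \<Lambda> where "\<Lambda> = 4 * real K / \<delta>"
  \<comment> \<open>The exponent \<open>m + p * m\<close> pays for replacing \<open>h\<close> by
    \<open>\<rho>\<close> in the size of the differences of \<open>Lz w\<close>, and
    \<open>b'\<close> for doing so in the growth factor.\<close>
  define ee where "ee = m + p * m + b'"
  have \<Lambda>: "1 \<le> \<Lambda>"
  proof -
    have "\<delta> \<le> 4 * real K" using \<delta> K1 by linarith
    then show ?thesis using \<delta> by (simp add: \<Lambda>_def le_divide_eq)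
  qed
  define C where "C = 2 ^ Suc q * (1 + c3) powr \<eta> + D1 * (CR * (c4 * \<Lambda> ^ ee))"
  show ?thesis
  proof (intro exI[of _ C] conjI allI impI)
    show "0 \<le> C" using D1 CR(1) c457 \<Lambda> by (simp add: C_def)
    fix u v P :: zfun and y N A M
    assume as: "0 \<le> N \<and> 0 \<le> A \<and> 0 \<le> M \<and> y \<in> Z \<and>
     (\<forall>n\<in>Z. cmod (u n) \<le> N * nm n powr \<eta>) \<and>
     (\<forall>\<gamma>\<in>MI d. real (sdeg s d \<gamma>) \<le> \<eta> \<longrightarrow> dop (mw \<gamma> True) u (\<lambda>_. 0) = 0) \<and>
     (\<forall>h\<ge>1. \<forall>z\<in>Z. cmod (mu h (Lz u) z) \<le> A * real h powr (\<eta> - real m) * (1 + nm z / real h) ^ b) \<and>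
     (\<forall>n\<in>Z. cmod (v n) \<le> N * nm (\<lambda>i. n i - y i) powr \<eta>) \<and> Pol (Suc q) P \<and>
     (\<forall>n\<in>Z. cmod (u n - v n - P n) \<le> M * nm (\<lambda>i. n i - y i) powr \<alpha> * (nm y + nm (\<lambda>i. n i - y i)) powr (\<eta> - \<alpha>))"
    have NAM: "0 \<le> N" "0 \<le> A" "0 \<le> M" and y: "y \<in> Z"
      and un: "\<And>n. n \<in> Z \<Longrightarrow> cmod (u n) \<le> N * nm n powr \<eta>"
      and cen: "\<And>\<gamma>. \<gamma> \<in> MI d \<Longrightarrow> real (sdeg s d \<gamma>) \<le> \<eta> \<Longrightarrow> dop (mw \<gamma> True) u (\<lambda>_. 0) = 0"
      and Lu: "\<And>h z. 1 \<le> h \<Longrightarrow> z \<in> Z \<Longrightarrow> cmod (mu h (Lz u) z) \<le> A * real h powr (\<eta> - real m) * (1 + nm z / real h) ^ b"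
      and vn: "\<And>n. n \<in> Z \<Longrightarrow> cmod (v n) \<le> N * nm (\<lambda>i. n i - y i) powr \<eta>" and P: "Pol (Suc q) P"
      and uvP: "\<And>n. n \<in> Z \<Longrightarrow> cmod (u n - v n - P n) \<le> M * nm (\<lambda>i. n i - y i) powr \<alpha> * (nm y + nm (\<lambda>i. n i - y i)) powr (\<eta> - \<alpha>)"
      using as by auto
    show "cmod (u y) \<le> (N / 2 + C * (A + M)) * nm y powr \<eta>"
    proof (cases "y = (\<lambda>_. 0)")
      case True
      then show ?thesis using un[OF y] by simp
    next
      case False
      define r where "r = nm y"
      have r: "1 \<le> r" unfolding r_def by (rule nm_ge_1[OF y False])
      \<comment> \<open>The scale is an integer and never below the mesh; rounding down a number
        that is at least 2 loses at most a factor 2.\<close>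
      define h where "h = (if \<delta> * r < 2 then 1 else nat \<lfloor>\<delta> * r\<rfloor>)"
      have h1: "1 \<le> h" and hr: "h = 1 \<or> real h \<le> \<delta> * r" and hl: "\<delta> * r \<le> 2 * real h"
      proof -
        show "1 \<le> h" by (auto simp: h_def le_nat_iff le_floor_iff)
        show "h = 1 \<or> real h \<le> \<delta> * r" by (auto simp: h_def)
        show "\<delta> * r \<le> 2 * real h" unfolding h_def by (auto simp: not_less) linarith
      qed
      define \<rho> where "\<rho> = K * nat \<lceil>r\<rceil>"
      have rc: "r \<le> real (nat \<lceil>r\<rceil>)" "real (nat \<lceil>r\<rceil>) \<le> 2 * r" using r by linarith+
      have Kr: "real K * r \<le> real \<rho>" "real \<rho> \<le> 2 * real K * r"
        using rc K1 by (auto simp: \<rho>_def mult_left_mono mult.left_commute)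
      have "1 * r \<le> real K * r" using K1 r by (intro mult_right_mono) auto
      then have rr: "r \<le> real \<rho>" using Kr(1) by linarith
      have \<rho>1: "1 \<le> \<rho>" using rr r by linarith
      have \<delta>r: "\<delta> * r \<le> r" using \<delta> r by (simp add: mult_le_cancel_right1)
      have h\<rho>: "real h \<le> real \<rho>" using hr \<delta>r rr \<rho>1 by linarith
      have \<Lambda>h: "real \<rho> \<le> \<Lambda> * real h"
      proof -
        have "real \<rho> \<le> 2 * real K * r" by (rule Kr)
        also have "\<dots> = (2 * real K / \<delta>) * (\<delta> * r)" using \<delta> by simp
        also have "\<dots> \<le> (2 * real K / \<delta>) * (2 * real h)" using hl \<delta> by (intro mult_left_mono) auto
        finally show ?thesis by (simp add: \<Lambda>_def)
      qed
      have hp: "0 < real h" "0 < real \<rho>" using h1 \<rho>1 by auto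
      define w where "w = Ah p h (Th p q h u)"
      have TIs: "TI (Ah p h)" "TI (Th p q h)" "TI (bxs h ^^ p)" "TI (mu h)" "TI Lz" "TI (Dh p h)"
        by (rule Ah_props(3)[OF h1] Th_props(1)[OF h1] TI_bxs_mu[OF h1] TI_Lz Dh_props(1)[OF h1])+
      have AT: "avgc c2 (c3 * real h) (\<lambda>u. Ah p h (Th p q h u))"
      proof -
        have "avgc (1 * c2) (cA p * real h + real q * (cA p * real h)) (\<lambda>u. Ah p h (Th p q h u))"
          unfolding c2_def by (rule avgc_comp[OF Ah_props(2)[OF h1] Th_props(2)[OF h1]])
        then show ?thesis by (simp add: c3_def algebra_simps)
      qed
      have DT: "avgc (2 ^ length \<beta> / real h ^ wdeg \<beta> * c2) (c3 * real h) (\<lambda>u. dop \<beta> ((bxs h ^^ p) (Th p q h u)))"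
        "avgc (2 ^ length \<beta> / real h ^ wdeg \<beta> * c2) (c3 * real h) (\<lambda>u. dop \<beta> ((bxs h ^^ p) (Th p q h (mu h u))))"
        if "\<beta> \<in> words" "length \<beta> \<le> p" for \<beta>
      proof -
        note 1 = avgc_comp[OF dop_bxs[OF h1 that] Th_props(2)[OF h1, of q p]]
        from 1 show "avgc (2 ^ length \<beta> / real h ^ wdeg \<beta> * c2) (c3 * real h) (\<lambda>u. dop \<beta> ((bxs h ^^ p) (Th p q h u)))"
          unfolding c2_def by (rule avgc_mono) (use c3 in \<open>auto simp: c3_def cA_def algebra_simps\<close>)
        from avgc_comp[OF 1 mu_props(2)[OF h1]]
        show "avgc (2 ^ length \<beta> / real h ^ wdeg \<beta> * c2) (c3 * real h) (\<lambda>u. dop \<beta> ((bxs h ^^ p) (Th p q h (mu h u))))"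
          unfolding c2_def by (rule avgc_mono) (use c3 in \<open>auto simp: c3_def cA_def algebra_simps\<close>)
      qed
      \<comment> \<open>With \<open>mu\<close> innermost it acts on \<open>Lz u\<close>, the form in
        which the equation is controlled, while differences fall on the box averages.\<close>
      have w_eq: "w = (bxs h ^^ p) (Th p q h (mu h u))"
        unfolding w_def Ah_def TI_comm[OF TIs(4,2)] ..
      have gw: "cmod (w n) \<le> c5 * N * real \<rho> powr \<eta> * (1 + nm n / real \<rho>) ^ b'" if n: "n \<in> Z" for n
      proof -
        have "cmod (w n) \<le> c2 * (N * (nm n + c3 * real h) powr \<eta>)"
          unfolding w_def using \<alpha> NAM
          by (intro avgc_growth[where g = "\<lambda>t. N * t powr \<eta>" and u = u, OF AT un] n mult_left_mono powr_mono2) auto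
        also have "(nm n + c3 * real h) powr \<eta> \<le> ((1 + c3) * real \<rho> * (1 + nm n / real \<rho>)) powr \<eta>"
        proof (rule powr_mono2)
          have "c3 * real h \<le> c3 * real \<rho>" using c3 h\<rho> by (intro mult_left_mono) auto
          moreover have "0 \<le> c3 * nm n" using c3 by simp
          moreover have "(1 + c3) * real \<rho> * (1 + nm n / real \<rho>) = real \<rho> + nm n + c3 * real \<rho> + c3 * nm n"
            using hp by (simp add: field_simps)
          ultimately show "nm n + c3 * real h \<le> (1 + c3) * real \<rho> * (1 + nm n / real \<rho>)" using hp by linarith
        qed (use c3 hp \<alpha> in auto)
        also have "\<dots> = (1 + c3) powr \<eta> * real \<rho> powr \<eta> * (1 + nm n / real \<rho>) powr \<eta>"
          by (simp add: powr_mult)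
        also have "(1 + nm n / real \<rho>) powr \<eta> \<le> (1 + nm n / real \<rho>) ^ b'"
        proof -
          have "\<eta> \<le> real b'" using q1 by (simp add: b'_def le_max_iff_disj)
          then have "(1 + nm n / real \<rho>) powr \<eta> \<le> (1 + nm n / real \<rho>) powr real b'" by (intro powr_mono) auto
          then show ?thesis by (simp add: powr_realpow add_pos_nonneg)
        qed
        finally have "cmod (w n) \<le> c2 * (N * ((1 + c3) powr \<eta> * real \<rho> powr \<eta> * (1 + nm n / real \<rho>) ^ b'))"
          using c2 NAM by (simp add: mult_left_mono)
        then show ?thesis by (simp add: c5_def mult_ac)
      qed
      have gL: "cmod (dop \<beta> (Lz w) n) \<le> c4 * \<Lambda> ^ ee * A * real \<rho> powr \<eta> / real \<rho> ^ (m + wdeg \<beta>) * (1 + nm n / real \<rho>) ^ b'"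
        if \<beta>: "\<beta> \<in> words" "length \<beta> \<le> P0 + d" and n: "n \<in> Z" for \<beta> n
      proof -
        have lp: "length \<beta> \<le> p" using \<beta> by (simp add: p_def)
        have eq: "dop \<beta> (Lz w) = dop \<beta> ((bxs h ^^ p) (Th p q h (mu h (Lz u))))"
          unfolding w_eq TI_comm[OF TIs(5,3)] TI_comm[OF TIs(5,2)] TI_comm[OF TIs(5,4)] ..
        have f: "cmod (mu h (Lz u) z) \<le> A * real h powr (\<eta> - real m) * (1 + nm z / real h) ^ b'" if "z \<in> Z" for z
        proof -
          have "(1 + nm z / real h) ^ b \<le> (1 + nm z / real h) ^ b'" by (intro power_increasing) (auto simp: b'_def)
          then have "A * real h powr (\<eta> - real m) * (1 + nm z / real h) ^ b \<le> A * real h powr (\<eta> - real m) * (1 + nm z / real h) ^ b'"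
            using NAM by (intro mult_left_mono) auto
          with Lu[OF h1 that] show ?thesis by linarith
        qed
        have "cmod (dop \<beta> (Lz w) n) \<le> (2 ^ length \<beta> / real h ^ wdeg \<beta> * c2) * (A * real h powr (\<eta> - real m) * (1 + (nm n + c3 * real h) / real h) ^ b')"
          unfolding eq
          by (rule avgc_growth[where g = "\<lambda>t. A * real h powr (\<eta> - real m) * (1 + t / real h) ^ b'" and u = "mu h (Lz u)", OF DT(1)[OF \<beta>(1) lp] f])
            (use n NAM hp in \<open>auto intro!: mult_left_mono power_mono divide_right_mono add_nonneg_nonneg\<close>)
        also have "\<dots> \<le> (2 ^ p / real h ^ wdeg \<beta> * c2) * (A * real h powr (\<eta> - real m) * ((1 + c3) * (\<Lambda> * (1 + nm n / real \<rho>))) ^ b')"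
        proof (intro mult_mono mult_left_mono power_mono divide_right_mono power_increasing lp)
          have "nm n / real h \<le> \<Lambda> * (nm n / real \<rho>)"
          proof -
            have "nm n * real \<rho> \<le> nm n * (\<Lambda> * real h)" using \<Lambda>h by (intro mult_left_mono) auto
            then show ?thesis using hp by (simp add: field_simps)
          qed
          then have "1 + nm n / real h \<le> \<Lambda> * (1 + nm n / real \<rho>)" using \<Lambda> by (simp add: distrib_left)
          then have "(1 + c3) * (1 + nm n / real h) \<le> (1 + c3) * (\<Lambda> * (1 + nm n / real \<rho>))" using c3 by (intro mult_left_mono) auto
          moreover have "1 + (nm n + c3 * real h) / real h \<le> (1 + c3) * (1 + nm n / real h)"
            using hp c3 by (simp add: add_divide_distrib algebra_simps)
          ultimately show "1 + (nm n + c3 * real h) / real h \<le> (1 + c3) * (\<Lambda> * (1 + nm n / real \<rho>))" by simp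
        qed (use c2 c3 NAM hp \<Lambda> in \<open>auto intro!: mult_nonneg_nonneg add_nonneg_nonneg\<close>)
        also have "\<dots> = c4 * \<Lambda> ^ b' * A * (real h powr (\<eta> - real m) / real h ^ wdeg \<beta>) * (1 + nm n / real \<rho>) ^ b'"
          by (simp add: c4_def power_mult_distrib mult_ac)
        also have "\<dots> \<le> c4 * \<Lambda> ^ b' * A * (\<Lambda> ^ (m + p * m) * (real \<rho> powr \<eta> / real \<rho> ^ (m + wdeg \<beta>))) * (1 + nm n / real \<rho>) ^ b'"
        proof (intro mult_right_mono mult_left_mono)
          \<comment> \<open>Nonnegative because \<open>\<eta> < m\<close>, so passing from
            \<open>h\<close> to \<open>\<rho>\<close> costs only powers of
            \<open>\<Lambda>\<close>.\<close>
          let ?t = "real m + real (wdeg \<beta>) - \<eta>"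
          have t: "0 \<le> ?t" using \<eta> by simp
          have wd: "wdeg \<beta> \<le> p * m"
          proof -
            have "w \<in> words \<Longrightarrow> wdeg w \<le> length w * m" for w
              by (induction w) (auto intro: add_mono s_le_m)
            from this[OF \<beta>(1)] have "wdeg \<beta> \<le> length \<beta> * m" .
            also have "\<dots> \<le> p * m" using lp by (intro mult_right_mono) auto
            finally show ?thesis .
          qed
          have "(real \<rho>) powr ?t \<le> (\<Lambda> * real h) powr ?t" using \<Lambda>h hp t by (intro powr_mono2) auto
          also have "\<dots> = \<Lambda> powr ?t * real h powr ?t" by (rule powr_mult)
          also have "\<Lambda> powr ?t \<le> \<Lambda> powr real (m + p * m)"
            using \<Lambda> wd \<alpha> \<eta> by (intro powr_mono) (auto simp flip: of_nat_mult)
          also have "\<Lambda> powr real (m + p * m) = \<Lambda> ^ (m + p * m)" using \<Lambda> by (intro powr_realpow) auto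
          finally have le: "real \<rho> powr ?t \<le> \<Lambda> ^ (m + p * m) * real h powr ?t" by (simp add: mult_right_mono)
          have hh: "real h powr (\<eta> - real m) / real h ^ wdeg \<beta> = 1 / real h powr ?t"
          proof -
            have "real h powr (\<eta> - real m) / real h ^ wdeg \<beta> = real h powr (\<eta> - real m - real (wdeg \<beta>))"
              using hp by (simp add: powr_diff powr_realpow)
            also have "\<dots> = real h powr (- ?t)" by (rule arg_cong[where f = "(powr) (real h)"]) simp
            finally show ?thesis by (simp only: powr_minus_divide)
          qed
          have rh: "real \<rho> powr \<eta> / real \<rho> ^ (m + wdeg \<beta>) = 1 / real \<rho> powr ?t"
          proof -
            have "real \<rho> powr \<eta> / real \<rho> ^ (m + wdeg \<beta>) = real \<rho> powr (\<eta> - real (m + wdeg \<beta>))"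
              using hp by (simp only: powr_diff powr_realpow)
            also have "\<dots> = real \<rho> powr (- ?t)" by (rule arg_cong[where f = "(powr) (real \<rho>)"]) simp
            finally show ?thesis by (simp only: powr_minus_divide)
          qed
          have pp: "0 < real h powr ?t" "0 < real \<rho> powr ?t" using hp by auto
          show "real h powr (\<eta> - real m) / real h ^ wdeg \<beta> \<le> \<Lambda> ^ (m + p * m) * (real \<rho> powr \<eta> / real \<rho> ^ (m + wdeg \<beta>))"
            unfolding hh rh using le pp by (simp add: field_simps)
        qed (use c457 \<Lambda> NAM in auto)
        also have "\<dots> = c4 * \<Lambda> ^ ee * A * real \<rho> powr \<eta> / real \<rho> ^ (m + wdeg \<beta>) * (1 + nm n / real \<rho>) ^ b'"
          by (simp add: ee_def power_add mult_ac)
        finally show ?thesis .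
      qed
      define E1 where "E1 = CR * (c5 * N * real K powr (\<eta> - (real q + 1)) + c4 * \<Lambda> ^ ee * A)"
      define E0 where "E0 = c7 * N * \<delta> powr (\<eta> - real q)"
      have E: "0 \<le> E0" "0 \<le> E1" using c457 NAM CR(1) \<Lambda> by (auto simp: E0_def E1_def)
      have "cmod (w y) \<le> (E0 + E1) * (1 + real d) ^ Suc q * r powr \<eta>"
      proof (rule taylor_bound[OF r E])
        fix j assume "j < d" then show "s j \<le> m" by (rule s_le_m)
      next
        fix j assume "j < d" then show "\<bar>real_of_int (y j)\<bar> \<le> r ^ s j" unfolding r_def by (rule abs_le_nm_pow)
      next
        show "y \<in> Z" by (rule y)
      next
        fix \<gamma> assume \<gamma>: "\<gamma> \<in> MI d" "sdeg s d \<gamma> \<le> q"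
        let ?g = "sdeg s d \<gamma>"
        show "cmod (dop (mw \<gamma> True) w (\<lambda>_. 0)) \<le> E0 * r powr (\<eta> - real ?g)"
        proof (cases "h = 1")
          case True
          have "w = u" unfolding w_def Ah_Th[OF h1] using True Dh_1 by simp
          then have "dop (mw \<gamma> True) w (\<lambda>_. 0) = 0" using cen[OF \<gamma>(1)] \<gamma>(2) q1 by simp
          then show ?thesis using E by simp
        next
          case False
          then have h2: "real h \<le> \<delta> * r" using hr by simp
          have lw: "length (mw \<gamma> True) \<le> p" using length_le_wdeg[OF mw_words, of \<gamma> True] \<gamma>(2) qm by (simp add: wdeg_mw p_def P0_def)
          have "cmod (dop (mw \<gamma> True) w (\<lambda>_. 0)) \<le> (2 ^ length (mw \<gamma> True) / real h ^ ?g * c2) * (N * (nm (\<lambda>_. 0) + c3 * real h) powr \<eta>)"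
            unfolding w_eq wdeg_mw[of \<gamma> True, symmetric] using \<alpha> NAM
            by (intro avgc_growth[where g = "\<lambda>t. N * t powr \<eta>" and u = u, OF DT(2)[OF mw_words lw] un] mult_left_mono powr_mono2) auto
          also have "\<dots> \<le> (2 ^ p / real h ^ ?g * c2) * (N * (c3 powr \<eta> * real h powr \<eta>))"
            using lw c2 hp NAM by (auto simp: powr_mult intro!: mult_right_mono divide_right_mono power_increasing)
          also have "\<dots> = c7 * N * (real h powr \<eta> / real h ^ ?g)" by (simp add: c7_def mult_ac)
          also have "real h powr \<eta> / real h ^ ?g = real h powr (\<eta> - real ?g)" using hp by (simp add: powr_diff powr_realpow)
          also have "\<dots> \<le> (\<delta> * r) powr (\<eta> - real ?g)" using h2 hp \<gamma>(2) q1 by (intro powr_mono2) auto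
          also have "\<dots> = \<delta> powr (\<eta> - real ?g) * r powr (\<eta> - real ?g)" by (rule powr_mult)
          also have "\<delta> powr (\<eta> - real ?g) \<le> \<delta> powr (\<eta> - real q)" using \<delta> \<gamma>(2) by (intro powr_mono') auto
          finally have "cmod (dop (mw \<gamma> True) w (\<lambda>_. 0)) \<le> c7 * N * (\<delta> powr (\<eta> - real q) * r powr (\<eta> - real ?g))"
            using c457 NAM by (simp add: mult_left_mono mult_right_mono)
          then show ?thesis by (simp add: E0_def mult_ac)
        qed
      next
        fix \<gamma> x assume \<gamma>: "\<gamma> \<in> MI d" "q < sdeg s d \<gamma>" "sdeg s d \<gamma> \<le> q + m" and x: "x \<in> Z" "\<And>j. j < d \<Longrightarrow> \<bar>real_of_int (x j)\<bar> \<le> r ^ s j"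
        let ?g = "sdeg s d \<gamma>"
        have lw: "length (mw \<gamma> True) \<le> P0" using length_le_wdeg[OF mw_words, of \<gamma> True] \<gamma>(3) qm by (simp add: wdeg_mw P0_def)
        have xb: "\<bar>x j\<bar> \<le> int (\<rho> ^ s j)" if "j < d" for j
        proof -
          have "\<bar>real_of_int (x j)\<bar> \<le> r ^ s j" by (rule x(2)[OF that])
          also have "\<dots> \<le> real \<rho> ^ s j" using rr r by (intro power_mono) auto
          finally have "real_of_int \<bar>x j\<bar> \<le> real_of_int (int (\<rho> ^ s j))" by simp
          then show ?thesis by (simp only: of_int_le_iff)
        qed
        have "cmod (dop (mw \<gamma> True) w x) \<le> CR * (c5 * N * real \<rho> powr \<eta> + c4 * \<Lambda> ^ ee * A * real \<rho> powr \<eta>) / real \<rho> ^ wdeg (mw \<gamma> True)"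
          by (rule CR(2)[OF \<rho>1 _ _ gw gL mw_words lw x(1) xb]) (use c457 NAM \<Lambda> in auto)
        also have "\<dots> = CR * (c5 * N + c4 * \<Lambda> ^ ee * A) * (real \<rho> powr \<eta> / real \<rho> ^ ?g)"
          by (simp add: wdeg_mw algebra_simps add_divide_distrib)
        also have "real \<rho> powr \<eta> / real \<rho> ^ ?g = real \<rho> powr (\<eta> - real ?g)" using hp by (simp add: powr_diff powr_realpow)
        \<comment> \<open>For orders above \<open>q\<close> the exponent is negative, so enlarging
          the regularity scale improves the bound.\<close>
        also have "\<dots> \<le> (real K * r) powr (\<eta> - real ?g)" using Kr K1 r q1 \<gamma>(2) by (intro powr_mono2') auto
        also have "\<dots> = real K powr (\<eta> - real ?g) * r powr (\<eta> - real ?g)" by (rule powr_mult)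
        also have "real K powr (\<eta> - real ?g) \<le> real K powr (\<eta> - (real q + 1))" using K1 \<gamma>(2) by (intro powr_mono) auto
        finally have 1: "cmod (dop (mw \<gamma> True) w x) \<le> CR * (c5 * N + c4 * \<Lambda> ^ ee * A) * (real K powr (\<eta> - (real q + 1)) * r powr (\<eta> - real ?g))"
          using CR(1) c457 NAM \<Lambda> by (simp add: mult_left_mono mult_right_mono)
        have k1: "real K powr (\<eta> - (real q + 1)) \<le> 1"
          using K1 q1 powr_mono[of "\<eta> - (real q + 1)" 0 "real K"] by simp
        have "c4 * \<Lambda> ^ ee * A * real K powr (\<eta> - (real q + 1)) \<le> c4 * \<Lambda> ^ ee * A * 1"
          using k1 c457 NAM \<Lambda> by (intro mult_left_mono) auto
        then have "CR * (c5 * N + c4 * \<Lambda> ^ ee * A) * real K powr (\<eta> - (real q + 1)) \<le> E1"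
          unfolding E1_def mult.assoc[of CR] using CR(1) by (intro mult_left_mono) (auto simp: distrib_right)
        then have "CR * (c5 * N + c4 * \<Lambda> ^ ee * A) * real K powr (\<eta> - (real q + 1)) * r powr (\<eta> - real ?g) \<le> E1 * r powr (\<eta> - real ?g)"
          by (intro mult_right_mono) auto
        with 1 show "cmod (dop (mw \<gamma> True) w x) \<le> E1 * r powr (\<eta> - real ?g)" by (simp add: mult.assoc)
      qed
      then have wy: "cmod (w y) \<le> D1 * (E0 + E1) * r powr \<eta>" by (simp add: D1_def mult_ac)
      have uw: "cmod (u y - w y) \<le> (2 ^ Suc q * (1 + c3) powr \<eta> * M + 2 ^ Suc q * c3 powr \<eta> * \<delta> powr (\<eta> - real q) * N) * r powr \<eta>"
      proof (cases "h = 1")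
        case True
        have "w = u" unfolding w_def Ah_Th[OF h1] using True Dh_1 by simp
        then show ?thesis using NAM c3 by simp
      next
        case False
        then have h2: "real h \<le> \<delta> * r" using hr by simp
        then have h3: "real h \<le> r" using \<delta>r by simp
        let ?D = "Dh p h ^^ Suc q"
        have TD: "TI ?D" by (rule TI_funpow[OF TIs(6)])
        have aD: "avgc (2 ^ Suc q) (c3 * real h) ?D" using Dh_props(2)[OF h1, of "Suc q" p] by (simp add: c3_def mult.assoc)
        \<comment> \<open>The error operator is evaluated at \<open>y\<close>, where it annihilates
          \<open>P\<close> and sees \<open>v\<close> only within a multiple of
          \<open>h\<close>.\<close>
        have "u y - w y = ?D u y" unfolding w_def Ah_Th[OF h1] by simp
        also have "?D u y = ?D (\<lambda>n. (u n - v n - P n) + (v n + P n)) y" by simp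
        also have "\<dots> = ?D (\<lambda>n. u n - v n - P n) y + (?D v y + ?D P y)"
          unfolding TI_lin_add[OF TD] ..
        also have "?D P y = 0" by (rule Dh_kill[OF h1 P y])
        finally have eq: "u y - w y = ?D (\<lambda>n. u n - v n - P n) y + ?D v y" by simp
        have 1: "cmod (?D (\<lambda>n. u n - v n - P n) y) \<le> 2 ^ Suc q * (M * ((1 + c3) powr \<eta> * r powr \<eta>))"
        proof (rule avgcD[OF aD y])
          fix k assume k: "k \<in> Z" "nm (\<lambda>i. k i - y i) \<le> c3 * real h"
          have kr: "nm (\<lambda>i. k i - y i) \<le> c3 * r"
            using k(2) mult_left_mono[OF h3 c3] by linarith
          have "cmod (u k - v k - P k) \<le> M * (nm (\<lambda>i. k i - y i) powr \<alpha> * (nm y + nm (\<lambda>i. k i - y i)) powr (\<eta> - \<alpha>))"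
            using uvP[OF k(1)] by (simp add: mult.assoc)
          also have "\<dots> \<le> M * (((1 + c3) * r) powr \<alpha> * ((1 + c3) * r) powr (\<eta> - \<alpha>))"
            using kr r c3 \<alpha> NAM unfolding r_def[symmetric]
            by (intro mult_left_mono mult_mono powr_mono2) (auto simp: distrib_right)
          also have "((1 + c3) * r) powr \<alpha> * ((1 + c3) * r) powr (\<eta> - \<alpha>) = ((1 + c3) * r) powr \<eta>" by (simp add: powr_add[symmetric])
          also have "\<dots> = (1 + c3) powr \<eta> * r powr \<eta>" by (rule powr_mult)
          finally show "cmod (u k - v k - P k) \<le> M * ((1 + c3) powr \<eta> * r powr \<eta>)" .
        qed
        have 2: "cmod (?D v y) \<le> 2 ^ Suc q * (N * (c3 powr \<eta> * (\<delta> powr (\<eta> - real q) * r powr \<eta>)))"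
        proof (rule avgcD[OF aD y])
          fix k assume k: "k \<in> Z" "nm (\<lambda>i. k i - y i) \<le> c3 * real h"
          have kr: "nm (\<lambda>i. k i - y i) \<le> c3 * (\<delta> * r)"
            using k(2) mult_left_mono[OF h2 c3] by linarith
          have "cmod (v k) \<le> N * nm (\<lambda>i. k i - y i) powr \<eta>" by (rule vn[OF k(1)])
          also have "\<dots> \<le> N * (c3 * (\<delta> * r)) powr \<eta>" using kr NAM \<alpha> by (intro mult_left_mono powr_mono2) auto
          also have "(c3 * (\<delta> * r)) powr \<eta> = c3 powr \<eta> * (\<delta> powr \<eta> * r powr \<eta>)" by (simp add: powr_mult)
          also have "\<delta> powr \<eta> \<le> \<delta> powr (\<eta> - real q)" using \<delta> by (intro powr_mono') auto
          finally show "cmod (v k) \<le> N * (c3 powr \<eta> * (\<delta> powr (\<eta> - real q) * r powr \<eta>))"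
            using NAM by (simp add: mult_left_mono mult_right_mono)
        qed
        have "cmod (u y - w y) \<le> 2 ^ Suc q * (M * ((1 + c3) powr \<eta> * r powr \<eta>)) + 2 ^ Suc q * (N * (c3 powr \<eta> * (\<delta> powr (\<eta> - real q) * r powr \<eta>)))"
          unfolding eq using norm_triangle_ineq[of "?D (\<lambda>n. u n - v n - P n) y" "?D v y"] 1 2 by linarith
        then show ?thesis by (simp add: algebra_simps)
      qed
      have "cmod (u y) \<le> cmod (u y - w y) + cmod (w y)" using norm_triangle_ineq[of "u y - w y" "w y"] by simp
      also have "\<dots> \<le> ((2 ^ Suc q * (1 + c3) powr \<eta> * M + 2 ^ Suc q * c3 powr \<eta> * \<delta> powr (\<eta> - real q) * N) + D1 * (E0 + E1)) * r powr \<eta>"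
        using uw wy by (simp only: distrib_right)
      also have "\<dots> \<le> (N / 2 + C * (A + M)) * r powr \<eta>"
      proof (rule mult_right_mono)
        have e1: "(2 ^ Suc q * c3 powr \<eta> + D1 * c7) * \<delta> powr (\<eta> - real q) * N \<le> 1 / 8 * N"
          using \<delta>(3) NAM by (intro mult_right_mono) auto
        have e2: "D1 * (CR * c5) * real K powr (\<eta> - (real q + 1)) * N \<le> 1 / 8 * N"
          using Ksmall NAM by (intro mult_right_mono) auto
        have e3: "2 ^ Suc q * (1 + c3) powr \<eta> * M \<le> C * M"
          using D1 CR(1) c457 \<Lambda> NAM by (intro mult_right_mono) (auto simp: C_def)
        have e4: "D1 * (CR * (c4 * \<Lambda> ^ ee)) * A \<le> C * A"
          using NAM by (intro mult_right_mono) (auto simp: C_def)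
        have "(2 ^ Suc q * (1 + c3) powr \<eta> * M + 2 ^ Suc q * c3 powr \<eta> * \<delta> powr (\<eta> - real q) * N) + D1 * (E0 + E1)
          = 2 ^ Suc q * (1 + c3) powr \<eta> * M + (2 ^ Suc q * c3 powr \<eta> + D1 * c7) * \<delta> powr (\<eta> - real q) * N
            + D1 * (CR * c5) * real K powr (\<eta> - (real q + 1)) * N + D1 * (CR * (c4 * \<Lambda> ^ ee)) * A"
          unfolding E0_def E1_def by (simp only: distrib_left distrib_right mult_ac add_ac)
        also have "\<dots> \<le> C * M + 1 / 8 * N + 1 / 8 * N + C * A" using e1 e2 e3 e4 by linarith
        also have "\<dots> \<le> N / 2 + C * (A + M)" using NAM by (simp add: distrib_left)
        finally show "(2 ^ Suc q * (1 + c3) powr \<eta> * M + 2 ^ Suc q * c3 powr \<eta> * \<delta> powr (\<eta> - real q) * N) + D1 * (E0 + E1) \<le> N / 2 + C * (A + M)" .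
      qed simp
      finally show ?thesis by (simp only: r_def)
    qed
  qed
qed

end

section \<open>Transfer between the lattice of mesh \<epsilon> and the unit lattice\<close>

context scaled begin

lemma emb_0: "emb \<epsilon> x (\<lambda>_. 0) = x"
  by (simp add: emb_def)

lemma emb_upd: "(emb \<epsilon> x n)(j := emb \<epsilon> x n j + \<epsilon> ^ s j) = emb \<epsilon> x (n(j := n j + 1))"
    "(emb \<epsilon> x n)(j := emb \<epsilon> x n j - \<epsilon> ^ s j) = emb \<epsilon> x (n(j := n j - 1))"
  by (auto simp: emb_def algebra_simps)

text \<open>Stated for an abstract family \<open>D\<close> to cover forward and backward differences
  at once.\<close>

lemma fold_diff_emb:
  assumes D: "\<And>j f. j < d \<Longrightarrow> (\<lambda>n. D j f (emb \<epsilon> x n)) = (\<lambda>n. of_real (1 / \<epsilon> ^ s j) * dl (j, b) (\<lambda>n. f (emb \<epsilon> x n)) n)"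
  shows "(\<lambda>n. foldr (\<lambda>j f. (D j ^^ \<gamma> j) f) [0..<d] f (emb \<epsilon> x n)) = (\<lambda>n. of_real (1 / \<epsilon> ^ sdeg s d \<gamma>) * dop (mw \<gamma> b) (\<lambda>n. f (emb \<epsilon> x n)) n)"
proof -
  have pow: "(\<lambda>n. (D j ^^ k) f (emb \<epsilon> x n)) = (\<lambda>n. of_real (1 / \<epsilon> ^ (s j * k)) * dop (replicate k (j, b)) (\<lambda>n. f (emb \<epsilon> x n)) n)"
    if "j < d" for j k f
  proof (induction k)
    case (Suc k)
    have "(\<lambda>n. (D j ^^ Suc k) f (emb \<epsilon> x n)) = (\<lambda>n. D j ((D j ^^ k) f) (emb \<epsilon> x n))" by simp
    also have "\<dots> = (\<lambda>n. of_real (1 / \<epsilon> ^ s j) * dl (j, b) (\<lambda>n. (D j ^^ k) f (emb \<epsilon> x n)) n)" by (rule D[OF that])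
    also have "\<dots> = (\<lambda>n. of_real (1 / \<epsilon> ^ s j) * (of_real (1 / \<epsilon> ^ (s j * k)) * dl (j, b) (dop (replicate k (j, b)) (\<lambda>n. f (emb \<epsilon> x n))) n))"
      unfolding Suc using that by (subst TI_lin_scale[OF TI_dl]) auto
    finally show ?case by (simp add: power_add)
  qed simp
  have "(\<lambda>n. foldr (\<lambda>j f. (D j ^^ \<gamma> j) f) xs f (emb \<epsilon> x n)) =
     (\<lambda>n. of_real (1 / \<epsilon> ^ (\<Sum>j\<leftarrow>xs. s j * \<gamma> j)) * dop (concat (map (\<lambda>j. replicate (\<gamma> j) (j, b)) xs)) (\<lambda>n. f (emb \<epsilon> x n)) n)"
    if "set xs \<subseteq> {..<d}" for xs
    using that
  proof (induction xs)
    case (Cons j xs)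
    have j: "j < d" and r: "replicate (\<gamma> j) (j, b) \<in> words" using Cons.prems by (auto simp: words_def)
    have IH: "(\<lambda>n. foldr (\<lambda>j f. (D j ^^ \<gamma> j) f) xs f (emb \<epsilon> x n)) =
     (\<lambda>n. of_real (1 / \<epsilon> ^ (\<Sum>j\<leftarrow>xs. s j * \<gamma> j)) * dop (concat (map (\<lambda>j. replicate (\<gamma> j) (j, b)) xs)) (\<lambda>n. f (emb \<epsilon> x n)) n)"
      using Cons by simp
    have "(\<lambda>n. foldr (\<lambda>j f. (D j ^^ \<gamma> j) f) (j # xs) f (emb \<epsilon> x n)) = (\<lambda>n. (D j ^^ \<gamma> j) (foldr (\<lambda>j f. (D j ^^ \<gamma> j) f) xs f) (emb \<epsilon> x n))"
      by simp
    also have "\<dots> = (\<lambda>n. of_real (1 / \<epsilon> ^ (s j * \<gamma> j)) * dop (replicate (\<gamma> j) (j, b)) (\<lambda>n. foldr (\<lambda>j f. (D j ^^ \<gamma> j) f) xs f (emb \<epsilon> x n)) n)"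
      by (rule pow[OF j])
    also have "\<dots> = (\<lambda>n. of_real (1 / \<epsilon> ^ (s j * \<gamma> j)) * (of_real (1 / \<epsilon> ^ (\<Sum>j\<leftarrow>xs. s j * \<gamma> j)) *
        dop (replicate (\<gamma> j) (j, b)) (dop (concat (map (\<lambda>j. replicate (\<gamma> j) (j, b)) xs)) (\<lambda>n. f (emb \<epsilon> x n))) n))"
      unfolding IH TI_lin_scale[OF TI_dop[OF r]] ..
    finally show ?case by (simp add: power_add)
  qed simp
  from this[of "[0..<d]"] show ?thesis
    by (simp add: mw_def sdeg_def atLeast0LessThan interv_sum_list_conv_sum_set_nat)
qed

lemma Dgam_emb: "(\<lambda>n. Dgam s d \<epsilon> \<gamma> f (emb \<epsilon> x n)) = (\<lambda>n. of_real (1 / \<epsilon> ^ sdeg s d \<gamma>) * dop (mw \<gamma> True) (\<lambda>n. f (emb \<epsilon> x n)) n)"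
  unfolding Dgam_def by (rule fold_diff_emb) (simp add: fwd_diff_def dl_def df_def emb_upd)

lemma Dbar_emb: "(\<lambda>n. Dbar s d \<epsilon> \<gamma> f (emb \<epsilon> x n)) = (\<lambda>n. of_real (1 / \<epsilon> ^ sdeg s d \<gamma>) * dop (mw \<gamma> False) (\<lambda>n. f (emb \<epsilon> x n)) n)"
  unfolding Dbar_def by (rule fold_diff_emb) (simp add: bwd_diff_def dl_def db_def emb_upd)

lemma sdist_emb: assumes "0 < \<epsilon>" shows "sdist s d (emb \<epsilon> x k) (emb \<epsilon> x n) = \<epsilon> * nm (\<lambda>i. n i - k i)"
proof -
  have "\<bar>emb \<epsilon> x k i - emb \<epsilon> x n i\<bar> powr (1 / real (s i)) = \<epsilon> * \<bar>real_of_int (n i - k i)\<bar> powr (1 / real (s i))"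
    if i: "i < d" for i
  proof -
    have "emb \<epsilon> x k i - emb \<epsilon> x n i = \<epsilon> ^ s i * real_of_int (k i - n i)" by (simp add: emb_def algebra_simps)
    then have "\<bar>emb \<epsilon> x k i - emb \<epsilon> x n i\<bar> = \<epsilon> ^ s i * \<bar>real_of_int (n i - k i)\<bar>"
      using assms by (simp add: abs_mult abs_minus_commute)
    moreover have "(\<epsilon> ^ s i) powr (1 / real (s i)) = \<epsilon>" using assms s_pos[OF i] by (simp add: powr_realpow[symmetric] powr_powr)
    ultimately show ?thesis by (simp add: powr_mult)
  qed
  then show ?thesis by (simp add: sdist_def nm_def sum_distrib_left)
qed

text \<open>Since all \<open>s j\<close> are at least 1, the ordinary degree is at most the scaled
  one, and the affine change of variables preserves it.\<close>

lemma Pol_poly_space: assumes "P \<in> poly_space s d q" shows "Pol (Suc q) (\<lambda>n. P (emb \<epsilon> x n))"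
proof -
  obtain c where P: "P = (\<lambda>z. \<Sum>\<beta>\<in>{\<beta>\<in>MI d. sdeg s d \<beta> \<le> q}. c \<beta> * of_real (\<Prod>j<d. z j ^ \<beta> j))"
    using assms by (auto simp: poly_space_def)
  show ?thesis
    unfolding P
  proof (rule Pol_sum, rule Pol_scale)
    fix \<beta> assume \<beta>: "\<beta> \<in> {\<beta>\<in>MI d. sdeg s d \<beta> \<le> q}"
    have "(\<Sum>j<d. \<beta> j) \<le> sdeg s d \<beta>" unfolding sdeg_def using s_pos by (intro sum_mono) auto
    then have le: "Suc (\<Sum>j<d. \<beta> j) \<le> Suc q" using \<beta> by simp
    have "Pol (Suc (\<Sum>j<d. \<beta> j)) (\<lambda>n. \<Prod>j<d. of_real (x j + \<epsilon> ^ s j * real_of_int (n j)) ^ \<beta> j)"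
      by (rule Pol_prod_power) (rule Pol_coord)
    then have "Pol (Suc q) (\<lambda>n. \<Prod>j<d. of_real (x j + \<epsilon> ^ s j * real_of_int (n j)) ^ \<beta> j)" by (rule Pol_mono[OF le])
    then show "Pol (Suc q) (\<lambda>n. of_real (\<Prod>j<d. emb \<epsilon> x n j ^ \<beta> j))"
      by (simp only: of_real_prod of_real_power emb_def)
  qed
qed

end

context elliptic begin

text \<open>All terms have the same total scaled order \<open>m\<close>, so the powers of the mesh
  combine into one factor.\<close>

lemma Lop_emb: "(\<lambda>n. Lop s d m a \<epsilon> f (emb \<epsilon> x n)) = (\<lambda>n. of_real (1 / \<epsilon> ^ m) * Lz (\<lambda>n. f (emb \<epsilon> x n)) n)"
proof
  fix n
  have "a (fst p) (snd p) * Dgam s d \<epsilon> (fst p) (Dbar s d \<epsilon> (snd p) f) (emb \<epsilon> x n) =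
     of_real (1 / \<epsilon> ^ m) * (a (fst p) (snd p) * dop (mw (fst p) True @ mw (snd p) False) (\<lambda>n. f (emb \<epsilon> x n)) n)"
    if p: "p \<in> Mset s d m" for p
  proof -
    have "m = sdeg s d (fst p) + sdeg s d (snd p)" using p by (auto simp: Mset_def)
    moreover have "Dgam s d \<epsilon> (fst p) (Dbar s d \<epsilon> (snd p) f) (emb \<epsilon> x n) =
       of_real (1 / \<epsilon> ^ sdeg s d (fst p)) * (of_real (1 / \<epsilon> ^ sdeg s d (snd p)) * dop (mw (fst p) True) (dop (mw (snd p) False) (\<lambda>n. f (emb \<epsilon> x n))) n)"
      using fun_cong[OF Dgam_emb[of \<epsilon> "fst p" "Dbar s d \<epsilon> (snd p) f" x], of n]
      unfolding Dbar_emb TI_lin_scale[OF TI_dop[OF mw_words]] .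
    ultimately show ?thesis by (simp add: power_add)
  qed
  then show "Lop s d m a \<epsilon> f (emb \<epsilon> x n) = of_real (1 / \<epsilon> ^ m) * Lz (\<lambda>n. f (emb \<epsilon> x n)) n"
    unfolding Lop_def Lz_def sum_distrib_left case_prod_unfold by (intro sum.cong refl) simp
qed

text \<open>In unit coordinates \<open>N\<close>, \<open>A\<close> and \<open>M\<close> are all
  multiplied by \<open>\<epsilon> powr \<eta>\<close>, for \<open>A\<close> up to the factor
  \<open>CT\<close>, and so is the conclusion; the constant is therefore independent of the
  mesh.\<close>

lemma schauder_step:
  assumes \<alpha>: "0 < \<alpha>" "\<alpha> < \<eta>" and \<eta>: "\<eta> < real m" "\<eta> \<notin> \<nat>"
  shows "\<exists>C>0. \<forall>\<epsilon>>0. \<forall>U :: germ. \<forall>N A M. centered s d \<epsilon> \<eta> U \<and> 0 < N \<and> 0 \<le> A \<and> 0 < M \<and>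
     (\<forall>x\<in>lattice s d \<epsilon>. \<forall>y\<in>lattice s d \<epsilon>. cmod (U x y) \<le> N * sdist s d x y powr \<eta>) \<and>
     G_neg s d \<epsilon> (\<eta> - real m) (\<lambda>x. Lop s d m a \<epsilon> (U x)) \<le> ereal A \<and>
     (\<forall>x\<in>lattice s d \<epsilon>. \<forall>y\<in>lattice s d \<epsilon>. \<exists>P\<in>poly_space s d (nat \<lfloor>\<eta>\<rfloor>).
         \<forall>z\<in>lattice s d \<epsilon>. cmod (U x z - U y z - P z)
            \<le> M * sdist s d y z powr \<alpha> * (sdist s d x y + sdist s d y z) powr (\<eta> - \<alpha>)) \<longrightarrow>
     (\<forall>x\<in>lattice s d \<epsilon>. \<forall>y\<in>lattice s d \<epsilon>. cmod (U x y) \<le> (N / 2 + C * (A + M)) * sdist s d x y powr \<eta>)"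
proof -
  define q where "q = nat \<lfloor>\<eta>\<rfloor>"
  define \<gamma> where "\<gamma> = \<eta> - real m"
  define k where "k = nat \<lceil>\<bar>\<gamma>\<bar>\<rceil>"
  have \<gamma>0: "\<gamma> \<le> 0" using \<eta> by (simp add: \<gamma>_def)
  obtain C1 where C1: "0 \<le> C1" and one: "\<forall>u v P y N A M. 0 \<le> N \<and> 0 \<le> A \<and> 0 \<le> M \<and> y \<in> Z \<and>
     (\<forall>n\<in>Z. cmod (u n) \<le> N * nm n powr \<eta>) \<and>
     (\<forall>\<gamma>\<in>MI d. real (sdeg s d \<gamma>) \<le> \<eta> \<longrightarrow> dop (mw \<gamma> True) u (\<lambda>_. 0) = 0) \<and>
     (\<forall>h\<ge>1. \<forall>z\<in>Z. cmod (mu h (Lz u) z) \<le> A * real h powr (\<eta> - real m) * (1 + nm z / real h) ^ (k + S)) \<and>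
     (\<forall>n\<in>Z. cmod (v n) \<le> N * nm (\<lambda>i. n i - y i) powr \<eta>) \<and> Pol (Suc q) P \<and>
     (\<forall>n\<in>Z. cmod (u n - v n - P n) \<le> M * nm (\<lambda>i. n i - y i) powr \<alpha> * (nm y + nm (\<lambda>i. n i - y i)) powr (\<eta> - \<alpha>)) \<longrightarrow>
     cmod (u y) \<le> (N / 2 + C1 * (A + M)) * nm y powr \<eta>"
    using unit_lattice_step[OF \<alpha> \<eta> q_def, of "k + S"] by (elim exE conjE)
  obtain CT where CT: "0 \<le> CT" and test: "\<forall>\<epsilon>>0. \<forall>f x \<gamma> A. \<gamma> \<le> 0 \<and> x \<in> lattice s d \<epsilon> \<and> 
     (\<forall>\<phi>\<in>testB s d k. \<forall>lam\<ge>\<epsilon>. lam powr (- \<gamma>) * cmod (pair_eps s d \<epsilon> f (\<lambda>y. complex_of_real (rescale s d \<phi> x lam y))) \<le> A) \<longrightarrow>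
     (\<forall>h\<ge>1. \<forall>z\<in>Z. cmod (mu h (\<lambda>n. f (emb \<epsilon> x n)) z) \<le> CT * A * \<epsilon> powr \<gamma> * real h powr \<gamma> * (1 + nm z / real h) ^ (k + S))"
    using mu_test_bound[of k] by (elim exE conjE)
  define C where "C = C1 * (1 + CT) + 1"
  show ?thesis
  proof (intro exI[of _ C] conjI allI impI ballI)
    show "0 < C" using C1 CT by (simp add: C_def add_nonneg_pos)
    fix \<epsilon> :: real and U :: germ and N A M x y
    assume \<epsilon>: "0 < \<epsilon>" and xy: "x \<in> lattice s d \<epsilon>" "y \<in> lattice s d \<epsilon>"
      and as: "centered s d \<epsilon> \<eta> U \<and> 0 < N \<and> 0 \<le> A \<and> 0 < M \<and>
     (\<forall>x\<in>lattice s d \<epsilon>. \<forall>y\<in>lattice s d \<epsilon>. cmod (U x y) \<le> N * sdist s d x y powr \<eta>) \<and>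
     G_neg s d \<epsilon> (\<eta> - real m) (\<lambda>x. Lop s d m a \<epsilon> (U x)) \<le> ereal A \<and>
     (\<forall>x\<in>lattice s d \<epsilon>. \<forall>y\<in>lattice s d \<epsilon>. \<exists>P\<in>poly_space s d (nat \<lfloor>\<eta>\<rfloor>).
         \<forall>z\<in>lattice s d \<epsilon>. cmod (U x z - U y z - P z)
            \<le> M * sdist s d y z powr \<alpha> * (sdist s d x y + sdist s d y z) powr (\<eta> - \<alpha>))"
    from as have pos: "0 < N" "0 \<le> A" "0 < M"
      and cen: "centered s d \<epsilon> \<eta> U"
      and UN: "\<And>x y. x \<in> lattice s d \<epsilon> \<Longrightarrow> y \<in> lattice s d \<epsilon> \<Longrightarrow> cmod (U x y) \<le> N * sdist s d x y powr \<eta>"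
      and GA: "G_neg s d \<epsilon> \<gamma> (\<lambda>x. Lop s d m a \<epsilon> (U x)) \<le> ereal A"
      unfolding \<gamma>_def by blast+
    from as xy obtain P where P: "P \<in> poly_space s d q"
      "\<And>z. z \<in> lattice s d \<epsilon> \<Longrightarrow> cmod (U x z - U y z - P z) \<le> M * sdist s d y z powr \<alpha> * (sdist s d x y + sdist s d y z) powr (\<eta> - \<alpha>)"
      unfolding q_def by blast
    have bij: "bij_betw (emb \<epsilon> x) Z (lattice s d \<epsilon>)" by (rule bij_emb[OF \<epsilon> xy(1)])
    then obtain l where l: "l \<in> Z" "y = emb \<epsilon> x l" using xy(2) by (auto simp: bij_betw_def)
    have lat: "emb \<epsilon> x n \<in> lattice s d \<epsilon>" if "n \<in> Z" for n using bij that by (auto simp: bij_betw_def)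
    define u where "u = (\<lambda>n. U x (emb \<epsilon> x n))"
    have sx: "sdist s d x (emb \<epsilon> x n) = \<epsilon> * nm n" for n
      using sdist_emb[OF \<epsilon>, of x "\<lambda>_. 0" n] by (simp add: emb_0)
    have sy: "sdist s d y (emb \<epsilon> x n) = \<epsilon> * nm (\<lambda>i. n i - l i)" for n
      unfolding l(2) by (rule sdist_emb[OF \<epsilon>])
    have e\<eta>: "\<epsilon> powr \<alpha> * \<epsilon> powr (\<eta> - \<alpha>) = \<epsilon> powr \<eta>" by (simp add: powr_add[symmetric])
    let ?E = "\<epsilon> powr \<eta>"
    have E0: "0 \<le> ?E" by simp
    have "cmod (u l) \<le> (N * ?E / 2 + C1 * (CT * A * ?E + M * ?E)) * nm l powr \<eta>"
    proof (rule one[rule_format], intro conjI ballI allI impI)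
      show "0 \<le> N * ?E" "0 \<le> M * ?E" "0 \<le> CT * A * ?E" using pos CT by auto
      show "l \<in> Z" by (rule l)
      show "cmod (u n) \<le> N * ?E * nm n powr \<eta>" if "n \<in> Z" for n
        using UN[OF xy(1) lat[OF that]] by (simp add: u_def sx powr_mult mult.assoc)
      show "cmod (U y (emb \<epsilon> x n)) \<le> N * ?E * nm (\<lambda>i. n i - l i) powr \<eta>" if "n \<in> Z" for n
        using UN[OF xy(2) lat[OF that]] by (simp add: sy powr_mult mult.assoc)
      show "Pol (Suc q) (\<lambda>n. P (emb \<epsilon> x n))" by (rule Pol_poly_space[OF P(1)])
      show "cmod (u n - U y (emb \<epsilon> x n) - P (emb \<epsilon> x n)) \<le> M * ?E * nm (\<lambda>i. n i - l i) powr \<alpha> * (nm l + nm (\<lambda>i. n i - l i)) powr (\<eta> - \<alpha>)" if "n \<in> Z" for n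
      proof -
        have "sdist s d x y = \<epsilon> * nm l" unfolding l(2) by (rule sx)
        then have "cmod (u n - U y (emb \<epsilon> x n) - P (emb \<epsilon> x n)) \<le> M * (\<epsilon> * nm (\<lambda>i. n i - l i)) powr \<alpha> * (\<epsilon> * (nm l + nm (\<lambda>i. n i - l i))) powr (\<eta> - \<alpha>)"
          using P(2)[OF lat[OF that]] by (simp add: u_def sy distrib_left)
        also have "\<dots> = M * (\<epsilon> powr \<alpha> * \<epsilon> powr (\<eta> - \<alpha>)) * nm (\<lambda>i. n i - l i) powr \<alpha> * (nm l + nm (\<lambda>i. n i - l i)) powr (\<eta> - \<alpha>)"
          by (simp only: powr_mult mult_ac)
        finally show ?thesis unfolding e\<eta> .
      qed
      show "dop (mw \<beta> True) u (\<lambda>_. 0) = 0" if "\<beta> \<in> MI d" "real (sdeg s d \<beta>) \<le> \<eta>" for \<beta>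
      proof -
        have "Dgam s d \<epsilon> \<beta> (U x) (emb \<epsilon> x (\<lambda>_. 0)) = 0" using cen xy(1) that by (simp add: centered_def emb_0)
        then have "of_real (1 / \<epsilon> ^ sdeg s d \<beta>) * dop (mw \<beta> True) u (\<lambda>_. 0) = 0"
          using fun_cong[OF Dgam_emb[of \<epsilon> \<beta> "U x" x], of "\<lambda>_. 0"] by (simp add: u_def)
        then show ?thesis using \<epsilon> by simp
      qed
      fix h :: nat and z assume h: "1 \<le> h" and z: "z \<in> Z"
      let ?f = "Lop s d m a \<epsilon> (U x)"
      have "cmod (mu h (\<lambda>n. ?f (emb \<epsilon> x n)) z) \<le> CT * A * \<epsilon> powr \<gamma> * real h powr \<gamma> * (1 + nm z / real h) ^ (k + S)"
      proof (rule test[rule_format, OF \<epsilon> _ h z], intro conjI ballI allI impI \<gamma>0 xy(1))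
        fix \<phi> lam assume "\<phi> \<in> testB s d k" "\<epsilon> \<le> lam"
        then have "(\<phi>, x, lam) \<in> {(\<phi>, x, lam). \<phi> \<in> testB s d (nat \<lceil>\<bar>\<gamma>\<bar>\<rceil>) \<and> x \<in> lattice s d \<epsilon> \<and> lam \<ge> \<epsilon>}"
          using xy by (simp add: k_def)
        from SUP_upper[OF this, of "\<lambda>(\<phi>, x, lam). ereal (lam powr (- \<gamma>) * cmod (pair_eps s d \<epsilon> (Lop s d m a \<epsilon> (U x)) (\<lambda>y. complex_of_real (rescale s d \<phi> x lam y))))"]
        have "ereal (lam powr (- \<gamma>) * cmod (pair_eps s d \<epsilon> ?f (\<lambda>y. complex_of_real (rescale s d \<phi> x lam y)))) \<le> G_neg s d \<epsilon> \<gamma> (\<lambda>x. Lop s d m a \<epsilon> (U x))"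
          unfolding G_neg_def by simp
        also have "\<dots> \<le> ereal A" by (rule GA)
        finally show "lam powr (- \<gamma>) * cmod (pair_eps s d \<epsilon> ?f (\<lambda>y. complex_of_real (rescale s d \<phi> x lam y))) \<le> A" by simp
      qed
      moreover have "mu h (\<lambda>n. ?f (emb \<epsilon> x n)) z = of_real (1 / \<epsilon> ^ m) * mu h (Lz u) z"
        unfolding Lop_emb TI_lin_scale[OF TI_bxs_mu(2)[OF h]] u_def ..
      ultimately have "(1 / \<epsilon> ^ m) * cmod (mu h (Lz u) z) \<le> CT * A * \<epsilon> powr \<gamma> * real h powr \<gamma> * (1 + nm z / real h) ^ (k + S)"
        using \<epsilon> by (simp add: norm_mult norm_divide norm_power)
      then have "\<epsilon> ^ m * ((1 / \<epsilon> ^ m) * cmod (mu h (Lz u) z)) \<le> \<epsilon> ^ m * (CT * A * \<epsilon> powr \<gamma> * real h powr \<gamma> * (1 + nm z / real h) ^ (k + S))"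
        using \<epsilon> by (intro mult_left_mono) auto
      moreover have "\<epsilon> ^ m * ((1 / \<epsilon> ^ m) * cmod (mu h (Lz u) z)) = cmod (mu h (Lz u) z)" using \<epsilon> by simp
      moreover have "\<epsilon> ^ m * (CT * A * \<epsilon> powr \<gamma> * real h powr \<gamma> * (1 + nm z / real h) ^ (k + S)) = CT * A * (\<epsilon> ^ m * \<epsilon> powr \<gamma>) * real h powr \<gamma> * (1 + nm z / real h) ^ (k + S)"
        by (simp only: mult_ac)
      moreover have "\<epsilon> ^ m * \<epsilon> powr \<gamma> = ?E"
        using \<epsilon> by (simp add: \<gamma>_def powr_realpow[symmetric] powr_add[symmetric])
      ultimately show "cmod (mu h (Lz u) z) \<le> CT * A * ?E * real h powr (\<eta> - real m) * (1 + nm z / real h) ^ (k + S)"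
        by (simp only: \<gamma>_def)
    qed
    also have "\<dots> = (N / 2 + C1 * (CT * A + M)) * (?E * nm l powr \<eta>)" by (simp add: algebra_simps)
    also have "\<dots> \<le> (N / 2 + C * (A + M)) * (?E * nm l powr \<eta>)"
    proof (rule mult_right_mono)
      have "C1 * (CT * A + M) \<le> C1 * ((1 + CT) * (A + M))"
        using C1 CT pos by (intro mult_left_mono) (auto simp: algebra_simps)
      also have "\<dots> \<le> C * (A + M)" using pos by (simp add: C_def distrib_right[of "C1 * (1 + CT)" 1] mult.assoc)
      finally show "N / 2 + C1 * (CT * A + M) \<le> N / 2 + C * (A + M)" by simp
    qed simp
    also have "?E * nm l powr \<eta> = sdist s d x y powr \<eta>" unfolding l(2) sx by (simp add: powr_mult)
    finally show "cmod (U x y) \<le> (N / 2 + C * (A + M)) * sdist s d x y powr \<eta>" by (simp add: u_def l(2))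
  qed
qed

text \<open>The bump shows that the supremum is over a nonempty set; it is thus not minus infinity
  and can safely be added to \<open>G_semi\<close>.\<close>

lemma G_neg_nonneg:
  assumes "0 < \<epsilon>" shows "0 \<le> G_neg s d \<epsilon> \<gamma> V"
proof -
  obtain M where "PF d (1 / (M * ((1 + nm (\<lambda>_. 0)) / 1) ^ nat \<lceil>\<bar>\<gamma>\<bar>\<rceil>)) (tfam 1 (\<lambda>_. 0)) (\<lambda>_. 0) \<in> testB s d (nat \<lceil>\<bar>\<gamma>\<bar>\<rceil>)"
    using tfam_testB[of "nat \<lceil>\<bar>\<gamma>\<bar>\<rceil>"] Z_0 by (metis order_refl)
  then obtain \<phi> where \<phi>: "\<phi> \<in> testB s d (nat \<lceil>\<bar>\<gamma>\<bar>\<rceil>)" by blast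
  have 0: "(\<lambda>_. 0) \<in> lattice s d \<epsilon>" by (auto simp: lattice_def Rd_def intro!: exI[of _ 0])
  have "(0::ereal) \<le> ereal (\<epsilon> powr (- \<gamma>) * cmod (pair_eps s d \<epsilon> (V (\<lambda>_. 0)) (\<lambda>y. complex_of_real (rescale s d \<phi> (\<lambda>_. 0) \<epsilon> y))))"
    by simp
  also have "\<dots> \<le> G_neg s d \<epsilon> \<gamma> V"
    unfolding G_neg_def using \<phi> 0 by (intro SUP_upper2[of "(\<phi>, \<lambda>_. 0, \<epsilon>)"]) auto
  finally show ?thesis .
qed

end

theorem theorem3p11:
  fixes d m :: nat and s :: "nat \<Rightarrow> nat"
    and a :: "(nat \<Rightarrow> nat) \<Rightarrow> (nat \<Rightarrow> nat) \<Rightarrow> complex"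
    and \<alpha> \<eta> :: real
  assumes "0 < d" and "\<forall>i<d. 1 \<le> s i"
    and "\<forall>\<epsilon>>0. disc_elliptic s d m a \<epsilon>"
    and "0 < \<alpha>" and "\<alpha> < \<eta>" and "\<eta> < real m"
    and "\<alpha> \<notin> \<nat>" and "\<eta> \<notin> \<nat>"
  shows "\<exists>C>0. \<forall>\<epsilon>>0. \<forall>U :: germ. centered s d \<epsilon> \<eta> U \<and> G_norm s d \<epsilon> \<eta> U < \<infinity> \<longrightarrow>
           G_norm s d \<epsilon> \<eta> U \<le> ereal C * (G_neg s d \<epsilon> (\<eta> - real m) (\<lambda>x. Lop s d m a \<epsilon> (U x))
                                      + G_semi s d \<epsilon> \<eta> \<alpha> U)"
proof -
  interpret elliptic d s m a
    by unfold_locales (use assms in auto)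
  obtain C where C: "0 < C" and step: "\<forall>\<epsilon>>0. \<forall>U :: germ. \<forall>N A M. centered s d \<epsilon> \<eta> U \<and> 0 < N \<and> 0 \<le> A \<and> 0 < M \<and>
     (\<forall>x\<in>lattice s d \<epsilon>. \<forall>y\<in>lattice s d \<epsilon>. cmod (U x y) \<le> N * sdist s d x y powr \<eta>) \<and>
     G_neg s d \<epsilon> (\<eta> - real m) (\<lambda>x. Lop s d m a \<epsilon> (U x)) \<le> ereal A \<and>
     (\<forall>x\<in>lattice s d \<epsilon>. \<forall>y\<in>lattice s d \<epsilon>. \<exists>P\<in>poly_space s d (nat \<lfloor>\<eta>\<rfloor>).
         \<forall>z\<in>lattice s d \<epsilon>. cmod (U x z - U y z - P z)
            \<le> M * sdist s d y z powr \<alpha> * (sdist s d x y + sdist s d y z) powr (\<eta> - \<alpha>)) \<longrightarrow>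
     (\<forall>x\<in>lattice s d \<epsilon>. \<forall>y\<in>lattice s d \<epsilon>. cmod (U x y) \<le> (N / 2 + C * (A + M)) * sdist s d x y powr \<eta>)"
    using schauder_step[OF assms(4,5,6,8)] by (elim exE conjE)
  show ?thesis
  proof (intro exI[of _ "2 * C"] conjI allI impI)
    show "0 < 2 * C" using C by simp
    fix \<epsilon> :: real and U :: germ
    assume \<epsilon>: "0 < \<epsilon>" and U: "centered s d \<epsilon> \<eta> U \<and> G_norm s d \<epsilon> \<eta> U < \<infinity>"
    let ?g = "G_norm s d \<epsilon> \<eta> U" and ?A = "G_neg s d \<epsilon> (\<eta> - real m) (\<lambda>x. Lop s d m a \<epsilon> (U x))" and ?S = "G_semi s d \<epsilon> \<eta> \<alpha> U"
    let ?N = "\<lambda>N. 0 < N \<and> (\<forall>x\<in>lattice s d \<epsilon>. \<forall>y\<in>lattice s d \<epsilon>. cmod (U x y) \<le> N * sdist s d x y powr \<eta>)"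
    let ?M = "\<lambda>M. 0 < M \<and> (\<forall>x\<in>lattice s d \<epsilon>. \<forall>y\<in>lattice s d \<epsilon>. \<exists>P\<in>poly_space s d (nat \<lfloor>\<eta>\<rfloor>).
         \<forall>z\<in>lattice s d \<epsilon>. cmod (U x z - U y z - P z)
            \<le> M * sdist s d y z powr \<alpha> * (sdist s d x y + sdist s d y z) powr (\<eta> - \<alpha>))"
    have g: "?g = Inf {ereal N | N. ?N N}" and S: "?S = Inf {ereal M | M. ?M M}"
      by (simp_all only: G_norm_def G_semi_def)
    have gle: "?g \<le> ereal N" if "?N N" for N unfolding g by (rule Inf_lower) (use that in blast)
    have S0: "0 \<le> ?S" unfolding S by (rule Inf_greatest) auto
    have A0: "0 \<le> ?A" by (rule G_neg_nonneg[OF \<epsilon>])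
    have "\<exists>N. ?N N"
    proof (rule ccontr)
      assume "\<nexists>N. ?N N"
      then have e: "{ereal N | N. ?N N} = {}" by simp
      have "?g = \<infinity>" unfolding g e by (simp add: top_ereal_def)
      with U show False by simp
    qed
    then obtain N0 where N0: "?N N0" by blast
    show "?g \<le> ereal (2 * C) * (?A + ?S)"
    proof (cases "?A = \<infinity> \<or> ?S = \<infinity>")
      case True
      then have e: "?A + ?S = \<infinity>" using A0 S0 by auto
      have "ereal (2 * C) * \<infinity> = \<infinity>" using C by simp
      then show ?thesis unfolding e by simp
    next
      case False
      then obtain A \<sigma> where A: "?A = ereal A" "0 \<le> A" and \<sigma>: "?S = ereal \<sigma>" "0 \<le> \<sigma>"
        using A0 S0 by (cases ?A; cases ?S) auto
      have M_bound: "?g \<le> ereal (2 * C * (A + M))" if M: "?M M" for M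
      proof -
        have half: "?N (N / 2 + C * (A + M))" if "?N N" for N
        proof
          have "0 < C * (A + M)" using C A(2) M by (intro mult_pos_pos) auto
          with that show "0 < N / 2 + C * (A + M)" by (intro add_pos_pos) auto
          show "\<forall>x\<in>lattice s d \<epsilon>. \<forall>y\<in>lattice s d \<epsilon>. cmod (U x y) \<le> (N / 2 + C * (A + M)) * sdist s d x y powr \<eta>"
          proof (intro ballI, rule step[rule_format, OF \<epsilon>])
            show "centered s d \<epsilon> \<eta> U \<and> 0 < N \<and> 0 \<le> A \<and> 0 < M \<and>
     (\<forall>x\<in>lattice s d \<epsilon>. \<forall>y\<in>lattice s d \<epsilon>. cmod (U x y) \<le> N * sdist s d x y powr \<eta>) \<and>
     G_neg s d \<epsilon> (\<eta> - real m) (\<lambda>x. Lop s d m a \<epsilon> (U x)) \<le> ereal A \<and>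
     (\<forall>x\<in>lattice s d \<epsilon>. \<forall>y\<in>lattice s d \<epsilon>. \<exists>P\<in>poly_space s d (nat \<lfloor>\<eta>\<rfloor>).
         \<forall>z\<in>lattice s d \<epsilon>. cmod (U x z - U y z - P z)
            \<le> M * sdist s d y z powr \<alpha> * (sdist s d x y + sdist s d y z) powr (\<eta> - \<alpha>))"
              using U that M A by auto
          qed
        qed
        \<comment> \<open>Repeated halving from the finite bound \<open>N0\<close> tends to the
          fixed point \<open>2 * C * (A + M)\<close>; the finiteness of the norm supplies
          \<open>N0\<close>.\<close>
        have iter: "?N (2 * C * (A + M) + N0 / 2 ^ i)" for i
        proof (induction i)
          case 0
          have c: "0 \<le> 2 * C * (A + M)" using C A(2) M by simp
          have "cmod (U x y) \<le> (2 * C * (A + M) + N0) * sdist s d x y powr \<eta>" if "x \<in> lattice s d \<epsilon>" "y \<in> lattice s d \<epsilon>" for x y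
          proof -
            have "cmod (U x y) \<le> N0 * sdist s d x y powr \<eta>" using N0 that by blast
            also have "\<dots> \<le> (2 * C * (A + M) + N0) * sdist s d x y powr \<eta>" using c by (intro mult_right_mono) auto
            finally show ?thesis .
          qed
          then show ?case using c N0 by (simp add: add_nonneg_pos)
        next
          case (Suc i)
          have "(2 * C * (A + M) + N0 / 2 ^ i) / 2 + C * (A + M) = 2 * C * (A + M) + N0 / 2 ^ Suc i"
            by (simp add: field_simps)
          from half[OF Suc, unfolded this] show ?case .
        qed
        show ?thesis
        proof (rule ereal_le_epsilon2)
          fix e :: real assume e: "0 < e"
          obtain i where i: "N0 / e < 2 ^ i" using real_arch_pow[of 2] by auto
          then have "N0 / 2 ^ i \<le> e" using e by (simp add: field_simps)
          then have "ereal (2 * C * (A + M) + N0 / 2 ^ i) \<le> ereal (2 * C * (A + M)) + ereal e" by simp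
          with gle[OF iter[of i]] show "?g \<le> ereal (2 * C * (A + M)) + ereal e" by (rule order_trans)
        qed
      qed
      \<comment> \<open>An admissible \<open>M\<close> must be positive and the infimum
        \<open>\<sigma>\<close> may be 0 or not attained, so it is approached from above; the margin
        \<open>e / (2 * C)\<close> is calibrated to cost \<open>e\<close>.\<close>
      have "?g \<le> ereal (2 * C * (A + \<sigma>))"
      proof (rule ereal_le_epsilon2)
        fix e :: real assume e: "0 < e"
        have "Inf {ereal M | M. ?M M} < ereal (\<sigma> + e / (2 * C))" using \<sigma>(1) e C unfolding S by simp
        then obtain M where M: "?M M" "M < \<sigma> + e / (2 * C)" unfolding Inf_less_iff by auto
        have "2 * C * (A + M) \<le> 2 * C * (A + (\<sigma> + e / (2 * C)))" using M(2) C by (intro mult_left_mono) auto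
        also have "\<dots> = 2 * C * (A + \<sigma>) + e" using C by (simp add: field_simps)
        finally have "ereal (2 * C * (A + M)) \<le> ereal (2 * C * (A + \<sigma>)) + ereal e" by simp
        with M_bound[OF M(1)] show "?g \<le> ereal (2 * C * (A + \<sigma>)) + ereal e" by (rule order_trans)
      qed
      then show ?thesis by (simp add: A(1) \<sigma>(1))
    qed
  qed
qed

end
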